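(* Let $f\in L^2(\Omega)$ with $f|_T\in H^1(T)$ for every $T\in\mathcal T_h$. Let $p\in\widetilde H^2(\Omega)\cap H^1_0(\Omega)$ be the solution of $\int_\Omega\beta\nabla p\cdot\nabla q\,dx=\int_\Omega fq\,dx$ for all $q\in H_0^1(\Omega)$, and let $\mathbf u=-\beta\nabla p$ (so that $\mathbf u+\beta\nabla p=0$ and $\mathrm{div}\,\mathbf u=f$ in $\Omega$, $p=0$ on $\partial\Omega$). Let $(\mathbf u_h,p_h)\in\mathbf V_h\times\widehat S_h(\Omega)$ be the solution of the mixed finite volume scheme: for every $T\in\mathcal T_h$, $$\int_T(\mathbf u_h+\beta\nabla p_h)\cdot\nabla\phi\,dx=0\quad\forall\phi\in\widehat S_h(T),\qquad \int_T\mathrm{div}\,\mathbf u_h\,dx=\int_T f\,dx.$$ Then there exists a constant $C>0$, independent of $h$, $f$, $p$ and $\mathbf u$, such that $$\|\mathbf u-\mathbf u_h\|_{L^2(\Omega)}+\|\mathrm{div}\,\mathbf u-\mathrm{div}\,\mathbf u_h\|_{L^2(\Omega)}\le C h\left\{\|\mathbf u\|_{\mathbf H^1(\Omega)}+\|p\|_{\widetilde H^2(\Omega)}+\|f\|_{1,h}\right\},$$ provided $\mathbf u\in\mathbf H^1(\Omega)$.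
   Context: Setting. $\Omega\subset\mathbb{R}^2$ is a rectangular domain separated into $\Omega^-$ and $\Omega^+=\Omega\setminus\Omega^-$ by a $C^2$ interface $\Gamma=\partial\Omega^-\subset\Omega$. The coefficient $\beta$ is positive and piecewise constant: $\beta=\beta^-$ in $\Omega^-$, $\beta=\beta^+$ in $\Omega^+$. $\widetilde H^2(\Omega)=\{p\in H^1(\Omega): p|_{\Omega^s}\in H^2(\Omega^s),\ s=+,-\}$ with norm $\|p\|^2_{\widetilde H^2(\Omega)}=\|p\|^2_{H^1(\Omega)}+\|p\|^2_{H^2(\Omega^+)}+\|p\|^2_{H^2(\Omega^-)}$. $\mathbf H^1(\Omega)=H^1(\Omega)^2$. Mesh. $\mathcal T_h$ is the triangulation obtained from a uniform rectangular partition of $\Omega$ of mesh size $h$ by cutting each rectangle along a diagonal. It need not fit $\Gamma$. $h$ is small enough that $\Gamma$ meets the edges of an interface element in no more than two points and meets each edge at most once, except that it may pass through two vertices. $T\in\mathcal T_h$ is an interface element if $\Gamma$ passes through the interior of $T$, otherwise a non-interface element. For an interface element $T$, let $D,E$ be the intersection points of $\Gamma$ with the edges of $T$; the segment $\overline{DE}$ divides $T$ into $T^+$ and $T^-$ (approximating $T\cap\Omega^+$ and $T\cap\Omega^-$ respectively). The broken norm is $\|v\|_{1,h}^2=\sum_{T\in\mathcal T_h}\|v\|_{H^1(T)}^2$. Pressure space. For a non-interface element $T$, $\widehat S_h(T)$ is the space of linear functions on $T$. For an interface element $T$, $\widehat S_h(T)$ is the three-dimensional space of functions $\phi$ with $\phi=\phi^+$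 on $T^+$ and $\phi=\phi^-$ on $T^-$, $\phi^\pm$ linear, such that $\phi^+(D)=\phi^-(D)$, $\phi^+(E)=\phi^-(E)$ and $\beta^+\partial\phi^+/\partial\mathbf n_{\overline{DE}}=\beta^-\partial\phi^-/\partial\mathbf n_{\overline{DE}}$, where $\mathbf n_{\overline{DE}}$ is a unit normal to $\overline{DE}$. $\widehat S_h(\Omega)$ is the set of functions $\phi$ with $\phi|_T\in\widehat S_h(T)$ for each $T\in\mathcal T_h$, such that $\int_e\phi|_{T_1}ds=\int_e\phi|_{T_2}ds$ for every common edge $e$ of adjacent elements $T_1,T_2$, and $\int_e\phi\,ds=0$ for every edge $e\subset\partial\Omega$. Velocity space. $\mathbf V_h$ is the lowest-order Raviart–Thomas space: vector fields $\mathbf v$ such that for each $T\in\mathcal T_h$, $\mathbf v|_T=(a+cx,b+cy)$ for some $a,b,c\in\mathbb{R}$, and $\mathbf v\cdot\mathbf n$ is continuous across interior edges. *)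

theory Defs
  imports "HOL-Analysis.Analysis"
begin

type_synonym plane = "real^2"

section \<open>Sobolev spaces on open subsets of the plane\<close>

definition L2 :: "plane set \<Rightarrow> (plane \<Rightarrow> 'a::euclidean_space) set" where
  "L2 S = {f \<in> borel_measurable (lebesgue_on S). integrable (lebesgue_on S) (\<lambda>x. (norm (f x))\<^sup>2)}"

definition l2norm :: "plane set \<Rightarrow> (plane \<Rightarrow> 'a::euclidean_space) \<Rightarrow> real" where
  "l2norm S f = sqrt (LINT x|lebesgue_on S. (norm (f x))\<^sup>2)"

definition locally_integrable :: "plane set \<Rightarrow> (plane \<Rightarrow> 'a::euclidean_space) \<Rightarrow> bool" where
  "locally_integrable S f \<longleftrightarrow> (\<forall>K. compact K \<and> K \<subseteq> S \<longrightarrow> integrable (lebesgue_on K) f)"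

definition grad :: "(plane \<Rightarrow> real) \<Rightarrow> plane \<Rightarrow> plane" where
  "grad f x = (\<chi> i. frechet_derivative f (at x) (axis i 1))"

primrec Ck :: "nat \<Rightarrow> (plane \<Rightarrow> real) \<Rightarrow> bool" where
  "Ck 0 f \<longleftrightarrow> continuous_on UNIV f"
| "Ck (Suc k) f \<longleftrightarrow> (\<forall>x. f differentiable at x) \<and> (\<forall>i. Ck k (\<lambda>x. grad f x $ i))"

definition test_functions :: "plane set \<Rightarrow> (plane \<Rightarrow> real) set" where
  "test_functions S = {\<phi>. (\<forall>k. Ck k \<phi>) \<and> compact (closure {x. \<phi> x \<noteq> 0}) \<and> closure {x. \<phi> x \<noteq> 0} \<subseteq> S}"

definition has_weak_grad :: "plane set \<Rightarrow> (plane \<Rightarrow> real) \<Rightarrow> (plane \<Rightarrow> plane) \<Rightarrow> bool" where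
  "has_weak_grad S f g \<longleftrightarrow> locally_integrable S f \<and> locally_integrable S g \<and>
     (\<forall>\<phi>\<in>test_functions S. \<forall>i.
        (LINT x|lebesgue_on S. f x * grad \<phi> x $ i) = - (LINT x|lebesgue_on S. g x $ i * \<phi> x))"

definition has_weak_div :: "plane set \<Rightarrow> (plane \<Rightarrow> plane) \<Rightarrow> (plane \<Rightarrow> real) \<Rightarrow> bool" where
  "has_weak_div S v d \<longleftrightarrow> locally_integrable S v \<and> locally_integrable S d \<and>
     (\<forall>\<phi>\<in>test_functions S.
        (LINT x|lebesgue_on S. v x \<bullet> grad \<phi> x) = - (LINT x|lebesgue_on S. d x * \<phi> x))"

text \<open>Weak gradients and divergences are unique up to a null set, so the representative chosen
  here does not matter as long as it only enters integrals over \<open>S\<close> or subsets of \<open>S\<close>.\<close>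

definition wgrad :: "plane set \<Rightarrow> (plane \<Rightarrow> real) \<Rightarrow> plane \<Rightarrow> plane" where
  "wgrad S f = (SOME g. has_weak_grad S f g)"

definition wdiv :: "plane set \<Rightarrow> (plane \<Rightarrow> plane) \<Rightarrow> plane \<Rightarrow> real" where
  "wdiv S v = (SOME d. has_weak_div S v d)"

definition H1 :: "plane set \<Rightarrow> (plane \<Rightarrow> real) set" where
  "H1 S = {f \<in> L2 S. \<exists>g\<in>L2 S. has_weak_grad S f g}"

definition h1norm :: "plane set \<Rightarrow> (plane \<Rightarrow> real) \<Rightarrow> real" where
  "h1norm S f = sqrt ((l2norm S f)\<^sup>2 + (l2norm S (wgrad S f))\<^sup>2)"

definition H1_vec :: "plane set \<Rightarrow> (plane \<Rightarrow> plane) set" where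
  "H1_vec S = {v. \<forall>i. (\<lambda>x. v x $ i) \<in> H1 S}"

definition h1norm_vec :: "plane set \<Rightarrow> (plane \<Rightarrow> plane) \<Rightarrow> real" where
  "h1norm_vec S v = sqrt (\<Sum>i\<in>UNIV. (h1norm S (\<lambda>x. v x $ i))\<^sup>2)"

definition H2 :: "plane set \<Rightarrow> (plane \<Rightarrow> real) set" where
  "H2 S = {f \<in> H1 S. wgrad S f \<in> H1_vec S}"

definition h2norm :: "plane set \<Rightarrow> (plane \<Rightarrow> real) \<Rightarrow> real" where
  "h2norm S f = sqrt ((l2norm S f)\<^sup>2 + (h1norm_vec S (wgrad S f))\<^sup>2)"

definition H1_0 :: "plane set \<Rightarrow> (plane \<Rightarrow> real) set" where
  "H1_0 S = {f \<in> H1 S. \<exists>\<phi>::nat \<Rightarrow> plane \<Rightarrow> real. (\<forall>n. \<phi> n \<in> test_functions S) \<and>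
     (\<lambda>n. h1norm S (\<lambda>x. \<phi> n x - f x)) \<longlonglongrightarrow> 0}"

section \<open>The interface problem\<close>

definition C2_fun :: "(real \<Rightarrow> real) \<Rightarrow> bool" where
  "C2_fun \<gamma> \<longleftrightarrow> (\<exists>\<gamma>' \<gamma>''. (\<forall>t. (\<gamma> has_real_derivative \<gamma>' t) (at t)) \<and>
     (\<forall>t. (\<gamma>' has_real_derivative \<gamma>'' t) (at t)) \<and> continuous_on UNIV \<gamma>'')"

text \<open>Near each boundary point the set is, in suitable Cartesian coordinates, the region on one
  side of the graph of a \<open>C\<^sup>2\<close> function.\<close>

definition C2_boundary :: "plane set \<Rightarrow> bool" where
  "C2_boundary U \<longleftrightarrow> (\<forall>z\<in>frontier U. \<exists>r>0. \<exists>e1 e2 \<gamma>.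
     norm e1 = 1 \<and> norm e2 = 1 \<and> e1 \<bullet> e2 = 0 \<and> C2_fun \<gamma> \<and>
     (\<forall>x\<in>ball z r. x \<in> U \<longleftrightarrow> x \<bullet> e2 > \<gamma> (x \<bullet> e1)))"

text \<open>The set \<open>Om\<close> is \<open>\<Omega>\<^sup>-\<close>, and \<open>frontier Om\<close> is the interface.\<close>

definition interface_geometry :: "plane set \<Rightarrow> plane set \<Rightarrow> bool" where
  "interface_geometry \<Omega> Om \<longleftrightarrow>
     open Om \<and> Om \<noteq> {} \<and> Om \<subseteq> \<Omega> \<and> frontier Om \<subseteq> \<Omega> \<and> C2_boundary Om"

text \<open>The Sobolev spaces need open sets, so the null set \<open>frontier Om\<close> is removed from
  \<open>\<Omega> - Om\<close>.\<close>

definition Om_plus :: "plane set \<Rightarrow> plane set \<Rightarrow> plane set" where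
  "Om_plus \<Omega> Om = \<Omega> - closure Om"

definition coef :: "plane set \<Rightarrow> real \<Rightarrow> real \<Rightarrow> plane \<Rightarrow> real" where
  "coef Om \<beta>m \<beta>p x = (if x \<in> Om then \<beta>m else \<beta>p)"

definition H2_tilde :: "plane set \<Rightarrow> plane set \<Rightarrow> (plane \<Rightarrow> real) set" where
  "H2_tilde \<Omega> Om = H1 \<Omega> \<inter> H2 (Om_plus \<Omega> Om) \<inter> H2 Om"

definition h2norm_tilde :: "plane set \<Rightarrow> plane set \<Rightarrow> (plane \<Rightarrow> real) \<Rightarrow> real" where
  "h2norm_tilde \<Omega> Om p =
     sqrt ((h1norm \<Omega> p)\<^sup>2 + (h2norm (Om_plus \<Omega> Om) p)\<^sup>2 + (h2norm Om p)\<^sup>2)"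

definition weak_solution ::
  "plane set \<Rightarrow> plane set \<Rightarrow> real \<Rightarrow> real \<Rightarrow> (plane \<Rightarrow> real) \<Rightarrow> (plane \<Rightarrow> real) \<Rightarrow> bool" where
  "weak_solution \<Omega> Om \<beta>m \<beta>p f p \<longleftrightarrow> (\<forall>q\<in>H1_0 \<Omega>.
     (LINT x|lebesgue_on \<Omega>. coef Om \<beta>m \<beta>p x * (wgrad \<Omega> p x \<bullet> wgrad \<Omega> q x)) =
     (LINT x|lebesgue_on \<Omega>. f x * q x))"

section \<open>The mesh\<close>

text \<open>The rectangle \<open>box a b\<close> is partitioned into \<open>N1 \<times> N2\<close> congruent rectangles. The flag
  \<open>\<delta> i j\<close> selects the diagonal along which the rectangle with indices \<open>i\<close>, \<open>j\<close> is cut. Elements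
  are closed triangles.\<close>

definition step1 :: "plane \<Rightarrow> plane \<Rightarrow> nat \<Rightarrow> real" where
  "step1 a b N1 = (b $ 1 - a $ 1) / real N1"

definition step2 :: "plane \<Rightarrow> plane \<Rightarrow> nat \<Rightarrow> real" where
  "step2 a b N2 = (b $ 2 - a $ 2) / real N2"

definition mesh_size :: "plane \<Rightarrow> plane \<Rightarrow> nat \<Rightarrow> nat \<Rightarrow> real" where
  "mesh_size a b N1 N2 = max (step1 a b N1) (step2 a b N2)"

text \<open>Bounded aspect ratio of the congruent rectangles. Squares have \<open>\<kappa> = 1\<close>. Error constants
  may depend on \<open>\<kappa>\<close>, but not on \<open>N1\<close>, \<open>N2\<close> or \<open>\<delta>\<close>.\<close>

definition shape_regular :: "real \<Rightarrow> plane \<Rightarrow> plane \<Rightarrow> nat \<Rightarrow> nat \<Rightarrow> bool" where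
  "shape_regular \<kappa> a b N1 N2 \<longleftrightarrow>
     max (step1 a b N1) (step2 a b N2) \<le> \<kappa> * min (step1 a b N1) (step2 a b N2)"

definition node :: "plane \<Rightarrow> plane \<Rightarrow> nat \<Rightarrow> nat \<Rightarrow> nat \<Rightarrow> nat \<Rightarrow> plane" where
  "node a b N1 N2 i j = vector [a $ 1 + real i * step1 a b N1, a $ 2 + real j * step2 a b N2]"

definition cell_triangles ::
  "plane \<Rightarrow> plane \<Rightarrow> nat \<Rightarrow> nat \<Rightarrow> bool \<Rightarrow> nat \<Rightarrow> nat \<Rightarrow> plane set set" where
  "cell_triangles a b N1 N2 s i j =
    (let P = node a b N1 N2 in
     if s then {convex hull {P i j, P (i+1) j, P (i+1) (j+1)},
                convex hull {P i j, P i (j+1), P (i+1) (j+1)}}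
     else {convex hull {P i j, P (i+1) j, P i (j+1)},
           convex hull {P (i+1) (j+1), P (i+1) j, P i (j+1)}})"

definition mesh ::
  "plane \<Rightarrow> plane \<Rightarrow> nat \<Rightarrow> nat \<Rightarrow> (nat \<Rightarrow> nat \<Rightarrow> bool) \<Rightarrow> plane set set" where
  "mesh a b N1 N2 \<delta> = (\<Union>i\<in>{..<N1}. \<Union>j\<in>{..<N2}. cell_triangles a b N1 N2 (\<delta> i j) i j)"

definition interface_element :: "plane set \<Rightarrow> plane set \<Rightarrow> bool" where
  "interface_element Om T \<longleftrightarrow> frontier Om \<inter> interior T \<noteq> {}"

text \<open>The points \<open>D\<close>, \<open>E\<close> are the intersection points of the interface with the edges of \<open>T\<close>, and
  \<open>n\<close> is the unit normal to the segment \<open>DE\<close> pointing from \<open>T\<^sup>-\<close> to \<open>T\<^sup>+\<close>, where \<open>T\<^sup>-\<close> is the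
  piece of \<open>T\<close> whose outer boundary lies in \<open>Om\<close>. If the interface passes through two vertices
  of \<open>T\<close>, then \<open>DE\<close> is an edge and one of the pieces degenerates to it.\<close>

definition cut :: "plane set \<Rightarrow> plane set \<Rightarrow> plane \<Rightarrow> plane \<Rightarrow> plane \<Rightarrow> bool" where
  "cut Om T D E n \<longleftrightarrow> D \<noteq> E \<and> frontier Om \<inter> frontier T = {D, E} \<and>
     norm n = 1 \<and> n \<bullet> (E - D) = 0 \<and>
     {x \<in> frontier T. n \<bullet> (x - D) < 0} \<subseteq> Om \<and>
     {x \<in> frontier T. n \<bullet> (x - D) > 0} \<inter> Om = {}"

definition piece_plus :: "plane set \<Rightarrow> plane \<Rightarrow> plane \<Rightarrow> plane set" where
  "piece_plus T D n = {x \<in> T. n \<bullet> (x - D) \<ge> 0}"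

definition piece_minus :: "plane set \<Rightarrow> plane \<Rightarrow> plane \<Rightarrow> plane set" where
  "piece_minus T D n = {x \<in> T. n \<bullet> (x - D) \<le> 0}"

definition resolves_interface :: "plane set \<Rightarrow> plane set set \<Rightarrow> bool" where
  "resolves_interface Om M \<longleftrightarrow> (\<forall>T\<in>M. interface_element Om T \<longrightarrow>
     (\<exists>D E n. cut Om T D E n) \<and>
     (\<forall>v w. closed_segment v w edge_of T \<longrightarrow>
        (\<exists>x. frontier Om \<inter> closed_segment v w \<subseteq> {x}) \<or>
        frontier Om \<inter> closed_segment v w = {v, w}))"

definition broken_h1norm :: "plane set set \<Rightarrow> (plane \<Rightarrow> real) \<Rightarrow> real" where
  "broken_h1norm M f = sqrt (\<Sum>T\<in>M. (h1norm (interior T) f)\<^sup>2)"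

section \<open>The discrete spaces and the scheme\<close>

definition edge_integral :: "plane \<Rightarrow> plane \<Rightarrow> (plane \<Rightarrow> real) \<Rightarrow> real" where
  "edge_integral v w g = norm (w - v) * (LINT t|lebesgue_on {0..1}. g (linepath v w t))"

text \<open>Membership in a local space only concerns the values of the function on \<open>T\<close>.\<close>

definition S_local :: "plane set \<Rightarrow> real \<Rightarrow> real \<Rightarrow> plane set \<Rightarrow> (plane \<Rightarrow> real) set" where
  "S_local Om \<beta>m \<beta>p T =
    (if interface_element Om T then
      {\<phi>. \<exists>D E n cp gp cm gm. cut Om T D E n \<and>
         (\<forall>x\<in>piece_plus T D n. \<phi> x = cp + gp \<bullet> x) \<and>
         (\<forall>x\<in>piece_minus T D n. \<phi> x = cm + gm \<bullet> x) \<and>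
         cp + gp \<bullet> D = cm + gm \<bullet> D \<and> cp + gp \<bullet> E = cm + gm \<bullet> E \<and>
         \<beta>p * (gp \<bullet> n) = \<beta>m * (gm \<bullet> n)}
     else {\<phi>. \<exists>c g. \<forall>x\<in>T. \<phi> x = c + g \<bullet> x})"

text \<open>Discrete functions may jump across edges, so the restriction to an element is fixed on its
  interior only. The families \<open>\<Phi>\<close> and \<open>V\<close> give the one-sided values on the edges.\<close>

definition S_h ::
  "plane set \<Rightarrow> plane set \<Rightarrow> real \<Rightarrow> real \<Rightarrow> plane set set \<Rightarrow> (plane \<Rightarrow> real) set" where
  "S_h \<Omega> Om \<beta>m \<beta>p M = {\<phi>. \<exists>\<Phi> :: plane set \<Rightarrow> plane \<Rightarrow> real.
     (\<forall>T\<in>M. \<Phi> T \<in> S_local Om \<beta>m \<beta>p T \<and> (\<forall>x\<in>interior T. \<phi> x = \<Phi> T x)) \<and>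
     (\<forall>T1\<in>M. \<forall>T2\<in>M. \<forall>v w. T1 \<noteq> T2 \<and> closed_segment v w edge_of T1 \<and> closed_segment v w edge_of T2 \<longrightarrow>
        edge_integral v w (\<Phi> T1) = edge_integral v w (\<Phi> T2)) \<and>
     (\<forall>T\<in>M. \<forall>v w. closed_segment v w edge_of T \<and> closed_segment v w \<subseteq> frontier \<Omega> \<longrightarrow>
        edge_integral v w (\<Phi> T) = 0)}"

definition RT0 :: "(plane \<Rightarrow> plane) set" where
  "RT0 = {v. \<exists>a b c. \<forall>x. v x = vector [a + c * x $ 1, b + c * x $ 2]}"

definition V_h :: "plane set set \<Rightarrow> (plane \<Rightarrow> plane) set" where
  "V_h M = {v. \<exists>V :: plane set \<Rightarrow> plane \<Rightarrow> plane.
     (\<forall>T\<in>M. V T \<in> RT0 \<and> (\<forall>x\<in>interior T. v x = V T x)) \<and>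
     (\<forall>T1\<in>M. \<forall>T2\<in>M. \<forall>y z. T1 \<noteq> T2 \<and> closed_segment y z edge_of T1 \<and> closed_segment y z edge_of T2 \<longrightarrow>
        (\<forall>n. n \<bullet> (z - y) = 0 \<longrightarrow> (\<forall>x\<in>closed_segment y z. V T1 x \<bullet> n = V T2 x \<bullet> n)))}"

definition mfv_scheme ::
  "plane set \<Rightarrow> plane set \<Rightarrow> real \<Rightarrow> real \<Rightarrow> plane set set \<Rightarrow> (plane \<Rightarrow> real) \<Rightarrow>
   (plane \<Rightarrow> plane) \<Rightarrow> (plane \<Rightarrow> real) \<Rightarrow> bool" where
  "mfv_scheme \<Omega> Om \<beta>m \<beta>p M f uh ph \<longleftrightarrow> (\<forall>T\<in>M.
     (\<forall>\<phi>\<in>S_local Om \<beta>m \<beta>p T.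
        (LINT x|lebesgue_on T. (uh x + coef Om \<beta>m \<beta>p x *\<^sub>R wgrad (interior T) ph x) \<bullet>
           wgrad (interior T) \<phi> x) = 0) \<and>
     (LINT x|lebesgue_on T. wdiv \<Omega> uh x) = (LINT x|lebesgue_on T. f x))"

end

theory Submission
  imports Defs
begin

text \<open>The finite volume scheme says that \<open>u\<^sub>h\<close> is orthogonal, element by element, to the gradients of
the local spaces against \<open>- \<beta> \<nabla>p\<^sub>h\<close>. Let \<open>u\<^sub>I\<close> be the Raviart--Thomas interpolant whose divergence is the element mean
of \<open>f\<close>, so that \<open>w = u\<^sub>I - u\<^sub>h\<close> is divergence free, hence constant on each element and orthogonal to
\<open>\<nabla>p = - u / \<beta>\<close> and to the broken gradient of \<open>p\<^sub>h\<close>. On each element let \<open>G w\<close> be the local gradient with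
\<open>\<integral> \<beta> \<nabla>\<psi> \<cdot> G w = \<integral> \<nabla>\<psi> \<cdot> w\<close> for all local \<open>\<psi>\<close>. Testing the scheme with \<open>G w\<close> bounds \<open>w\<close> by
\<open>u - u\<^sub>I\<close> and by the consistency term \<open>\<integral> u \<cdot> (G w - w / \<beta>)\<close>, which lives on interface elements. There the normal
part is of order \<open>h\<^sup>3\<close>, because chord and interface enclose a region of that area, and the tangential part
of \<open>u\<close> is small on average because \<open>\<nabla>p\<close> is curl free while \<open>\<beta>\<close> jumps: the mean of \<open>u\<close> over a square of size
\<open>h\<close> is almost normal to the chord.\<close>

text \<open>The scheme weighs gradients with \<open>coef\<close>, which jumps on the curve, while
  local functions have their kink on the chord. \<open>Gop\<close> reconciles the two through
  integrals of the true coefficient, but its tangential part differs from that of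
  \<open>w / \<beta>\<close> by a term of order one; a constant \<open>u\<close> is harmless only if
  it is normal to the chord. To see that it nearly is, pair fields with the rotated gradient of a
  cutoff. For \<open>u / \<beta>\<close> the integral vanishes, for \<open>u\<close> it is an
  integral of first derivatives. As \<open>\<beta>\<close> takes two different values, these two
  facts control the integral of \<open>u\<close> over \<open>Om\<close> alone, and for a constant
  field that integral is the tangential component times the mass of the cutoff along the interface.
  The jumps of \<open>p\<^sub>h\<close> cost nothing: Raviart--Thomas fields have constant normal
  components on edges and \<open>p\<^sub>h\<close> has matching edge means, so summation by parts is
  exact. Traces of Sobolev functions are avoided by writing edge means as cell integrals. Small
  \<open>h\<close> enters through the chord geometry; coarse meshes are covered by a cruder bound
  whose constant depends on the threshold.\<close>

abbreviation "leb \<equiv> lebesgue_on"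
abbreviation "vol \<equiv> measure lebesgue"
abbreviation "ind \<equiv> indicator"
abbreviation "L1 S \<equiv> integrable (lebesgue_on S)"
abbreviation "Mb S \<equiv> borel_measurable (lebesgue_on S)"
abbreviation "Sq D h \<equiv> cbox (D - vector [2 * h, 2 * h]) (D + vector [2 * h, 2 * h] :: plane)"
notation scaleR (infixr "*R" 75)
notation inner (infixl "\<cdot>" 70)
abbreviation "Bm \<equiv> borel_measurable borel"
lemmas L1_cmult = integrable_mult_right
lemmas LINT_add = Bochner_Integration.integral_add
lemmas LINT_diff = Bochner_Integration.integral_diff
lemmas LINT_cong = Bochner_Integration.integral_cong
lemmas LINT_nonneg = Bochner_Integration.integral_nonneg
lemmas L1_add = Bochner_Integration.integrable_add
lemmas L1_diff = Bochner_Integration.integrable_diff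
lemmas L1_bound = Bochner_Integration.integrable_bound
lemmas cont_Bm = borel_measurable_continuous_onI
lemmas L1_meas = borel_measurable_integrable
lemmas meas_leb = measurable_restrict_space1


section \<open>Smooth functions of one variable\<close>

primrec Ck1 :: "nat => (real => real) => bool" where
 "Ck1 0 f \<longleftrightarrow> continuous_on UNIV f"
| "Ck1 (Suc k) f \<longleftrightarrow> (EX f'. (ALL t. (f has_real_derivative f' t) (at t)) & Ck1 k f')"

lemma Ck1_mono: "Ck1 (Suc k) f ==> Ck1 k f"
proof (induction k arbitrary: f)
 case 0
 thus ?case by (auto intro: DERIV_continuous_on has_field_derivative_at_within)
next
 case (Suc k)
 from Suc.prems obtain f' where "ALL t. (f has_real_derivative f' t) (at t)" "Ck1 (Suc k) f'" by auto
 with Suc.IH show ?case by auto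
qed

lemma Ck1_const: "Ck1 k (%_. c)"
proof (induction k arbitrary: c)
 case (Suc k)
 thus ?case by (auto intro!: exI[of _ "%_. 0"] derivative_eq_intros)
qed auto

lemma Ck1_add: "Ck1 k f ==> Ck1 k g ==> Ck1 k (%t. f t + g t)"
proof (induction k arbitrary: f g)
 case 0 thus ?case by (auto intro!: continuous_intros)
next
 case (Suc k)
 from Suc.prems obtain f' g' where "ALL t. (f has_real_derivative f' t) (at t)" "Ck1 k f'"
  "ALL t. (g has_real_derivative g' t) (at t)" "Ck1 k g'" by auto
 with Suc.IH[of f' g'] show ?case by (auto intro!: exI[of _ "%t. f' t + g' t"] derivative_eq_intros)
qed

lemma Ck1_mult: "Ck1 k f ==> Ck1 k g ==> Ck1 k (%t. f t*g t)"
proof (induction k arbitrary: f g)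
 case 0 thus ?case by (auto intro!: continuous_intros)
next
 case (Suc k)
 have fg: "Ck1 k f" "Ck1 k g" using Suc.prems Ck1_mono by blast+
 from Suc.prems obtain f' g' where *: "ALL t. (f has_real_derivative f' t) (at t)" "Ck1 k f'"
  "ALL t. (g has_real_derivative g' t) (at t)" "Ck1 k g'" by auto
 have "Ck1 k (%t. f' t*g t + f t*g' t)" using Suc.IH fg * Ck1_add by simp
 with * show ?case
  by (auto intro!: exI[of _ "%t. f' t*g t + f t*g' t"] derivative_eq_intros)
qed

lemma Ck1_affine: "Ck1 k f ==> Ck1 k (%t. f (c*t + d))"
proof (induction k arbitrary: f)
 case 0 thus ?case
  by (auto intro!: continuous_intros continuous_on_compose2[of UNIV f])
next
 case (Suc k)
 from Suc.prems obtain f' where *: "ALL t. (f has_real_derivative f' t) (at t)" "Ck1 k f'" by auto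
 have "Ck1 k (%t. f' (c*t + d)*c)" using Suc.IH * Ck1_mult Ck1_const by blast
 moreover have "((%t. f (c*t + d)) has_real_derivative f' (c*t + d)*c) (at t)" for t
  by (rule DERIV_chain2[of f]) (use * in "auto intro!: derivative_eq_intros")
 ultimately show ?case by (auto intro!: exI[of _ "%t. f' (c*t + d)*c"])
qed

text \<open>The factor \<open>inverse t ^ m\<close> makes the family closed under differentiation up
  to linear combinations. Smoothness of \<open>exp (- inverse t)\<close>, extended by zero, then is
  a single induction that runs over all \<open>m\<close> at once.\<close>

definition hexp :: "nat => real => real" where
 "hexp m t = (if t <= 0 then 0 else inverse t ^ m*exp (- inverse t))"

lemma hexp_tendsto_0: "((%t. inverse t ^ m*exp (- inverse t)) \<longlongrightarrow> 0) (at_right (0::real))"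
proof -
 have "((%t. inverse t ^ m/exp (inverse t)) \<longlongrightarrow> 0) (at_right (0::real))"
  using filterlim_compose[OF tendsto_power_div_exp_0 filterlim_inverse_at_top_right] .
 thus ?thesis by (simp add: exp_minus divide_inverse)
qed

lemma hexp_deriv: "(hexp m has_real_derivative (hexp (m + 2) t - real m*hexp (m + 1) t)) (at t)"
proof -
 consider "t < 0" | "t = 0" | "t > 0" by linarith
 thus ?thesis
 proof cases
  case 1
  have "((%_. 0::real) has_real_derivative 0) (at t)" by simp
  hence "(hexp m has_real_derivative 0) (at t)"
  by (rule has_field_derivative_transform_within_open[of _ _ _ "{..<0}"])
  (use 1 in "simp_all add: hexp_def")
  thus ?thesis using 1 by (simp add: hexp_def)
 next
  \<comment> \<open>From the right the difference quotient at 0 is the same expression with exponent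
    \<open>Suc m\<close>, which tends to 0 by \<open>hexp_tendsto_0\<close>; from the left it
    vanishes.\<close>
  case 2
  have "((%s. (hexp m s - hexp m 0)/(s - 0)) \<longlongrightarrow> 0) (at 0)"
  proof (rule filterlim_split_at)
  show "((%s. (hexp m s - hexp m 0)/(s - 0)) \<longlongrightarrow> 0) (at_left 0)"
  by (rule tendsto_eventually) (auto simp: hexp_def eventually_at_filter)
  have "eventually (%s. inverse s ^ (Suc m)*exp (- inverse s) = (hexp m s - hexp m 0)/(s - 0)) (at_right (0::real))"
  by (auto simp: hexp_def eventually_at_filter divide_inverse mult_ac)
  with hexp_tendsto_0[of "Suc m"]
  show "((%s. (hexp m s - hexp m 0)/(s - 0)) \<longlongrightarrow> 0) (at_right 0)"
  by (rule Lim_transform_eventually)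
  qed
  thus ?thesis using 2 by (simp add: has_field_derivative_iff hexp_def)
 next
  case 3
  have i: "(inverse has_real_derivative - (inverse t ^ Suc (Suc 0))) (at t)"
  using 3 DERIV_inverse[of t UNIV] by simp
  have e: "((%t. exp (- inverse t)) has_real_derivative exp (- inverse t)*(- (- (inverse t ^ Suc (Suc 0))))) (at t)"
  by (rule DERIV_chain2[OF DERIV_exp]) (rule DERIV_minus[OF i])
  have "((%t. inverse t ^ m*exp (- inverse t)) has_real_derivative (hexp (m + 2) t - real m*hexp (m + 1) t)) (at t)"
  by (rule DERIV_cong[OF DERIV_mult[OF DERIV_power[OF i, of m] e]])
  (use 3 in "cases m; simp add: hexp_def algebra_simps")
  thus ?thesis
  by (rule has_field_derivative_transform_within_open[of _ _ _ "{0<..}"])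
  (use 3 in "simp_all add: hexp_def")
 qed
qed

lemma Ck1_hexp: "Ck1 k (hexp m)"
proof (induction k arbitrary: m)
 case 0
 show ?case
  unfolding Ck1.simps by (rule DERIV_continuous_on, rule has_field_derivative_at_within, rule hexp_deriv)
next
 case (Suc k)
 have "Ck1 k (%t. hexp (m + 2) t + (- real m)*hexp (m + 1) t)"
  by (intro Ck1_add Ck1_mult Ck1_const Suc)
 hence "Ck1 k (%t. hexp (m + 2) t - real m*hexp (m + 1) t)" by simp
 thus ?case
  unfolding Ck1.simps by (intro exI[of _ "%t. hexp (m + 2) t - real m*hexp (m + 1) t"] conjI allI hexp_deriv)
qed

definition smooth1 :: "(real => real) => bool" where
 "smooth1 f \<longleftrightarrow> (ALL k. Ck1 k f)"

lemma smooth1_deriv: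
 assumes "smooth1 f"
 shows "(f has_real_derivative deriv f t) (at t)" "smooth1 (deriv f)"
proof -
 have *: "EX f'. (ALL t. (f has_real_derivative f' t) (at t)) & Ck1 k f'" for k
  using assms unfolding smooth1_def by (metis Ck1.simps(2))
 thus "(f has_real_derivative deriv f t) (at t)" by (metis DERIV_imp_deriv)
 show "smooth1 (deriv f)"
  unfolding smooth1_def
 proof
  fix k
  from * obtain f' where "ALL t. (f has_real_derivative f' t) (at t)" "Ck1 k f'" by blast
  moreover hence "deriv f = f'" by (auto intro: DERIV_imp_deriv)
  ultimately show "Ck1 k (deriv f)" by simp
 qed
qed

lemma smooth1_continuous: "smooth1 f ==> continuous_on S f"
 unfolding smooth1_def by (metis Ck1.simps(1) continuous_on_subset top_greatest)

lemma deriv_support: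
 assumes "!!t. t ~: {c<..<d} ==> f t = 0" "t ~: {c..d}"
 shows "deriv f t = (0::real)"
proof -
 have "eventually (%s. f s = 0) (nhds t)"
  using assms by (intro eventually_mono[OF eventually_nhds_in_open[of "- {c..d}" t]]) auto
 hence "deriv f t = deriv (%_. 0) t"
  by (rule deriv_cong_ev) auto
 thus ?thesis by simp
qed

section \<open>Test functions of product form\<close>

definition prod_fun :: "(real => real) => (real => real) => plane => real" where
 "prod_fun b c x = b (x$1)*c (x$2)"

lemma prod_fun_has_derivative:
 assumes "(b has_real_derivative b') (at (x$1))" "(c has_real_derivative c') (at (x$2))"
 shows "(prod_fun b c has_derivative (%v. vector [b'*c (x$2), b (x$1)*c'] \<cdot> v)) (at x)"
proof -
 have 1: "((%x::plane. b (x$1)) has_derivative (%v. b' * v$1)) (at x)"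
  by (rule has_derivative_compose[of "%x. x$1" "%x. x$1" x UNIV b])
  (use assms(1)[unfolded has_field_derivative_def] in "simp_all add: bounded_linear_imp_has_derivative bounded_linear_vec_nth")
 have 2: "((%x::plane. c (x$2)) has_derivative (%v. c' * v$2)) (at x)"
  by (rule has_derivative_compose[of "%x. x$2" "%x. x$2" x UNIV c])
  (use assms(2)[unfolded has_field_derivative_def] in "simp_all add: bounded_linear_imp_has_derivative bounded_linear_vec_nth")
 show ?thesis
  unfolding prod_fun_def
  using has_derivative_mult[OF 1 2]
  by (simp add: inner_vec_def sum_2 algebra_simps)
qed

lemma grad_eqI:
 assumes "(f has_derivative (%v. g \<cdot> v)) (at x)"
 shows "grad f x = g"
 by (simp add: grad_def vec_eq_iff inner_axis flip: frechet_derivative_at[OF assms])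

lemma grad_has_derivative:
 assumes "f differentiable at x"
 shows "(f has_derivative (%v. grad f x \<cdot> v)) (at x)"
proof -
 have *: "(f has_derivative frechet_derivative f (at x)) (at x)"
  using assms frechet_derivative_works by blast
 then interpret bounded_linear "frechet_derivative f (at x)" by (rule has_derivative_bounded_linear)
 have "frechet_derivative f (at x) v = grad f x \<cdot> v" for v
 proof -
  have "v = (\<Sum>i\<in>UNIV. v$i *R axis i 1)"
  by (simp add: vec_eq_iff axis_def forall_2 sum_2)
  hence "frechet_derivative f (at x) v = (\<Sum>i\<in>UNIV. v$i*frechet_derivative f (at x) (axis i 1))"
  using sum[of "%i. v$i *R axis i 1" UNIV] by (simp add: scaleR)
  thus ?thesis by (simp add: grad_def inner_vec_def mult.commute)
 qed
 thus ?thesis using * by (metis (no_types, lifting) ext)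
qed

lemma prod_fun_grad:
 assumes "smooth1 b" "smooth1 c"
 shows "grad (prod_fun b c) x = vector [prod_fun (deriv b) c x, prod_fun b (deriv c) x]"
 unfolding prod_fun_def[of "deriv b"] prod_fun_def[of b "deriv c"]
 by (intro grad_eqI prod_fun_has_derivative smooth1_deriv assms)

text \<open>Partial derivatives of a product function are product functions again, so the induction
  over \<open>k\<close> must leave both factors arbitrary.\<close>

lemma Ck_prod_fun:
 assumes "smooth1 b" "smooth1 c"
 shows "Ck k (prod_fun b c)"
 using assms
proof (induction k arbitrary: b c)
 case 0
 thus ?case
  using has_derivative_continuous[OF prod_fun_has_derivative[OF smooth1_deriv(1) smooth1_deriv(1)]]
  by (simp add: continuous_on_eq_continuous_within)
next
 case (Suc k)
 have "prod_fun b c differentiable at x" for x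
  using prod_fun_has_derivative smooth1_deriv Suc.prems differentiable_def by blast
 moreover have "Ck k (%x. grad (prod_fun b c) x$i)" for i
  using exhaust_2[of i] Suc smooth1_deriv by (auto simp: prod_fun_grad)
 ultimately show ?case by auto
qed

lemma prod_fun_test:
 assumes "smooth1 b" "smooth1 c" "!!t. t ~: {p$1<..<q$1} ==> b t = 0" "!!t. t ~: {p$2<..<q$2} ==> c t = 0"
  and "cbox p q \<subseteq> S"
 shows "prod_fun b c : test_functions S"
proof -
 have "{x. prod_fun b c x ~= 0} \<subseteq> cbox p q"
 proof (rule subsetI, rule ccontr)
  fix x assume x: "x : {x. prod_fun b c x ~= 0}" "x ~: cbox p q"
  hence "x$1 ~: {p$1<..<q$1} \<or> x$2 ~: {p$2<..<q$2}"
  by (auto simp: mem_box_cart forall_2)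
  moreover have "b (x$1) ~= 0" "c (x$2) ~= 0" using x(1) by (auto simp: prod_fun_def)
  ultimately show False using assms(3)[of "x$1"] assms(4)[of "x$2"] by blast
 qed
 hence "closure {x. prod_fun b c x ~= 0} \<subseteq> cbox p q"
  by (intro closure_minimal closed_cbox)
 thus ?thesis
  using Ck_prod_fun[OF assms(1,2)] assms(5) unfolding test_functions_def
  by (auto simp: compact_eq_bounded_closed intro: bounded_subset[OF bounded_cbox])
qed

text \<open>The factor \<open>n\<close> steepens both flanks while the support stays in the
  interval, so that the pointwise limit is the indicator of the open interval. The case
  \<open>n = 1\<close> later serves as a cutoff.\<close>

definition bump :: "nat => real => real => real => real" where
 "bump n c d t = hexp 0 (real n*(t - c))*hexp 0 (real n*(d - t))"

lemma smooth1_bump: "smooth1 (bump n c d)"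
proof -
 have *: "Ck1 k (%t. hexp 0 (real n*t + (- real n*c))*hexp 0 ((- real n)*t + real n*d))" for k
  by (intro Ck1_mult Ck1_affine Ck1_hexp)
 have **: "bump n c d = (%t. hexp 0 (real n*t + (- real n*c))*hexp 0 ((- real n)*t + real n*d))"
  by (simp add: bump_def fun_eq_iff right_diff_distrib)
 show ?thesis unfolding smooth1_def ** using * by (rule allI)
qed

lemma bump_zero: "t ~: {c<..<d} ==> bump n c d t = 0"
 by (cases "t <= c") (auto simp: bump_def hexp_def mult_nonneg_nonpos)

lemma bump_bounds: "0 <= bump n c d t" "bump n c d t <= 1"
proof -
 have "0 <= hexp 0 s & hexp 0 s <= 1" for s by (simp add: hexp_def)
 thus "0 <= bump n c d t" "bump n c d t <= 1"
  unfolding bump_def by (auto intro: mult_le_one mult_nonneg_nonneg)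
qed

lemma bump_tendsto: "(%n. bump n c d t) \<longlonglongrightarrow> ind {c<..<d} t"
proof (cases "t : {c<..<d}")
 case True
 have *: "(%n. hexp 0 (real n * s)) \<longlonglongrightarrow> 1" if "s > 0" for s
 proof -
  have "(%n. exp (- (inverse (real n)*inverse s))) \<longlonglongrightarrow> exp (- (0*inverse s))"
  by (intro tendsto_intros lim_inverse_n)
  moreover have "eventually (%n. exp (- (inverse (real n)*inverse s)) = hexp 0 (real n * s)) sequentially"
  using eventually_gt_at_top[of 0]
  by eventually_elim (use that in "simp add: hexp_def mult_le_0_iff not_le inverse_mult_distrib")
  ultimately have "(%n. hexp 0 (real n * s)) \<longlonglongrightarrow> exp (- (0*inverse s))"
  by (rule Lim_transform_eventually)
  thus ?thesis by (simp only: mult_zero_left minus_zero exp_zero)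
 qed
 show ?thesis unfolding bump_def
  using tendsto_mult[OF *[of "t - c"] *[of "d - t"]] True
  by (simp only: indicator_simps mult_1_left greaterThanLessThan_iff diff_gt_0_iff_gt simp_thms)
next
 case False
 have "(%n. bump n c d t) = (%n. ind {c<..<d} t)"
  by (rule ext) (simp only: bump_zero[OF False] indicator_simps(2)[OF False])
 thus ?thesis by (simp only: tendsto_const)
qed

section \<open>Integrals over subsets and the fundamental lemma of the calculus of
  variations\<close>

lemma AE_leb_iff:
 "S : sets lebesgue ==> (AE x in leb S. P x) \<longleftrightarrow> (AE x in lebesgue. x : S --> P x)"
 by (subst AE_restrict_space_iff) auto

lemma LINT_lebesgue_on:
 fixes f :: "'a::euclidean_space => 'b::{banach,second_countable_topology}"
 assumes "S : sets lebesgue"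
 shows "(LINT x|leb S. f x) = (LINT x|lebesgue. ind S x *R f x)"
 using assms by (simp add: integral_restrict_space)

lemma integrable_lebesgue_on:
 fixes f :: "'a::euclidean_space => 'b::{banach,second_countable_topology}"
 assumes "S : sets lebesgue"
 shows "L1 S f \<longleftrightarrow> integrable lebesgue (%x. ind S x *R f x)"
 using assms by (simp add: integrable_restrict_space)

lemma L1_subset:
 fixes f :: "'a::euclidean_space => 'b::{banach,second_countable_topology}"
 assumes "L1 S f" "S : sets lebesgue" "T : sets lebesgue" "T \<subseteq> S"
 shows "L1 T f"
proof -
 have "integrable lebesgue (%x. ind T x *R (ind S x *R f x))"
  by (rule integrable_mult_indicator) (use assms integrable_lebesgue_on in auto)
 moreover have "(%x. ind T x *R (ind S x *R f x)) = (%x. ind T x *R f x)"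
  using \<open>T \<subseteq> S\<close> by (auto simp: fun_eq_iff split: split_indicator)
 ultimately show ?thesis using assms by (simp only: integrable_lebesgue_on)
qed

lemma LINT_support:
 fixes f :: "'a::euclidean_space => 'b::{banach,second_countable_topology}"
 assumes "S : sets lebesgue" "T : sets lebesgue" "T \<subseteq> S" "!!x. x : S - T ==> f x = 0"
 shows "(LINT x|leb S. f x) = (LINT x|leb T. f x)"
  and "L1 S f \<longleftrightarrow> L1 T f"
proof -
 have "(%x. ind S x *R f x) = (%x. ind T x *R f x)"
  using assms by (auto simp: indicator_def fun_eq_iff)
 thus "(LINT x|leb S. f x) = (LINT x|leb T. f x)"
  "L1 S f \<longleftrightarrow> L1 T f"
  using assms by (simp_all add: LINT_lebesgue_on integrable_lebesgue_on)
qed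

text \<open>Lebesgue differentiation: at almost every point the function is the limit of its means
  over cubes with a corner at that point, and these means vanish. Covering \<open>U\<close> by
  countably many closed boxes reduces local to global integrability.\<close>

lemma AE_zero_of_box_integrals:
 fixes f :: "plane => real"
 assumes "open U" "locally_integrable U f"
  and 0: "!!p q. cbox p q \<subseteq> U ==> (LINT x|leb (cbox p q). f x) = 0"
 shows "AE x in lebesgue. x : U --> f x = 0"
proof -
 obtain \<D> where D: "countable \<D>" "\<D> \<subseteq> Pow U" "!!X. X : \<D> ==> EX a b. X = cbox a b" "\<Union>\<D> = U"
  using open_countable_Union_open_cbox[OF \<open>open U\<close>] by metis
 have "AE x in lebesgue. x : C --> f x = 0" if CD: "C : \<D>" for C
 proof -
  obtain p q where C: "C = cbox p q" using D(3)[OF CD] by blast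
  have CU: "C \<subseteq> U" using D CD by blast
  let ?g = "%x. ind C x *R f x"
  have ig: "integrable lebesgue ?g"
  by (subst integrable_lebesgue_on[symmetric]) (use assms(2) CU C in "auto simp: locally_integrable_def")
  have "?g integrable_on UNIV"
  using ig integrable_on_lebesgue by blast
  hence int: "?g integrable_on cbox a b" for a b
  using integrable_on_subcbox by blast
  have zero: "integral (cbox a b) ?g = 0" for a b
  proof -
  obtain a' b' where ab: "cbox a b \<inter> C = cbox a' b'" unfolding C Int_interval by blast
  have "integrable lebesgue (%x. ind (cbox a b) x *R ?g x)"
  by (rule integrable_mult_indicator[OF _ ig]) simp
  hence "integral UNIV (%x. ind (cbox a b) x *R ?g x) = (LINT x|lebesgue. ind (cbox a b) x *R ?g x)"
  by (rule integral_lebesgue)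
  also have "... = (LINT x|leb (cbox a' b'). f x)"
  unfolding ab[symmetric]
  by (subst LINT_lebesgue_on) (auto simp: C indicator_inter_arith mult_ac)
  also have "... = 0" using 0 ab CU by blast
  finally have z: "integral UNIV (%x. ind (cbox a b) x *R ?g x) = 0" .
  have "(%x. ind (cbox a b) x *R ?g x) = (%x. if x : cbox a b then ?g x else 0)"
  proof
  fix x show "ind (cbox a b) x *R ?g x = (if x : cbox a b then ?g x else 0)"
  by (cases "x : cbox a b") (simp_all only: indicator_simps if_True if_False scaleR_one scaleR_zero_left simp_thms)
  qed
  from z[unfolded this] show ?thesis unfolding integral_restrict_UNIV .
  qed
  obtain N where N: "negligible N" "!!x e. [|x ~: N; 0 < e|] ==>
  EX d>0. ALL h. 0 < h & h < d -->
  norm(integral (cbox x (x + h *R One)) ?g /\<^sub>R h ^ DIM(plane) - ?g x) < e"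
  by (rule integrable_ccontinuous_explicit[of ?g, OF int]) (rule that)
  have "?g x = 0" if "x ~: N" for x
  proof (rule ccontr)
  assume "?g x ~= 0"
  hence "norm (?g x) > 0" by simp
  from N(2)[OF that this] obtain d where "d > 0"
  and d: "!!h. 0 < h & h < d ==> norm (integral (cbox x (x + h *R One)) ?g /\<^sub>R h ^ DIM(plane) - ?g x) < norm (?g x)"
  by blast
  show False using d[of "d/2"] \<open>d > 0\<close> unfolding zero by simp
  qed
  hence "AE x in lebesgue. x ~: N --> ?g x = 0" by simp
  moreover have "AE x in lebesgue. x ~: N"
  using N(1) by (simp add: negligible_iff_null_sets AE_not_in)
  ultimately show ?thesis by eventually_elim (auto simp: indicator_def split: if_splits)
 qed
 hence "AE x in lebesgue. ALL C:\<D>. x : C --> f x = 0"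
  by (subst AE_ball_countable[OF D(1)]) blast
 thus ?thesis
  by eventually_elim (use D(4) in blast)
qed

lemma test_continuous:
 assumes "\<phi> : test_functions S"
 shows "continuous_on UNIV \<phi>" "continuous_on UNIV (%x. grad \<phi> x$i)" "\<phi> differentiable at x"
proof -
 have C: "Ck k \<phi>" for k using assms by (simp add: test_functions_def)
 from C[of 0] show "continuous_on UNIV \<phi>" by simp
 from C[of "Suc 0"] show "\<phi> differentiable at x" "continuous_on UNIV (%x. grad \<phi> x$i)" by simp_all
qed

lemma test_support:
 assumes "\<phi> : test_functions S"
 shows "EX K. compact K & K \<subseteq> S & (ALL x. x ~: K --> \<phi> x = 0 & grad \<phi> x = 0)"
proof -
 obtain K where K: "K = closure {x. \<phi> x ~= 0}" by blast
 have c: "compact K" "K \<subseteq> S"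
  using assms unfolding test_functions_def K by blast+
 have *: "\<phi> x = 0" if "x ~: K" for x
  using that closure_subset[of "{x. \<phi> x ~= 0}"] unfolding K by blast
 have "grad \<phi> x = 0" if x: "x ~: K" for x
 proof (rule grad_eqI)
  have "((%_. 0::real) has_derivative (%v. 0 \<cdot> v)) (at x)" by simp
  thus "(\<phi> has_derivative (%v. 0 \<cdot> v)) (at x)"
  by (rule has_derivative_transform_within_open[of _ _ _ _ "- K"])
  (use x * c in "auto simp: open_Compl compact_imp_closed")
 qed
 with c * show ?thesis by blast
qed

lemma integrable_mult_continuous_compact:
 fixes g :: "'a::euclidean_space => real" and h :: "'a => real"
 assumes "L1 K g" "compact K" "continuous_on UNIV h"
 shows "L1 K (%x. g x*h x)"
proof -
 obtain B where B: "!!x. x : K ==> abs(h x) <= B"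
  using compact_imp_bounded[OF compact_continuous_image[OF continuous_on_subset[OF assms(3) subset_UNIV] assms(2)]]
  by (auto simp: bounded_iff)
 have h: "h : Mb K"
  using assms(3) by (intro meas_leb measurable_completion) (simp add: cont_Bm)
 show ?thesis
 proof (rule L1_bound[of _ "%x. B*g x"])
  show "L1 K (%x. B*g x)" using assms(1) by simp
  show "(%x. g x*h x) : Mb K"
  using h L1_meas[OF assms(1)] by measurable
  have "abs(g x*h x) <= abs(B*g x)" if "x : K" for x
  using mult_left_mono[OF order_trans[OF B[OF that] abs_ge_self[of B]], of "abs(g x)"]
  by (simp add: abs_mult mult.commute)
  thus "AE x in leb K. norm (g x*h x) <= norm (B*g x)"
  by (auto intro!: AE_I2)
 qed
qed

lemma L1_test:
 fixes g :: "plane => real"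
 assumes "open S" "locally_integrable S g" "\<phi> : test_functions S"
 shows "L1 S (%x. g x * \<phi> x)"
  and "L1 S (%x. g x*grad \<phi> x$i)"
proof -
 obtain K where t: "compact K" "K \<subseteq> S" "!!x. x ~: K ==> \<phi> x = 0" "!!x. x ~: K ==> grad \<phi> x = 0"
  using test_support[OF assms(3)] by blast
 note c = test_continuous[OF assms(3)]
 have K: "K : sets lebesgue" "S : sets lebesgue" using assms(1) t(1) by (auto simp: compact_imp_closed)
 have g: "L1 K g" using assms(2) t unfolding locally_integrable_def by blast
 show "L1 S (%x. g x * \<phi> x)"
  by (subst LINT_support(2)[OF K(2,1) t(2)])
  (simp_all add: t(3) integrable_mult_continuous_compact[OF g t(1) c(1)])
 show "L1 S (%x. g x*grad \<phi> x$i)"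
  by (subst LINT_support(2)[OF K(2,1) t(2)])
  (simp_all add: t(4) integrable_mult_continuous_compact[OF g t(1) c(2)])
qed

text \<open>Products of bumps are enough. They are bounded by 1 and converge to the indicator of an
  open box, whose boundary is a null set, so dominated convergence shows that the integral over
  every closed box in \<open>U\<close> is 0.\<close>

lemma AE_zero_of_test:
 fixes f :: "plane => real"
 assumes "open U" "locally_integrable U f"
  and 0: "!!\<phi>. \<phi> : test_functions U ==> (LINT x|leb U. f x * \<phi> x) = 0"
 shows "AE x in lebesgue. x : U --> f x = 0"
proof (rule AE_zero_of_box_integrals[OF assms(1,2)])
 fix p q :: plane assume pq: "cbox p q \<subseteq> U"
 let ?K = "cbox p q"
 let ?\<phi> = "%n. prod_fun (bump n (p$1) (q$1)) (bump n (p$2) (q$2))"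
 have f: "L1 ?K f"
  using assms(2)[unfolded locally_integrable_def, rule_format, of ?K] pq compact_cbox by simp
 have t: "?\<phi> n : test_functions U" for n
  by (rule prod_fun_test[OF smooth1_bump smooth1_bump _ _ pq]) (erule bump_zero)+
 have out: "?\<phi> n x = 0" if "x ~: ?K" for n x
 proof -
  from that have "x$1 ~: {p$1<..<q$1} \<or> x$2 ~: {p$2<..<q$2}"
  by (auto simp: mem_box_cart forall_2)
  thus ?thesis
  unfolding prod_fun_def by (elim disjE) (simp_all only: bump_zero mult_zero_left mult_zero_right not_False_eq_True)
 qed
 have z: "(LINT x|leb ?K. f x * ?\<phi> n x) = 0" for n
 proof -
  have "(LINT x|leb U. f x * ?\<phi> n x) = (LINT x|leb ?K. f x * ?\<phi> n x)"
  by (rule LINT_support(1)) (use pq assms(1) out in auto)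
  thus ?thesis using 0[OF t[of n]] by simp
 qed
 have lim: "(%n. ?\<phi> n x) \<longlonglongrightarrow> ind (box p q) x" for x
 proof -
  have "(%n. ?\<phi> n x) \<longlonglongrightarrow> ind {p$1<..<q$1} (x$1)*ind {p$2<..<q$2} (x$2)"
  unfolding prod_fun_def by (intro tendsto_mult bump_tendsto)
  also have "ind {p$1<..<q$1} (x$1)*ind {p$2<..<q$2} (x$2) = (ind (box p q) x :: real)"
  by (auto simp: indicator_def mem_box_cart forall_2)
  finally show ?thesis .
 qed
 have b: "abs(?\<phi> n x) <= 1" for n x
  using bump_bounds[of n "p$1" "q$1" "x$1"] bump_bounds[of n "p$2" "q$2" "x$2"]
  by (simp add: prod_fun_def mult_le_one)
 have mI: "(%x. f x*ind (box p q) x) : Mb ?K"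
  by (intro borel_measurable_times L1_meas[OF f] meas_leb borel_measurable_indicator) simp
 have "(%n. LINT x|leb ?K. f x * ?\<phi> n x) \<longlonglongrightarrow> (LINT x|leb ?K. f x*ind (box p q) x)"
 proof (rule integral_dominated_convergence[where w = "%x. norm (f x)"])
  show "AE x in leb ?K. (%n. f x * ?\<phi> n x) \<longlonglongrightarrow> f x*ind (box p q) x"
  by (intro AE_I2 tendsto_mult lim tendsto_const)
  show "AE x in leb ?K. norm (f x * ?\<phi> n x) <= norm (f x)" for n
  by (intro AE_I2) (use b in "simp add: abs_mult mult_left_le")
  show "(%x. f x*ind (box p q) x) : Mb ?K"
  by (rule mI)
  show "(%x. f x * ?\<phi> n x) : Mb ?K" for n
  using integrable_mult_continuous_compact[OF f compact_cbox test_continuous(1)[OF t[of n]]]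
  by (rule L1_meas)
 qed (use f in auto)
 hence "(LINT x|leb ?K. f x*ind (box p q) x) = 0"
  by (simp add: z LIMSEQ_const_iff)
 moreover have "(LINT x|leb ?K. f x*ind (box p q) x) = (LINT x|leb ?K. f x)"
 proof (rule integral_cong_AE)
  have "AE x in lebesgue. x ~: ?K - box p q"
  by (rule AE_not_in) (use negligible_frontier_interval in "simp only: negligible_iff_null_sets")
  hence "AE x in lebesgue. x : ?K --> f x*ind (box p q) x = f x"
  by eventually_elim (simp split: split_indicator)
  thus "AE x in leb ?K. f x*ind (box p q) x = f x"
  by (subst AE_leb_iff) simp_all
  show "(%x. f x*ind (box p q) x) : Mb ?K"
  by (rule mI)
 qed (use f in auto)
 ultimately show "(LINT x|leb ?K. f x) = 0" by simp
qed

section \<open>Uniqueness of weak gradients and weak divergences\<close>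

lemma locally_integrable_diff:
 "locally_integrable S f ==> locally_integrable S g ==> locally_integrable S (%x. f x - g x)"
 by (auto simp: locally_integrable_def)

lemma locally_L1_component:
 fixes g :: "plane => plane"
 shows "locally_integrable S g ==> locally_integrable S (%x. g x$i)"
 unfolding locally_integrable_def
 by (auto intro: integrable_bounded_linear[OF bounded_linear_vec_nth])

text \<open>Local integrability gives measurability on compact boxes; countably many of them exhaust
  an open set.\<close>

lemma locally_integrable_measurable:
 fixes g :: "plane => 'a::euclidean_space"
 assumes "open S" "locally_integrable S g"
 shows "g : Mb S"
proof -
 obtain \<D> where D: "countable \<D>" "\<D> \<subseteq> Pow S" "!!X. X : \<D> ==> EX a b. X = cbox a b" "\<Union>\<D> = S"
  using open_countable_Union_open_cbox[OF \<open>open S\<close>] by metis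
 show ?thesis
 proof (rule measurable_piecewise_restrict[of \<D>])
  show "countable \<D>" "space (leb S) \<subseteq> \<Union> \<D>" using D by auto
  fix X assume X: "X : \<D>"
  obtain p q where pq: "X = cbox p q" using D(3)[OF X] by blast
  have XS: "X \<subseteq> S" using D(2) X by blast
  show "X \<inter> space (leb S) : sets (leb S)"
  using XS \<open>open S\<close> pq by (simp add: sets_restrict_space_iff)
  have "S \<inter> X = X" using XS by blast
  hence "restrict_space (leb S) X = leb X"
  using pq \<open>open S\<close> by (subst restrict_restrict_space) simp_all
  moreover have "L1 X g"
  using assms(2)[unfolded locally_integrable_def, rule_format, of X] XS pq compact_cbox by simp
  ultimately show "g : borel_measurable (restrict_space (leb S) X)"
  by (simp add: L1_meas)
 qed
qed

lemma has_weak_grad_unique: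
 assumes "open S" "has_weak_grad S f g" "has_weak_grad S f g'"
 shows "AE x in leb S. g x = g' x"
proof -
 have "AE x in lebesgue. x : S --> g x$i - g' x$i = 0" for i
 proof (rule AE_zero_of_test[OF \<open>open S\<close>])
  have lg: "locally_integrable S (%x. g x$i)" "locally_integrable S (%x. g' x$i)"
  using assms by (auto simp: has_weak_grad_def locally_L1_component)
  show "locally_integrable S (%x. g x$i - g' x$i)"
  by (intro locally_integrable_diff lg)
  fix \<phi> assume \<phi>: "\<phi> : test_functions S"
  show "(LINT x|leb S. (g x$i - g' x$i) * \<phi> x) = 0"
  using assms \<phi> L1_test(1)[OF \<open>open S\<close> _ \<phi>] lg
  by (simp add: left_diff_distrib has_weak_grad_def)
 qed
 hence "AE x in lebesgue. ALL i:UNIV. x : S --> g x$i - g' x$i = 0"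
  by (intro AE_ball_countable[THEN iffD2]) auto
 thus ?thesis
  using \<open>open S\<close> by (subst AE_leb_iff) (auto simp: vec_eq_iff elim!: eventually_mono)
qed

lemma has_weak_div_unique:
 assumes "open S" "has_weak_div S f g" "has_weak_div S f g'"
 shows "AE x in leb S. g x = g' x"
proof -
 have "AE x in lebesgue. x : S --> g x - g' x = 0"
 proof (rule AE_zero_of_test[OF \<open>open S\<close>])
  have lg: "locally_integrable S g" "locally_integrable S g'"
  using assms by (auto simp: has_weak_div_def)
  thus "locally_integrable S (%x. g x - g' x)"
  by (rule locally_integrable_diff)
  fix \<phi> assume \<phi>: "\<phi> : test_functions S"
  show "(LINT x|leb S. (g x - g' x) * \<phi> x) = 0"
  using assms \<phi> L1_test(1)[OF \<open>open S\<close> _ \<phi>] lg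
  by (simp add: left_diff_distrib has_weak_div_def)
 qed
 thus ?thesis
  using \<open>open S\<close> by (subst AE_leb_iff) auto
qed

lemma wgrad_AE:
 assumes "open S" "has_weak_grad S f g"
 shows "has_weak_grad S f (wgrad S f)" "AE x in leb S. wgrad S f x = g x"
proof -
 show *: "has_weak_grad S f (wgrad S f)" unfolding wgrad_def by (rule someI[of "has_weak_grad S f"], rule assms(2))
 show "AE x in leb S. wgrad S f x = g x" by (rule has_weak_grad_unique[OF assms(1) * assms(2)])
qed

lemma wdiv_AE:
 assumes "open S" "has_weak_div S f g"
 shows "has_weak_div S f (wdiv S f)" "AE x in leb S. wdiv S f x = g x"
proof -
 show *: "has_weak_div S f (wdiv S f)" unfolding wdiv_def by (rule someI[of "has_weak_div S f"], rule assms(2))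
 show "AE x in leb S. wdiv S f x = g x" by (rule has_weak_div_unique[OF assms(1) * assms(2)])
qed

lemma L2_cong_AE:
 assumes "g : L2 S" "f : Mb S" "AE x in leb S. f x = g x"
 shows "f : L2 S" "l2norm S f = l2norm S g"
proof -
 have g: "g : Mb S" "L1 S (%x. (norm (g x))^2)"
  using assms(1) by (auto simp: L2_def)
 have m: "(%x. (norm (f x))^2) : Mb S" using assms(2) by measurable
 have ae: "AE x in leb S. (norm (g x))^2 = (norm (f x))^2"
  using assms(3) by eventually_elim simp
 show "f : L2 S" unfolding L2_def
  using integrable_cong_AE_imp[OF g(2) m] ae assms(2) by (simp add: eq_commute)
 show "l2norm S f = l2norm S g" unfolding l2norm_def
  using integral_cong_AE[OF _ m ae] g by (simp add: L1_meas)
qed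

lemma H1_wgrad:
 assumes "open S" "f : H1 S"
 shows "has_weak_grad S f (wgrad S f)" "wgrad S f : L2 S" "f : L2 S"
proof -
 obtain g where g: "g : L2 S" "has_weak_grad S f g" using assms by (auto simp: H1_def)
 show *: "has_weak_grad S f (wgrad S f)" using wgrad_AE[OF assms(1) g(2)] by simp
 hence "wgrad S f : Mb S"
  by (intro locally_integrable_measurable[OF assms(1)]) (simp add: has_weak_grad_def)
 thus "wgrad S f : L2 S" using L2_cong_AE(1)[OF g(1)] wgrad_AE[OF assms(1) g(2)] by blast
 show "f : L2 S" using assms by (simp add: H1_def)
qed

section \<open>Plane Lebesgue measure as a product measure\<close>

abbreviation pt :: "real => real => plane" where
 "pt x y \<equiv> vector [x, y]"

lemma plane_eq_iff: "(x::plane) = y \<longleftrightarrow> x$1 = y$1 & x$2 = y$2"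
 by (simp add: vec_eq_iff forall_2)

lemma pt_eta [simp]: "pt (x$1) (x$2) = x"
 by (simp add: plane_eq_iff)

lemma pt_axis: "pt x y = x *R axis 1 1 + y *R axis 2 1"
 by (simp add: plane_eq_iff axis_def)

lemma continuous_pt [continuous_intros]:
 "continuous_on S f ==> continuous_on S g ==> continuous_on S (%x. pt (f x) (g x))"
 unfolding pt_axis by (intro continuous_intros)

lemma measurable_pt [measurable]: "(%z. pt (fst z) (snd z)) : borel_measurable (borel \<Otimes>\<^sub>M borel)"
 unfolding pt_axis by measurable

lemma Basis_plane: "(Basis :: plane set) = {axis 1 1, axis 2 1}"
 by (auto simp: Basis_vec_def UNIV_2)

lemma prod_Basis_plane: "(\<Prod>b\<in>(Basis::plane set). f b) = f (axis 1 1)*f (axis 2 1)"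
proof -
 have "axis 1 1 ~= (axis 2 1 :: plane)" by (simp add: axis_eq_axis)
 thus ?thesis by (simp add: Basis_plane)
qed

lemma inner_axis_plane: "x \<cdot> axis i 1 = (x :: plane)$i"
 by (simp add: inner_axis)

text \<open>\<open>real^2\<close> is not the product type, so Fubini has to be transported along
  \<open>pt\<close>. Agreement on open boxes identifies the two measures.\<close>

lemma lborel_plane: "distr (lborel \<Otimes>\<^sub>M lborel) borel (%z. pt (fst z) (snd z)) = lborel"
proof (rule lborel_eqI[symmetric])
 fix l u :: plane assume lu: "!!b. b : Basis ==> l \<cdot> b <= u \<cdot> b"
 have l1: "l$1 <= u$1" "l$2 <= u$2"
  using lu[of "axis 1 1"] lu[of "axis 2 1"] by (auto simp: Basis_plane inner_axis_plane)
 have "(%z. pt (fst z) (snd z)) -` box l u = {l$1<..<u$1} \<times> {l$2<..<u$2}"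
  by (auto simp: mem_box_cart forall_2)
 hence "emeasure (distr (lborel \<Otimes>\<^sub>M lborel) borel (%z. pt (fst z) (snd z))) (box l u)
  = emeasure (lborel \<Otimes>\<^sub>M lborel) ({l$1<..<u$1} \<times> {l$2<..<u$2})"
  by (subst emeasure_distr) (simp_all add: space_pair_measure)
 also have "... = ennreal (u$1 - l$1)*ennreal (u$2 - l$2)"
  using l1 by (subst lborel.emeasure_pair_measure_Times) simp_all
 also have "... = (\<Prod>b\<in>Basis. (u - l) \<cdot> b)"
  using l1 by (simp add: prod_Basis_plane inner_axis_plane ennreal_mult)
 finally show "emeasure (distr (lborel \<Otimes>\<^sub>M lborel) borel (%z. pt (fst z) (snd z))) (box l u)
  = (\<Prod>b\<in>Basis. (u - l) \<cdot> b)" .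
qed simp

lemma integral_plane:
 fixes f :: "plane => real"
 assumes [measurable]: "f : Bm"
 shows "integrable lborel f \<longleftrightarrow> integrable (lborel \<Otimes>\<^sub>M lborel) (%(x, y). f (pt x y))"
  and "integral\<^sup>L lborel f = integral\<^sup>L (lborel \<Otimes>\<^sub>M lborel) (%(x, y). f (pt x y))"
  and "integral\<^sup>N lborel (%x. ennreal (f x)) = (\<integral>\<^sup>+ y. \<integral>\<^sup>+ x. ennreal (f (pt x y)) \<partial>lborel \<partial>lborel)"
proof -
 have m: "(%z. pt (fst z) (snd z)) : measurable (lborel \<Otimes>\<^sub>M lborel) borel" by measurable
 have eq: "(%(x, y). f (pt x y)) = (%z. f (pt (fst z) (snd z)))" by auto
 show "integrable lborel f \<longleftrightarrow> integrable (lborel \<Otimes>\<^sub>M lborel) (%(x, y). f (pt x y))"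
  unfolding eq by (subst lborel_plane[symmetric]) (rule integrable_distr_eq[OF m assms])
 show "integral\<^sup>L lborel f = integral\<^sup>L (lborel \<Otimes>\<^sub>M lborel) (%(x, y). f (pt x y))"
  unfolding eq by (subst lborel_plane[symmetric]) (rule integral_distr[OF m assms])
 have "integral\<^sup>N lborel (%x. ennreal (f x)) = (\<integral>\<^sup>+ z. ennreal (f (pt (fst z) (snd z))) \<partial>(lborel \<Otimes>\<^sub>M lborel))"
  by (subst lborel_plane[symmetric]) (rule nn_integral_distr[OF m], measurable)
 also have "... = (\<integral>\<^sup>+ y. \<integral>\<^sup>+ x. ennreal (f (pt (fst (x, y)) (snd (x, y)))) \<partial>lborel \<partial>lborel)"
  by (subst lborel_pair.nn_integral_snd[symmetric]) simp_all
 finally show "integral\<^sup>N lborel (%x. ennreal (f x)) = (\<integral>\<^sup>+ y. \<integral>\<^sup>+ x. ennreal (f (pt x y)) \<partial>lborel \<partial>lborel)"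
  by simp
qed

section \<open>The divergence theorem on right triangles\<close>

lemma LINT_lebesgue_on_borel:
 fixes f :: "'a::euclidean_space => 'b::{banach,second_countable_topology}"
 assumes "S : sets borel" "f : Bm"
 shows "(LINT x|leb S. f x) = (LINT x|lborel. ind S x *R f x)"
  and "L1 S f \<longleftrightarrow> integrable lborel (%x. ind S x *R f x)"
proof -
 have S: "S : sets lebesgue" using assms(1) by simp
 have m: "(%x. ind S x *R f x) : borel_measurable lborel" using assms by simp
 show "(LINT x|leb S. f x) = (LINT x|lborel. ind S x *R f x)"
  unfolding LINT_lebesgue_on[OF S] by (rule integral_completion[OF m])
 show "L1 S f \<longleftrightarrow> integrable lborel (%x. ind S x *R f x)"
  unfolding integrable_lebesgue_on[OF S] by (rule integrable_completion[OF m])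
qed

text \<open>Signed lengths keep one formula for all orientations of a triangle: dividing by
  \<open>c\<close> turns the segment from \<open>p\<close> to \<open>p + m*c\<close> into an
  interval starting at 0, and the factor \<open>sgn c\<close> alone remembers the direction. The
  finite exceptional set admits integrands with kinks.\<close>

lemma ftc_segment:
 fixes p c m B :: real
 assumes c: "c ~= 0" and m: "0 <= m" and G: "continuous_on UNIV G" and S: "finite S"
  and D: "!!x. x ~: S ==> (G has_real_derivative g x) (at x)"
  and g: "g : Bm"
  and B: "!!x. 0 <= (x - p)/c ==> (x - p)/c <= m ==> abs(g x) <= B"
 shows "(\<integral>x. ind {x. 0 <= (x - p)/c & (x - p)/c <= m} x*g x \<partial>lborel) = sgn c*(G (p + m*c) - G p)"
proof -
 define a b where "a = min p (p + m*c)" and "b = max p (p + m*c)"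
 have set: "{x. 0 <= (x - p)/c & (x - p)/c <= m} = {a..b}"
 proof (cases "c > 0")
  case True thus ?thesis using m by (auto simp: a_def b_def min_def max_def field_simps)
 next
  case False
  with c have "c < 0" by simp
  moreover hence "m*c <= 0" using m by (simp add: mult_nonneg_nonpos)
  ultimately show ?thesis by (auto simp: a_def b_def min_def max_def field_simps)
 qed
 have ab: "a <= b" by (simp add: a_def b_def)
 have "(g has_integral (G b - G a)) {a..b}"
 proof (rule fundamental_theorem_of_calculus_strong[OF S ab])
  show "(G has_vector_derivative g x) (at x)" if "x : {a..b} - S" for x
  using D that by (simp add: has_real_derivative_iff_has_vector_derivative)
  show "continuous_on {a..b} G" using G continuous_on_subset by blast
 qed
 hence 1: "((%x. if x : {a..b} then g x else 0) has_integral (G b - G a)) UNIV"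
  by (subst has_integral_restrict_UNIV)
 have "integrable lborel (%x. ind {a..b} x *R g x)"
 proof (rule integrableI_bounded_set_indicator[where B=B])
  have "abs(g x) <= B" if "x : {a..b}" for x
  using that B unfolding set[symmetric] by blast
  thus "AE x in lborel. x : {a..b} --> norm (g x) <= B" by simp
  show "emeasure lborel {a..b} < \<infinity>" using ab by simp
 qed (use g in simp_all)
 hence i: "integrable lborel (%x. ind {a..b} x*g x)" by simp
 have "(%x. ind {a..b} x*g x) = (%x. if x : {a..b} then g x else 0)"
  by (rule ext) (simp add: indicator_def)
 from has_integral_unique[OF has_integral_integral_real[OF i] 1[folded this]]
 have "(\<integral>x. ind {a..b} x*g x \<partial>lborel) = G b - G a" .
 moreover have "G b - G a = sgn c*(G (p + m*c) - G p)"
 proof (cases "c > 0")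
  case True hence "p <= p + m*c" using m by simp
  thus ?thesis using True by (simp add: a_def b_def)
 next
  case False
  with c have "c < 0" by simp
  moreover hence "p + m*c <= p" using m by (simp add: mult_nonneg_nonpos)
  ultimately show ?thesis by (simp add: a_def b_def)
 qed
 ultimately show ?thesis unfolding set by simp
qed

text \<open>Fubini with the inner integration in the direction of the derivative: a horizontal
  section runs from the leg \<open>x = p\<close> to the hypotenuse, where the fundamental theorem
  leaves two boundary values. The substitution \<open>y = q + d*t\<close> turns them into means over
  edges, so that edge lengths and outer normals never have to be introduced.\<close>

lemma triangle_divergence_core:
 fixes c d p q B :: real and F f :: "real => real => real"
 defines "R \<equiv> {(x, y). 0 <= (x - p)/c & 0 <= (y - q)/d & (x - p)/c + (y - q)/d <= 1}"
 assumes c: "c ~= 0" and d: "d ~= 0"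
  and F: "continuous_on UNIV (%z. F (fst z) (snd z))"
  and f: "(%z. f (fst z) (snd z)) : borel_measurable (borel \<Otimes>\<^sub>M borel)"
  and B: "!!x y. (x, y) : R ==> abs(f x y) <= B"
  and D: "!!y. EX S. finite S & (ALL x. x ~: S --> ((%s. F s y) has_real_derivative f x y) (at x))"
 shows "integrable (lborel \<Otimes>\<^sub>M lborel) (%(x, y). ind R (x, y)*f x y)"
  and "(\<integral>z. (case z of (x, y) => ind R (x, y)*f x y) \<partial>(lborel \<Otimes>\<^sub>M lborel)) =
  abs(c*d)/c*((LINT t|leb {0..1}. F (p + (1 - t)*c) (q + t*d)) - (LINT t|leb {0..1}. F p (q + t*d)))"
proof -
 have R[measurable]: "R : sets (borel \<Otimes>\<^sub>M borel)"
 proof -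
  have "{z : space (borel \<Otimes>\<^sub>M borel). 0 <= (fst z - p)/c & 0 <= (snd z - q)/d & (fst z - p)/c + (snd z - q)/d <= 1}
  : sets (borel \<Otimes>\<^sub>M borel)" by measurable
  also have "{z : space (borel \<Otimes>\<^sub>M borel). 0 <= (fst z - p)/c & 0 <= (snd z - q)/d & (fst z - p)/c + (snd z - q)/d <= 1} = R"
  by (auto simp: R_def space_pair_measure)
  finally show ?thesis .
 qed
 have sub: "R \<subseteq> {p - abs(c)..p + abs(c)} \<times> {q - abs(d)..q + abs(d)}"
 proof -
  have *: "abs(x - p) <= abs(c)" if "0 <= (x - p)/c" "(x - p)/c <= 1" "c ~= 0" for x p c :: real
  proof -
  have "abs((x - p)/c) <= 1" using that by (simp only: abs_of_nonneg)
  hence "abs((x - p)/c)*abs(c) <= 1*abs(c)" by (rule mult_right_mono) simp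
  thus ?thesis using that(3) by (simp add: abs_mult[symmetric] del: abs_divide)
  qed
  show ?thesis
  proof
  fix z assume z: "z : R"
  obtain x y where xy: "z = (x, y)" by (cases z)
  have "abs(x - p) <= abs(c)" "abs(y - q) <= abs(d)"
  using z c d unfolding R_def xy by (auto intro!: *)
  thus "z : {p - abs(c)..p + abs(c)} \<times> {q - abs(d)..q + abs(d)}" unfolding xy by auto
  qed
 qed
 have "emeasure (lborel \<Otimes>\<^sub>M lborel) R <= emeasure (lborel \<Otimes>\<^sub>M lborel) ({p - abs(c)..p + abs(c)} \<times> {q - abs(d)..q + abs(d)})"
  by (rule emeasure_mono[OF sub]) simp
 also have "... = ennreal (2*abs(c))*ennreal (2*abs(d))"
  by (subst lborel.emeasure_pair_measure_Times) simp_all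
 also have "... < \<infinity>" by (simp add: ennreal_mult_less_top)
 finally have fin: "emeasure (lborel \<Otimes>\<^sub>M lborel) R < \<infinity>" .
 have "integrable (lborel \<Otimes>\<^sub>M lborel) (%z. ind R z *R f (fst z) (snd z))"
  by (rule integrableI_bounded_set_indicator[where B=B, OF _ _ fin]) (use R f B in "auto")
 thus int: "integrable (lborel \<Otimes>\<^sub>M lborel) (%(x, y). ind R (x, y)*f x y)"
  by (simp add: case_prod_beta')
 define I where "I = (%y. ind {0..1} ((y - q)/d)*(sgn c*(F (p + (1 - (y - q)/d)*c) y - F p y)))"
 have inner: "(\<integral>x. ind R (x, y)*f x y \<partial>lborel) = I y" for y
 proof (cases "0 <= (y - q)/d & (y - q)/d <= 1")
  case True
  obtain S where S: "finite S" "!!x. x ~: S ==> ((%s. F s y) has_real_derivative f x y) (at x)"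
  using D[of y] by blast
  have "(\<integral>x. ind {x. 0 <= (x - p)/c & (x - p)/c <= 1 - (y - q)/d} x*f x y \<partial>lborel)
  = sgn c*(F (p + (1 - (y - q)/d)*c) y - F p y)"
  proof (rule ftc_segment[OF c _ _ S(1), of _ "%s. F s y" "%x. f x y" p B])
  show "0 <= 1 - (y - q)/d" using True by simp
  have "continuous_on UNIV (%x. (x, y))" by (intro continuous_intros)
  from continuous_on_compose2[OF F this] show "continuous_on UNIV (%s. F s y)" by simp
  have "(%x. (x, y)) : borel \<rightarrow>\<^sub>M borel \<Otimes>\<^sub>M borel" by measurable
  from measurable_compose[OF this f] show "(%x. f x y) : Bm" by simp
  show "abs(f x y) <= B" if "0 <= (x - p)/c" "(x - p)/c <= 1 - (y - q)/d" for x
  using that True by (intro B) (simp add: R_def)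
  qed (rule S(2))
  moreover have "ind {x. 0 <= (x - p)/c & (x - p)/c <= 1 - (y - q)/d} x = (ind R (x, y) :: real)" for x
  using True by (auto simp: R_def indicator_def)
  ultimately show ?thesis using True by (simp add: I_def)
 next
  case False
  hence "(x, y) ~: R" for x
  by (auto simp: R_def)
  moreover have "(y - q)/d ~: {0..1}" using False by simp
  ultimately show ?thesis by (simp add: I_def)
 qed
 have "(\<integral>z. (case z of (x, y) => ind R (x, y)*f x y) \<partial>(lborel \<Otimes>\<^sub>M lborel)) = (\<integral>y. I y \<partial>lborel)"
  using lborel_pair.integral_snd[OF int] by (simp add: inner)
 also have "... = abs(d)*(\<integral>t. I (q + d*t) \<partial>lborel)"
  using lborel_integral_real_affine[OF d, of I q] by simp
 also have "(\<integral>t. I (q + d*t) \<partial>lborel) = (\<integral>t. ind {0..1} t *R (sgn c*F (p + (1 - t)*c) (q + t*d) - sgn c*F p (q + t*d)) \<partial>lborel)"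
 proof -
  have "(q + d*t - q)/d = t" for t using d by simp
  thus ?thesis by (simp add: I_def right_diff_distrib[of "sgn c"] mult.commute[of d])
 qed
 also have "... = (LINT t|leb {0..1}. sgn c*F (p + (1 - t)*c) (q + t*d) - sgn c*F p (q + t*d))"
 proof (rule LINT_lebesgue_on_borel(1)[symmetric])
  have "continuous_on UNIV (%t. (p + (1 - t)*c, q + t*d))" "continuous_on UNIV (%t. (p, q + t*d))" by (intro continuous_intros)+
  from this[THEN continuous_on_compose2[OF F]]
  have "continuous_on UNIV (%t. sgn c*F (p + (1 - t)*c) (q + t*d) - sgn c*F p (q + t*d))"
  by (auto intro!: continuous_on_diff continuous_on_mult_left)
  thus "(%t. sgn c*F (p + (1 - t)*c) (q + t*d) - sgn c*F p (q + t*d)) : Bm"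
  by (rule cont_Bm)
 qed simp
 also have "... = sgn c*(LINT t|leb {0..1}. F (p + (1 - t)*c) (q + t*d)) - sgn c*(LINT t|leb {0..1}. F p (q + t*d))"
 proof -
  have "continuous_on {0..1} (%t. (p + (1 - t)*c, q + t*d))" "continuous_on {0..1} (%t. (p, q + t*d))" by (intro continuous_intros)+
  from this[THEN continuous_on_compose2[OF F]]
  have "integrable (leb {0..1}) (%t. F (p + (1 - t)*c) (q + t*d))" "integrable (leb {0..1}) (%t. F p (q + t*d))"
  by (simp_all only: fst_conv snd_conv subset_UNIV simp_thms continuous_imp_integrable_real)
  thus ?thesis by (simp del: continuous_imp_integrable_real)
 qed
 finally show "(\<integral>z. (case z of (x, y) => ind R (x, y)*f x y) \<partial>(lborel \<Otimes>\<^sub>M lborel)) =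
  abs(c*d)/c*((LINT t|leb {0..1}. F (p + (1 - t)*c) (q + t*d)) - (LINT t|leb {0..1}. F p (q + t*d)))"
  using c by (cases "c > 0") (simp_all add: abs_mult algebra_simps)
qed


text \<open>The right angle is at \<open>P\<close>, and \<open>c\<close>, \<open>d\<close> are
  signed legs. The two quotients are the barycentric coordinates of the other two vertices.\<close>

definition tri :: "plane => real => real => plane set" where
 "tri P c d = {x. 0 <= (x$1 - P$1)/c & 0 <= (x$2 - P$2)/d & (x$1 - P$1)/c + (x$2 - P$2)/d <= 1}"

definition avg :: "plane => plane => (plane => real) => real" where
 "avg v w F = (LINT t|leb {0..1}. F (linepath v w t))"

lemma edge_integral_avg: "edge_integral v w F = norm (w - v)*avg v w F"
 by (simp add: edge_integral_def avg_def)

lemma integrable_avg: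
 fixes F :: "plane => real"
 assumes "continuous_on UNIV F"
 shows "integrable (leb {0..1}) (%t. F (linepath v w t))"
 by (intro continuous_imp_integrable_real continuous_on_compose2[OF assms]) auto

lemma avg_commute:
 assumes "continuous_on UNIV F"
 shows "avg v w F = avg w v F"
proof -
 have B: "(%t. F (linepath v w t)) : Bm" for v w
  by (intro cont_Bm continuous_on_compose2[OF assms]) auto
 have "avg v w F = (\<integral>t. ind {0..1} t*F (linepath v w t) \<partial>lborel)"
  unfolding avg_def by (subst LINT_lebesgue_on_borel(1)) (use B in auto)
 also have "... = (\<integral>t. ind {0..1} (1 + (-1)*t)*F (linepath v w (1 + (-1)*t)) \<partial>lborel)"
  by (subst lborel_integral_real_affine[of "-1" _ 1]) simp_all
 also have "... = (\<integral>t. ind {0..1} t*F (linepath w v t) \<partial>lborel)"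
  by (rule LINT_cong) (auto simp: linepath_def indicator_def add.commute)
 also have "... = avg w v F"
  unfolding avg_def by (subst LINT_lebesgue_on_borel(1)) (use B in auto)
 finally show ?thesis .
qed

lemma tri_borel [measurable]: "tri P c d : sets borel"
proof -
 have "{x : space borel. 0 <= (x$1 - P$1)/c & 0 <= (x$2 - P$2)/d & (x$1 - P$1)/c + (x$2 - P$2)/d <= 1} : sets borel"
  by measurable
 thus ?thesis by (simp add: tri_def)
qed

lemma borel_pt_swap: "(%z. pt (snd z) (fst z)) : borel_measurable (borel \<Otimes>\<^sub>M borel)"
 unfolding pt_axis by measurable

lemma tri_div1:
 assumes c: "c ~= 0" and d: "d ~= 0" and F: "continuous_on UNIV F" and f[measurable]: "f : Bm"
  and B: "!!x. x : tri P c d ==> abs(f x) <= B"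
  and D: "!!y. EX S. finite S & (ALL x. x ~: S --> ((%s. F (pt s y)) has_real_derivative f (pt x y)) (at x))"
 shows "L1 (tri P c d) f"
  and "(LINT x|leb (tri P c d). f x) = abs(c*d)/c*(avg (P + pt c 0) (P + pt 0 d) F - avg P (P + pt 0 d) F)"
proof -
 let ?R = "{(x, y). 0 <= (x - P$1)/c & 0 <= (y - P$2)/d & (x - P$1)/c + (y - P$2)/d <= 1}"
 have m: "(%x. ind (tri P c d) x*f x) : Bm" by measurable
 have eq: "(%(x, y). ind (tri P c d) (pt x y)*f (pt x y)) = (%(x, y). ind ?R (x, y)*f (pt x y))"
  by (auto simp: fun_eq_iff tri_def indicator_def)
 have 1: "continuous_on UNIV (%z. F (pt (fst z) (snd z)))"
  by (intro continuous_on_compose2[OF F] continuous_intros) auto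
 have 2: "(%z. f (pt (fst z) (snd z))) : borel_measurable (borel \<Otimes>\<^sub>M borel)"
  by (rule measurable_compose[OF measurable_pt f])
 have 3: "abs(f (pt x y)) <= B" if "(x, y) : ?R" for x y
  using that by (intro B) (simp add: tri_def)
 note core = triangle_divergence_core[of c d "%x y. F (pt x y)" "%x y. f (pt x y)" "P$1" "P$2" B, OF c d 1 2 3 D]
 show "L1 (tri P c d) f"
  using core(1) unfolding eq[symmetric] by (simp add: LINT_lebesgue_on_borel(2) integral_plane(1)[OF m])
 have l: "pt (P$1 + (1 - t)*c) (P$2 + t*d) = linepath (P + pt c 0) (P + pt 0 d) t"
  "pt (P$1) (P$2 + t*d) = linepath P (P + pt 0 d) t" for t
  by (simp_all add: plane_eq_iff linepath_def algebra_simps)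
 show "(LINT x|leb (tri P c d). f x) = abs(c*d)/c*(avg (P + pt c 0) (P + pt 0 d) F - avg P (P + pt 0 d) F)"
  using core(2) unfolding eq[symmetric] l avg_def
  by (simp add: LINT_lebesgue_on_borel(1) integral_plane(2)[OF m])
qed

lemma tri_div2:
 assumes c: "c ~= 0" and d: "d ~= 0" and F: "continuous_on UNIV F" and f[measurable]: "f : Bm"
  and B: "!!x. x : tri P c d ==> abs(f x) <= B"
  and D: "!!x. EX S. finite S & (ALL y. y ~: S --> ((%s. F (pt x s)) has_real_derivative f (pt x y)) (at y))"
 shows "L1 (tri P c d) f"
  and "(LINT x|leb (tri P c d). f x) = abs(c*d)/d*(avg (P + pt c 0) (P + pt 0 d) F - avg P (P + pt c 0) F)"
proof -
 let ?R = "{(y, x). 0 <= (y - P$2)/d & 0 <= (x - P$1)/c & (y - P$2)/d + (x - P$1)/c <= 1}"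
 have m: "(%x. ind (tri P c d) x*f x) : Bm" by measurable
 have eq: "(%(y, x). ind (tri P c d) (pt x y)*f (pt x y)) = (%(y, x). ind ?R (y, x)*f (pt x y))"
  by (auto simp: fun_eq_iff tri_def indicator_def)
 have 1: "continuous_on UNIV (%z. F (pt (snd z) (fst z)))"
  by (intro continuous_on_compose2[OF F] continuous_intros) auto
 have 2: "(%z. f (pt (snd z) (fst z))) : borel_measurable (borel \<Otimes>\<^sub>M borel)"
  by (rule measurable_compose[OF borel_pt_swap f])
 have 3: "abs(f (pt x y)) <= B" if "(y, x) : ?R" for x y
  using that by (intro B) (simp add: tri_def add.commute)
 note core = triangle_divergence_core[of d c "%y x. F (pt x y)" "%y x. f (pt x y)" "P$2" "P$1" B, OF d c 1 2 3 D]
 have i: "integrable (lborel \<Otimes>\<^sub>M lborel) (%(x, y). ind (tri P c d) (pt x y)*f (pt x y))"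
  using core(1) unfolding eq[symmetric]
  by (subst lborel_pair.integrable_product_swap_iff[symmetric]) (simp add: case_prod_beta')
 thus "L1 (tri P c d) f"
  by (simp add: LINT_lebesgue_on_borel(2) integral_plane(1)[OF m])
 have sw: "(\<integral>z. (case z of (x, y) => ind (tri P c d) (pt x y)*f (pt x y)) \<partial>(lborel \<Otimes>\<^sub>M lborel))
  = (\<integral>z. (case z of (y, x) => ind (tri P c d) (pt x y)*f (pt x y)) \<partial>(lborel \<Otimes>\<^sub>M lborel))"
  using lborel_pair.integral_product_swap[OF L1_meas[OF i]] by (simp add: case_prod_beta')
 have l: "pt (P$1 + t*c) (P$2 + (1 - t)*d) = linepath (P + pt 0 d) (P + pt c 0) t"
  "pt (P$1 + t*c) (P$2) = linepath P (P + pt c 0) t" for t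
  by (simp_all add: plane_eq_iff linepath_def algebra_simps)
 have "(LINT x|leb (tri P c d). f x) = abs(d*c)/d*(avg (P + pt 0 d) (P + pt c 0) F - avg P (P + pt c 0) F)"
  using core(2) unfolding eq[symmetric] sw[symmetric] l avg_def
  by (simp add: LINT_lebesgue_on_borel(1) integral_plane(2)[OF m])
 thus "(LINT x|leb (tri P c d). f x) = abs(c*d)/d*(avg (P + pt c 0) (P + pt 0 d) F - avg P (P + pt c 0) F)"
  by (simp add: avg_commute[OF F, of "P + pt 0 d"] mult.commute)
qed

text \<open>A calculus for functions with a kink along a line: on every axis-parallel line the
  partial derivative may fail at finitely many points, and \<open>g\<close> is a Borel gradient that
  is bounded on bounded sets. The class contains test functions and the functions of the local
  spaces and is closed under products, which is what the divergence theorem asks for.\<close>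

definition kdiff :: "(plane => real) => (plane => plane) => bool" where
 "kdiff F g \<longleftrightarrow> continuous_on UNIV F & g : Bm & (ALL S. bounded S --> bounded (g ` S)) &
  (ALL y. EX S. finite S & (ALL x. x ~: S --> ((%s. F (pt s y)) has_real_derivative g (pt x y)$1) (at x))) &
  (ALL x. EX S. finite S & (ALL y. y ~: S --> ((%s. F (pt x s)) has_real_derivative g (pt x y)$2) (at y)))"

lemma continuous_bounded_image:
 fixes F :: "plane => 'a::metric_space"
 assumes "continuous_on UNIV F" "bounded S"
 shows "bounded (F ` S)"
proof -
 have "compact (F ` closure S)"
  using assms by (intro compact_continuous_image) (auto intro: continuous_on_subset)
 thus ?thesis
  by (rule bounded_subset[OF compact_imp_bounded]) (intro image_mono closure_subset)
qed

lemma kdiff_mult: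
 assumes "kdiff F g" "kdiff G h"
 shows "kdiff (%x. F x*G x) (%x. F x *R h x + G x *R g x)"
 unfolding kdiff_def
proof (intro conjI allI impI)
 have c: "continuous_on UNIV F" "continuous_on UNIV G" using assms by (auto simp: kdiff_def)
 hence [measurable]: "F : Bm" "G : Bm"
  by (auto intro: cont_Bm)
 have [measurable]: "g : Bm" "h : Bm" using assms by (auto simp: kdiff_def)
 show "continuous_on UNIV (%x. F x*G x)" by (intro continuous_intros c)
 show "(%x. F x *R h x + G x *R g x) : Bm" by measurable
 show "bounded ((%x. F x *R h x + G x *R g x) ` S)" if S: "bounded S" for S
 proof -
  have "bounded (h ` S)" "bounded (g ` S)" using S assms by (auto simp: kdiff_def)
  moreover have "bounded (F ` S)" "bounded (G ` S)" using continuous_bounded_image c S by blast+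
  ultimately obtain b1 b2 b3 b4 where b: "ALL x:S. norm (h x) <= b1" "ALL x:S. norm (g x) <= b2"
  "ALL x:S. norm (F x) <= b3" "ALL x:S. norm (G x) <= b4" by (auto simp: bounded_iff)
  have "norm (F x *R h x + G x *R g x) <= b3*b1 + b4*b2" if "x : S" for x
  proof -
  have "norm (F x *R h x + G x *R g x) <= norm (F x)*norm (h x) + norm (G x)*norm (g x)"
  using norm_triangle_ineq[of "F x *R h x" "G x *R g x"] by simp
  also have "... <= b3*b1 + b4*b2"
  using b that by (intro add_mono mult_mono) (auto intro: order_trans[OF norm_ge_zero])
  finally show ?thesis .
  qed
  thus ?thesis by (auto simp: bounded_iff)
 qed
 show "EX S. finite S & (ALL x. x ~: S --> ((%s. F (pt s y)*G (pt s y)) has_real_derivative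
  (F (pt x y) *R h (pt x y) + G (pt x y) *R g (pt x y))$1) (at x))" for y
 proof -
  obtain S where S: "finite S" "ALL x. x ~: S --> ((%s. F (pt s y)) has_real_derivative g (pt x y)$1) (at x)"
  using assms(1) unfolding kdiff_def by meson
  obtain S' where S': "finite S'" "ALL x. x ~: S' --> ((%s. G (pt s y)) has_real_derivative h (pt x y)$1) (at x)"
  using assms(2) unfolding kdiff_def by meson
  show ?thesis
  by (intro exI[of _ "S \<union> S'"] conjI allI impI DERIV_cong[OF DERIV_mult])
  (use S S' in "auto simp: algebra_simps")
 qed
 show "EX S. finite S & (ALL y. y ~: S --> ((%s. F (pt x s)*G (pt x s)) has_real_derivative
  (F (pt x y) *R h (pt x y) + G (pt x y) *R g (pt x y))$2) (at y))" for x
 proof -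
  obtain S where S: "finite S" "ALL y. y ~: S --> ((%s. F (pt x s)) has_real_derivative g (pt x y)$2) (at y)"
  using assms(1) unfolding kdiff_def by meson
  obtain S' where S': "finite S'" "ALL y. y ~: S' --> ((%s. G (pt x s)) has_real_derivative h (pt x y)$2) (at y)"
  using assms(2) unfolding kdiff_def by meson
  show ?thesis
  by (intro exI[of _ "S \<union> S'"] conjI allI impI DERIV_cong[OF DERIV_mult])
  (use S S' in "auto simp: algebra_simps")
 qed
qed

text \<open>An axis-parallel line either meets the kink once or is parallel to it; in the second
  case the positive part is constant along the line, and the corresponding component of
  \<open>k *R n\<close> is zero.\<close>

lemma kdiff_add_kink:
 "kdiff (%x. k0 + g0 \<cdot> x + k*max 0 (n \<cdot> (x - D))) (%x. g0 + (if n \<cdot> (x - D) > 0 then k *R n else 0))"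
 unfolding kdiff_def
proof (intro conjI allI impI)
 show "continuous_on UNIV (%x. k0 + g0 \<cdot> x + k*max 0 (n \<cdot> (x - D)))"
  by (intro continuous_intros)
 show "(%x. g0 + (if n \<cdot> (x - D) > 0 then k *R n else 0)) : Bm"
  by measurable
 show "bounded ((%x. g0 + (if n \<cdot> (x - D) > 0 then k *R n else 0)) ` S)" for S
 proof (rule bounded_subset)
  show "bounded {g0 + k *R n, g0}" by simp
 qed auto
 have kink: "EX S. finite S & (ALL x. x ~: S --> ((%s. A + B * s + k*max 0 (m * s + e)) has_real_derivative
  B + (if m*x + e > 0 then k*m else 0)) (at x))" for A B m e :: real
 proof (cases "m = 0")
  case True
  thus ?thesis by (auto intro!: exI[of _ "{}"] derivative_eq_intros)
 next
  case False
  show ?thesis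
  proof (intro exI[of _ "{- e/m}"] conjI allI impI)
  fix x assume "x ~: {- e/m}"
  hence "m*x + e ~= 0" using False by (auto simp: field_simps add_eq_0_iff)
  then consider "m*x + e > 0" | "m*x + e < 0" by linarith
  thus "((%s. A + B * s + k*max 0 (m * s + e)) has_real_derivative B + (if m*x + e > 0 then k*m else 0)) (at x)"
  proof cases
  case 1
  have "((%s. A + B * s + k*(m * s + e)) has_real_derivative B + k*m) (at x)"
  by (auto intro!: derivative_eq_intros)
  moreover have "open {s. 0 < m * s + e}" by (intro open_Collect_less continuous_intros)
  ultimately have "((%s. A + B * s + k*max 0 (m * s + e)) has_real_derivative B + k*m) (at x)"
  by (rule has_field_derivative_transform_within_open) (use 1 in auto)
  thus ?thesis using 1 by simp
  next
  case 2
  have "((%s. A + B * s) has_real_derivative B) (at x)"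
  by (auto intro!: derivative_eq_intros)
  moreover have "open {s. m * s + e < 0}" by (intro open_Collect_less continuous_intros)
  ultimately have "((%s. A + B * s + k*max 0 (m * s + e)) has_real_derivative B) (at x)"
  by (rule has_field_derivative_transform_within_open) (use 2 in auto)
  thus ?thesis using 2 by simp
  qed
  qed simp
 qed
 have e1: "k0 + g0 \<cdot> pt s y + k*max 0 (n \<cdot> (pt s y - D)) = (k0 + g0$2*y) + g0$1 * s + k*max 0 (n$1 * s + (n$2*y - n \<cdot> D))" for s y
  by (simp add: inner_vec_def sum_2 algebra_simps)
 have f1: "(g0 + (if n \<cdot> (pt x y - D) > 0 then k *R n else 0))$1 = g0$1 + (if n$1*x + (n$2*y - n \<cdot> D) > 0 then k*n$1 else 0)" for x y
  by (simp add: inner_vec_def sum_2 algebra_simps)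
 show "EX S. finite S & (ALL x. x ~: S --> ((%s. k0 + g0 \<cdot> pt s y + k*max 0 (n \<cdot> (pt s y - D))) has_real_derivative
  (g0 + (if n \<cdot> (pt x y - D) > 0 then k *R n else 0))$1) (at x))" for y
  unfolding e1 f1 by (rule kink)
 have e2: "k0 + g0 \<cdot> pt x s + k*max 0 (n \<cdot> (pt x s - D)) = (k0 + g0$1*x) + g0$2 * s + k*max 0 (n$2 * s + (n$1*x - n \<cdot> D))" for s x
  by (simp add: inner_vec_def sum_2 algebra_simps)
 have f2: "(g0 + (if n \<cdot> (pt x y - D) > 0 then k *R n else 0))$2 = g0$2 + (if n$2*y + (n$1*x - n \<cdot> D) > 0 then k*n$2 else 0)" for x y
  by (simp add: inner_vec_def sum_2 algebra_simps)
 show "EX S. finite S & (ALL y. y ~: S --> ((%s. k0 + g0 \<cdot> pt x s + k*max 0 (n \<cdot> (pt x s - D))) has_real_derivative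
  (g0 + (if n \<cdot> (pt x y - D) > 0 then k *R n else 0))$2) (at y))" for x
  unfolding e2 f2 by (rule kink)
qed

lemma kdiff_C1:
 assumes d: "!!x. F differentiable at x" and g: "!!i. continuous_on UNIV (%x. grad F x$i)"
 shows "kdiff F (grad F)"
 unfolding kdiff_def
proof (intro conjI allI impI)
 show "continuous_on UNIV F"
  using d by (simp add: continuous_on_eq_continuous_within differentiable_imp_continuous_within)
 have "continuous_on UNIV (%x. \<chi> i. grad F x$i)" by (intro continuous_on_vec_lambda g)
 hence c: "continuous_on UNIV (grad F)" by simp
 thus "grad F : Bm" by (rule cont_Bm)
 show "bounded (grad F ` S)" if "bounded S" for S using continuous_bounded_image[OF c that] .
 have ch: "((%s. F (v + s *R w)) has_real_derivative grad F (v + x *R w) \<cdot> w) (at x)" for v w x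
 proof -
  have "((%s. v + s *R w) has_derivative (%s. s *R w)) (at x)"
  by (auto intro!: derivative_eq_intros)
  from has_derivative_compose[OF this grad_has_derivative[OF d]]
  show ?thesis by (simp add: has_field_derivative_def mult.commute[of _ "grad F _ \<cdot> w"] mult_commute_abs)
 qed
 show "EX S. finite S & (ALL x. x ~: S --> ((%s. F (pt s y)) has_real_derivative grad F (pt x y)$1) (at x))" for y
  using ch[of "y *R axis 2 1" "axis 1 1"]
  by (intro exI[of _ "{}"]) (simp add: pt_axis inner_axis_plane add.commute)
 show "EX S. finite S & (ALL y. y ~: S --> ((%s. F (pt x s)) has_real_derivative grad F (pt x y)$2) (at y))" for x
  using ch[of "x *R axis 1 1" "axis 2 1"]
  by (intro exI[of _ "{}"]) (simp add: pt_axis inner_axis_plane)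
qed

lemma kdiff_test: "\<phi> : test_functions S ==> kdiff \<phi> (grad \<phi>)"
 using test_continuous by (intro kdiff_C1) blast+

lemma tri_bounded: "c ~= 0 ==> d ~= 0 ==> bounded (tri P c d)"
proof -
 assume cd: "c ~= 0" "d ~= 0"
 have *: "abs(x - p) <= abs(c)" if "0 <= (x - p)/c" "(x - p)/c <= 1" "c ~= 0" for x p c :: real
 proof -
  have "abs((x - p)/c) <= 1" using that by (simp only: abs_of_nonneg)
  hence "abs((x - p)/c)*abs(c) <= 1*abs(c)" by (rule mult_right_mono) simp
  thus ?thesis using that(3) by (simp add: abs_mult[symmetric] del: abs_divide)
 qed
 have "tri P c d \<subseteq> cbox (pt (P$1 - abs(c)) (P$2 - abs(d))) (pt (P$1 + abs(c)) (P$2 + abs(d)))"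
 proof
  fix x assume x: "x : tri P c d"
  hence "abs(x$1 - P$1) <= abs(c)" "abs(x$2 - P$2) <= abs(d)"
  using cd by (auto simp: tri_def intro!: *)
  thus "x : cbox (pt (P$1 - abs(c)) (P$2 - abs(d))) (pt (P$1 + abs(c)) (P$2 + abs(d)))"
  by (auto simp: mem_box_cart forall_2)
 qed
 thus ?thesis by (rule bounded_subset[OF bounded_cbox])
qed

lemma tri_kdiff:
 assumes cd: "c ~= 0" "d ~= 0" and k: "kdiff F g"
 shows "L1 (tri P c d) (%x. g x$i)"
  and "(LINT x|leb (tri P c d). g x$1) = abs(c*d)/c*(avg (P + pt c 0) (P + pt 0 d) F - avg P (P + pt 0 d) F)"
  and "(LINT x|leb (tri P c d). g x$2) = abs(c*d)/d*(avg (P + pt c 0) (P + pt 0 d) F - avg P (P + pt c 0) F)"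
proof -
 have c: "continuous_on UNIV F" and [measurable]: "g : Bm" using k by (auto simp: kdiff_def)
 have "bounded (g ` tri P c d)" using k tri_bounded[OF cd] by (auto simp: kdiff_def)
 then obtain B where B: "!!x. x : tri P c d ==> norm (g x) <= B" by (auto simp: bounded_iff)
 have B': "abs(g x$i) <= B" if "x : tri P c d" for x i
  using order_trans[OF component_le_norm_cart B[OF that]] by blast
 have D1: "EX S. finite S & (ALL x. x ~: S --> ((%s. F (pt s y)) has_real_derivative g (pt x y)$1) (at x))" for y
  using k unfolding kdiff_def by blast
 have D2: "EX S. finite S & (ALL y. y ~: S --> ((%s. F (pt x s)) has_real_derivative g (pt x y)$2) (at y))" for x
  using k unfolding kdiff_def by blast
 have m: "(%x. g x$j) : Bm" for j
  by (rule measurable_compose[OF _ borel_measurable_nth]) measurable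
 note 1 = tri_div1[OF cd c m[of 1] B' D1] and 2 = tri_div2[OF cd c m[of 2] B' D2]
 show "L1 (tri P c d) (%x. g x$i)" using exhaust_2[of i] 1(1) 2(1) by auto
 show "(LINT x|leb (tri P c d). g x$1) = abs(c*d)/c*(avg (P + pt c 0) (P + pt 0 d) F - avg P (P + pt 0 d) F)"
  by (rule 1(2))
 show "(LINT x|leb (tri P c d). g x$2) = abs(c*d)/d*(avg (P + pt c 0) (P + pt 0 d) F - avg P (P + pt c 0) F)"
  by (rule 2(2))
qed

lemma kdiff_affine: "kdiff (%x. k0 + g0 \<cdot> x) (%x. g0)"
 using kdiff_add_kink[of k0 g0 0 0 0] by simp

lemma tri_measure:
 assumes "c ~= 0" "d ~= 0"
 shows "tri P c d : lmeasurable" "vol (tri P c d) = abs(c*d)/2"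
proof -
 show l: "tri P c d : lmeasurable"
  by (rule bounded_set_imp_lmeasurable) (use tri_bounded[OF assms] in auto)
 have "vol (tri P c d) = (LINT x|leb (tri P c d). 1)"
  using l by (simp add: measure_restrict_space)
 also have "... = (LINT x|leb (tri P c d). (axis 1 1 :: plane)$1)" by (simp add: axis_def)
 also have "... = abs(c*d)/c*(avg (P + pt c 0) (P + pt 0 d) (%x. 0 + axis 1 1 \<cdot> x) - avg P (P + pt 0 d) (%x. 0 + axis 1 1 \<cdot> x))"
  by (rule tri_kdiff(2)[OF assms kdiff_affine])
 also have "avg (P + pt c 0) (P + pt 0 d) (%x. 0 + axis 1 1 \<cdot> x) - avg P (P + pt 0 d) (%x. 0 + axis 1 1 \<cdot> x)
  = avg (P + pt c 0) (P + pt 0 d) (%x. x$1) - avg P (P + pt 0 d) (%x. x$1)"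
  by (simp add: inner_commute[of "axis 1 1"] inner_axis_plane)
 also have "... = (LINT t|leb {0..1}. c - c*t)"
 proof -
  have e: "linepath (P + pt c 0) (P + pt 0 d) t$1 = P$1 + (c - c*t)" "linepath P (P + pt 0 d) t$1 = P$1" for t
  by (simp_all add: linepath_def algebra_simps)
  have i: "integrable (leb {0..1::real}) (%t. P$1)" "integrable (leb {0..1}) (%t. c - c*t)"
  by (intro continuous_imp_integrable_real continuous_intros)+
  show ?thesis
  unfolding avg_def e by (subst LINT_add[OF i]) simp
 qed
 also have "(LINT t|leb {0..1}. c - c*t) = c/2"
 proof -
  have "((%t. c - c*t) has_integral (c*1 - c*1^2/2) - (c*0 - c*0^2/2)) {0..1}"
  by (rule fundamental_theorem_of_calculus)
  (auto intro!: derivative_eq_intros simp flip: has_real_derivative_iff_has_vector_derivative)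
  moreover have "integrable (leb {0..1}) (%t. c - c*t)"
  by (intro continuous_imp_integrable_real continuous_intros)
  ultimately show ?thesis
  by (simp add: lebesgue_integral_eq_integral integral_unique)
 qed
 finally show "vol (tri P c d) = abs(c*d)/2" using assms by simp
qed

lemma avg_cong: "(!!t. t : {0..1} ==> F (linepath v w t) = G (linepath v w t)) ==> avg v w F = avg v w G"
 unfolding avg_def by (rule LINT_cong) auto

lemma avg_cmult: "avg v w (%x. k*F x) = k*avg v w F"
 unfolding avg_def by simp

text \<open>The integrand is the divergence of the product of \<open>\<Phi>\<close> and
  \<open>V\<close>, because \<open>V\<close> has divergence \<open>2 * k\<close>. A Raviart--Thomas
  field has a constant normal component on each edge, so \<open>\<Phi>\<close> enters through its
  edge means alone. This is why matching edge means suffice for the discontinuous pressures.\<close>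

lemma tri_RT:
 fixes V :: "plane => plane"
 assumes cd: "c ~= 0" "d ~= 0" and k: "kdiff \<Phi> g"
  and V: "!!x. V x = pt (a + k*x$1) (b + k*x$2)"
 shows "(LINT x|leb (tri P c d). V x \<cdot> g x + 2 * k * \<Phi> x) = abs(c*d) *
  ((V P$1/c + V P$2/d + k)*avg (P + pt c 0) (P + pt 0 d) \<Phi>
  - V P$1/c*avg P (P + pt 0 d) \<Phi> - V P$2/d*avg P (P + pt c 0) \<Phi>)"
  and "L1 (tri P c d) (%x. V x \<cdot> g x + 2 * k * \<Phi> x)"
proof -
 let ?h = "%F. avg (P + pt c 0) (P + pt 0 d) F"
 have C: "continuous_on UNIV \<Phi>" using k by (simp add: kdiff_def)
 have V1: "V x$1 = a + (k *R axis 1 1) \<cdot> x" and V2: "V x$2 = b + (k *R axis 2 1) \<cdot> x" for x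
  by (simp_all add: V inner_commute[of "axis _ 1"] inner_axis_plane)
 have k1: "kdiff (%x. V x$1 * \<Phi> x) (%x. V x$1 *R g x + \<Phi> x *R (k *R axis 1 1))"
  unfolding V1 by (rule kdiff_mult[OF kdiff_affine k])
 have k2: "kdiff (%x. V x$2 * \<Phi> x) (%x. V x$2 *R g x + \<Phi> x *R (k *R axis 2 1))"
  unfolding V2 by (rule kdiff_mult[OF kdiff_affine k])
 note t1 = tri_kdiff[OF cd k1] and t2 = tri_kdiff[OF cd k2]
 have eq: "V x \<cdot> g x + 2 * k * \<Phi> x = (V x$1 *R g x + \<Phi> x *R (k *R axis 1 1))$1
  + (V x$2 *R g x + \<Phi> x *R (k *R axis 2 1))$2" for x
  by (simp add: inner_vec_def sum_2 axis_def)
 show "L1 (tri P c d) (%x. V x \<cdot> g x + 2 * k * \<Phi> x)"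
  unfolding eq by (intro L1_add t1(1) t2(1))
 have "(LINT x|leb (tri P c d). V x \<cdot> g x + 2 * k * \<Phi> x) =
  abs(c*d)/c*(?h (%x. V x$1 * \<Phi> x) - avg P (P + pt 0 d) (%x. V x$1 * \<Phi> x))
  + abs(c*d)/d*(?h (%x. V x$2 * \<Phi> x) - avg P (P + pt c 0) (%x. V x$2 * \<Phi> x))"
  unfolding eq by (subst LINT_add[OF t1(1) t2(1)]) (simp only: t1(2) t2(3))
 also have "avg P (P + pt 0 d) (%x. V x$1 * \<Phi> x) = V P$1*avg P (P + pt 0 d) \<Phi>"
  unfolding avg_cmult[symmetric] by (rule avg_cong) (simp add: V linepath_def algebra_simps)
 also have "avg P (P + pt c 0) (%x. V x$2 * \<Phi> x) = V P$2*avg P (P + pt c 0) \<Phi>"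
  unfolding avg_cmult[symmetric] by (rule avg_cong) (simp add: V linepath_def algebra_simps)
 finally have 1: "(LINT x|leb (tri P c d). V x \<cdot> g x + 2 * k * \<Phi> x) =
  abs(c*d)*((1/c * ?h (%x. V x$1 * \<Phi> x) + 1/d * ?h (%x. V x$2 * \<Phi> x))
  - V P$1/c*avg P (P + pt 0 d) \<Phi> - V P$2/d*avg P (P + pt c 0) \<Phi>)"
  by (simp add: algebra_simps)
 have i: "integrable (leb {0..1}) (%t. (V (linepath (P + pt c 0) (P + pt 0 d) t)$j * \<Phi> (linepath (P + pt c 0) (P + pt 0 d) t)))" for j
 proof (rule integrable_avg)
  show "continuous_on UNIV (%x. V x$j * \<Phi> x)"
  using exhaust_2[of j] k1 k2 by (auto simp: kdiff_def)
 qed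
 have "1/c * ?h (%x. V x$1 * \<Phi> x) + 1/d * ?h (%x. V x$2 * \<Phi> x) = ?h (%x. 1/c*(V x$1 * \<Phi> x) + 1/d*(V x$2 * \<Phi> x))"
  unfolding avg_def
  by (subst LINT_add[OF L1_cmult[OF i] L1_cmult[OF i]]) (simp only: integral_mult_right_zero)
 \<comment> \<open>The vector with components \<open>1/c\<close> and \<open>1/d\<close> is normal to
   the hypotenuse; along it the two contributions of \<open>k\<close> add up to
   \<open>k * (1 - t) + k * t\<close>.\<close>
 also have "... = ?h (%x. (V P$1/c + V P$2/d + k) * \<Phi> x)"
 proof (rule avg_cong)
  fix t :: real
  let ?x = "linepath (P + pt c 0) (P + pt 0 d) t"
  have e: "?x$1 = P$1 + (1 - t)*c" "?x$2 = P$2 + t*d" by (simp_all add: linepath_def algebra_simps)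
  have Ve: "V ?x$1 = V P$1 + k*(1 - t)*c" "V ?x$2 = V P$2 + k*t*d"
  unfolding V vector_2 e by (simp_all add: algebra_simps)
  have "1/c*V ?x$1 + 1/d*V ?x$2 = V P$1/c + V P$2/d + k"
  unfolding Ve using cd by (simp add: field_simps)
  hence "(1/c*V ?x$1 + 1/d*V ?x$2) * \<Phi> ?x = (V P$1/c + V P$2/d + k) * \<Phi> ?x" by simp
  thus "1/c*(V ?x$1 * \<Phi> ?x) + 1/d*(V ?x$2 * \<Phi> ?x) = (V P$1/c + V P$2/d + k) * \<Phi> ?x"
  by (simp only: distrib_right mult.assoc)
 qed
 finally show "(LINT x|leb (tri P c d). V x \<cdot> g x + 2 * k * \<Phi> x) = abs(c*d) *
  ((V P$1/c + V P$2/d + k)*avg (P + pt c 0) (P + pt 0 d) \<Phi>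
  - V P$1/c*avg P (P + pt 0 d) \<Phi> - V P$2/d*avg P (P + pt c 0) \<Phi>)"
  unfolding 1 avg_cmult by simp
qed

lemma kdiff_locally_integrable:
 fixes S :: "plane set"
 assumes "kdiff F g"
 shows "locally_integrable S F" "locally_integrable S g"
proof -
 have "L1 K F & L1 K g" if K: "compact K" for K :: "plane set"
 proof
 have c: "continuous_on UNIV F" and g: "g : Bm" using assms by (auto simp: kdiff_def)
 have fin: "emeasure lborel K < \<infinity>" using compact_imp_bounded[OF K] by (rule emeasure_bounded_finite)
 have Kb: "K : sets borel" using K by (simp add: borel_compact)
 have bi: "L1 K h" if h: "h : Bm" "bounded (h ` K)" for h :: "plane => 'b::euclidean_space"
 proof -
  obtain B where B: "!!x. x : K ==> norm (h x) <= B" using h(2) by (auto simp: bounded_iff)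
  show ?thesis
  unfolding LINT_lebesgue_on_borel(2)[OF Kb h(1)]
  by (rule integrableI_bounded_set_indicator[where B=B, OF _ _ fin]) (use Kb h(1) B in simp_all)
 qed
 show "L1 K F"
  unfolding LINT_lebesgue_on_borel(2)[OF Kb cont_Bm[OF c]]
 proof -
  obtain B where B: "!!x. x : K ==> norm (F x) <= B"
  using continuous_bounded_image[OF c compact_imp_bounded[OF K]] by (auto simp: bounded_iff)
  show "integrable lborel (%x. ind K x *R F x)"
  by (rule integrableI_bounded_set_indicator[where B=B, OF _ _ fin]) (use Kb cont_Bm[OF c] B in simp_all)
 qed
 show "L1 K g"
  by (rule bi[OF g]) (use assms compact_imp_bounded[OF K] in "auto simp: kdiff_def")
 qed
 thus "locally_integrable S F" "locally_integrable S g"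
  unfolding locally_integrable_def by simp_all
qed

text \<open>Integrate the gradient of the product with the test function over a triangle so large
  that the test function vanishes on all three edges; then all edge means are zero.\<close>

lemma kdiff_weak_grad:
 assumes "open S" "kdiff F g"
 shows "has_weak_grad S F g"
 unfolding has_weak_grad_def
proof (intro conjI ballI allI)
 show "locally_integrable S F" "locally_integrable S g" using kdiff_locally_integrable[OF assms(2)] by auto
 fix \<phi> i assume \<phi>: "\<phi> : test_functions S"
 obtain K where K: "compact K" "K \<subseteq> S" "!!x. x ~: K ==> \<phi> x = 0" "!!x. x ~: K ==> grad \<phi> x = 0"
  using test_support[OF \<phi>] by blast
 obtain R where R: "R > 0" "!!x. x : K ==> norm x < R"
  using compact_imp_bounded[OF K(1)] bounded_pos_less by blast
 have xR: "abs(x$j) < R" if "x : K" for x j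
  using le_less_trans[OF component_le_norm_cart R(2)[OF that]] .
 \<comment> \<open>With legs \<open>4 * R\<close> the hypotenuse is the line on which the
   coordinates add up to \<open>2 * R\<close>. The open square of half side \<open>R\<close> lies
   strictly inside the triangle.\<close>
 let ?P = "pt (-R) (-R)"
 let ?T = "tri ?P (4 * R) (4 * R)"
 have KT: "K \<subseteq> ?T"
 proof
  fix x assume "x : K"
  hence "abs(x$1) < R" "abs(x$2) < R" using xR by blast+
  hence "0 <= (x$1 - ?P$1)/(4 * R)" "0 <= (x$2 - ?P$2)/(4 * R)"
  "(x$1 - ?P$1)/(4 * R) <= 1/2" "(x$2 - ?P$2)/(4 * R) <= 1/2"
  using R(1) by (simp_all add: divide_le_eq)
  thus "x : ?T" unfolding tri_def mem_Collect_eq by (intro conjI) linarith+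
 qed
 have cd: "4 * R ~= 0" using R by simp
 note km = kdiff_mult[OF assms(2) kdiff_test[OF \<phi>]]
 have z: "avg (?P + pt (4* R) 0) (?P + pt 0 (4* R)) (%x. F x * \<phi> x) = 0"
  "avg ?P (?P + pt 0 (4* R)) (%x. F x * \<phi> x) = 0" "avg ?P (?P + pt (4* R) 0) (%x. F x * \<phi> x) = 0"
 proof -
  have *: "avg v w (%x. F x * \<phi> x) = 0" if "!!t. linepath v w t ~: K" for v w
  unfolding avg_def by (simp add: K(3)[OF that])
  have 1: "linepath (?P + pt (4* R) 0) (?P + pt 0 (4* R)) t$1 + linepath (?P + pt (4* R) 0) (?P + pt 0 (4* R)) t$2 = 2 * R" for t
  by (simp add: linepath_def algebra_simps)
  show "avg (?P + pt (4* R) 0) (?P + pt 0 (4* R)) (%x. F x * \<phi> x) = 0"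
  by (rule *) (use 1 xR in "smt (verit)")
  have 2: "linepath ?P (?P + pt 0 (4* R)) t$1 = - R" "linepath ?P (?P + pt (4* R) 0) t$2 = - R" for t
  by (simp_all add: linepath_def algebra_simps)
  show "avg ?P (?P + pt 0 (4* R)) (%x. F x * \<phi> x) = 0"
  by (rule *) (use 2(1) xR in "smt (verit)")
  show "avg ?P (?P + pt (4* R) 0) (%x. F x * \<phi> x) = 0"
  by (rule *) (use 2(2) xR in "smt (verit)")
 qed
 have "(LINT x|leb ?T. (F x *R grad \<phi> x + \<phi> x *R g x)$i) = 0"
  using exhaust_2[of i] tri_kdiff(2,3)[OF cd cd km, of ?P] unfolding z by auto
 also have "(LINT x|leb ?T. (F x *R grad \<phi> x + \<phi> x *R g x)$i) = (LINT x|leb K. (F x *R grad \<phi> x + \<phi> x *R g x)$i)"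
  by (rule LINT_support(1)) (use K KT in "auto simp: borel_compact")
 also have "... = (LINT x|leb S. (F x *R grad \<phi> x + \<phi> x *R g x)$i)"
  by (rule LINT_support(1)[symmetric]) (use K \<open>open S\<close> in "auto simp: borel_compact")
 also have "... = (LINT x|leb S. F x*grad \<phi> x$i + g x$i * \<phi> x)"
  by (simp add: mult.commute)
 also have "... = (LINT x|leb S. F x*grad \<phi> x$i) + (LINT x|leb S. g x$i * \<phi> x)"
  by (rule LINT_add[OF L1_test(2)[OF assms(1) _ \<phi>] L1_test(1)[OF assms(1) _ \<phi>]])
  (use kdiff_locally_integrable[OF assms(2)] locally_L1_component in auto)
 finally show "(LINT x|leb S. F x*grad \<phi> x$i) = - (LINT x|leb S. g x$i * \<phi> x)"
  by simp
qed

section \<open>Changing functions and domains on null sets\<close>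

lemma locally_integrable_cong:
 assumes "!!x. x : S ==> f x = g x"
 shows "locally_integrable S f \<longleftrightarrow> locally_integrable S g"
 unfolding locally_integrable_def
 by (intro all_cong1 imp_cong refl Bochner_Integration.integrable_cong) (use assms in auto)

lemma has_weak_grad_cong:
 assumes "!!x. x : S ==> f x = f' x"
 shows "has_weak_grad S f g \<longleftrightarrow> has_weak_grad S f' g"
proof -
 have "(LINT x|leb S. f x*grad \<phi> x$i) = (LINT x|leb S. f' x*grad \<phi> x$i)" for \<phi> i
  by (rule LINT_cong) (use assms in auto)
 thus ?thesis
  unfolding has_weak_grad_def using locally_integrable_cong[OF assms] by simp
qed

lemma borel_measurable_lebesgue_AE:
 fixes f g :: "'a::euclidean_space => 'b::topological_space"
 assumes f: "f : borel_measurable lebesgue" and ae: "AE x in lebesgue. f x = g x"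
 shows "g : borel_measurable lebesgue"
proof (rule measurableI)
 fix A :: "'b set" assume "A : sets borel"
 hence fA: "f -` A : sets lebesgue" using measurable_sets[OF f] by simp
 have "AE x in lebesgue. x : f -` A \<longleftrightarrow> x : g -` A" using ae by eventually_elim simp
 from completion.in_sets_AE[OF this fA] show "g -` A \<inter> space lebesgue : sets lebesgue" by simp
qed simp

lemma leb_AE_cong:
 fixes f :: "'a::euclidean_space => 'b::euclidean_space"
 assumes S: "S : sets lebesgue" and ae: "AE x in leb S. f x = g x"
 shows "f : Mb S ==> g : Mb S"
  and "L1 S f ==> L1 S g"
  and "L1 S f ==> (LINT x|leb S. g x) = (LINT x|leb S. f x)"
proof -
 show 1: "g : Mb S" if "f : Mb S"
 proof -
  have "AE x in lebesgue. ind S x *R f x = ind S x *R g x"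
  using ae unfolding AE_leb_iff[OF S] by eventually_elim (simp split: split_indicator)
  from borel_measurable_lebesgue_AE[OF _ this] show ?thesis
  using that S by (simp add: borel_measurable_restrict_space_iff)
 qed
 show "L1 S g" if "L1 S f"
  by (rule integrable_cong_AE_imp[OF that 1[OF L1_meas[OF that]]]) (use ae in eventually_elim, simp)
 show "(LINT x|leb S. g x) = (LINT x|leb S. f x)" if "L1 S f"
  by (rule integral_cong_AE[OF 1 _ ]) (use that ae in "auto elim!: eventually_mono")
qed

lemma leb_AE_set:
 fixes f :: "'a::euclidean_space => 'b::euclidean_space"
 assumes S: "S : sets lebesgue" and T: "T : sets lebesgue" and ae: "AE x in lebesgue. x : S \<longleftrightarrow> x : T"
 shows "L1 S f ==> L1 T f"
  and "L1 S f ==> (LINT x|leb T. f x) = (LINT x|leb S. f x)"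
proof -
 have ae': "AE x in leb UNIV. ind S x *R f x = ind T x *R f x"
  unfolding lebesgue_on_UNIV_eq using ae by eventually_elim (simp split: split_indicator)
 note * = leb_AE_cong[OF _ ae', unfolded lebesgue_on_UNIV_eq, simplified]
 show "L1 S f ==> L1 T f"
  using *(2) by (simp add: integrable_lebesgue_on S T)
 show "L1 S f ==> (LINT x|leb T. f x) = (LINT x|leb S. f x)"
  using *(3) by (simp add: integrable_lebesgue_on LINT_lebesgue_on S T)
qed

section \<open>Convex geometry of the triangles\<close>

lemma vector_pt: "(vector [x, y] :: plane) + vector [x', y'] = pt (x + x') (y + y')"
 by (simp add: plane_eq_iff)

lemma tri_hull:
 assumes "c ~= 0" "d ~= 0"
 shows "tri P c d = convex hull {P, P + pt c 0, P + pt 0 d}"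
proof -
 have "x : convex hull {P, P + pt c 0, P + pt 0 d} \<longleftrightarrow> x : tri P c d" for x
 proof -
  have "x : convex hull {P, P + pt c 0, P + pt 0 d} \<longleftrightarrow>
  (EX u v w. 0 <= u & 0 <= v & 0 <= w & u + v + w = 1 & x = u *R P + v *R (P + pt c 0) + w *R (P + pt 0 d))"
  by (auto simp: convex_hull_3)
  also have "... \<longleftrightarrow> (EX u v w. 0 <= u & 0 <= v & 0 <= w & u + v + w = 1 & v = (x$1 - P$1)/c & w = (x$2 - P$2)/d)"
  proof (intro ex_cong1 conj_cong refl)
  fix u v w :: real assume s: "u + v + w = 1"
  have "x = u *R P + v *R (P + pt c 0) + w *R (P + pt 0 d) \<longleftrightarrow>
  x$1 = (u + v + w)*P$1 + v * c & x$2 = (u + v + w)*P$2 + w*d"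
  by (simp add: plane_eq_iff algebra_simps)
  also have "... \<longleftrightarrow> v = (x$1 - P$1)/c & w = (x$2 - P$2)/d"
  unfolding s using assms by (auto simp: field_simps)
  finally show "x = u *R P + v *R (P + pt c 0) + w *R (P + pt 0 d) \<longleftrightarrow> v = (x$1 - P$1)/c & w = (x$2 - P$2)/d" .
  qed
  also have "... \<longleftrightarrow> 0 <= 1 - (x$1 - P$1)/c - (x$2 - P$2)/d & 0 <= (x$1 - P$1)/c & 0 <= (x$2 - P$2)/d"
  by (auto intro!: exI[of _ "1 - (x$1 - P$1)/c - (x$2 - P$2)/d"])
  also have "... \<longleftrightarrow> x : tri P c d" by (auto simp: tri_def)
  finally show ?thesis .
 qed
 thus ?thesis by blast
qed

lemma tri_convex: "c ~= 0 ==> d ~= 0 ==> convex (tri P c d)"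
 by (simp add: tri_hull)

lemma tri_interior:
 assumes "c ~= 0" "d ~= 0"
 shows "interior (tri P c d) = {x. 0 < (x$1 - P$1)/c & 0 < (x$2 - P$2)/d & (x$1 - P$1)/c + (x$2 - P$2)/d < 1}"
proof -
 have i1: "(axis 1 (1/c) :: plane) \<cdot> x = x$1/c" and i2: "(axis 2 (1/d) :: plane) \<cdot> x = x$2/d" for x
  by (simp_all add: inner_vec_def sum_2 axis_def)
 have n: "(axis 1 (1/c) :: plane) ~= 0" "(axis 2 (1/d) :: plane) ~= 0"
  using assms by (simp_all add: plane_eq_iff axis_def)
 have n3: "(axis 1 (1/c) + axis 2 (1/d) :: plane) ~= 0"
  using assms by (simp add: plane_eq_iff axis_def)
 have "tri P c d = {x. axis 1 (1/c) \<cdot> x >= P$1/c} \<inter> {x. axis 2 (1/d) \<cdot> x >= P$2/d} \<inter>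
  {x. (axis 1 (1/c) + axis 2 (1/d)) \<cdot> x <= 1 + P$1/c + P$2/d}"
  unfolding inner_add_left i1 i2 by (auto simp: tri_def diff_divide_distrib algebra_simps)
 thus ?thesis
  by (simp add: interior_Int interior_halfspace_ge[OF n(1)] interior_halfspace_ge[OF n(2)] interior_halfspace_le[OF n3])
  (auto simp: inner_add_left i1 i2 diff_divide_distrib algebra_simps)
qed

lemma tri_frontier_negligible: "c ~= 0 ==> d ~= 0 ==> negligible (frontier (tri P c d))"
 by (rule negligible_convex_frontier[OF tri_convex])

lemma tri_interior_nonempty:
 assumes "c ~= 0" "d ~= 0" shows "P + pt (c/3) (d/3) : interior (tri P c d)"
 using assms by (simp add: tri_interior)

text \<open>A nonempty interior makes the three vertices affinely independent, and for affinely
  independent points the faces of the convex hull are the hulls of subsets.\<close>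

lemma tri_edges:
 assumes cd: "c ~= 0" "d ~= 0" and vw: "v : {P, P + pt c 0, P + pt 0 d}" "w : {P, P + pt c 0, P + pt 0 d}" "v ~= w"
 shows "closed_segment v w edge_of tri P c d"
proof -
 let ?S = "{P, P + pt c 0, P + pt 0 d}"
 have d: "P ~= P + pt c 0" "P ~= P + pt 0 d" "P + pt c 0 ~= P + pt 0 d"
  using cd by (simp_all add: plane_eq_iff)
 have "aff_dim (convex hull ?S) = int (DIM(plane))"
  by (rule aff_dim_nonempty_interior) (use tri_interior_nonempty[OF cd, of P] tri_hull[OF cd, of P] in auto)
 hence "aff_dim ?S = 2" by (simp add: aff_dim_convex_hull)
 moreover have "card ?S = 3" using d by simp
 ultimately have ai: "\<not> affine_dependent ?S"
  by (subst affine_independent_iff_card) simp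
 have "convex hull {v, w} face_of convex hull ?S"
  by (subst face_of_convex_hull_affine_independent[OF ai]) (intro exI[of _ "{v, w}"], use vw in auto)
 thus ?thesis
  using vw(3) unfolding edge_of_def segment_convex_hull tri_hull[OF cd]
  by (simp add: aff_dim_convex_hull)
qed

section \<open>The triangulation in coordinates\<close>

locale grid =
 fixes a b :: plane and N1 N2 :: nat and \<delta> :: "nat => nat => bool"
 assumes ab: "a$i < b$i" and N: "N1 > 0" "N2 > 0"
begin

definition "h1 = step1 a b N1"
definition "h2 = step2 a b N2"
definition "X i = a$1 + real i*h1"
definition "Y j = a$2 + real j*h2"
text \<open>The flag \<open>k\<close> names the two triangles of a cell: \<open>True\<close> is the
  one whose horizontal leg is on top. The comparison of \<open>\<delta> i j\<close> with
  \<open>k\<close> then decides whether the vertical leg is on the left, so that both choices of the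
  diagonal are covered by one formula. The corner is the right-angle vertex.\<close>

definition "corner i j k = pt (X (if \<delta> i j = k then i else Suc i)) (Y (if k then Suc j else j))"
definition "sx i j k = (if \<delta> i j = k then h1 else - h1)"
definition "sy (k::bool) = (if k then - h2 else h2)"
definition "T i j k = tri (corner i j k) (sx i j k) (sy k)"
abbreviation "leT i j k \<equiv> lebesgue_on (T i j k)"
definition "I = {..<N1} \<times> {..<N2} \<times> (UNIV :: bool set)"

lemma h_pos: "h1 > 0" "h2 > 0"
 using ab N by (simp_all add: h1_def h2_def step1_def step2_def)

lemma s_nz [simp]: "sx i j k ~= 0" "sy k ~= 0" "abs(sx i j k) = h1" "abs(sy k) = h2"
 using h_pos by (auto simp: sx_def sy_def)

lemma XY_end: "X 0 = a$1" "Y 0 = a$2" "X N1 = b$1" "Y N2 = b$2"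
 using N by (simp_all add: X_def Y_def h1_def h2_def step1_def step2_def)

lemma XY_Suc: "X (Suc i) = X i + h1" "Y (Suc j) = Y j + h2"
 by (simp_all add: X_def Y_def algebra_simps)

lemma XY_mono: "i <= i' ==> X i <= X i'" "j <= j' ==> Y j <= Y j'"
 using h_pos by (simp_all add: X_def Y_def mult_right_mono)

lemma finite_I: "finite I" by (simp add: I_def)

lemma node_pt: "node a b N1 N2 i j = pt (X i) (Y j)"
 by (simp add: node_def X_def Y_def h1_def h2_def)

lemma T_hull:
 "T i j k = convex hull {pt (X (if \<delta> i j = k then i else Suc i)) (Y (if k then Suc j else j)),
  pt (X (if \<delta> i j = k then Suc i else i)) (Y (if k then Suc j else j)),
  pt (X (if \<delta> i j = k then i else Suc i)) (Y (if k then j else Suc j))}"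
 unfolding T_def tri_hull[OF s_nz(1,2)]
 unfolding corner_def sx_def sy_def
 by (cases "\<delta> i j"; cases k) (simp_all add: vector_pt XY_Suc)

lemma mesh_T: "mesh a b N1 N2 \<delta> = (%(i, j, k). T i j k) ` I"
proof -
 have "cell_triangles a b N1 N2 (\<delta> i j) i j = {T i j False, T i j True}" for i j
  by (cases "\<delta> i j") (simp_all add: cell_triangles_def Let_def node_pt T_hull insert_commute)
 thus ?thesis
  unfolding mesh_def I_def by (auto simp: image_iff UNIV_bool)
qed

lemma interior_T:
 "x : interior (T i j k) \<longleftrightarrow> 0 < (x$1 - corner i j k$1)/sx i j k & 0 < (x$2 - corner i j k$2)/sy k
  & (x$1 - corner i j k$1)/sx i j k + (x$2 - corner i j k$2)/sy k < 1"
 unfolding T_def tri_interior[OF s_nz(1,2)] by simp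

lemma T_local:
 "x : T i j k \<longleftrightarrow> 0 <= (x$1 - corner i j k$1)/sx i j k & 0 <= (x$2 - corner i j k$2)/sy k
  & (x$1 - corner i j k$1)/sx i j k + (x$2 - corner i j k$2)/sy k <= 1"
 unfolding T_def tri_def by simp

lemma local_coord:
 "(x$1 - corner i j k$1)/sx i j k = (if \<delta> i j = k then (x$1 - X i)/h1 else 1 - (x$1 - X i)/h1)"
 "(x$2 - corner i j k$2)/sy k = (if k then 1 - (x$2 - Y j)/h2 else (x$2 - Y j)/h2)"
 using h_pos by (auto simp: corner_def sx_def sy_def XY_Suc field_simps)

lemma cell_local:
 "X i < x$1 \<longleftrightarrow> 0 < (x$1 - X i)/h1" "x$1 < X (Suc i) \<longleftrightarrow> (x$1 - X i)/h1 < 1"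
 "Y j < x$2 \<longleftrightarrow> 0 < (x$2 - Y j)/h2" "x$2 < Y (Suc j) \<longleftrightarrow> (x$2 - Y j)/h2 < 1"
 "X i <= x$1 \<longleftrightarrow> 0 <= (x$1 - X i)/h1" "x$1 <= X (Suc i) \<longleftrightarrow> (x$1 - X i)/h1 <= 1"
 "Y j <= x$2 \<longleftrightarrow> 0 <= (x$2 - Y j)/h2" "x$2 <= Y (Suc j) \<longleftrightarrow> (x$2 - Y j)/h2 <= 1"
 using h_pos by (auto simp: XY_Suc zero_less_divide_iff zero_le_divide_iff divide_less_eq divide_le_eq)

lemma interior_T_cell:
 assumes "x : interior (T i j k)"
 shows "X i < x$1" "x$1 < X (Suc i)" "Y j < x$2" "x$2 < Y (Suc j)"
 using assms unfolding interior_T local_coord cell_local by (simp_all only: split: if_splits) linarith+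

lemma T_cell:
 assumes "x : T i j k"
 shows "X i <= x$1" "x$1 <= X (Suc i)" "Y j <= x$2" "x$2 <= Y (Suc j)"
 using assms unfolding T_local local_coord cell_local by (simp_all only: split: if_splits) linarith+

lemma cell_T:
 assumes "X i <= x$1" "x$1 <= X (Suc i)" "Y j <= x$2" "x$2 <= Y (Suc j)"
 shows "EX k. x : T i j k"
proof -
 have "0 <= (x$1 - X i)/h1" "(x$1 - X i)/h1 <= 1" "0 <= (x$2 - Y j)/h2" "(x$2 - Y j)/h2 <= 1"
  using assms h_pos by (simp_all add: XY_Suc divide_le_eq)
 hence "x : T i j True \<or> x : T i j False" unfolding T_local local_coord by auto
 thus ?thesis by blast
qed

lemma index_unique:
 assumes "X i < s" "s < X (Suc i)" "X i' < s" "s < X (Suc i')" shows "i = i'"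
proof (rule ccontr)
 assume "i ~= i'"
 hence "Suc i <= i' \<or> Suc i' <= i" by linarith
 thus False using XY_mono(1)[of "Suc i" i'] XY_mono(1)[of "Suc i'" i] assms by auto
qed

lemma index_unique_Y:
 assumes "Y i < s" "s < Y (Suc i)" "Y i' < s" "s < Y (Suc i')" shows "i = i'"
proof (rule ccontr)
 assume "i ~= i'"
 hence "Suc i <= i' \<or> Suc i' <= i" by linarith
 thus False using XY_mono(2)[of "Suc i" i'] XY_mono(2)[of "Suc i'" i] assms by auto
qed

lemma interior_T_unique:
 assumes "x : interior (T i j k)" "x : interior (T i' j' k')"
 shows "i = i' & j = j' & k = k'"
proof -
 have ij: "i = i'" "j = j'"
  using interior_T_cell[OF assms(1)] interior_T_cell[OF assms(2)] index_unique index_unique_Y by blast+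
 have "k = k'"
 proof (rule ccontr)
  assume "k ~= k'"
  hence "(\<delta> i j = k) = (\<not> (\<delta> i j = k'))" "k' = (\<not> k)" by auto
  thus False
  using assms unfolding ij interior_T local_coord by (auto split: if_splits)
 qed
 with ij show ?thesis by simp
qed

lemma T_interior_nonempty: "interior (T i j k) ~= {}"
 using tri_interior_nonempty[of "sx i j k" "sy k" "corner i j k"] unfolding T_def by auto

lemma T_eq_iff: "T i j k = T i' j' k' \<longleftrightarrow> i = i' & j = j' & k = k'"
proof
 assume eq: "T i j k = T i' j' k'"
 obtain x where x: "x : interior (T i j k)" using T_interior_nonempty by blast
 hence "x : interior (T i' j' k')" using eq by simp
 from interior_T_unique[OF x this] show "i = i' & j = j' & k = k'" .
qed simp

lemma T_inj: "inj_on (%(i, j, k). T i j k) I"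
 by (rule inj_onI) (auto simp: T_eq_iff)

lemma T_lebesgue [simp]: "T i j k : sets lebesgue" "T i j k : sets borel" "T i j k : lmeasurable"
 and T_measure: "vol (T i j k) = h1*h2/2"
 and T_convex: "convex (T i j k)" and T_negl: "negligible (frontier (T i j k))"
 and T_bounded: "bounded (T i j k)"
 unfolding T_def using tri_measure[OF s_nz(1,2)] tri_convex[OF s_nz(1,2)] tri_frontier_negligible[OF s_nz(1,2)] tri_bounded[OF s_nz(1,2)] h_pos
 by (simp_all add: abs_mult)

lemma T_closed: "closed (T i j k)"
 unfolding T_def tri_hull[OF s_nz(1,2)] by (intro compact_imp_closed finite_imp_compact_convex_hull) simp

lemma box_cell:
 assumes "x : box a b"
 obtains i j k where "i < N1" "j < N2" "x : T i j k"
proof -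
 have x: "a$1 < x$1" "x$1 < b$1" "a$2 < x$2" "x$2 < b$2" using assms by (auto simp: mem_box_cart)
 define i where "i = nat \<lfloor>(x$1 - a$1)/h1\<rfloor>"
 define j where "j = nat \<lfloor>(x$2 - a$2)/h2\<rfloor>"
 have i: "real i <= (x$1 - a$1)/h1" "(x$1 - a$1)/h1 < real i + 1"
  and j: "real j <= (x$2 - a$2)/h2" "(x$2 - a$2)/h2 < real j + 1"
  using x h_pos unfolding i_def j_def by (simp_all add: of_nat_floor)
 have X: "X i <= x$1" "x$1 <= X (Suc i)" and Y: "Y j <= x$2" "x$2 <= Y (Suc j)"
  using i j h_pos by (simp_all add: X_def Y_def field_simps)
 have "X i < X N1" "Y j < Y N2" using X Y x by (simp_all add: XY_end)
 hence "i < N1" "j < N2" using XY_mono by (meson not_le leD)+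
 thus ?thesis using cell_T[OF X Y] that by blast
qed

lemma interior_T_box: "i < N1 ==> j < N2 ==> interior (T i j k) \<subseteq> box a b"
proof
 fix x assume ij: "i < N1" "j < N2" and x: "x : interior (T i j k)"
 have "X 0 <= X i" "X (Suc i) <= X N1" "Y 0 <= Y j" "Y (Suc j) <= Y N2" using ij XY_mono by simp_all
 thus "x : box a b"
  using interior_T_cell[OF x] by (simp add: XY_end mem_box_cart forall_2)
qed

lemma T_cbox: "i < N1 ==> j < N2 ==> T i j k \<subseteq> cbox a b"
proof
 fix x assume ij: "i < N1" "j < N2" and x: "x : T i j k"
 have "X 0 <= X i" "X (Suc i) <= X N1" "Y 0 <= Y j" "Y (Suc j) <= Y N2" using ij XY_mono by simp_all
 thus "x : cbox a b"
  using T_cell[OF x] by (simp add: XY_end mem_box_cart forall_2)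
qed

lemma AE_interior_T: "AE x in lebesgue. ALL i<N1. ALL j<N2. ALL k. x : T i j k --> x : interior (T i j k)"
proof -
 have "AE x in lebesgue. x ~: frontier (T i j k)" for i j k
  using T_negl by (intro AE_not_in) (simp only: negligible_iff_null_sets)
 hence "AE x in lebesgue. ALL z:I. x ~: frontier (T (fst z) (fst (snd z)) (snd (snd z)))"
  by (intro AE_finite_allI[OF finite_I])
 thus ?thesis
  by eventually_elim (auto simp: I_def frontier_def T_closed closure_closed)
qed

text \<open>Off the null set of all element boundaries every point of the box lies in exactly one
  triangle, so the indicators of the elements sum up to that of the box.\<close>

lemma integral_box_T:
 fixes f :: "plane => real"
 assumes f: "L1 (box a b) f"
 shows "!!i j k. i < N1 ==> j < N2 ==> L1 (T i j k) f"
  and "(LINT x|leb (box a b). f x) = (\<Sum>(i, j, k)\<in>I. LINT x|leb (T i j k). f x)"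
proof -
 have boxl: "box a b : sets lebesgue" by simp
 have fb: "integrable lebesgue (%x. ind (box a b) x *R f x)" using f by (simp add: integrable_lebesgue_on)
 have sub: "interior (T i j k) \<subseteq> box a b" if "i < N1" "j < N2" for i j k by (rule interior_T_box[OF that])
 have aeT: "AE x in lebesgue. x : interior (T i j k) \<longleftrightarrow> x : T i j k" if "i < N1" "j < N2" for i j k
  using AE_interior_T by eventually_elim (use that interior_subset in blast)
 have iI: "integrable (leb (interior (T i j k))) f" if "i < N1" "j < N2" for i j k
  by (rule L1_subset[OF f _ _ sub[OF that]]) auto
 show it: "L1 (T i j k) f" if "i < N1" "j < N2" for i j k
  by (rule leb_AE_set(1)[OF _ _ aeT[OF that] iI[OF that]]) auto
 have "(LINT x|leb (box a b). f x) = (LINT x|lebesgue. (\<Sum>(i, j, k)\<in>I. ind (T i j k) x *R f x))"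
  unfolding LINT_lebesgue_on[OF boxl]
 proof (rule leb_AE_cong(3)[where S=UNIV, unfolded lebesgue_on_UNIV_eq, symmetric])
  show "integrable lebesgue (%x. ind (box a b) x *R f x)" by (rule fb)
  show "AE x in lebesgue. ind (box a b) x *R f x = (\<Sum>(i, j, k)\<in>I. ind (T i j k) x *R f x)"
  using AE_interior_T
  proof eventually_elim
  fix x assume x: "ALL i<N1. ALL j<N2. ALL k. x : T i j k --> x : interior (T i j k)"
  show "ind (box a b) x *R f x = (\<Sum>(i, j, k)\<in>I. ind (T i j k) x *R f x)"
  proof (cases "x : box a b")
  case True
  obtain i j k where ij: "i < N1" "j < N2" "x : T i j k" using box_cell[OF True] .
  have "(\<Sum>(i, j, k)\<in>I. ind (T i j k) x *R f x) = (\<Sum>z\<in>{(i, j, k)}. case z of (i, j, k) => ind (T i j k) x *R f x)"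
  proof (rule sum.mono_neutral_right[OF finite_I])
  show "{(i, j, k)} \<subseteq> I" using ij by (simp add: I_def)
  show "ALL z:I - {(i, j, k)}. (case z of (i, j, k) => ind (T i j k) x *R f x) = 0"
  proof
  fix z assume zI: "z : I - {(i, j, k)}"
  obtain i' j' k' where zz: "z = (i', j', k')" by (cases z)
  have z: "(i', j', k') : I" "(i', j', k') ~= (i, j, k)" using zI zz by auto
  have "x ~: T i' j' k'"
  proof
  assume "x : T i' j' k'"
  hence "x : interior (T i' j' k')" "x : interior (T i j k)" using x z ij by (auto simp: I_def)
  from interior_T_unique[OF this] show False using z(2) by simp
  qed
  thus "(case z of (i, j, k) => ind (T i j k) x *R f x) = 0" by (simp add: zz)
  qed
  qed
  thus ?thesis using ij True by simp
  next
  case False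
  have "x ~: T i j k" if "i < N1" "j < N2" for i j k
  using x that False sub[OF that] by blast
  thus ?thesis using False by (simp add: I_def split_beta)
  qed
  qed
 qed simp
 also have "... = (\<Sum>(i, j, k)\<in>I. LINT x|lebesgue. ind (T i j k) x *R f x)"
  unfolding split_beta
  by (rule Bochner_Integration.integral_sum) (use it in "auto simp: I_def integrable_lebesgue_on")
 finally show "(LINT x|leb (box a b). f x) = (\<Sum>(i, j, k)\<in>I. LINT x|leb (T i j k). f x)"
  by (simp add: LINT_lebesgue_on)
qed

end

section \<open>Discrete integration by parts and the divergence of Raviart--Thomas fields\<close>

definition rt :: "real => real => real => plane => plane" where
 "rt \<alpha> \<beta> \<kappa> x = pt (\<alpha> + \<kappa>*x$1) (\<beta> + \<kappa>*x$2)"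

lemma continuous_rt: "continuous_on S (rt \<alpha> \<beta> \<kappa>)"
 unfolding rt_def by (intro continuous_intros)

lemma telescope_zero:
 fixes L R :: "nat => real"
 assumes "!!i. Suc i < N ==> R i = L (Suc i)" "L 0 = 0" "!!i. Suc i = N ==> R i = 0"
 shows "(\<Sum>i<N. R i - L i) = 0"
proof -
 define M where "M i = (if i < N then L i else 0)" for i
 have "(\<Sum>i<N. R i - L i) = (\<Sum>i<N. M (Suc i) - M i)"
 proof (rule sum.cong[OF refl])
  fix i assume "i : {..<N}"
  then consider "Suc i < N" | "Suc i = N" by force
  thus "R i - L i = M (Suc i) - M i"
  by cases (auto simp: M_def assms)
 qed
 also have "... = M N - M 0" by (rule sum_lessThan_telescope)
 also have "... = 0" using assms(2) by (simp add: M_def)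
 finally show ?thesis .
qed

context grid
begin

definition "avgV i j \<Phi> = avg (pt (X i) (Y j)) (pt (X i) (Y (Suc j))) \<Phi>"
definition "avgH i j \<Phi> = avg (pt (X i) (Y j)) (pt (X (Suc i)) (Y j)) \<Phi>"
definition "avgD i j \<Phi> = (if \<delta> i j then avg (pt (X i) (Y j)) (pt (X (Suc i)) (Y (Suc j))) \<Phi>
 else avg (pt (X i) (Y (Suc j))) (pt (X (Suc i)) (Y j)) \<Phi>)"

lemma avg_edges:
 assumes "continuous_on UNIV \<Phi>"
 shows "avg (corner i j k) (corner i j k + pt 0 (sy k)) \<Phi> = avgV (if \<delta> i j = k then i else Suc i) j \<Phi>"
  "avg (corner i j k) (corner i j k + pt (sx i j k) 0) \<Phi> = avgH i (if k then Suc j else j) \<Phi>"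
  "avg (corner i j k + pt (sx i j k) 0) (corner i j k + pt 0 (sy k)) \<Phi> = avgD i j \<Phi>"
 using avg_commute[OF assms]
 by (auto simp: corner_def sx_def sy_def vector_pt avgV_def avgH_def avgD_def XY_Suc)

text \<open>The factor of the diagonal mean in \<open>T_integral\<close>: \<open>h1 * h2\<close>
  times this number is the outward flux of the field through the hypotenuse.\<close>

definition "Df A B K i j k = (A i j k + K i j k*corner i j k$1)/sx i j k + (B i j k + K i j k*corner i j k$2)/sy k + K i j k"

lemma T_integral:
 assumes k: "kdiff \<Phi> g"
 shows "(LINT x|leT i j k. rt (A i j k) (B i j k) (K i j k) x \<cdot> g x + 2*K i j k * \<Phi> x) = h1*h2 *
  (Df A B K i j k*avgD i j \<Phi>
  - (A i j k + K i j k*corner i j k$1)/sx i j k*avgV (if \<delta> i j = k then i else Suc i) j \<Phi>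
  - (B i j k + K i j k*corner i j k$2)/sy k*avgH i (if k then Suc j else j) \<Phi>)"
  and "L1 (T i j k) (%x. rt (A i j k) (B i j k) (K i j k) x \<cdot> g x + 2*K i j k * \<Phi> x)"
proof -
 have c: "continuous_on UNIV \<Phi>" using k by (simp add: kdiff_def)
 have s: "abs(sx i j k * sy k) = h1*h2" by (simp add: abs_mult)
 have "(LINT x|leT i j k. rt (A i j k) (B i j k) (K i j k) x \<cdot> g x + 2*K i j k * \<Phi> x) = abs(sx i j k * sy k) *
  ((rt (A i j k) (B i j k) (K i j k) (corner i j k)$1/sx i j k + rt (A i j k) (B i j k) (K i j k) (corner i j k)$2/sy k + K i j k) *
  avg (corner i j k + pt (sx i j k) 0) (corner i j k + pt 0 (sy k)) \<Phi>
  - rt (A i j k) (B i j k) (K i j k) (corner i j k)$1/sx i j k*avg (corner i j k) (corner i j k + pt 0 (sy k)) \<Phi>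
  - rt (A i j k) (B i j k) (K i j k) (corner i j k)$2/sy k*avg (corner i j k) (corner i j k + pt (sx i j k) 0) \<Phi>)"
  unfolding T_def by (rule tri_RT(1)[OF s_nz(1,2) k rt_def])
 thus "(LINT x|leT i j k. rt (A i j k) (B i j k) (K i j k) x \<cdot> g x + 2*K i j k * \<Phi> x) = h1*h2 *
  (Df A B K i j k*avgD i j \<Phi>
  - (A i j k + K i j k*corner i j k$1)/sx i j k*avgV (if \<delta> i j = k then i else Suc i) j \<Phi>
  - (B i j k + K i j k*corner i j k$2)/sy k*avgH i (if k then Suc j else j) \<Phi>)"
  unfolding s avg_edges[OF c] Df_def rt_def vector_2 .
 show "L1 (T i j k) (%x. rt (A i j k) (B i j k) (K i j k) x \<cdot> g x + 2*K i j k * \<Phi> x)"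
  unfolding T_def by (rule tri_RT(2)[OF s_nz(1,2) k rt_def])
qed

text \<open>Continuity of the normal component, separately for vertical, horizontal and diagonal
  edges. On a diagonal the two numbers are outward fluxes with respect to opposite normals, which is
  why they have to cancel.\<close>

definition "conforming A B K \<longleftrightarrow>
 (ALL i j. Suc i < N1 --> j < N2 --> A i j (\<not> \<delta> i j) + K i j (\<not> \<delta> i j)*X (Suc i)
  = A (Suc i) j (\<delta> (Suc i) j) + K (Suc i) j (\<delta> (Suc i) j)*X (Suc i)) &
 (ALL i j. i < N1 --> Suc j < N2 --> B i j True + K i j True*Y (Suc j) = B i (Suc j) False + K i (Suc j) False*Y (Suc j)) &
 (ALL i j. i < N1 --> j < N2 --> Df A B K i j True + Df A B K i j False = 0)"

definition "mean_conforming \<Phi> \<longleftrightarrow>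
 (ALL i j. Suc i < N1 --> j < N2 --> avgV (Suc i) j (\<Phi> i j (\<not> \<delta> i j)) = avgV (Suc i) j (\<Phi> (Suc i) j (\<delta> (Suc i) j))) &
 (ALL i j. i < N1 --> Suc j < N2 --> avgH i (Suc j) (\<Phi> i j True) = avgH i (Suc j) (\<Phi> i (Suc j) False)) &
 (ALL i j. i < N1 --> j < N2 --> avgD i j (\<Phi> i j True) = avgD i j (\<Phi> i j False)) &
 (ALL j<N2. avgV 0 j (\<Phi> 0 j (\<delta> 0 j)) = 0) & (ALL i j. Suc i = N1 --> j < N2 --> avgV (Suc i) j (\<Phi> i j (\<not> \<delta> i j)) = 0) &
 (ALL i<N1. avgH i 0 (\<Phi> i 0 False) = 0) & (ALL i j. Suc j = N2 --> i < N1 --> avgH i (Suc j) (\<Phi> i j True) = 0)"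

lemma sum_I: "(\<Sum>(i, j, k)\<in>I. f i j k) = (\<Sum>i<N1. \<Sum>j<N2. f i j True + f i j False)"
 unfolding I_def by (simp add: sum.cartesian_product[symmetric] UNIV_bool add.commute)

text \<open>On an interior edge the two neighbours contribute the same flux times the same mean with
  opposite signs, and on the boundary the mean is zero. Organised without a sum over edges: the
  diagonal terms cancel inside a cell, the vertical ones telescope along rows, the horizontal ones
  along columns.\<close>

lemma discrete_orthogonality:
 assumes "conforming A B K" "mean_conforming \<Phi>" and k: "!!i j k. i < N1 ==> j < N2 ==> kdiff (\<Phi> i j k) (g i j k)"
 shows "(\<Sum>(i, j, k)\<in>I. LINT x|leT i j k. rt (A i j k) (B i j k) (K i j k) x \<cdot> g i j k x + 2*K i j k * \<Phi> i j k x) = 0"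
proof -
 define L where "L i j = (A i j (\<delta> i j) + K i j (\<delta> i j)*X i)*avgV i j (\<Phi> i j (\<delta> i j))" for i j
 define R where "R i j = (A i j (\<not> \<delta> i j) + K i j (\<not> \<delta> i j)*X (Suc i))*avgV (Suc i) j (\<Phi> i j (\<not> \<delta> i j))" for i j
 define U where "U i j = (B i j False + K i j False*Y j)*avgH i j (\<Phi> i j False)" for i j
 define W where "W i j = (B i j True + K i j True*Y (Suc j))*avgH i (Suc j) (\<Phi> i j True)" for i j
 let ?t = "%i j k. LINT x|leT i j k. rt (A i j k) (B i j k) (K i j k) x \<cdot> g i j k x + 2*K i j k * \<Phi> i j k x"
 have t: "?t i j True + ?t i j False = h1*h2*((R i j - L i j)/h1 + (W i j - U i j)/h2)" if ij: "i < N1" "j < N2" for i j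
 proof -
  have D: "Df A B K i j True*avgD i j (\<Phi> i j True) + Df A B K i j False*avgD i j (\<Phi> i j False) = 0"
  proof -
  have "avgD i j (\<Phi> i j True) = avgD i j (\<Phi> i j False)" "Df A B K i j True + Df A B K i j False = 0"
  using assms ij unfolding conforming_def mean_conforming_def by blast+
  thus ?thesis by (simp flip: distrib_right)
  qed
  have e: "u*(p - q - r) + u*(p' - q' - r') = u*((p + p') - (q + q') - (r + r'))" for u p q r p' q' r' :: real
  by (simp add: algebra_simps)
  show ?thesis
  unfolding T_integral[OF k[OF ij]] e D
  by (cases "\<delta> i j") (simp_all add: L_def R_def U_def W_def sx_def sy_def corner_def diff_divide_distrib)
 qed
 have 1: "(\<Sum>i<N1. R i j - L i j) = 0" if "j < N2" for j
  by (rule telescope_zero)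
  (use assms that in "auto simp: R_def L_def conforming_def mean_conforming_def")
 have 2: "(\<Sum>j<N2. W i j - U i j) = 0" if "i < N1" for i
  by (rule telescope_zero)
  (use assms that in "auto simp: W_def U_def conforming_def mean_conforming_def")
 have "(\<Sum>(i, j, k)\<in>I. ?t i j k) = (\<Sum>i<N1. \<Sum>j<N2. h1*h2*((R i j - L i j)/h1 + (W i j - U i j)/h2))"
  unfolding sum_I by (intro sum.cong refl t) auto
 also have "... = (\<Sum>i<N1. \<Sum>j<N2. h2*(R i j - L i j)) + (\<Sum>i<N1. \<Sum>j<N2. h1*(W i j - U i j))"
  using h_pos by (simp add: sum.distrib[symmetric] distrib_left)
 also have "(\<Sum>i<N1. \<Sum>j<N2. h2*(R i j - L i j)) = h2*(\<Sum>j<N2. \<Sum>i<N1. R i j - L i j)"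
  by (subst sum.swap) (simp add: sum_distrib_left)
 also have "(\<Sum>i<N1. \<Sum>j<N2. h1*(W i j - U i j)) = h1*(\<Sum>i<N1. \<Sum>j<N2. W i j - U i j)"
  by (simp add: sum_distrib_left)
 finally show ?thesis using 1 2 by simp
qed

definition pw :: "(nat => nat => bool => plane => 'e::real_normed_vector) => plane => 'e" where
 "pw F x = (\<Sum>(i, j, k)\<in>I. ind (interior (T i j k)) x *R F i j k x)"

lemma pw_interior:
 assumes "i < N1" "j < N2" "x : interior (T i j k)"
 shows "pw F x = F i j k x"
proof -
 have "pw F x = (\<Sum>z\<in>{(i, j, k)}. case z of (i, j, k) => ind (interior (T i j k)) x *R F i j k x)"
  unfolding pw_def
 proof (rule sum.mono_neutral_right[OF finite_I])
  show "{(i, j, k)} \<subseteq> I" using assms by (simp add: I_def)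
  show "ALL z:I - {(i, j, k)}. (case z of (i, j, k) => ind (interior (T i j k)) x *R F i j k x) = 0"
  proof
  fix z assume zI: "z : I - {(i, j, k)}"
  obtain i' j' k' where zz: "z = (i', j', k')" by (cases z)
  have "x ~: interior (T i' j' k')"
  proof
  assume "x : interior (T i' j' k')"
  from interior_T_unique[OF assms(3) this] show False using zI zz by simp
  qed
  thus "(case z of (i, j, k) => ind (interior (T i j k)) x *R F i j k x) = 0" by (simp add: zz)
  qed
 qed
 thus ?thesis using assms(3) by simp
qed

lemma pw_integrable:
 fixes F :: "nat => nat => bool => plane => 'e::euclidean_space"
 assumes "!!i j k. continuous_on UNIV (F i j k)"
 shows "L1 (box a b) (pw F)"
proof -
 have "L1 (box a b) (%x. ind (interior (T i j k)) x *R F i j k x)" if "i < N1" "j < N2" for i j k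
 proof (rule integrable_mult_indicator)
  have "L1 (cbox a b) (F i j k)"
  by (rule continuous_imp_integrable) (rule continuous_on_subset[OF assms], simp)
  thus "L1 (box a b) (F i j k)"
  by (rule L1_subset) (auto simp: box_subset_cbox)
  show "interior (T i j k) : sets (leb (box a b))"
  using interior_T_box[OF that] by (simp add: sets_restrict_space_iff)
 qed
 thus ?thesis unfolding pw_def split_beta by (intro Bochner_Integration.integrable_sum) (auto simp: I_def)
qed

lemma box_AE:
 assumes "!!i j k x. i < N1 ==> j < N2 ==> x : interior (T i j k) ==> P x"
 shows "AE x in leb (box a b). P x"
proof -
 have "AE x in lebesgue. x : box a b --> P x"
  using AE_interior_T
 proof eventually_elim
  fix x assume x: "ALL i<N1. ALL j<N2. ALL k. x : T i j k --> x : interior (T i j k)"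
  show "x : box a b --> P x"
  proof
  assume "x : box a b"
  then obtain i j k where "i < N1" "j < N2" "x : T i j k" by (rule box_cell)
  with x show "P x" by (intro assms[of i j x k]) auto
  qed
 qed
 thus ?thesis by (subst AE_leb_iff) auto
qed

lemma T_AE:
 assumes "i < N1" "j < N2" "!!x. x : interior (T i j k) ==> P x"
 shows "AE x in leT i j k. P x"
proof -
 have "AE x in lebesgue. x : T i j k --> P x"
  using AE_interior_T by eventually_elim (use assms in blast)
 thus ?thesis by (subst AE_leb_iff) auto
qed

text \<open>A single test function, used on all elements, is mean conforming. For it the discrete
  orthogonality is literally the identity that defines the weak divergence.\<close>

lemma conforming_div:
 assumes "conforming A B K"
  and v: "!!i j k x. i < N1 ==> j < N2 ==> x : interior (T i j k) ==> v x = rt (A i j k) (B i j k) (K i j k) x"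
 shows "has_weak_div (box a b) v (pw (%i j k x. 2*K i j k))"
  and "L1 (box a b) v"
proof -
 let ?d = "pw (%i j k x. 2*K i j k)"
 have "L1 (box a b) (pw (%i j k. rt (A i j k) (B i j k) (K i j k)))"
  by (rule pw_integrable) (rule continuous_rt)
 thus iv: "L1 (box a b) v"
  by (rule leb_AE_cong(2)[rotated 2]) (auto intro!: box_AE simp: pw_interior v)
 have id: "L1 (box a b) ?d" by (rule pw_integrable) simp
 have sub: "L1 C f" if "L1 (box a b) f" "compact C" "C \<subseteq> box a b"
  for C and f :: "plane => 'e::{banach,second_countable_topology}"
  by (rule L1_subset[OF that(1) _ _ that(3)]) (simp_all add: borel_compact that(2))
 have li: "locally_integrable (box a b) v" "locally_integrable (box a b) ?d"
  unfolding locally_integrable_def using sub[OF iv] sub[OF id] by simp_all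
 show "has_weak_div (box a b) v ?d"
  unfolding has_weak_div_def
 proof (intro conjI ballI li)
  fix \<phi> assume \<phi>: "\<phi> : test_functions (box a b)"
  note kd = kdiff_test[OF \<phi>]
  have i1: "L1 (box a b) (%x. v x \<cdot> grad \<phi> x)"
  proof -
  have "L1 (box a b) (%x. \<Sum>i\<in>UNIV. v x$i*grad \<phi> x$i)"
  by (intro Bochner_Integration.integrable_sum L1_test(2)[OF open_box _ \<phi>] locally_L1_component li)
  thus ?thesis by (simp add: inner_vec_def)
  qed
  have i2: "L1 (box a b) (%x. ?d x * \<phi> x)"
  by (rule L1_test(1)[OF open_box li(2) \<phi>])
  have mc: "mean_conforming (%i j k. \<phi>)"
  proof -
  obtain C where C: "C \<subseteq> box a b" "!!x. x ~: C ==> \<phi> x = 0" using test_support[OF \<phi>] by blast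
  have z: "avg p q \<phi> = 0" if "!!t. linepath p q t ~: box a b" for p q
  proof -
  have "\<phi> (linepath p q t) = 0" for t using C that[of t] by blast
  thus ?thesis unfolding avg_def by simp
  qed
  have "avgV 0 j \<phi> = 0" "Suc i = N1 ==> avgV (Suc i) j \<phi> = 0" "avgH i 0 \<phi> = 0" "Suc j = N2 ==> avgH i (Suc j) \<phi> = 0" for i j
  proof -
  have l: "linepath (pt p q) (pt p q') t$1 = p" "linepath (pt p q) (pt p' q) t$2 = q" for p q p' q' t
  by (simp_all add: linepath_def algebra_simps)
  have o: "x ~: box a b" if "x$1 = a$1 \<or> x$1 = b$1 \<or> x$2 = a$2 \<or> x$2 = b$2" for x
  proof
  assume "x : box a b"
  hence "a$1 < x$1" "x$1 < b$1" "a$2 < x$2" "x$2 < b$2" by (simp_all add: mem_box_cart)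
  thus False using that by linarith
  qed
  show "avgV 0 j \<phi> = 0" unfolding avgV_def by (intro z o) (simp only: l XY_end simp_thms)
  show "avgH i 0 \<phi> = 0" unfolding avgH_def by (intro z o) (simp only: l XY_end simp_thms)
  show "Suc i = N1 ==> avgV (Suc i) j \<phi> = 0" unfolding avgV_def by (intro z o) (simp only: l XY_end simp_thms)
  show "Suc j = N2 ==> avgH i (Suc j) \<phi> = 0" unfolding avgH_def by (intro z o) (simp only: l XY_end simp_thms)
  qed
  thus ?thesis unfolding mean_conforming_def by auto
  qed
  have "(LINT x|leb (box a b). v x \<cdot> grad \<phi> x) + (LINT x|leb (box a b). ?d x * \<phi> x)
  = (LINT x|leb (box a b). v x \<cdot> grad \<phi> x + ?d x * \<phi> x)"
  by (rule LINT_add[OF i1 i2, symmetric])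
  also have "... = (\<Sum>(i, j, k)\<in>I. LINT x|leT i j k. v x \<cdot> grad \<phi> x + ?d x * \<phi> x)"
  by (rule integral_box_T(2)[OF L1_add[OF i1 i2]])
  also have "... = (\<Sum>(i, j, k)\<in>I. LINT x|leT i j k. rt (A i j k) (B i j k) (K i j k) x \<cdot> grad \<phi> x + 2*K i j k * \<phi> x)"
  proof (rule sum.cong[OF refl], clarify)
  fix i j k assume "(i, j, k) : I"
  hence ij: "i < N1" "j < N2" by (auto simp: I_def)
  show "(LINT x|leT i j k. v x \<cdot> grad \<phi> x + ?d x * \<phi> x) = (LINT x|leT i j k. rt (A i j k) (B i j k) (K i j k) x \<cdot> grad \<phi> x + 2*K i j k * \<phi> x)"
  by (rule leb_AE_cong(3)[OF _ T_AE[OF ij] T_integral(2)[OF kd]]) (simp_all add: v[OF ij] pw_interior[OF ij])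
  qed
  also have "... = 0"
  by (rule discrete_orthogonality[OF assms(1) mc kd])
  finally show "(LINT x|leb (box a b). v x \<cdot> grad \<phi> x) = - (LINT x|leb (box a b). ?d x * \<phi> x)" by simp
 qed
qed

lemma T_edges:
 "closed_segment (pt (X (if \<delta> i j = k then i else Suc i)) (Y j)) (pt (X (if \<delta> i j = k then i else Suc i)) (Y (Suc j))) edge_of T i j k"
 "closed_segment (pt (X i) (Y (if k then Suc j else j))) (pt (X (Suc i)) (Y (if k then Suc j else j))) edge_of T i j k"
 "\<delta> i j ==> closed_segment (pt (X i) (Y j)) (pt (X (Suc i)) (Y (Suc j))) edge_of T i j k"
 "\<not> \<delta> i j ==> closed_segment (pt (X i) (Y (Suc j))) (pt (X (Suc i)) (Y j)) edge_of T i j k"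
proof -
 have c: "corner i j k = pt (X (if \<delta> i j = k then i else Suc i)) (Y (if k then Suc j else j))"
  "corner i j k + pt (sx i j k) 0 = pt (X (if \<delta> i j = k then Suc i else i)) (Y (if k then Suc j else j))"
  "corner i j k + pt 0 (sy k) = pt (X (if \<delta> i j = k then i else Suc i)) (Y (if k then j else Suc j))"
  by (cases "\<delta> i j"; cases k; simp add: corner_def sx_def sy_def vector_pt XY_Suc)+
 have e: "v : {corner i j k, corner i j k + pt (sx i j k) 0, corner i j k + pt 0 (sy k)} ==>
  w : {corner i j k, corner i j k + pt (sx i j k) 0, corner i j k + pt 0 (sy k)} ==> v ~= w ==> closed_segment v w edge_of T i j k" for v w
  unfolding T_def by (rule tri_edges[OF s_nz(1,2)])
 note e = e[unfolded c(2,3), unfolded c(1)]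
 have n: "X i ~= X (Suc i)" "Y j ~= Y (Suc j)" using h_pos by (simp_all add: XY_Suc)
 show "closed_segment (pt (X (if \<delta> i j = k then i else Suc i)) (Y j)) (pt (X (if \<delta> i j = k then i else Suc i)) (Y (Suc j))) edge_of T i j k"
  by (rule e) (use n in "simp_all add: plane_eq_iff")
 show "closed_segment (pt (X i) (Y (if k then Suc j else j))) (pt (X (Suc i)) (Y (if k then Suc j else j))) edge_of T i j k"
  by (rule e) (use n in "simp_all add: plane_eq_iff")
 show "\<delta> i j ==> closed_segment (pt (X i) (Y j)) (pt (X (Suc i)) (Y (Suc j))) edge_of T i j k"
  by (rule e) (use n in "simp_all add: plane_eq_iff")
 show "\<not> \<delta> i j ==> closed_segment (pt (X i) (Y (Suc j))) (pt (X (Suc i)) (Y j)) edge_of T i j k"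
  by (rule e) (use n in "simp_all add: plane_eq_iff")
qed

lemma Df_diag:
 "\<delta> i j ==> Df A B K i j True = (A i j True + K i j True*X i)/h1 - (B i j True + K i j True*Y j)/h2"
 "\<delta> i j ==> Df A B K i j False = (B i j False + K i j False*Y j)/h2 - (A i j False + K i j False*X i)/h1"
 "\<not> \<delta> i j ==> Df A B K i j True = - ((A i j True + K i j True*X i)/h1) - (B i j True + K i j True*Y (Suc j))/h2"
 "\<not> \<delta> i j ==> Df A B K i j False = (A i j False + K i j False*X i)/h1 + (B i j False + K i j False*Y (Suc j))/h2"
 using h_pos by (simp_all add: Df_def sx_def sy_def corner_def XY_Suc add_divide_distrib diff_divide_distrib distrib_left)

text \<open>Normal continuity is evaluated at one endpoint of each edge with a convenient normal.
  The vectors with components \<open>1/h1\<close> and \<open>- 1/h2\<close>, or \<open>1/h1\<close>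
  and \<open>1/h2\<close>, are normal to the two kinds of diagonals and are scaled to reproduce
  \<open>Df\<close>.\<close>

lemma V_h_conforming:
 assumes "v : V_h (mesh a b N1 N2 \<delta>)"
 obtains A B K where "conforming A B K"
  "!!i j k x. i < N1 ==> j < N2 ==> x : interior (T i j k) ==> v x = rt (A i j k) (B i j k) (K i j k) x"
proof -
 let ?M = "mesh a b N1 N2 \<delta>"
 obtain V where V1: "ALL T:?M. V T : RT0 & (ALL x:interior T. v x = V T x)"
  and V2: "ALL T1:?M. ALL T2:?M. ALL y z. T1 ~= T2 & closed_segment y z edge_of T1 & closed_segment y z edge_of T2 -->
  (ALL n. n \<cdot> (z - y) = 0 --> (ALL x:closed_segment y z. V T1 x \<cdot> n = V T2 x \<cdot> n))"
  using assms unfolding V_h_def mem_Collect_eq by (elim exE conjE) (rule that)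
 have M: "T i j k : ?M" if "i < N1" "j < N2" for i j k
  unfolding mesh_T using that by (auto simp: I_def)
 have "EX c. i < N1 --> j < N2 --> (ALL x. V (T i j k) x = rt (fst c) (fst (snd c)) (snd (snd c)) x)" for i j k
 proof (cases "i < N1 & j < N2")
  case True
  hence "V (T i j k) : RT0" using V1 M by blast
  then obtain \<alpha> \<beta> \<kappa> where "!!x. V (T i j k) x = rt \<alpha> \<beta> \<kappa> x" unfolding RT0_def rt_def by blast
  thus ?thesis by (intro exI[of _ "(\<alpha>, \<beta>, \<kappa>)"]) simp
 qed blast
 hence "ALL i j k. EX c. i < N1 --> j < N2 --> (ALL x. V (T i j k) x = rt (fst c) (fst (snd c)) (snd (snd c)) x)" by blast
 then obtain F where F: "ALL i j k. i < N1 --> j < N2 --> (ALL x. V (T i j k) x = rt (fst (F i j k)) (fst (snd (F i j k))) (snd (snd (F i j k))) x)"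
  unfolding choice_iff by blast
 define A B K where "A i j k = fst (F i j k)" and "B i j k = fst (snd (F i j k))" and "K i j k = snd (snd (F i j k))" for i j k
 have ABK: "V (T i j k) x = rt (A i j k) (B i j k) (K i j k) x" if "i < N1" "j < N2" for i j k x
  using F that by (simp add: A_def B_def K_def)
 have cont: "V T1 y \<cdot> n = V T2 y \<cdot> n"
  if "T1 : ?M" "T2 : ?M" "T1 ~= T2" "closed_segment y z edge_of T1" "closed_segment y z edge_of T2" "n \<cdot> (z - y) = 0" for T1 T2 y z n
  using V2[rule_format, of T1 T2 y z n y] that by simp
 have "conforming A B K"
  unfolding conforming_def
 proof (intro conjI allI impI)
  fix i j assume ij: "Suc i < N1" "j < N2"
  have "V (T i j (\<not> \<delta> i j)) (pt (X (Suc i)) (Y j)) \<cdot> pt 1 0 = V (T (Suc i) j (\<delta> (Suc i) j)) (pt (X (Suc i)) (Y j)) \<cdot> pt 1 0"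
  proof (rule cont)
  show "closed_segment (pt (X (Suc i)) (Y j)) (pt (X (Suc i)) (Y (Suc j))) edge_of T i j (\<not> \<delta> i j)"
  using T_edges(1)[of i j "\<not> \<delta> i j"] by simp
  show "closed_segment (pt (X (Suc i)) (Y j)) (pt (X (Suc i)) (Y (Suc j))) edge_of T (Suc i) j (\<delta> (Suc i) j)"
  using T_edges(1)[of "Suc i" j "\<delta> (Suc i) j"] by simp
  qed (use ij M in "simp_all add: T_eq_iff inner_vec_def sum_2")
  thus "A i j (\<not> \<delta> i j) + K i j (\<not> \<delta> i j)*X (Suc i) = A (Suc i) j (\<delta> (Suc i) j) + K (Suc i) j (\<delta> (Suc i) j)*X (Suc i)"
  using ij by (simp add: ABK rt_def inner_vec_def sum_2)
 next
  fix i j assume ij: "i < N1" "Suc j < N2"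
  have "V (T i j True) (pt (X i) (Y (Suc j))) \<cdot> pt 0 1 = V (T i (Suc j) False) (pt (X i) (Y (Suc j))) \<cdot> pt 0 1"
  proof (rule cont)
  show "closed_segment (pt (X i) (Y (Suc j))) (pt (X (Suc i)) (Y (Suc j))) edge_of T i j True"
  using T_edges(2)[of i True j] by simp
  show "closed_segment (pt (X i) (Y (Suc j))) (pt (X (Suc i)) (Y (Suc j))) edge_of T i (Suc j) False"
  using T_edges(2)[of i False "Suc j"] by simp
  qed (use ij M in "simp_all add: T_eq_iff inner_vec_def sum_2")
  thus "B i j True + K i j True*Y (Suc j) = B i (Suc j) False + K i (Suc j) False*Y (Suc j)"
  using ij by (simp add: ABK rt_def inner_vec_def sum_2)
 next
  fix i j assume ij: "i < N1" "j < N2"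
  show "Df A B K i j True + Df A B K i j False = 0"
  proof (cases "\<delta> i j")
  case True
  have "V (T i j True) (pt (X i) (Y j)) \<cdot> pt (1/h1) (- 1/h2) = V (T i j False) (pt (X i) (Y j)) \<cdot> pt (1/h1) (- 1/h2)"
  by (rule cont[OF M[OF ij] M[OF ij] _ T_edges(3)[OF True] T_edges(3)[OF True]])
  (use h_pos in "simp_all add: T_eq_iff inner_vec_def sum_2 XY_Suc")
  thus ?thesis
  by (simp add: ABK[OF ij] rt_def inner_vec_def sum_2 Df_diag[where A=A and B=B and K=K] True)
  next
  case False
  have "V (T i j True) (pt (X i) (Y (Suc j))) \<cdot> pt (1/h1) (1/h2) = V (T i j False) (pt (X i) (Y (Suc j))) \<cdot> pt (1/h1) (1/h2)"
  by (rule cont[OF M[OF ij] M[OF ij] _ T_edges(4)[OF False] T_edges(4)[OF False]])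
  (use h_pos in "simp_all add: T_eq_iff inner_vec_def sum_2 XY_Suc")
  thus ?thesis
  by (simp add: ABK[OF ij] rt_def inner_vec_def sum_2 Df_diag[where A=A and B=B and K=K] False)
  qed
 qed
 moreover have "v x = rt (A i j k) (B i j k) (K i j k) x" if "i < N1" "j < N2" "x : interior (T i j k)" for i j k x
  using V1[rule_format, OF M[OF that(1,2), of k]] that(3) ABK[OF that(1,2)] by simp
 ultimately show ?thesis using that by blast
qed

end

section \<open>The local interface space\<close>

definition perp :: "plane => plane" where
 "perp n = pt (- n$2) (n$1)"

lemma perp_simps: "n \<cdot> perp n = 0" "perp n \<cdot> n = 0" "norm (perp n) = norm n" "perp n \<cdot> perp n = n \<cdot> n"
 by (simp_all add: perp_def inner_vec_def sum_2 norm_eq_sqrt_inner)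

lemma plane_decompose:
 assumes "norm n = 1"
 shows "x = (x \<cdot> perp n) *R perp n + (x \<cdot> n) *R n"
proof -
 have nn: "n$1*n$1 + n$2*n$2 = 1"
  using assms by (simp add: norm_eq_sqrt_inner inner_vec_def sum_2)
 have "x$1 = x$1*(n$1*n$1 + n$2*n$2)" "x$2 = x$2*(n$1*n$1 + n$2*n$2)" unfolding nn by simp_all
 thus ?thesis
  unfolding plane_eq_iff by (simp add: perp_def inner_vec_def sum_2 algebra_simps)
qed

lemma plane_parallel:
 assumes "norm n = 1" "n \<cdot> v = 0" "v ~= 0" "w \<cdot> v = (0::real)"
 shows "w = (w \<cdot> n) *R (n::plane)"
proof -
 have v: "v = (v \<cdot> perp n) *R perp n"
  using plane_decompose[OF assms(1), of v] assms(2) by (simp add: inner_commute)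
 hence vp: "v \<cdot> perp n ~= 0" using assms(3) by auto
 have "w \<cdot> v = (v \<cdot> perp n)*(w \<cdot> perp n)" by (subst v) simp
 with vp assms(4) have "w \<cdot> perp n = 0" by simp
 with plane_decompose[OF assms(1), of w] show ?thesis by simp
qed

definition beta_h :: "real => real => plane => plane => plane => real" where
 "beta_h bm bp D n x = (if n \<cdot> (x - D) > 0 then bp else bm)"

text \<open>Gradients of the local space in terms of the two quantities that do not jump across the
  chord, the tangential derivative \<open>\<tau>\<close> and the flux \<open>\<nu>\<close>. In these
  coordinates the coupling conditions hold automatically. The coefficient \<open>beta_h\<close>
  jumps on the line through the chord, not on the interface.\<close>

definition lgrad :: "real => real => plane => plane => real => real => plane => plane" where
 "lgrad bm bp D n \<tau> \<nu> x = \<tau> *R perp n + (\<nu> / beta_h bm bp D n x) *R n"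

lemma lgrad_kink:
 "lgrad bm bp D n \<tau> \<nu> = (%x. (\<tau> *R perp n + (\<nu> / bm) *R n) + (if n \<cdot> (x - D) > 0 then (\<nu> / bp - \<nu> / bm) *R n else 0))"
 by (auto simp: fun_eq_iff lgrad_def beta_h_def scaleR_diff_left)

text \<open>Continuity at \<open>D\<close> and \<open>E\<close> forces the two gradients to differ
  by a multiple of \<open>n\<close>. A local function therefore is an affine function plus a
  multiple of the positive part of the distance to the chord line, a formula that makes sense on the
  whole plane and so fits \<open>kdiff\<close>.\<close>

lemma S_local_kink:
 assumes "\<phi> : S_local Om bm bp T" and \<beta>: "bm ~= 0" "bp ~= 0"
 shows "EX \<Psi> G. kdiff \<Psi> G & (ALL x:T. \<phi> x = \<Psi> x) &
  (if interface_element Om T then EX D E n \<tau> \<nu>. cut Om T D E n & G = lgrad bm bp D n \<tau> \<nu> else EX g. G = (%x. g))"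
proof (cases "interface_element Om T")
 case False
 then obtain c g where "ALL x:T. \<phi> x = c + g \<cdot> x" using assms(1) by (auto simp: S_local_def)
 thus ?thesis using False kdiff_affine[of c g] by auto
next
 case True
 hence "\<phi> : {\<phi>. EX D E n cp gp cm gm. cut Om T D E n &
  (ALL x:piece_plus T D n. \<phi> x = cp + gp \<cdot> x) &
  (ALL x:piece_minus T D n. \<phi> x = cm + gm \<cdot> x) &
  cp + gp \<cdot> D = cm + gm \<cdot> D & cp + gp \<cdot> E = cm + gm \<cdot> E &
  bp*(gp \<cdot> n) = bm*(gm \<cdot> n)}"
  using assms(1) by (simp add: S_local_def)
 then obtain D E n cp gp cm gm where cut: "cut Om T D E n"
  and p: "ALL x:piece_plus T D n. \<phi> x = cp + gp \<cdot> x" and m: "ALL x:piece_minus T D n. \<phi> x = cm + gm \<cdot> x"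
  and DE: "cp + gp \<cdot> D = cm + gm \<cdot> D" "cp + gp \<cdot> E = cm + gm \<cdot> E"
  and flux: "bp*(gp \<cdot> n) = bm*(gm \<cdot> n)"
  unfolding mem_Collect_eq by (elim exE conjE)
 have n: "norm n = 1" "n \<cdot> (E - D) = 0" "E - D ~= 0" using cut by (auto simp: cut_def)
 have "(gp - gm) \<cdot> (E - D) = 0" using DE by (simp add: inner_diff_left inner_diff_right)
 from plane_parallel[OF n this] have gd: "gp - gm = (gp \<cdot> n - gm \<cdot> n) *R n" by (simp add: inner_diff_left)
 define \<tau> \<nu> where "\<tau> = gm \<cdot> perp n" and "\<nu> = bm*(gm \<cdot> n)"
 have nu: "\<nu> / bm = gm \<cdot> n" "\<nu> / bp = gp \<cdot> n"
  using \<beta> flux by (simp_all add: \<nu>_def field_simps)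
 define \<Psi> where "\<Psi> x = cm + gm \<cdot> x + (\<nu> / bp - \<nu> / bm)*max 0 (n \<cdot> (x - D))" for x
 have gm: "\<tau> *R perp n + (\<nu> / bm) *R n = gm" unfolding nu \<tau>_def by (rule plane_decompose[OF n(1), symmetric])
 have "kdiff \<Psi> (lgrad bm bp D n \<tau> \<nu>)"
  unfolding \<Psi>_def lgrad_kink gm by (rule kdiff_add_kink)
 moreover have "\<phi> x = \<Psi> x" if "x : T" for x
 proof (cases "n \<cdot> (x - D) <= 0")
  case True thus ?thesis using m that by (simp add: piece_minus_def \<Psi>_def)
 next
  case False
  have "gp \<cdot> (x - D) = gm \<cdot> (x - D) + (gp \<cdot> n - gm \<cdot> n)*(n \<cdot> (x - D))"
  using arg_cong[OF gd, of "%v. v \<cdot> (x - D)"] by (simp add: inner_diff_left)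
  thus ?thesis using False p that DE(1) by (simp add: piece_plus_def \<Psi>_def nu inner_diff_right)
 qed
 ultimately have "kdiff \<Psi> (lgrad bm bp D n \<tau> \<nu>) & (ALL x:T. \<phi> x = \<Psi> x)" by blast
 moreover have "EX D' E' n' \<tau>' \<nu>'. cut Om T D' E' n' & lgrad bm bp D n \<tau> \<nu> = lgrad bm bp D' n' \<tau>' \<nu>'" using cut by blast
 ultimately show ?thesis using True by (simp only: if_True) blast
qed

text \<open>Every pair \<open>\<tau>\<close>, \<open>\<nu>\<close> occurs. This is what allows the
  test gradient \<open>Gop\<close> to be prescribed by its two parameters.\<close>

lemma S_local_exists:
 assumes cut: "cut Om T D E n" and int: "interface_element Om T" and \<beta>: "bm ~= 0" "bp ~= 0"
 shows "EX \<phi>:S_local Om bm bp T. kdiff \<phi> (lgrad bm bp D n \<tau> \<nu>)"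
proof -
 have n: "norm n = 1" "n \<cdot> (E - D) = 0" using cut by (auto simp: cut_def)
 let ?gm = "\<tau> *R perp n + (\<nu> / bm) *R n" and ?gp = "\<tau> *R perp n + (\<nu> / bp) *R n"
 let ?k = "\<nu> / bp - \<nu> / bm"
 define \<phi> where "\<phi> x = 0 + ?gm \<cdot> x + ?k*max 0 (n \<cdot> (x - D))" for x
 have nn: "n \<cdot> n = 1" using n(1) by (simp add: norm_eq_1)
 have "kdiff \<phi> (lgrad bm bp D n \<tau> \<nu>)" unfolding \<phi>_def lgrad_kink by (rule kdiff_add_kink)
 moreover have "\<phi> : S_local Om bm bp T"
 proof -
  have "(ALL x:piece_plus T D n. \<phi> x = - ?k*(n \<cdot> D) + ?gp \<cdot> x)"
  by (auto simp: piece_plus_def \<phi>_def inner_diff_right inner_add_left algebra_simps)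
  moreover have "(ALL x:piece_minus T D n. \<phi> x = 0 + ?gm \<cdot> x)"
  by (auto simp: piece_minus_def \<phi>_def)
  moreover have "- ?k*(n \<cdot> D) + ?gp \<cdot> D = 0 + ?gm \<cdot> D"
  by (simp add: inner_add_left algebra_simps)
  moreover have "- ?k*(n \<cdot> D) + ?gp \<cdot> E = 0 + ?gm \<cdot> E"
  proof -
  have "n \<cdot> E = n \<cdot> D" using n(2) by (simp add: inner_diff_right)
  thus ?thesis by (simp add: inner_add_left algebra_simps)
  qed
  moreover have "bp*(?gp \<cdot> n) = bm*(?gm \<cdot> n)"
  using \<beta> by (simp add: inner_add_left perp_simps nn)
  ultimately show ?thesis using cut int unfolding S_local_def
  by (simp only: if_True mem_Collect_eq) blast
 qed
 ultimately show ?thesis by blast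
qed

context grid
begin

text \<open>The one-sided functions behind \<open>S_h\<close> are replaced by kink functions on the
  plane. They agree on the closed elements, so no edge mean changes, and the conditions on edges
  become \<open>mean_conforming\<close>.\<close>

lemma S_h_conforming:
 assumes "ph : S_h (box a b) Om bm bp (mesh a b N1 N2 \<delta>)" and \<beta>: "bm ~= 0" "bp ~= 0"
 shows "EX \<Phi> G. mean_conforming \<Phi> & (ALL i<N1. ALL j<N2. ALL k. kdiff (\<Phi> i j k) (G i j k) &
  (ALL x:interior (T i j k). ph x = \<Phi> i j k x) &
  (if interface_element Om (T i j k) then EX D E n \<tau> \<nu>. cut Om (T i j k) D E n & G i j k = lgrad bm bp D n \<tau> \<nu> else EX g. G i j k = (%x. g)))"
proof -
 let ?M = "mesh a b N1 N2 \<delta>"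
 obtain \<Phi> where P1: "ALL T:?M. \<Phi> T : S_local Om bm bp T & (ALL x:interior T. ph x = \<Phi> T x)"
  and P2: "ALL T1:?M. ALL T2:?M. ALL v w. T1 ~= T2 & closed_segment v w edge_of T1 & closed_segment v w edge_of T2 -->
  edge_integral v w (\<Phi> T1) = edge_integral v w (\<Phi> T2)"
  and P3: "ALL T:?M. ALL v w. closed_segment v w edge_of T & closed_segment v w \<subseteq> frontier (box a b) --> edge_integral v w (\<Phi> T) = 0"
  using assms(1) unfolding S_h_def mem_Collect_eq by (elim exE conjE) (rule that)
 have M: "T i j k : ?M" if "i < N1" "j < N2" for i j k
  unfolding mesh_T using that by (auto simp: I_def)
 have "EX \<Psi> G. i < N1 --> j < N2 --> kdiff \<Psi> G & (ALL x:T i j k. \<Phi> (T i j k) x = \<Psi> x) &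
  (if interface_element Om (T i j k) then EX D E n \<tau> \<nu>. cut Om (T i j k) D E n & G = lgrad bm bp D n \<tau> \<nu> else EX g. G = (%x. g))" for i j k
 proof (cases "i < N1 & j < N2")
  case True
  hence "\<Phi> (T i j k) : S_local Om bm bp (T i j k)" using P1 M by blast
  from S_local_kink[OF this \<beta>] True show ?thesis by simp
 qed blast
 hence "ALL i j k. EX \<Psi> G. i < N1 --> j < N2 --> kdiff \<Psi> G & (ALL x:T i j k. \<Phi> (T i j k) x = \<Psi> x) &
  (if interface_element Om (T i j k) then EX D E n \<tau> \<nu>. cut Om (T i j k) D E n & G = lgrad bm bp D n \<tau> \<nu> else EX g. G = (%x. g))" by blast
 then obtain \<Psi> G where PG: "ALL i j k. i < N1 --> j < N2 --> kdiff (\<Psi> i j k) (G i j k) & (ALL x:T i j k. \<Phi> (T i j k) x = \<Psi> i j k x) &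
  (if interface_element Om (T i j k) then EX D E n \<tau> \<nu>. cut Om (T i j k) D E n & G i j k = lgrad bm bp D n \<tau> \<nu> else EX g. G i j k = (%x. g))"
  unfolding choice_iff by (elim exE) (rule that)
 have av: "edge_integral v w (\<Phi> (T i j k)) = norm (w - v)*avg v w (\<Psi> i j k)"
  if "i < N1" "j < N2" "closed_segment v w edge_of T i j k" for i j k v w
 proof -
  have "closed_segment v w \<subseteq> T i j k" using that(3) by (simp add: edge_of_imp_subset)
  hence "avg v w (\<Phi> (T i j k)) = avg v w (\<Psi> i j k)"
  using PG that(1,2) by (intro avg_cong) (meson linepath_in_path subsetD)
  thus ?thesis by (simp add: edge_integral_avg)
 qed
 have eq: "avg v w (\<Psi> i j k) = avg v w (\<Psi> i' j' k')"
  if "i < N1" "j < N2" "i' < N1" "j' < N2" "(i, j, k) ~= (i', j', k')" "closed_segment v w edge_of T i j k" "closed_segment v w edge_of T i' j' k'" "v ~= w"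
  for i j k i' j' k' v w
  using P2[rule_format, of "T i j k" "T i' j' k'" v w] M that av[of i j v w k] av[of i' j' v w k'] by (simp add: T_eq_iff)
 have eq0: "avg v w (\<Psi> i j k) = 0"
  if "i < N1" "j < N2" "closed_segment v w edge_of T i j k" "v ~= w" "closed_segment v w \<inter> box a b = {}" for i j k v w
 proof -
  have "closed_segment v w \<subseteq> T i j k" using that(3) by (simp add: edge_of_imp_subset)
  hence "closed_segment v w \<subseteq> frontier (box a b)"
  using T_cbox[OF that(1,2), of k] that(5) ab by (subst frontier_box) (auto simp: box_ne_empty Basis_plane inner_axis_plane)
  thus ?thesis
  using P3[rule_format, OF M[OF that(1,2)], of v w k] that av[of i j v w k] by simp
 qed
 have nV: "pt (X i) (Y j) ~= pt (X i) (Y (Suc j))" and nH: "pt (X i) (Y j) ~= pt (X (Suc i)) (Y j)"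
  and nD: "pt (X i) (Y j) ~= pt (X (Suc i)) (Y (Suc j))" "pt (X i) (Y (Suc j)) ~= pt (X (Suc i)) (Y j)" for i j
  using h_pos by (simp_all add: plane_eq_iff XY_Suc)
 have e1: "closed_segment (pt (X (Suc i)) (Y j)) (pt (X (Suc i)) (Y (Suc j))) edge_of T i j (\<not> \<delta> i j)"
  "closed_segment (pt (X i) (Y j)) (pt (X i) (Y (Suc j))) edge_of T i j (\<delta> i j)"
  "closed_segment (pt (X i) (Y (Suc j))) (pt (X (Suc i)) (Y (Suc j))) edge_of T i j True"
  "closed_segment (pt (X i) (Y j)) (pt (X (Suc i)) (Y j)) edge_of T i j False" for i j
  using T_edges(1)[of i j "\<not> \<delta> i j"] T_edges(1)[of i j "\<delta> i j"] T_edges(2)[of i True j] T_edges(2)[of i False j] by simp_all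
 have off: "closed_segment v w \<inter> box a b = {}"
  if vw: "v$1 = w$1 & (v$1 = a$1 \<or> v$1 = b$1) \<or> v$2 = w$2 & (v$2 = a$2 \<or> v$2 = b$2)" for v w
 proof -
  have "x ~: box a b" if x: "x : closed_segment v w" for x
  proof
  assume "x : box a b"
  hence xb: "a$1 < x$1" "x$1 < b$1" "a$2 < x$2" "x$2 < b$2" by (simp_all add: mem_box_cart)
  obtain u where u: "x = (1 - u) *R v + u *R w" using x by (auto simp: in_segment)
  have "v$i = w$i ==> x$i = v$i" for i unfolding u by (simp add: left_diff_distrib)
  thus False using vw xb by auto
  qed
  thus ?thesis by blast
 qed
 have "mean_conforming \<Psi>"
  unfolding mean_conforming_def
 proof (intro conjI allI impI)
  fix i j assume "Suc i < N1" "j < N2"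
  thus "avgV (Suc i) j (\<Psi> i j (\<not> \<delta> i j)) = avgV (Suc i) j (\<Psi> (Suc i) j (\<delta> (Suc i) j))"
  unfolding avgV_def by (intro eq e1 nV) auto
 next
  fix i j assume "i < N1" "Suc j < N2"
  thus "avgH i (Suc j) (\<Psi> i j True) = avgH i (Suc j) (\<Psi> i (Suc j) False)"
  unfolding avgH_def by (intro eq e1 nH) auto
 next
  fix i j assume "i < N1" "j < N2"
  thus "avgD i j (\<Psi> i j True) = avgD i j (\<Psi> i j False)"
  unfolding avgD_def by (cases "\<delta> i j") (simp_all only: if_True if_False, (intro eq T_edges nD; simp)+)
 next
  fix j assume "j < N2"
  thus "avgV 0 j (\<Psi> 0 j (\<delta> 0 j)) = 0"
  unfolding avgV_def using N by (intro eq0 e1 nV off) (simp_all add: XY_end)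
 next
  fix i j assume ij: "Suc i = N1" "j < N2"
  hence "X (Suc i) = b$1" by (simp add: XY_end)
  with ij show "avgV (Suc i) j (\<Psi> i j (\<not> \<delta> i j)) = 0"
  unfolding avgV_def by (intro eq0 e1 nV off) simp_all
 next
  fix i assume "i < N1"
  thus "avgH i 0 (\<Psi> i 0 False) = 0"
  unfolding avgH_def using N by (intro eq0 e1 nH off) (simp_all add: XY_end)
 next
  fix i j assume ij: "Suc j = N2" "i < N1"
  hence "Y (Suc j) = b$2" by (simp add: XY_end)
  with ij show "avgH i (Suc j) (\<Psi> i j True) = 0"
  unfolding avgH_def by (intro eq0 e1 nH off) simp_all
 qed
 moreover have "kdiff (\<Psi> i j k) (G i j k) & (ALL x:interior (T i j k). ph x = \<Psi> i j k x) &
  (if interface_element Om (T i j k) then EX D E n \<tau> \<nu>. cut Om (T i j k) D E n & G i j k = lgrad bm bp D n \<tau> \<nu> else EX g. G i j k = (%x. g))"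
  if ij: "i < N1" "j < N2" for i j k
 proof -
  note p = PG[rule_format, OF ij, of k]
  have "ph x = \<Psi> i j k x" if x: "x : interior (T i j k)" for x
  using P1[rule_format, OF M[OF ij, of k]] p x interior_subset[of "T i j k"] by (metis subsetD)
  thus ?thesis using p by blast
 qed
 ultimately show ?thesis by blast
qed

end

section \<open>Translation of Sobolev functions and the Poincare inequality\<close>

lemma lborel_translate:
 fixes f :: "'a::euclidean_space => real"
 assumes [measurable]: "f : Bm"
 shows "(\<integral>x. f (x + v) \<partial>lborel) = (\<integral>x. f x \<partial>lborel)"
  and "integrable lborel (%x. f (x + v)) \<longleftrightarrow> integrable lborel f"
  and "(\<integral>\<^sup>+x. ennreal (f (x + v)) \<partial>lborel) = (\<integral>\<^sup>+x. ennreal (f x) \<partial>lborel)"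
proof -
 have m: "(+) v : measurable lborel borel" by measurable
 show "(\<integral>x. f (x + v) \<partial>lborel) = (\<integral>x. f x \<partial>lborel)"
  using integral_distr[OF m assms] by (simp add: lborel_distr_plus add.commute)
 show "integrable lborel (%x. f (x + v)) \<longleftrightarrow> integrable lborel f"
  using integrable_distr_eq[OF m assms] by (simp add: lborel_distr_plus add.commute)
 have "(\<integral>\<^sup>+x. ennreal (f x) \<partial>distr lborel borel ((+) v)) = (\<integral>\<^sup>+x. ennreal (f (v + x)) \<partial>lborel)"
  by (rule nn_integral_distr[OF m]) measurable
 thus "(\<integral>\<^sup>+x. ennreal (f (x + v)) \<partial>lborel) = (\<integral>\<^sup>+x. ennreal (f x) \<partial>lborel)"
  by (simp add: lborel_distr_plus add.commute)
qed

lemma Ck_shift: "Ck k \<phi> ==> Ck k (%x. \<phi> (x + v))"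
proof (induction k arbitrary: \<phi>)
 case 0
 hence "continuous_on UNIV \<phi>" by simp
 hence "continuous_on UNIV (%x. \<phi> (x + v))"
  by (rule continuous_on_compose2) (auto intro: continuous_intros)
 thus ?case by simp
next
 case (Suc k)
 have d: "((%x. \<phi> (x + v)) has_derivative (%w. grad \<phi> (x + v) \<cdot> w)) (at x)" for x
 proof -
  have "((%x. x + v) has_derivative (%w. w)) (at x)" by (auto intro!: derivative_eq_intros)
  moreover have "\<phi> differentiable at (x + v)" using Suc.prems by simp
  ultimately show ?thesis using has_derivative_compose[OF _ grad_has_derivative] by fastforce
 qed
 have g: "grad (%x. \<phi> (x + v)) x = grad \<phi> (x + v)" for x by (rule grad_eqI[OF d])
 have "Ck k (%x. grad \<phi> (x + v)$i)" for i
  using Suc.IH[of "%x. grad \<phi> x$i"] Suc.prems by simp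
 thus ?case unfolding Ck.simps g using d differentiable_def by blast
qed

lemma grad_shift:
 assumes "\<phi> : test_functions U"
 shows "grad (%x. \<phi> (x + v)) x = grad \<phi> (x + v)"
proof (rule grad_eqI)
 have "((%x. x + v) has_derivative (%w. w)) (at x)" by (auto intro!: derivative_eq_intros)
 from has_derivative_compose[OF this grad_has_derivative[OF test_continuous(3)[OF assms]]]
 show "((%x. \<phi> (x + v)) has_derivative (%w. grad \<phi> (x + v) \<cdot> w)) (at x)" .
qed

lemma test_function_shift:
 assumes \<phi>: "\<phi> : test_functions U" and sub: "!!x. x : U ==> x - v : S"
 shows "(%x. \<phi> (x + v)) : test_functions S"
proof -
 obtain K where K: "compact K" "K \<subseteq> U" "ALL x. x ~: K --> \<phi> x = 0" using test_support[OF \<phi>] by blast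
 have cK: "compact ((%x. x - v) ` K)" using K(1) by (intro compact_continuous_image continuous_intros)
 have "{x. \<phi> (x + v) ~= 0} \<subseteq> (%x. x - v) ` K"
 proof
  fix x assume "x : {x. \<phi> (x + v) ~= 0}"
  hence "x + v : K" using K(3) by blast
  thus "x : (%x. x - v) ` K" by (intro image_eqI[of _ _ "x + v"]) auto
 qed
 hence cl: "closure {x. \<phi> (x + v) ~= 0} \<subseteq> (%x. x - v) ` K"
  by (intro closure_minimal compact_imp_closed[OF cK])
 have "compact (closure {x. \<phi> (x + v) ~= 0})"
  using bounded_subset[OF compact_imp_bounded[OF cK] cl] unfolding compact_eq_bounded_closed by (intro conjI closed_closure)
 moreover have "closure {x. \<phi> (x + v) ~= 0} \<subseteq> S" using cl K(2) sub by blast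
 moreover have "ALL k. Ck k (%x. \<phi> (x + v))" using \<phi> Ck_shift by (simp add: test_functions_def)
 ultimately show ?thesis unfolding test_functions_def by blast
qed

lemma borel_representative:
 fixes f :: "'a::euclidean_space => real"
 assumes S: "S : sets borel" and f: "f : Mb S"
 shows "EX f':borel_measurable borel. (ALL x. x ~: S --> f' x = 0) & (AE x in leb S. f x = f' x)"
proof -
 have "(%x. ind S x *R f x) : borel_measurable lebesgue"
  using f S by (simp add: borel_measurable_restrict_space_iff)
 then obtain h where h: "h : Bm" "AE x in lborel. ind S x *R f x = h x"
  using completion_ex_borel_measurable_real[of _ lborel] by auto
 have "AE x in lebesgue. x : S --> f x = ind S x*h x"
  using AE_completion[OF h(2)] by eventually_elim (auto split: split_indicator)
 hence "AE x in leb S. f x = ind S x*h x"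
  using S by (subst AE_leb_iff) auto
 moreover have "(%x. ind S x*h x) : Bm" using h(1) S by measurable
 ultimately show ?thesis by (intro bexI[of _ "%x. ind S x*h x"]) auto
qed

lemma LINT_repr:
 fixes f f' :: "'a::euclidean_space => real"
 assumes S: "S : sets borel" and f': "f' : Bm" "!!x. x ~: S ==> f' x = 0"
  and ae: "AE x in leb S. f x = f' x"
 shows "(LINT x|leb S. f x) = (\<integral>x. f' x \<partial>lborel)" "L1 S f \<longleftrightarrow> integrable lborel f'"
proof -
 have Sl: "S : sets lebesgue" using S by simp
 have eq: "(%x. ind S x *R f' x) = f'"
 proof
  fix x show "ind S x *R f' x = f' x" by (cases "x : S") (simp_all add: f'(2))
 qed
 have ae': "AE x in leb S. f' x = f x" using ae by eventually_elim simp
 have "L1 S f \<longleftrightarrow> L1 S f'"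
  using leb_AE_cong(2)[OF Sl ae] leb_AE_cong(2)[OF Sl ae'] by blast
 moreover have "L1 S f' \<longleftrightarrow> integrable lborel f'"
  using LINT_lebesgue_on_borel(2)[OF S f'(1)] by (simp only: eq)
 ultimately show i: "L1 S f \<longleftrightarrow> integrable lborel f'" by simp
 have f'm: "f' : Mb S" using f'(1) by (simp add: meas_leb measurable_completion)
 have fm: "f : Mb S" by (rule leb_AE_cong(1)[OF Sl ae' f'm])
 have "(LINT x|leb S. f x) = (LINT x|leb S. f' x)"
  by (rule integral_cong_AE[OF fm f'm ae])
 also have "... = (\<integral>x. f' x \<partial>lborel)"
  using LINT_lebesgue_on_borel(1)[OF S f'(1)] by (simp only: eq)
 finally show "(LINT x|leb S. f x) = (\<integral>x. f' x \<partial>lborel)" .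
qed

lemma L2_integrable:
 fixes f :: "plane => real"
 assumes "S : lmeasurable" "f : L2 S"
 shows "L1 S f"
proof (rule L1_bound[of _ "%x. 1 + (norm (f x))^2"])
 interpret finite_measure "leb S" by (rule finite_measure_lebesgue_on[OF assms(1)])
 show "L1 S (%x. 1 + (norm (f x))^2)"
  using assms(2) by (intro L1_add integrable_const) (simp add: L2_def)
 show "f : Mb S" using assms(2) by (simp add: L2_def)
 have "abs(y) <= 1 + y^2" for y :: real
  using zero_le_power2[of "abs(y) - 1"] by (simp add: power2_diff)
 thus "AE x in leb S. norm (f x) <= norm (1 + (norm (f x))^2)"
  by (intro AE_I2) (simp add: abs_of_nonneg)
qed

text \<open>A Borel function and a Borel weak gradient, both extended by zero outside
  \<open>S\<close>. For such representatives translations and Fubini work on \<open>lborel\<close>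
  without a restriction of the measure.\<close>

definition borel_weak_pair :: "plane set => (plane => real) => (2 => plane => real) => bool" where
 "borel_weak_pair S f g \<longleftrightarrow> f : Bm & (ALL i. g i : Bm) &
  integrable lborel f & (ALL i. integrable lborel (g i)) & (ALL x. x ~: S --> f x = 0 & (ALL i. g i x = 0)) &
  (ALL \<phi>:test_functions S. ALL i. (\<integral>x. f x*grad \<phi> x$i \<partial>lborel) = - (\<integral>x. g i x * \<phi> x \<partial>lborel))"

lemma H1_borel_weak_pair:
 assumes S: "open S" "bounded S" and f: "f : H1 S"
 shows "EX f' g'. borel_weak_pair S f' g' & (AE x in leb S. f x = f' x) & (ALL i. AE x in leb S. wgrad S f x$i = g' i x)"
proof -
 note H = H1_wgrad[OF S(1) f]
 have Sb: "S : sets borel" and Sm: "S : lmeasurable" using S by (auto intro: bounded_set_imp_lmeasurable)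
 have fm: "f : Mb S" using H(3) by (simp add: L2_def)
 have gm: "(%x. wgrad S f x$i) : Mb S" for i
  by (rule measurable_compose[OF _ borel_measurable_nth]) (use H(2) in "simp add: L2_def")
 have gL2: "(%x. wgrad S f x$i) : L2 S" for i
 proof -
  have "L1 S (%x. (norm (wgrad S f x$i))^2)"
  proof (rule L1_bound[of _ "%x. (norm (wgrad S f x))^2"])
  show "L1 S (%x. (norm (wgrad S f x))^2)" using H(2) by (simp add: L2_def)
  show "(%x. (norm (wgrad S f x$i))^2) : Mb S" using gm by measurable
  show "AE x in leb S. norm ((norm (wgrad S f x$i))^2) <= norm ((norm (wgrad S f x))^2)"
  proof (intro AE_I2)
  fix x
  have "abs(wgrad S f x$i)^2 <= (norm (wgrad S f x))^2" by (rule power_mono[OF component_le_norm_cart]) simp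
  thus "norm ((norm (wgrad S f x$i))^2) <= norm ((norm (wgrad S f x))^2)" by simp
  qed
  qed
  thus ?thesis using gm by (simp add: L2_def)
 qed
 obtain f' where f': "f' : Bm" "!!x. x ~: S ==> f' x = 0" "AE x in leb S. f x = f' x"
  using borel_representative[OF Sb fm] by blast
 have "ALL i. EX g'. g' : Bm & (ALL x. x ~: S --> g' x = 0) & (AE x in leb S. wgrad S f x$i = g' x)"
  using borel_representative[OF Sb gm] by blast
 then obtain g' where g': "!!i. g' i : Bm" "!!i x. x ~: S ==> g' i x = 0" "!!i. AE x in leb S. wgrad S f x$i = g' i x"
  unfolding choice_iff by blast
 have "borel_weak_pair S f' g'"
  unfolding borel_weak_pair_def
 proof (intro conjI allI impI ballI f'(1,2) g'(1,2))
  show "integrable lborel f'"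
  by (subst LINT_repr(2)[OF Sb f', symmetric]) (assumption | rule L2_integrable[OF Sm H(3)])+
  show "integrable lborel (g' i)" for i
  by (subst LINT_repr(2)[OF Sb g', symmetric]) (assumption | rule L2_integrable[OF Sm gL2])+
  fix \<phi> i assume \<phi>: "\<phi> : test_functions S"
  have b: "\<phi> : Bm" "(%x. grad \<phi> x$i) : Bm"
  using test_continuous(1,2)[OF \<phi>] by (auto intro: cont_Bm)
  have "(LINT x|leb S. f x*grad \<phi> x$i) = (\<integral>x. f' x*grad \<phi> x$i \<partial>lborel)"
  by (rule LINT_repr(1)[OF Sb]) (use f' b in "auto elim!: eventually_mono")
  moreover have "(LINT x|leb S. wgrad S f x$i * \<phi> x) = (\<integral>x. g' i x * \<phi> x \<partial>lborel)"
  by (rule LINT_repr(1)[OF Sb]) (use g'(1,2) g'(3)[of i] b in "auto elim!: eventually_mono")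
  moreover have "(LINT x|leb S. f x*grad \<phi> x$i) = - (LINT x|leb S. wgrad S f x$i * \<phi> x)"
  using H(1)[unfolded has_weak_grad_def] \<phi> by (elim conjE) (drule (1) bspec, erule allE)
  ultimately show "(\<integral>x. f' x*grad \<phi> x$i \<partial>lborel) = - (\<integral>x. g' i x * \<phi> x \<partial>lborel)"
  by linarith
 qed
 thus ?thesis by (intro exI[of _ f'] exI[of _ g'] conjI allI f'(3) g'(3))
qed

text \<open>Supplies the integrability for exchanging an integral along segments with one over the
  plane. The majorant is a translate of \<open>F\<close>, whose integral does not depend on
  \<open>t\<close>.\<close>

lemma unit_interval_product_integrable:
 fixes F :: "plane => real"
 assumes m: "(%z. H (fst z) (snd z)) : borel_measurable (borel \<Otimes>\<^sub>M borel)" and F: "F : Bm" "integrable lborel F"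
  and le: "!!t x. 0 <= t ==> t <= 1 ==> abs(H t x) <= C*abs(F (x + t *R w))"
 shows "integrable (lborel \<Otimes>\<^sub>M lborel) (%(t::real, x::plane). ind {0..1} t*H t x)"
proof -
 have [measurable]: "(%z. H (fst z) (snd z)) : borel_measurable (borel \<Otimes>\<^sub>M borel)" "F : Bm" using assms by auto
 have mF: "(%z. F (snd z + fst z *R w)) : borel_measurable (borel \<Otimes>\<^sub>M borel)" by measurable
 have "integrable (lborel \<Otimes>\<^sub>M lborel) (%z. ind {0..1} (fst z)*(C*abs(F (snd z + fst z *R w))))"
 proof (rule lborel_pair.Fubini_integrable)
  show "(%z. ind {0..1} (fst z)*(C*abs(F (snd z + fst z *R w)))) : borel_measurable (lborel \<Otimes>\<^sub>M lborel)"
  by measurable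
  have t: "(\<integral>x. abs(F (x + t *R w)) \<partial>lborel) = (\<integral>x. abs(F x) \<partial>lborel)" for t
  by (rule lborel_translate(1)[of "%x. abs(F x)"]) measurable
  show "integrable lborel (%t. \<integral>x. norm (ind {0..1} (fst (t, x))*(C*abs(F (snd (t, x) + fst (t, x) *R w)))) \<partial>lborel)"
  by (simp add: abs_mult t)
  show "AE t in lborel. integrable lborel (%x. ind {0..1} (fst (t, x))*(C*abs(F (snd (t, x) + fst (t, x) *R w))))"
  using F(2) lborel_translate(2)[of F] by (intro AE_I2) simp
 qed
 hence "integrable (lborel \<Otimes>\<^sub>M lborel) (%z. ind {0..1} (fst z)*H (fst z) (snd z))"
 proof (rule L1_bound)
  show "(%z. ind {0..1} (fst z)*H (fst z) (snd z)) : borel_measurable (lborel \<Otimes>\<^sub>M lborel)"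
  by measurable
  show "AE z in lborel \<Otimes>\<^sub>M lborel. norm (ind {0..1} (fst z)*H (fst z) (snd z)) <= norm (ind {0..1} (fst z)*(C*abs(F (snd z + fst z *R w))))"
  proof (intro AE_I2)
  fix z :: "real \<times> plane"
  show "norm (ind {0..1} (fst z)*H (fst z) (snd z)) <= norm (ind {0..1} (fst z)*(C*abs(F (snd z + fst z *R w))))"
  proof (cases "fst z : {0..1}")
  case True
  hence "abs(H (fst z) (snd z)) <= C*abs(F (snd z + fst z *R w))" using le by simp
  thus ?thesis using True by (simp add: abs_mult[symmetric])
  qed simp
  qed
 qed
 thus ?thesis by (simp add: case_prod_beta')
qed

lemma L1_mult_bounded:
 fixes f h :: "'a => real"
 assumes f: "integrable M f" and h: "h : borel_measurable M" and B: "!!x. abs(h x) <= B"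
 shows "integrable M (%x. f x*h x)"
proof (rule L1_bound[of _ "%x. B*f x"])
 show "integrable M (%x. B*f x)" using f by simp
 show "(%x. f x*h x) : borel_measurable M" using L1_meas[OF f] h by measurable
 have "abs(f x*h x) <= abs(B*f x)" for x
  using mult_left_mono[OF order_trans[OF B[of x] abs_ge_self[of B]], of "abs(f x)"]
  by (simp add: abs_mult mult.commute)
 thus "AE x in M. norm (f x*h x) <= norm (B*f x)" by (intro AE_I2) simp
qed

text \<open>The fundamental theorem along the segment from \<open>x\<close> to \<open>x + e\<close>,
  for Sobolev functions. It is verified against test functions supported where both endpoints lie in
  \<open>S\<close>: the difference is shifted onto the test function, the classical theorem applies
  there, and for each \<open>t\<close> the weak gradient brings the derivative back.\<close>

lemma weak_translation:
 assumes S: "open S" "convex S" and p: "borel_weak_pair S f g"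
 shows "AE x in lebesgue. x : S & x + e : S -->
  f (x + e) - f x = (\<integral>t. ind {0..1} t*(g 1 (x + t *R e)*e$1 + g 2 (x + t *R e)*e$2) \<partial>lborel)"
proof -
 define G where "G x = g 1 x*e$1 + g 2 x*e$2" for x
 define U where "U = S \<inter> (%x. x + e) -` S"
 define k where "k x = f (x + e) - f x - (\<integral>t. ind {0..1} t*G (x + t *R e) \<partial>lborel)" for x
 have wk: "(\<integral>x. f x*grad \<psi> x$i \<partial>lborel) = - (\<integral>x. g i x * \<psi> x \<partial>lborel)" if "\<psi> : test_functions S" for \<psi> i
  using p that unfolding borel_weak_pair_def by blast
 have [measurable]: "f : Bm" "g i : Bm" for i using p by (auto simp: borel_weak_pair_def)
 have int: "integrable lborel f" "integrable lborel (g i)" for i using p by (auto simp: borel_weak_pair_def)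
 have Gm[measurable]: "G : Bm" and Gi: "integrable lborel G"
  unfolding G_def using int by (auto intro!: L1_add)
 have U: "open U" unfolding U_def
  by (intro open_Int S(1) continuous_open_vimage[OF S(1)]) (intro continuous_intros)
 have mG: "(%z. G (snd z + fst z *R e)) : borel_measurable (borel \<Otimes>\<^sub>M borel)" by measurable
 have pG: "integrable (lborel \<Otimes>\<^sub>M lborel) (%(t, x). ind {0..1} t*G (x + t *R e))"
  by (rule unit_interval_product_integrable[where C=1 and F=G and w=e]) (use mG Gi in auto)
 have ki: "integrable lborel k"
  unfolding k_def using lborel_pair.integrable_snd[OF pG] int(1) lborel_translate(2)[of f e]
  by (intro L1_diff) auto
 have "AE x in lebesgue. x : U --> k x = 0"
 proof (rule AE_zero_of_test[OF U])
  have kl: "integrable lebesgue k" using ki integrable_completion L1_meas by blast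
  show "locally_integrable U k"
  unfolding locally_integrable_def
  by (intro allI impI, subst integrable_lebesgue_on, use borel_compact in force) (rule integrable_mult_indicator[OF _ kl], use borel_compact in force)
  fix \<phi> assume \<phi>: "\<phi> : test_functions U"
  have cont: "continuous_on UNIV \<phi>" "continuous_on UNIV (%x. grad \<phi> x$i)" for i using test_continuous[OF \<phi>] by auto
  have [measurable]: "\<phi> : Bm" "(%x. grad \<phi> x$i) : Bm" for i
  using cont by (auto intro: cont_Bm)
  obtain K where K: "compact K" "K \<subseteq> U" "ALL x. x ~: K --> \<phi> x = 0 & grad \<phi> x = 0" using test_support[OF \<phi>] by blast
  have bnd: "EX B>=0. ALL x. abs(h x) <= B" if h: "continuous_on UNIV h" "ALL x. x ~: K --> h x = 0" for h :: "plane => real"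
  proof -
  obtain B where "B > 0" "ALL x:K. abs(h x) <= B"
  using compact_imp_bounded[OF compact_continuous_image[OF continuous_on_subset[OF h(1) subset_UNIV] K(1)]]
  by (auto simp: bounded_pos)
  moreover have "abs(h x) <= B" if "x ~: K" for x using h(2) that \<open>B > 0\<close> by simp
  ultimately show ?thesis by (intro exI[of _ B]) (meson less_imp_le)
  qed
  define D where "D x = grad \<phi> x$1*e$1 + grad \<phi> x$2*e$2" for x
  have Dm[measurable]: "D : Bm" unfolding D_def by measurable
  have Dc: "continuous_on UNIV D" unfolding D_def by (intro continuous_intros cont)
  obtain B where B: "!!x. abs(\<phi> x) <= B" "B >= 0" using bnd[OF cont(1)] K(3) by auto
  obtain B' where B': "!!x. abs(D x) <= B'" "B' >= 0" using bnd[OF Dc] K(3) by (auto simp: D_def)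
  have segS: "x + t *R e : S" if "x : U" "0 <= t" "t <= 1" for x t
  proof -
  have "(1 - t) *R x + t *R (x + e) : S" using that S(2) by (intro convexD) (auto simp: U_def)
  thus ?thesis by (simp add: algebra_simps)
  qed
  \<comment> \<open>Convexity of \<open>S\<close> keeps the intermediate points of the segment, and
    hence the support of the shifted test function, inside \<open>S\<close>.\<close>
  have tt: "(%x. \<phi> (x + - (t *R e))) : test_functions S" if "0 <= t" "t <= 1" for t
  by (rule test_function_shift[OF \<phi>]) (use segS[OF _ that] in simp)
  have step: "(\<integral>x. f x*D (x - t *R e) \<partial>lborel) = - (\<integral>x. G (x + t *R e) * \<phi> x \<partial>lborel)" if t: "0 <= t" "t <= 1" for t
  proof -
  have w: "(\<integral>x. f x*grad \<phi> (x - t *R e)$i \<partial>lborel) = - (\<integral>x. g i x * \<phi> (x - t *R e) \<partial>lborel)" for i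
  using wk[OF tt[OF t], of i] unfolding grad_shift[OF \<phi>] by simp
  have i1: "integrable lborel (%x. f x*grad \<phi> (x - t *R e)$i)" for i
  proof -
  obtain B1 where B1: "ALL x. abs(grad \<phi> x$i) <= B1" using bnd[OF cont(2)[of i]] K(3) by auto
  show ?thesis
  by (rule L1_mult_bounded[OF int(1), where B=B1]) (use B1 in "measurable, blast")
  qed
  have i2: "integrable lborel (%x. g i x * \<phi> (x - t *R e))" for i
  by (intro L1_mult_bounded[OF int(2) _ B(1)]) measurable
  have "(\<integral>x. f x*D (x - t *R e) \<partial>lborel) = (\<integral>x. e$1*(f x*grad \<phi> (x - t *R e)$1) + e$2*(f x*grad \<phi> (x - t *R e)$2) \<partial>lborel)"
  by (simp add: D_def algebra_simps)
  also have "... = e$1*(\<integral>x. f x*grad \<phi> (x - t *R e)$1 \<partial>lborel) + e$2*(\<integral>x. f x*grad \<phi> (x - t *R e)$2 \<partial>lborel)"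
  using i1 by (subst LINT_add) auto
  also have "... = - (e$1*(\<integral>x. g 1 x * \<phi> (x - t *R e) \<partial>lborel) + e$2*(\<integral>x. g 2 x * \<phi> (x - t *R e) \<partial>lborel))"
  unfolding w by simp
  also have "e$1*(\<integral>x. g 1 x * \<phi> (x - t *R e) \<partial>lborel) + e$2*(\<integral>x. g 2 x * \<phi> (x - t *R e) \<partial>lborel)
  = (\<integral>x. e$1*(g 1 x * \<phi> (x - t *R e)) + e$2*(g 2 x * \<phi> (x - t *R e)) \<partial>lborel)"
  using i2 by (subst LINT_add) auto
  also have "... = (\<integral>x. G x * \<phi> (x - t *R e) \<partial>lborel)"
  by (simp add: G_def algebra_simps)
  also have "... = (\<integral>x. G (x + t *R e) * \<phi> (x + t *R e - t *R e) \<partial>lborel)"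
  by (rule lborel_translate(1)[of "%x. G x * \<phi> (x - t *R e)", symmetric]) measurable
  finally show ?thesis by simp
  qed
  have ftc: "\<phi> (x - e) - \<phi> x = - (\<integral>t. ind {0..1} t*D (x - t *R e) \<partial>lborel)" for x
  proof -
  have "((%t. \<phi> (x - t *R e)) has_vector_derivative - D (x - t *R e)) (at t within {0..1})" for t
  proof -
  have "((%t. x - t *R e) has_derivative (%s. - (s *R e))) (at t within {0..1})"
  by (auto intro!: derivative_eq_intros)
  from has_derivative_compose[OF this grad_has_derivative[OF test_continuous(3)[OF \<phi>]]]
  show ?thesis by (simp add: has_vector_derivative_def D_def inner_vec_def sum_2 algebra_simps)
  qed
  moreover have "continuous_on {0..1} (%t. - D (x - t *R e))"
  by (intro continuous_intros continuous_on_compose2[OF Dc]) auto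
  ultimately have "integral\<^sup>L lborel (%t. ind {0..1} t *R (- D (x - t *R e))) = \<phi> (x - 1 *R e) - \<phi> (x - 0 *R e)"
  by (intro integral_FTC_atLeastAtMost) auto
  thus ?thesis by simp
  qed
  have mH1: "(%z. f (snd z)*D (snd z - fst z *R e)) : borel_measurable (borel \<Otimes>\<^sub>M borel)" by measurable
  have mH2: "(%z. G (snd z + fst z *R e) * \<phi> (snd z)) : borel_measurable (borel \<Otimes>\<^sub>M borel)" by measurable
  have H1: "integrable (lborel \<Otimes>\<^sub>M lborel) (%(t, x). ind {0..1} t*(f x*D (x - t *R e)))"
  by (rule unit_interval_product_integrable[where C=B' and F=f and w=0, OF mH1])
  (use int B' in \<open>auto simp: abs_mult mult.commute[of "abs(f _)"] intro: mult_right_mono\<close>)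
  have H2: "integrable (lborel \<Otimes>\<^sub>M lborel) (%(t, x). ind {0..1} t*(G (x + t *R e) * \<phi> x))"
  by (rule unit_interval_product_integrable[where C=B and F=G and w=e, OF mH2])
  (use Gi B in \<open>auto simp: abs_mult mult.commute[of "abs(G _)"] intro: mult_right_mono\<close>)
  define Kf where "Kf x = (\<integral>t. ind {0..1} t*G (x + t *R e) \<partial>lborel)" for x
  have Kfi: "integrable lborel Kf" unfolding Kf_def using lborel_pair.integrable_snd[OF pG] by simp
  have fe: "integrable lborel (%x. f (x + e))" using int(1) lborel_translate(2)[of f e] by simp
  have I: "integrable lborel (%x. f (x + e) * \<phi> x)" "integrable lborel (%x. f x * \<phi> x)" "integrable lborel (%x. Kf x * \<phi> x)"
  "integrable lborel (%x. f x * \<phi> (x - e))"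
  by (intro L1_mult_bounded[OF fe _ B(1)] L1_mult_bounded[OF int(1) _ B(1)] L1_mult_bounded[OF Kfi _ B(1)]; measurable)+
  have "(\<integral>x. f (x + e) * \<phi> x \<partial>lborel) - (\<integral>x. f x * \<phi> x \<partial>lborel) = (\<integral>x. f x * \<phi> (x - e) \<partial>lborel) - (\<integral>x. f x * \<phi> x \<partial>lborel)"
  using lborel_translate(1)[of "%x. f x * \<phi> (x - e)" e] by simp
  also have "... = (\<integral>x. f x*(\<phi> (x - e) - \<phi> x) \<partial>lborel)"
  using I by (simp add: right_diff_distrib)
  also have "... = - (\<integral>x. (\<integral>t. ind {0..1} t*(f x*D (x - t *R e)) \<partial>lborel) \<partial>lborel)"
  unfolding ftc by (simp add: mult.left_commute[of "ind _ _"])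
  also have "(\<integral>x. (\<integral>t. ind {0..1} t*(f x*D (x - t *R e)) \<partial>lborel) \<partial>lborel)
  = (\<integral>t. (\<integral>x. ind {0..1} t*(f x*D (x - t *R e)) \<partial>lborel) \<partial>lborel)"
  by (rule lborel_pair.Fubini_integral[OF H1])
  also have "... = (\<integral>t. - (\<integral>x. ind {0..1} t*(G (x + t *R e) * \<phi> x) \<partial>lborel) \<partial>lborel)"
  proof (rule LINT_cong[OF refl])
  fix t :: real
  show "(\<integral>x. ind {0..1} t*(f x*D (x - t *R e)) \<partial>lborel) = - (\<integral>x. ind {0..1} t*(G (x + t *R e) * \<phi> x) \<partial>lborel)"
  using step[of t] by (cases "t : {0..1}") simp_all
  qed
  also have "- ... = (\<integral>t. (\<integral>x. ind {0..1} t*(G (x + t *R e) * \<phi> x) \<partial>lborel) \<partial>lborel)" by simp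
  also have "... = (\<integral>x. (\<integral>t. ind {0..1} t*(G (x + t *R e) * \<phi> x) \<partial>lborel) \<partial>lborel)"
  by (rule lborel_pair.Fubini_integral[OF H2, symmetric])
  also have "... = (\<integral>x. Kf x * \<phi> x \<partial>lborel)"
  unfolding Kf_def by (simp add: mult.assoc[symmetric])
  finally have main: "(\<integral>x. k x * \<phi> x \<partial>lborel) = 0"
  unfolding k_def Kf_def[symmetric] left_diff_distrib using I by simp
  have "(LINT x|leb U. k x * \<phi> x) = (\<integral>x. ind U x *R (k x * \<phi> x) \<partial>lborel)"
  by (rule LINT_lebesgue_on_borel(1)) (use U L1_meas[OF ki] in auto)
  also have "(%x. ind U x *R (k x * \<phi> x)) = (%x. k x * \<phi> x)"
  proof
  fix x show "ind U x *R (k x * \<phi> x) = k x * \<phi> x"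
  using K by (cases "x : K") (auto simp: indicator_def)
  qed
  finally show "(LINT x|leb U. k x * \<phi> x) = 0" using main by simp
 qed
 thus ?thesis by eventually_elim (auto simp: U_def k_def G_def)
qed

text \<open>The right side is a nonnegative integral so that it may be infinite; no integrability
  has to be known before the inequality is integrated once more in the Poincare proof.\<close>

lemma cauchy_schwarz_set:
 fixes h :: "'a::euclidean_space => real"
 assumes A[measurable]: "A : sets borel" and fin: "emeasure lborel A < \<infinity>" and h[measurable]: "h : Bm"
 shows "ennreal ((\<integral>x. ind A x*h x \<partial>lborel)^2) <= ennreal (measure lborel A)*(\<integral>\<^sup>+x. ind A x*ennreal ((h x)^2) \<partial>lborel)"
proof (cases "integrable lborel (%x. ind A x*(h x)^2)")
 case False
 have "(\<integral>\<^sup>+x. ind A x*ennreal ((h x)^2) \<partial>lborel) = (\<integral>\<^sup>+x. ennreal (ind A x*(h x)^2) \<partial>lborel)"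
  by (intro nn_integral_cong) (simp add: indicator_def)
 also have "... = \<infinity>"
 proof (rule ccontr)
  assume "(\<integral>\<^sup>+x. ennreal (ind A x*(h x)^2) \<partial>lborel) ~= \<infinity>"
  hence "(\<integral>\<^sup>+x. ennreal (ind A x*(h x)^2) \<partial>lborel) < \<infinity>" by (simp add: top.not_eq_extremum)
  hence "integrable lborel (%x. ind A x*(h x)^2)" by (intro integrableI_nonneg) auto
  with False show False by simp
 qed
 finally have inf: "(\<integral>\<^sup>+x. ind A x*ennreal ((h x)^2) \<partial>lborel) = \<infinity>" .
 \<comment> \<open>If \<open>A\<close> is a null set, the right side is 0 times infinity, which is
   0, so the left side has to vanish as well.\<close>
 show ?thesis
 proof (cases "measure lborel A = 0")
  case True
  hence "emeasure lborel A = 0" using fin by (simp add: emeasure_eq_ennreal_measure)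
  hence "AE x in lborel. x ~: A" by (intro AE_not_in null_setsI) auto
  hence "(\<integral>x. ind A x*h x \<partial>lborel) = 0" by (intro integral_eq_zero_AE) (auto elim!: eventually_mono)
  thus ?thesis by simp
 next
  case False
  thus ?thesis unfolding inf by (simp add: ennreal_mult_top zero_less_measure_iff)
 qed
next
 case True
 define m a where "m = (\<integral>x. ind A x*h x \<partial>lborel)" and "a = measure lborel A"
 have iA: "integrable lborel (%x. ind A x :: real)" using fin by (simp add: integrable_indicator_iff)
 have ih: "integrable lborel (%x. ind A x*h x)"
 proof (rule L1_bound)
  show "integrable lborel (%x. ind A x + ind A x*(h x)^2)" using iA True by simp
  have "abs(y) <= 1 + y^2" for y :: real
  using zero_le_power2[of "abs(y) - 1"] by (simp add: power2_diff)
  thus "AE x in lborel. norm (ind A x*h x) <= norm (ind A x + ind A x*(h x)^2)"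
  by (intro AE_I2) (simp add: indicator_def)
 qed measurable
 have mA: "(\<integral>x. ind A x \<partial>lborel) = a" by (simp add: a_def)
 have key: "m^2 <= a*(\<integral>x. ind A x*(h x)^2 \<partial>lborel)"
 proof (cases "a = 0")
  case True
  hence "emeasure lborel A = 0" using fin by (simp add: emeasure_eq_ennreal_measure a_def)
  hence "AE x in lborel. x ~: A" by (intro AE_not_in null_setsI) auto
  hence "m = 0" unfolding m_def by (intro integral_eq_zero_AE) (auto elim!: eventually_mono)
  thus ?thesis using True by simp
 next
  case False
  hence a: "a > 0" by (simp add: a_def zero_less_measure_iff)
  have "0 <= (\<integral>x. ind A x*(h x - m/a)^2 \<partial>lborel)" by (intro LINT_nonneg) simp
  also have "... = (\<integral>x. (ind A x*(h x)^2 - 2*(m/a)*(ind A x*h x)) + (m/a)^2*ind A x \<partial>lborel)"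
  by (intro LINT_cong) (simp_all add: power2_diff algebra_simps)
  also have "... = ((\<integral>x. ind A x*(h x)^2 \<partial>lborel) - 2*(m/a)*m) + (m/a)^2*a"
  using True ih iA by (simp add: m_def[symmetric] a_def)
  also have "... = (\<integral>x. ind A x*(h x)^2 \<partial>lborel) - m^2/a"
  using a by (simp add: power2_eq_square field_simps)
  finally show ?thesis using a by (simp add: field_simps)
 qed
 have "(\<integral>\<^sup>+x. ind A x*ennreal ((h x)^2) \<partial>lborel) = (\<integral>\<^sup>+x. ennreal (ind A x*(h x)^2) \<partial>lborel)"
  by (intro nn_integral_cong) (simp add: indicator_def)
 also have "... = ennreal (\<integral>x. ind A x*(h x)^2 \<partial>lborel)"
  by (rule nn_integral_eq_integral[OF True]) simp
 finally show ?thesis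
  using key by (simp add: m_def a_def ennreal_mult[symmetric] ennreal_leI)
qed

text \<open>Bound the deviation from the mean by the double integral of squared differences and
  substitute \<open>y = x + e\<close>. For a fixed displacement the segment formula costs at most
  \<open>l1^2 + l2^2\<close> times the whole gradient integral, and the displacements fill at most a
  box of area \<open>4*l1*l2\<close>.\<close>

lemma poincare_borel:
 assumes S: "open S" "convex S" "bounded S" "S ~= {}" and p: "borel_weak_pair S f g"
  and l: "!!x y. x : S ==> y : S ==> abs(x$1 - y$1) <= l1 & abs(x$2 - y$2) <= l2"
 shows "(\<integral>\<^sup>+x. ind S x*ennreal ((f x - (\<integral>x. f x \<partial>lborel)/measure lborel S)^2) \<partial>lborel)
  <= ennreal (4*l1*l2*(l1^2 + l2^2)/measure lborel S)*(\<integral>\<^sup>+x. ennreal ((g 1 x)^2 + (g 2 x)^2) \<partial>lborel)"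
proof -
 have [measurable]: "f : Bm" "g i : Bm" for i using p by (auto simp: borel_weak_pair_def)
 have fi: "integrable lborel f" and f0: "!!x. x ~: S ==> f x = 0" using p by (auto simp: borel_weak_pair_def)
 have Sb[measurable]: "S : sets borel" using S by auto
 have l0: "l1 >= 0" "l2 >= 0" using S(4) l by force+
 define \<mu> where "\<mu> = measure lborel S"
 have fin: "emeasure lborel S < \<infinity>" using S(3) by (rule emeasure_bounded_finite)
 have mu: "\<mu> > 0"
 proof -
  have "\<not> negligible S" using S(1,4) open_not_negligible by blast
  hence "emeasure lborel S ~= 0" by (auto simp: negligible_iff_null_sets null_sets_def)
  thus ?thesis using fin by (simp add: \<mu>_def emeasure_eq_ennreal_measure zero_less_measure_iff)
 qed
 have eS: "emeasure lborel S = ennreal \<mu>" using fin by (simp add: \<mu>_def emeasure_eq_ennreal_measure)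
 define m where "m = (\<integral>x. f x \<partial>lborel)/\<mu>"
 define N where "N = (\<integral>\<^sup>+x. ennreal ((g 1 x)^2 + (g 2 x)^2) \<partial>lborel)"
 define L where "L = l1^2 + l2^2"
 have L0: "L >= 0" by (simp add: L_def)
 \<comment> \<open>Since \<open>f\<close> vanishes outside \<open>S\<close>, averaging
   \<open>f x - f y\<close> over \<open>y\<close> in \<open>S\<close> gives exactly
   \<open>f x - m\<close>.\<close>
 have 1: "ennreal ((f x - m)^2) <= ennreal (1/\<mu>)*(\<integral>\<^sup>+y. ind S y*ennreal ((f x - f y)^2) \<partial>lborel)" for x
 proof -
  have e: "(%y. ind S y*(f x - f y)) = (%y. f x*ind S y - f y)"
  by (auto simp: fun_eq_iff indicator_def f0)
  have "(\<integral>y. ind S y*(f x - f y) \<partial>lborel) = f x * \<mu> - (\<integral>y. f y \<partial>lborel)"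
  unfolding e using fi fin by (subst LINT_diff) (auto simp: \<mu>_def integrable_indicator_iff)
  also have "... = \<mu>*(f x - m)" using mu by (simp add: m_def right_diff_distrib)
  finally have "(\<integral>y. ind S y*(f x - f y) \<partial>lborel) = \<mu>*(f x - m)" .
  with cauchy_schwarz_set[OF Sb fin, of "%y. f x - f y"]
  have "ennreal ((\<mu>*(f x - m))^2) <= ennreal \<mu>*(\<integral>\<^sup>+y. ind S y*ennreal ((f x - f y)^2) \<partial>lborel)"
  by (simp add: \<mu>_def)
  hence "ennreal (1/\<mu>^2)*ennreal ((\<mu>*(f x - m))^2) <= ennreal (1/\<mu>^2)*(ennreal \<mu>*(\<integral>\<^sup>+y. ind S y*ennreal ((f x - f y)^2) \<partial>lborel))"
  by (rule mult_left_mono) simp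
  also have "... = ennreal (1/\<mu>^2 * \<mu>)*(\<integral>\<^sup>+y. ind S y*ennreal ((f x - f y)^2) \<partial>lborel)"
  proof -
  have "ennreal (1/\<mu>^2 * \<mu>) = ennreal (1/\<mu>^2)*ennreal \<mu>" by (intro ennreal_mult) (use mu in simp_all)
  thus ?thesis by (simp only: mult.assoc)
  qed
  also have "1/\<mu>^2 * \<mu> = 1/\<mu>" using mu by (simp add: power2_eq_square)
  also have "ennreal (1/\<mu>^2)*ennreal ((\<mu>*(f x - m))^2) = ennreal ((f x - m)^2)"
  using mu by (simp add: ennreal_mult[symmetric] power_mult_distrib)
  finally show ?thesis .
 qed
 define Q where "Q = cbox (pt (- l1) (- l2)) (pt l1 l2)"
 have Qb[measurable]: "Q : sets borel" by (simp add: Q_def)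
 have eQ: "emeasure lborel Q = ennreal (4*l1*l2)"
  unfolding Q_def using l0
  by (simp add: emeasure_lborel_cbox_eq Basis_plane[symmetric] prod_Basis_plane inner_axis_plane) (simp add: Basis_plane inner_axis_plane)
 have 2: "(\<integral>\<^sup>+x. ind S x*(ind S (x + e)*ennreal ((f x - f (x + e))^2)) \<partial>lborel) <= ennreal L*N*ind Q e" for e
 proof (cases "e : Q")
  case False
  have z: "ind S x*(ind S (x + e)*ennreal ((f x - f (x + e))^2)) = 0" for x
  proof (cases "x : S & x + e : S")
  case True
  hence "abs(e$1) <= l1 & abs(e$2) <= l2" using l[of "x + e" x] by simp
  hence "e : Q" by (auto simp: Q_def mem_box_cart forall_2)
  with False show ?thesis by simp
  qed (auto simp: indicator_def)
  show ?thesis unfolding z by simp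
 next
  case True
  hence "abs(e$1) <= l1" "abs(e$2) <= l2" by (auto simp: Q_def mem_box_cart forall_2)
  hence eL: "(e$1)^2 + (e$2)^2 <= L" unfolding L_def by (intro add_mono) (simp_all add: abs_le_square_iff[symmetric] l0)
  have pw: "(g 1 y*e$1 + g 2 y*e$2)^2 <= L*((g 1 y)^2 + (g 2 y)^2)" for y
  proof -
  have "(g 1 y*e$1 + g 2 y*e$2)^2 + (g 1 y*e$2 - g 2 y*e$1)^2 = ((e$1)^2 + (e$2)^2)*((g 1 y)^2 + (g 2 y)^2)"
  by (simp add: power2_eq_square algebra_simps)
  hence "(g 1 y*e$1 + g 2 y*e$2)^2 <= ((e$1)^2 + (e$2)^2)*((g 1 y)^2 + (g 2 y)^2)"
  using zero_le_power2[of "g 1 y*e$2 - g 2 y*e$1"] by linarith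
  also have "... <= L*((g 1 y)^2 + (g 2 y)^2)" by (intro mult_right_mono eL) simp
  finally show ?thesis .
  qed
  define h where "h x = (\<integral>\<^sup>+t. ind {0..1} t*(ennreal L*ennreal ((g 1 (x + t *R e))^2 + (g 2 (x + t *R e))^2)) \<partial>lborel)" for x
  have ae: "AE x in lborel. x : S & x + e : S -->
  f (x + e) - f x = (\<integral>t. ind {0..1} t*(g 1 (x + t *R e)*e$1 + g 2 (x + t *R e)*e$2) \<partial>lborel)"
  using weak_translation[OF S(1,2) p, of e] by (simp add: AE_completion_iff)
  have "(\<integral>\<^sup>+x. ind S x*(ind S (x + e)*ennreal ((f x - f (x + e))^2)) \<partial>lborel) <= (\<integral>\<^sup>+x. h x \<partial>lborel)"
  proof (rule nn_integral_mono_AE)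
  show "AE x in lborel. ind S x*(ind S (x + e)*ennreal ((f x - f (x + e))^2)) <= h x"
  using ae
  proof eventually_elim
  fix x assume x: "x : S & x + e : S -->
  f (x + e) - f x = (\<integral>t. ind {0..1} t*(g 1 (x + t *R e)*e$1 + g 2 (x + t *R e)*e$2) \<partial>lborel)"
  show "ind S x*(ind S (x + e)*ennreal ((f x - f (x + e))^2)) <= h x"
  proof (cases "x : S & x + e : S")
  case True
  have "ennreal ((f x - f (x + e))^2) = ennreal ((\<integral>t. ind {0..1} t*(g 1 (x + t *R e)*e$1 + g 2 (x + t *R e)*e$2) \<partial>lborel)^2)"
  using x True by (subst power2_commute) simp
  also have "... <= ennreal (measure lborel {0..1::real})*(\<integral>\<^sup>+t. ind {0..1} t*ennreal ((g 1 (x + t *R e)*e$1 + g 2 (x + t *R e)*e$2)^2) \<partial>lborel)"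
  by (rule cauchy_schwarz_set) simp_all
  also have "... <= h x"
  proof -
  have "ennreal ((g 1 y*e$1 + g 2 y*e$2)^2) <= ennreal L*ennreal ((g 1 y)^2 + (g 2 y)^2)" for y
  by (subst ennreal_mult[symmetric]) (use L0 pw in "simp_all add: ennreal_leI del: ennreal_plus")
  hence "(\<integral>\<^sup>+t. ind {0..1} t*ennreal ((g 1 (x + t *R e)*e$1 + g 2 (x + t *R e)*e$2)^2) \<partial>lborel) <= h x"
  unfolding h_def by (intro nn_integral_mono mult_left_mono) simp_all
  thus ?thesis by simp
  qed
  finally show ?thesis using True by simp
  qed (auto simp: indicator_def)
  qed
  qed
  also have "(\<integral>\<^sup>+x. h x \<partial>lborel) = (\<integral>\<^sup>+t. \<integral>\<^sup>+x. ind {0..1} t*(ennreal L*ennreal ((g 1 (x + t *R e))^2 + (g 2 (x + t *R e))^2)) \<partial>lborel \<partial>lborel)"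
  unfolding h_def by (rule lborel_pair.Fubini') measurable
  also have "... = (\<integral>\<^sup>+t. ind {0..1} t*(ennreal L*N) \<partial>(lborel :: real measure))"
  proof (rule nn_integral_cong)
  fix t :: real
  have "(\<integral>\<^sup>+x. ennreal ((g 1 (x + t *R e))^2 + (g 2 (x + t *R e))^2) \<partial>lborel) = N"
  unfolding N_def by (rule lborel_translate(3)[of "%x. (g 1 x)^2 + (g 2 x)^2"]) measurable
  thus "(\<integral>\<^sup>+x. ind {0..1} t*(ennreal L*ennreal ((g 1 (x + t *R e))^2 + (g 2 (x + t *R e))^2)) \<partial>lborel) = ind {0..1} t*(ennreal L*N)"
  by (simp add: nn_integral_cmult)
  qed
  also have "... = ennreal L*N" by (subst nn_integral_multc) simp_all
  finally show ?thesis using True by simp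
 qed
 have "(\<integral>\<^sup>+x. ind S x*ennreal ((f x - m)^2) \<partial>lborel) <= (\<integral>\<^sup>+x. ind S x*(ennreal (1/\<mu>)*(\<integral>\<^sup>+y. ind S y*ennreal ((f x - f y)^2) \<partial>lborel)) \<partial>lborel)"
  by (intro nn_integral_mono mult_left_mono 1) simp
 also have "... = (\<integral>\<^sup>+x. ennreal (1/\<mu>)*(ind S x*(\<integral>\<^sup>+y. ind S y*ennreal ((f x - f y)^2) \<partial>lborel)) \<partial>lborel)"
  by (simp add: mult.left_commute)
 also have "... = ennreal (1/\<mu>)*(\<integral>\<^sup>+x. ind S x*(\<integral>\<^sup>+y. ind S y*ennreal ((f x - f y)^2) \<partial>lborel) \<partial>lborel)"
  by (rule nn_integral_cmult) measurable
 also have "(\<integral>\<^sup>+x. ind S x*(\<integral>\<^sup>+y. ind S y*ennreal ((f x - f y)^2) \<partial>lborel) \<partial>lborel)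
  = (\<integral>\<^sup>+x. \<integral>\<^sup>+e. ind S x*(ind S (x + e)*ennreal ((f x - f (x + e))^2)) \<partial>lborel \<partial>lborel)"
 proof (rule nn_integral_cong)
  fix x :: plane
  have "(\<integral>\<^sup>+y. ind S y*ennreal ((f x - f y)^2) \<partial>lborel) = (\<integral>\<^sup>+e. ind S (x + e)*ennreal ((f x - f (x + e))^2) \<partial>lborel)"
  by (subst lborel_distr_plus[of x, symmetric], subst nn_integral_distr) simp_all
  thus "ind S x*(\<integral>\<^sup>+y. ind S y*ennreal ((f x - f y)^2) \<partial>lborel) = (\<integral>\<^sup>+e. ind S x*(ind S (x + e)*ennreal ((f x - f (x + e))^2)) \<partial>lborel)"
  by (simp add: nn_integral_cmult)
 qed
 also have "... = (\<integral>\<^sup>+e. \<integral>\<^sup>+x. ind S x*(ind S (x + e)*ennreal ((f x - f (x + e))^2)) \<partial>lborel \<partial>lborel)"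
  by (rule lborel_pair.Fubini') measurable
 also have "... <= (\<integral>\<^sup>+e. ennreal L*N*ind Q e \<partial>lborel)"
  by (intro nn_integral_mono 2)
 also have "... = ennreal L*N*ennreal (4*l1*l2)" by (simp add: nn_integral_cmult_indicator eQ)
 finally have "(\<integral>\<^sup>+x. ind S x*ennreal ((f x - m)^2) \<partial>lborel) <= ennreal (1/\<mu>)*(ennreal L*N*ennreal (4*l1*l2))"
  by (simp add: mult_left_mono)
 also have "... = ennreal (4*l1*l2*L/\<mu>)*N"
 proof -
  have "ennreal (4*l1*l2*L/\<mu>) = ennreal (1/\<mu>)*(ennreal L*ennreal (4*l1*l2))"
  using mu L0 l0 by (simp add: ennreal_mult[symmetric] mult.commute)
  thus ?thesis by (simp add: mult_ac)
 qed
 finally show ?thesis by (simp add: m_def \<mu>_def L_def N_def)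
qed

text \<open>The segment formula integrated over \<open>R\<close>. After the exchange of integrals
  the directional derivative is weighted with the share of times \<open>t\<close> for which
  \<open>x\<close> lies in \<open>R\<close> shifted by \<open>t *R e\<close>, a hat function when
  \<open>R\<close> and its shift are adjacent boxes.\<close>

lemma hat_identity:
 assumes S: "open S" "convex S" and p: "borel_weak_pair S f g"
  and R[measurable]: "R : sets borel" "R \<subseteq> S" "!!x. x : R ==> x + e : S"
 shows "(\<integral>x. ind R x*(f (x + e) - f x) \<partial>lborel) =
  (\<integral>x. (g 1 x*e$1 + g 2 x*e$2)*(\<integral>t. ind {0..1} t*ind R (x - t *R e) \<partial>lborel) \<partial>lborel)"
proof -
 define G where "G x = g 1 x*e$1 + g 2 x*e$2" for x
 have [measurable]: "f : Bm" "g i : Bm" for i using p by (auto simp: borel_weak_pair_def)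
 have int: "integrable lborel f" "integrable lborel (g i)" for i using p by (auto simp: borel_weak_pair_def)
 have Gm[measurable]: "G : Bm" and Gi: "integrable lborel G"
  unfolding G_def using int by (auto intro!: L1_add)
 have H: "integrable (lborel \<Otimes>\<^sub>M lborel) (%(t, x). ind {0..1} t*(ind R x*G (x + t *R e)))"
  by (rule unit_interval_product_integrable[where C=1 and F=G and w=e]) (use Gi in "auto simp: indicator_def")
 have ae: "AE x in lborel. x : S & x + e : S --> f (x + e) - f x = (\<integral>t. ind {0..1} t*G (x + t *R e) \<partial>lborel)"
  using weak_translation[OF S p, of e] by (simp add: AE_completion_iff G_def)
 have "(\<integral>x. ind R x*(f (x + e) - f x) \<partial>lborel) = (\<integral>x. (\<integral>t. ind {0..1} t*(ind R x*G (x + t *R e)) \<partial>lborel) \<partial>lborel)"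
 proof (rule integral_cong_AE)
  show "(%x. \<integral>t. ind {0..1} t*(ind R x*G (x + t *R e)) \<partial>lborel) : borel_measurable lborel"
  using lborel_pair.integrable_snd[OF H] by (rule L1_meas)
  show "AE x in lborel. ind R x*(f (x + e) - f x) = (\<integral>t. ind {0..1} t*(ind R x*G (x + t *R e)) \<partial>lborel)"
  using ae
  proof eventually_elim
  fix x assume "x : S & x + e : S --> f (x + e) - f x = (\<integral>t. ind {0..1} t*G (x + t *R e) \<partial>lborel)"
  thus "ind R x*(f (x + e) - f x) = (\<integral>t. ind {0..1} t*(ind R x*G (x + t *R e)) \<partial>lborel)"
  using R by (cases "x : R") auto
  qed
 qed measurable
 also have "... = (\<integral>t. (\<integral>x. ind {0..1} t*(ind R x*G (x + t *R e)) \<partial>lborel) \<partial>lborel)"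
  by (rule lborel_pair.Fubini_integral[OF H])
 also have "... = (\<integral>t. (\<integral>x. ind {0..1} t*(ind R (x - t *R e)*G x) \<partial>lborel) \<partial>lborel)"
 proof (rule LINT_cong[OF refl])
  fix t :: real
  show "(\<integral>x. ind {0..1} t*(ind R x*G (x + t *R e)) \<partial>lborel) = (\<integral>x. ind {0..1} t*(ind R (x - t *R e)*G x) \<partial>lborel)"
  using lborel_translate(1)[of "%x. ind {0..1} t*(ind R (x - t *R e)*G x)" "t *R e"] by simp
 qed
 also have "... = (\<integral>x. (\<integral>t. ind {0..1} t*(ind R (x - t *R e)*G x) \<partial>lborel) \<partial>lborel)"
 proof (rule lborel_pair.Fubini_integral[symmetric])
  show "integrable (lborel \<Otimes>\<^sub>M lborel) (%(t, x). ind {0..1} t*(ind R (x - t *R e)*G x))"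
  by (rule unit_interval_product_integrable[where C=1 and F=G and w=0]) (use Gi in "auto simp: indicator_def")
 qed
 also have "... = (\<integral>x. G x*(\<integral>t. ind {0..1} t*ind R (x - t *R e) \<partial>lborel) \<partial>lborel)"
  by (simp add: mult.assoc[symmetric] mult.commute[of _ "G _"] del: integral_mult_left_zero) (simp add: mult.commute mult.left_commute)
 finally show ?thesis by (simp add: G_def)
qed

section \<open>Geometry of the interface and its chords\<close>

lemma mvt_near:
 assumes "!!t. (\<gamma> has_real_derivative \<gamma>' t) (at t)"
 shows "EX z. abs(z - d) <= abs(s - d) & \<gamma> s - \<gamma> d = (s - d) * \<gamma>' (z::real)"
proof -
 consider "s = d" | "s < d" | "d < s" by linarith
 thus ?thesis
 proof cases
  case 1 thus ?thesis by (intro exI[of _ d]) simp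
 next
  case 2
  obtain z where "s < z" "z < d" "\<gamma> d - \<gamma> s = (d - s) * \<gamma>' z" using MVT2[OF 2, of \<gamma> \<gamma>'] assms by blast
  thus ?thesis by (intro exI[of _ z]) (auto simp: algebra_simps)
 next
  case 3
  obtain z where "d < z" "z < s" "\<gamma> s - \<gamma> d = (s - d) * \<gamma>' z" using MVT2[OF 3, of \<gamma> \<gamma>'] assms by blast
  thus ?thesis by (intro exI[of _ z]) auto
 qed
qed

text \<open>The second derivative of the graph enters through the Lipschitz constant
  \<open>M\<close> of its slope. The centre \<open>z\<close> is a parameter, so a chart can be
  recentred at nearby points of the frontier.\<close>

definition chart :: "plane set => real => real => plane => plane => plane => (real => real) => (real => real) => bool" where
 "chart U r M z e1 e2 \<gamma> \<gamma>' \<longleftrightarrow> norm e1 = 1 & norm e2 = 1 & e1 \<cdot> e2 = 0 & (ALL t. (\<gamma> has_real_derivative \<gamma>' t) (at t)) &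
  (ALL s t. abs(s - z \<cdot> e1) <= r --> abs(t - z \<cdot> e1) <= r --> abs(\<gamma>' s - \<gamma>' t) <= M*abs(s - t)) &
  (ALL x:ball z r. x : U \<longleftrightarrow> x \<cdot> e2 > \<gamma> (x \<cdot> e1))"

lemma C2_boundary_chart:
 assumes "C2_boundary U" "z : frontier U"
 shows "EX r>0. EX M>=0. EX e1 e2 \<gamma> \<gamma>'. chart U r M z e1 e2 \<gamma> \<gamma>'"
proof -
 obtain r e1 e2 \<gamma> where r: "r > 0" and e: "norm e1 = 1" "norm e2 = 1" "e1 \<cdot> e2 = 0" and C2: "C2_fun \<gamma>"
  and U: "ALL x:ball z r. x : U \<longleftrightarrow> x \<cdot> e2 > \<gamma> (x \<cdot> e1)"
  using assms unfolding C2_boundary_def by blast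
 obtain \<gamma>' \<gamma>'' where d: "!!t. (\<gamma> has_real_derivative \<gamma>' t) (at t)" "!!t. (\<gamma>' has_real_derivative \<gamma>'' t) (at t)"
  and c: "continuous_on UNIV \<gamma>''" using C2 unfolding C2_fun_def by blast
 have "compact (\<gamma>'' ` {z \<cdot> e1 - r..z \<cdot> e1 + r})"
  by (intro compact_continuous_image continuous_on_subset[OF c]) auto
 from compact_imp_bounded[OF this]
 obtain M where M: "M > 0" "!!t. abs(t - z \<cdot> e1) <= r ==> abs(\<gamma>'' t) <= M"
  by (auto simp: bounded_pos abs_le_iff)
 have "abs(\<gamma>' s - \<gamma>' t) <= M*abs(s - t)" if "abs(s - z \<cdot> e1) <= r" "abs(t - z \<cdot> e1) <= r" for s t
 proof -
  have seg: "abs(w - z \<cdot> e1) <= r" if "w : closed_segment t s" for w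
  using that \<open>\<bar>s - z \<bullet> e1\<bar> \<le> r\<close> \<open>\<bar>t - z \<bullet> e1\<bar> \<le> r\<close> by (auto simp: closed_segment_eq_real_ivl split: if_splits)
  have "norm (\<gamma>' s - \<gamma>' t) <= M*norm (s - t)"
  by (rule field_differentiable_bound[of "closed_segment t s" \<gamma>' \<gamma>''])
  (use d(2) M(2) seg in "auto intro: has_field_derivative_at_within")
  thus ?thesis by simp
 qed
 hence "chart U r M z e1 e2 \<gamma> \<gamma>'" unfolding chart_def using e U d(1) by blast
 thus ?thesis using r M(1) less_imp_le by blast
qed

lemma chart_shift:
 assumes ch: "chart U r M z e1 e2 \<gamma> \<gamma>'" and D: "dist z D <= r/2" and r': "0 < r'" "r' <= r/2" and M: "M <= M'"
 shows "chart U r' M' D e1 e2 \<gamma> \<gamma>'"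
proof -
 have e: "norm e1 = 1" using ch by (simp add: chart_def)
 have "abs((D - z) \<cdot> e1) <= norm (D - z)*norm e1" by (rule Cauchy_Schwarz_ineq2)
 hence De: "abs(D \<cdot> e1 - z \<cdot> e1) <= r/2" using D e by (simp add: inner_diff_left dist_norm norm_minus_commute)
 have lip: "abs(\<gamma>' s - \<gamma>' t) <= M'*abs(s - t)" if "abs(s - D \<cdot> e1) <= r'" "abs(t - D \<cdot> e1) <= r'" for s t
 proof -
  have "abs(s - z \<cdot> e1) <= r" "abs(t - z \<cdot> e1) <= r" using that De r' by linarith+
  hence "abs(\<gamma>' s - \<gamma>' t) <= M*abs(s - t)" using ch by (simp add: chart_def)
  also have "... <= M'*abs(s - t)" using M by (simp add: mult_right_mono)
  finally show ?thesis .
 qed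
 have "ball D r' \<subseteq> ball z r"
 proof
  fix x assume "x : ball D r'"
  thus "x : ball z r" using dist_triangle[of z x D] D r' by simp
 qed
 thus ?thesis using ch lip unfolding chart_def by blast
qed

text \<open>Balls of half the chart radius around finitely many points cover the compact frontier,
  and every frontier point inherits the chart of a nearby centre. The sum of the finitely many
  constants bounds each of them; the inserted 1 keeps the minimum defined when there are no
  centres.\<close>

lemma uniform_charts:
 assumes "C2_boundary U" "bounded U"
 shows "EX r>0. EX M>=0. ALL D:frontier U. EX e1 e2 \<gamma> \<gamma>'. chart U r M D e1 e2 \<gamma> \<gamma>'"
proof -
 have K: "compact (frontier U)" using assms(2) by (rule compact_frontier_bounded)
 obtain r M where rM: "!!z. z : frontier U ==> r z > 0 & M z >= 0 & (EX e1 e2 \<gamma> \<gamma>'. chart U (r z) (M z) z e1 e2 \<gamma> \<gamma>')"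
  using C2_boundary_chart[OF assms(1)] by metis
 obtain C where C: "C \<subseteq> frontier U" "finite C" "frontier U \<subseteq> (\<Union>z\<in>C. ball z (r z/2))"
 proof (rule compactE_image[OF K, of "frontier U" "%z. ball z (r z/2)"])
  show "frontier U \<subseteq> (\<Union>z\<in>frontier U. ball z (r z/2))"
  proof
  fix z assume "z : frontier U"
  thus "z : (\<Union>z\<in>frontier U. ball z (r z/2))" using rM[of z] by (intro UN_I[of z]) auto
  qed
 qed auto
 define r0 where "r0 = Min (insert 1 ((%z. r z/2) ` C))"
 define M0 where "M0 = (\<Sum>z\<in>C. M z)"
 have r0: "r0 > 0" unfolding r0_def using C(1,2) rM by (subst Min_gr_iff) auto
 have M0: "M0 >= 0" unfolding M0_def using C(1) rM by (intro sum_nonneg) blast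
 have "EX e1 e2 \<gamma> \<gamma>'. chart U r0 M0 D e1 e2 \<gamma> \<gamma>'" if D: "D : frontier U" for D
 proof -
  obtain z where z: "z : C" "D : ball z (r z/2)" using C(3) D by blast
  obtain e1 e2 \<gamma> \<gamma>' where ch: "chart U (r z) (M z) z e1 e2 \<gamma> \<gamma>'" using rM C(1) z(1) by blast
  have "r0 <= r z/2" unfolding r0_def using C(2) z(1) by (intro Min_le) auto
  moreover have "M z <= M0" unfolding M0_def using C(1,2) z(1) rM by (intro member_le_sum) auto
  ultimately have "chart U r0 M0 D e1 e2 \<gamma> \<gamma>'"
  using chart_shift[OF ch] z(2) r0 by (simp add: less_imp_le)
  thus ?thesis by blast
 qed
 thus ?thesis using r0 M0 by blast
qed

text \<open>A point strictly below the graph has a neighbourhood that misses \<open>U\<close>, so it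
  is not in the closure; a point strictly above belongs to the open set itself.\<close>

lemma chart_frontier:
 assumes ch: "chart U r M D e1 e2 \<gamma> \<gamma>'" and z: "z : frontier U" "z : ball D r" and U: "open U"
 shows "z \<cdot> e2 = \<gamma> (z \<cdot> e1)"
proof (rule antisym)
 have Uc: "!!x. x : ball D r ==> x : U \<longleftrightarrow> x \<cdot> e2 > \<gamma> (x \<cdot> e1)" using ch unfolding chart_def by blast
 have "z ~: U" using z(1) U by (simp add: frontier_def interior_open)
 thus "z \<cdot> e2 <= \<gamma> (z \<cdot> e1)" using Uc[OF z(2)] by simp
 show "\<gamma> (z \<cdot> e1) <= z \<cdot> e2"
 proof (rule ccontr)
  assume neg: "\<not> \<gamma> (z \<cdot> e1) <= z \<cdot> e2"
  have "!!t. isCont \<gamma> t" using ch DERIV_isCont unfolding chart_def by blast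
  hence "continuous_on UNIV \<gamma>" by (simp add: continuous_at_imp_continuous_on)
  hence "continuous_on UNIV (%x::plane. \<gamma> (x \<cdot> e1))"
  by (rule continuous_on_compose2) (intro continuous_intros, simp)
  moreover have "continuous_on UNIV (%x::plane. x \<cdot> e2)" by (intro continuous_intros)
  ultimately have "open {x. x \<cdot> e2 < \<gamma> (x \<cdot> e1)}"
  by (intro open_Collect_less)
  hence o: "open ({x. x \<cdot> e2 < \<gamma> (x \<cdot> e1)} \<inter> ball D r)" by (intro open_Int open_ball)
  define W where "W = {x. x \<cdot> e2 < \<gamma> (x \<cdot> e1)} \<inter> ball D r"
  have "z : closure U" using z(1) by (simp add: frontier_def)
  hence zW: "z : W \<inter> closure U" using neg z(2) by (simp add: W_def)
  have "W \<inter> U ~= {}"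
  proof
  assume "W \<inter> U = {}"
  hence "W \<inter> closure U = {}" using open_Int_closure_eq_empty[OF o[folded W_def]] by simp
  with zW show False by simp
  qed
  then obtain x where x: "x : W" "x : U" by auto
  thus False using Uc[of x] by (simp add: W_def)
 qed
qed

text \<open>Interface and chord line are graphs over the same axis that meet at \<open>D\<close> and
  \<open>E\<close>, so at distance of order \<open>h\<close> from \<open>D\<close> they differ by at
  most a multiple of \<open>h^2\<close>. A point farther from the line than that is on the same side
  of both. What then remains is that the normal of \<open>cut\<close> points out of
  \<open>U\<close>, for which the element must not be too flat.\<close>

lemma chord_region:
 assumes U: "open U" "C2_boundary U" "bounded U" and \<kappa>: "\<kappa> > 0"
 shows "EX h0>0. EX C>=0. ALL P c d h D E n. 0 < h --> h <= h0 --> c ~= 0 --> d ~= 0 --> abs(c) <= h --> abs(d) <= h --> h <= \<kappa>*abs(c) --> h <= \<kappa>*abs(d) -->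
  cut U (tri P c d) D E n --> (ALL x. norm (x - D) <= 3*h --> C*h^2 < abs(n \<cdot> (x - D)) --> (x : U \<longleftrightarrow> n \<cdot> (x - D) < 0))"
proof -
 obtain r M where r: "r > 0" and M: "M >= 0" and ch: "!!D. D : frontier U ==> EX e1 e2 \<gamma> \<gamma>'. chart U r M D e1 e2 \<gamma> \<gamma>'"
  using uniform_charts[OF U(2,3)] by blast
 \<comment> \<open>The first bound keeps all points at distance \<open>3*h\<close> inside the chart.
   The second makes \<open>36 * \<kappa> * M * h\<close> at most one half, which is needed for the
   orientation of the normal.\<close>
 define h0 where "h0 = min (r/4) (1/(72*(M + 1) * \<kappa>))"
 have h0: "h0 > 0" using r M \<kappa> by (simp add: h0_def)
 have main: "x : U \<longleftrightarrow> n \<cdot> (x - D) < 0"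
  if h: "0 < h" "h <= h0" and cd: "c ~= 0" "d ~= 0" "abs(c) <= h" "abs(d) <= h" "h <= \<kappa>*abs(c)" "h <= \<kappa>*abs(d)"
  and cut: "cut U (tri P c d) D E n" and x: "norm (x - D) <= 3*h" "18*M*h^2 < abs(n \<cdot> (x - D))"
  for P c d h D E n x
 proof -
  let ?T = "tri P c d"
  have DE: "D ~= E" "D : frontier U" "E : frontier U" "D : frontier ?T" "E : frontier ?T" and n: "norm n = 1" "n \<cdot> (E - D) = 0"
  and cm: "!!x. x : frontier ?T ==> n \<cdot> (x - D) < 0 ==> x : U"
  and cp: "!!x. x : frontier ?T ==> n \<cdot> (x - D) > 0 ==> x ~: U"
  using cut unfolding cut_def by auto
  have closed: "closed ?T" unfolding tri_hull[OF cd(1,2)] by (intro compact_imp_closed finite_imp_compact_convex_hull) simp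
  have fT: "frontier ?T \<subseteq> ?T" using closed by (simp add: frontier_subset_eq)
  have close: "norm (y - y') <= 2*h" if "y : ?T" "y' : ?T" for y y'
  proof -
  have ab: "abs(u - v) <= h" if "0 <= (u - p)/q" "(u - p)/q <= 1" "0 <= (v - p)/q" "(v - p)/q <= 1" "q ~= 0" "abs(q) <= h" for u v p q :: real
  proof -
  have "abs((u - p)/q - (v - p)/q) <= 1" using that by linarith
  hence "abs((u - v)/q) <= 1" by (simp add: diff_divide_distrib[symmetric])
  hence "abs(u - v) <= abs(q)" using that(5) by (simp add: abs_divide divide_le_eq)
  thus ?thesis using that(6) by linarith
  qed
  have "0 <= (y$1 - P$1)/c" "(y$1 - P$1)/c <= 1" "0 <= (y'$1 - P$1)/c" "(y'$1 - P$1)/c <= 1"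
  "0 <= (y$2 - P$2)/d" "(y$2 - P$2)/d <= 1" "0 <= (y'$2 - P$2)/d" "(y'$2 - P$2)/d <= 1"
  using that unfolding tri_def mem_Collect_eq by linarith+
  hence "abs(y$1 - y'$1) <= h" "abs(y$2 - y'$2) <= h"
  using ab[of "y$1" "P$1" c "y'$1"] ab[of "y$2" "P$2" d "y'$2"] cd by blast+
  moreover have "norm (y - y') <= abs((y - y')$1) + abs((y - y')$2)"
  using norm_le_l1_cart[of "y - y'"] by (simp add: sum_2)
  ultimately show ?thesis by simp
  qed
  have hr: "3*h < r" using h r by (simp add: h0_def)
  obtain e1 e2 \<gamma> \<gamma>' where c: "chart U r M D e1 e2 \<gamma> \<gamma>'" using ch[OF DE(2)] by blast
  have e: "norm e1 = 1" "norm e2 = 1" "e1 \<cdot> e2 = 0" and der: "!!t. (\<gamma> has_real_derivative \<gamma>' t) (at t)"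
  and lip: "!!s t. abs(s - D \<cdot> e1) <= r ==> abs(t - D \<cdot> e1) <= r ==> abs(\<gamma>' s - \<gamma>' t) <= M*abs(s - t)"
  and Uc: "!!x. x : ball D r ==> x : U \<longleftrightarrow> x \<cdot> e2 > \<gamma> (x \<cdot> e1)"
  using c unfolding chart_def by simp_all
  have e21: "e2 \<cdot> e1 = 0" "e1 \<cdot> e1 = 1" "e2 \<cdot> e2 = 1" using e by (simp_all add: inner_commute norm_eq_1)
  define d0 where "d0 = D \<cdot> e1"
  define de where "de = E \<cdot> e1"
  have gD: "D \<cdot> e2 = \<gamma> d0" unfolding d0_def by (rule chart_frontier[OF c DE(2) _ U(1)]) (simp add: r)
  have ED: "norm (E - D) <= 2*h" using close DE(4,5) fT by blast
  have gE: "E \<cdot> e2 = \<gamma> de" unfolding de_def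
  by (rule chart_frontier[OF c DE(3) _ U(1)]) (use ED hr h in "simp add: dist_norm norm_minus_commute")
  have c1: "abs(y \<cdot> e1 - d0) <= norm (y - D)" for y
  using Cauchy_Schwarz_ineq2[of "y - D" e1] e by (simp add: d0_def inner_diff_left)
  have ortho: "v = (v \<cdot> e1) *R e1 + (v \<cdot> e2) *R e2" for v
  proof -
  have "e2 = (e2 \<cdot> perp e1) *R perp e1" using plane_decompose[OF e(1), of e2] e21 by simp
  hence sq: "(e2 \<cdot> perp e1)^2 = 1"
  proof -
  have "e2 \<cdot> e2 = ((e2 \<cdot> perp e1) *R perp e1) \<cdot> ((e2 \<cdot> perp e1) *R perp e1)"
  by (simp only: \<open>e2 = (e2 \<bullet> perp e1) *\<^sub>R perp e1\<close>[symmetric])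
  thus ?thesis by (simp add: e21 perp_simps power2_eq_square)
  qed
  have "(v \<cdot> e2) *R e2 = ((e2 \<cdot> perp e1)^2*(v \<cdot> perp e1)) *R perp e1"
  by (subst (1 2) \<open>e2 = (e2 \<bullet> perp e1) *\<^sub>R perp e1\<close>) (simp add: power2_eq_square)
  thus ?thesis using plane_decompose[OF e(1), of v] sq by (simp add: add.commute)
  qed
  have dne: "de ~= d0"
  proof
  assume "de = d0"
  hence "E \<cdot> e1 = D \<cdot> e1" "E \<cdot> e2 = D \<cdot> e2" using gD gE by (simp_all add: d0_def de_def)
  hence "E = D" using ortho[of E] ortho[of D] by simp
  with DE(1) show False by simp
  qed
  define m where "m = (\<gamma> de - \<gamma> d0)/(de - d0)"
  \<comment> \<open>The slope of the chord is the slope of the graph at some intermediate point. The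
    mean value theorem leaves \<open>3*h\<close> times the variation of the slope between two points
    at distance at most \<open>6*h\<close>, hence the factor 18.\<close>
  have chord: "abs(\<gamma> s - (\<gamma> d0 + m*(s - d0))) <= 18*M*h^2" if s: "abs(s - d0) <= 3*h" for s
  proof -
  obtain z1 where z1: "abs(z1 - d0) <= abs(s - d0)" "\<gamma> s - \<gamma> d0 = (s - d0) * \<gamma>' z1" using mvt_near[OF der] by blast
  obtain z2 where z2: "abs(z2 - d0) <= abs(de - d0)" "\<gamma> de - \<gamma> d0 = (de - d0) * \<gamma>' z2" using mvt_near[OF der] by blast
  have m: "m = \<gamma>' z2" using z2(2) dne by (simp add: m_def)
  have dd: "abs(de - d0) <= 3*h" using c1[of E] ED h by (simp add: de_def)
  have "abs(\<gamma>' z1 - \<gamma>' z2) <= M*abs(z1 - z2)"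
  by (rule lip) (use z1 z2 s dd hr in "auto simp: d0_def")
  also have "... <= M*(6*h)" by (rule mult_left_mono[OF _ M]) (use z1(1) z2(1) s dd in linarith)
  finally have "abs(s - d0)*abs(\<gamma>' z1 - \<gamma>' z2) <= (3*h)*(M*(6*h))"
  using s h by (intro mult_mono) auto
  also have "... = 18*M*h^2" by (simp add: power2_eq_square)
  finally have le: "abs(s - d0)*abs(\<gamma>' z1 - \<gamma>' z2) <= 18*M*h^2" .
  have eqv: "\<gamma> s - (\<gamma> d0 + m*(s - d0)) = (s - d0)*(\<gamma>' z1 - \<gamma>' z2)"
  using z1(2) by (simp add: m algebra_simps)
  show ?thesis unfolding eqv abs_mult by (rule le)
  qed
  define w where "w = sqrt (1 + m^2)"
  have w: "w >= 1" "w^2 = 1 + m^2" by (simp_all add: w_def)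
  have EDe: "E - D = (de - d0) *R (e1 + m *R e2)"
  proof -
  have "(E - D) \<cdot> e1 = de - d0" by (simp add: inner_diff_left d0_def de_def)
  moreover have "(E - D) \<cdot> e2 = (de - d0)*m" using gD gE dne by (simp add: inner_diff_left m_def)
  ultimately have "E - D = (de - d0) *R e1 + ((de - d0)*m) *R e2" using ortho[of "E - D"] by (simp only:)
  thus ?thesis by (simp add: scaleR_add_right)
  qed
  have nm: "n \<cdot> e1 + m*(n \<cdot> e2) = 0"
  using n(2) dne unfolding EDe by (simp add: inner_add_right)
  have nn: "(n \<cdot> e1)^2 + (n \<cdot> e2)^2 = 1"
  proof -
  have "n \<cdot> n = 1" using n(1) by (simp add: norm_eq_1)
  moreover have "n \<cdot> n = (n \<cdot> e1)^2 + (n \<cdot> e2)^2"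
  by (subst (2) ortho[of n]) (simp add: inner_add_right power2_eq_square)
  ultimately show ?thesis by simp
  qed
  define q where "q = n \<cdot> e2"
  have n1: "n \<cdot> e1 = - m*q" using nm by (simp add: q_def)
  have q2: "q^2*w^2 = 1" using nn unfolding n1 w(2) q_def[symmetric] by (simp add: power_mult_distrib algebra_simps)
  have q0: "q ~= 0" using q2 by auto
  have q1: "abs(q) <= 1"
  proof -
  have "q^2 <= q^2*w^2" using w(2) by (simp add: mult_le_cancel_left1)
  thus ?thesis using q2 by (simp add: abs_square_le_1)
  qed
  have nx: "n \<cdot> (y - D) = q*((y \<cdot> e2) - (\<gamma> d0 + m*(y \<cdot> e1 - d0)))" for y
  proof -
  have "n \<cdot> (y - D) = ((y - D) \<cdot> e1)*(n \<cdot> e1) + ((y - D) \<cdot> e2)*(n \<cdot> e2)"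
  by (subst ortho[of "y - D"]) (simp add: inner_add_right)
  thus ?thesis using gD by (simp add: n1 q_def[symmetric] inner_diff_left d0_def[symmetric] algebra_simps)
  qed
  have side: "y : U \<longleftrightarrow> n \<cdot> (y - D)/q > 0" if y: "norm (y - D) <= 3*h" "18*M*h^2 < abs(n \<cdot> (y - D))" for y
  proof -
  define L where "L = (y \<cdot> e2) - (\<gamma> d0 + m*(y \<cdot> e1 - d0))"
  have "18*M*h^2 < abs(q)*abs(L)" using y(2) unfolding nx L_def[symmetric] by (simp add: abs_mult)
  also have "... <= 1*abs(L)" by (intro mult_right_mono q1) simp
  finally have L: "18*M*h^2 < abs(L)" by simp
  have "abs(\<gamma> (y \<cdot> e1) - (\<gamma> d0 + m*(y \<cdot> e1 - d0))) <= 18*M*h^2"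
  by (rule chord) (use c1[of y] y(1) in linarith)
  hence "\<gamma> (y \<cdot> e1) < y \<cdot> e2 \<longleftrightarrow> 0 < L" using L unfolding L_def by linarith
  moreover have "y : U \<longleftrightarrow> \<gamma> (y \<cdot> e1) < y \<cdot> e2"
  by (rule Uc) (use y(1) hr in "simp add: dist_norm norm_minus_commute")
  ultimately show ?thesis using q0 unfolding nx L_def[symmetric] by simp
  qed
  \<comment> \<open>With the opposite orientation the sign conditions of \<open>cut\<close>
    contradict \<open>side\<close> at every boundary point of the triangle outside the strip. So the
    three vertices would lie in the strip, and their differences would force both components of the
    unit vector \<open>n\<close> to be at most one half.\<close>
  have "q < 0"
  proof (rule ccontr)
  assume "\<not> q < 0"
  hence qp: "q > 0" using q0 by simp
  have small: "abs(n \<cdot> (v - D)) <= 18*M*h^2" if v: "v : frontier ?T" for v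
  proof (rule ccontr)
  assume big: "\<not> \<bar>n \<cdot> (v - D)\<bar> <= 18*M*h^2"
  have "norm (v - D) <= 3*h" using close[of v D] v DE(4) fT h by fastforce
  from side[OF this] big have s: "v : U \<longleftrightarrow> n \<cdot> (v - D) > 0" using qp by (simp add: zero_less_divide_iff)
  have "18*M*h^2 >= 0" using M by simp
  hence "n \<cdot> (v - D) ~= 0" using big by auto
  then consider "n \<cdot> (v - D) < 0" | "n \<cdot> (v - D) > 0" by linarith
  thus False using cm[OF v] cp[OF v] s by cases auto
  qed
  have v: "P : frontier ?T" "P + pt c 0 : frontier ?T" "P + pt 0 d : frontier ?T"
  using cd(1,2) closed by (simp_all add: frontier_def tri_interior closure_closed) (simp_all add: tri_def)
  have b: "abs(c*n$1) <= 36*M*h^2" "abs(d*n$2) <= 36*M*h^2"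
  proof -
  have "c*n$1 = n \<cdot> (P + pt c 0 - D) - n \<cdot> (P - D)" "d*n$2 = n \<cdot> (P + pt 0 d - D) - n \<cdot> (P - D)"
  by (simp_all add: inner_vec_def sum_2 algebra_simps)
  thus "abs(c*n$1) <= 36*M*h^2" "abs(d*n$2) <= 36*M*h^2"
  using small[OF v(1)] small[OF v(2)] small[OF v(3)] by linarith+
  qed
  have half: "abs(t) <= 1/2" if t: "abs(g*t) <= 36*M*h^2" "h <= \<kappa>*abs(g)" for g t
  proof -
  have "h*abs(t) <= \<kappa>*abs(g)*abs(t)" using t(2) by (rule mult_right_mono) simp
  also have "... = \<kappa>*abs(g*t)" by (simp add: abs_mult)
  also have "... <= \<kappa>*(36*M*h^2)" using t(1) \<kappa> by simp
  also have "... = h*(36 * \<kappa>*M*h)" by (simp add: power2_eq_square)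
  finally have "abs(t) <= 36 * \<kappa>*M*h" using h(1) by simp
  also have "... <= 36 * \<kappa>*(M + 1)*h" using \<kappa> h(1) by (intro mult_right_mono mult_left_mono) auto
  also have "... <= 36 * \<kappa>*(M + 1)*(1/(72*(M + 1) * \<kappa>))"
  using h(2) \<kappa> M by (intro mult_left_mono) (auto simp: h0_def)
  also have "... = 1/2"
  proof -
  have "M + 1 ~= 0" "\<kappa> ~= 0" using M \<kappa> by linarith+
  thus ?thesis by simp
  qed
  finally show ?thesis .
  qed
  have "abs(n$1) <= 1/2" "abs(n$2) <= 1/2" by (rule half[OF b(1) cd(5)], rule half[OF b(2) cd(6)])
  hence "(n$1)^2 <= (1/2)^2" "(n$2)^2 <= (1/2)^2" by (simp_all add: abs_le_square_iff[symmetric])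
  moreover have "(n$1)^2 + (n$2)^2 = 1" using n(1) by (simp add: norm_eq_1 inner_vec_def sum_2 power2_eq_square)
  ultimately show False by (simp add: power2_eq_square)
  qed
  with side[OF x] show ?thesis by (simp add: zero_less_divide_iff)
 qed
 have fin: "EX C>=0. ALL P c d h D E n. 0 < h --> h <= h0 --> c ~= 0 --> d ~= 0 --> abs(c) <= h --> abs(d) <= h --> h <= \<kappa>*abs(c) --> h <= \<kappa>*abs(d) -->
  cut U (tri P c d) D E n --> (ALL x. norm (x - D) <= 3*h --> C*h^2 < abs(n \<cdot> (x - D)) --> (x : U \<longleftrightarrow> n \<cdot> (x - D) < 0))"
  by (intro exI[of _ "18*M"] conjI allI impI) (simp add: M, rule main)
 show ?thesis by (rule exI[of _ h0], rule conjI[OF h0 fin])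
qed

text \<open>Thin rectangles aligned with the chord measure every strip that occurs below; an
  orthogonal map and a translation carry them to a box.\<close>

lemma rectangle_measure:
 assumes n: "norm n = 1" and le: "\<alpha> <= \<beta>" "\<gamma> <= \<delta>"
 shows "{x. \<alpha> < n \<cdot> (x - D) & n \<cdot> (x - D) < \<beta> & \<gamma> < perp n \<cdot> (x - D) & perp n \<cdot> (x - D) < \<delta>} : lmeasurable"
  and "vol {x. \<alpha> < n \<cdot> (x - D) & n \<cdot> (x - D) < \<beta> & \<gamma> < perp n \<cdot> (x - D) & perp n \<cdot> (x - D) < \<delta>} = (\<beta> - \<alpha>)*(\<delta> - \<gamma>)"
proof -
 define f where "f y = y$1 *R n + y$2 *R perp n" for y :: plane
 have nn: "n \<cdot> n = 1" using n by (simp add: norm_eq_1)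
 have of: "orthogonal_transformation f"
  unfolding orthogonal_transformation_def
 proof (intro conjI allI)
  show "linear f" by (intro linearI) (simp_all add: f_def algebra_simps)
  show "f v \<cdot> f w = v \<cdot> w" for v w
  by (simp add: f_def inner_add_left inner_add_right perp_simps nn inner_vec_def[of v w] sum_2)
 qed
 let ?B = "box (pt \<alpha> \<gamma>) (pt \<beta> \<delta>)"
 let ?R = "{x. \<alpha> < n \<cdot> (x - D) & n \<cdot> (x - D) < \<beta> & \<gamma> < perp n \<cdot> (x - D) & perp n \<cdot> (x - D) < \<delta>}"
 have R: "?R = (+) D ` f ` ?B"
 proof (intro equalityI subsetI)
  fix x assume x: "x : ?R"
  have "x - D = f (pt (n \<cdot> (x - D)) (perp n \<cdot> (x - D)))"
  using plane_decompose[OF n, of "x - D"] by (simp add: f_def inner_commute add.commute)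
  moreover have "pt (n \<cdot> (x - D)) (perp n \<cdot> (x - D)) : ?B" using x by (simp add: mem_box_cart forall_2)
  ultimately have "x - D : f ` ?B" by (rule image_eqI)
  thus "x : (+) D ` f ` ?B" by (rule image_eqI[rotated]) simp
 next
  fix x assume "x : (+) D ` f ` ?B"
  then obtain y where y: "y : ?B" "x = D + f y" by blast
  have "n \<cdot> (x - D) = y$1" "perp n \<cdot> (x - D) = y$2"
  using y(2) by (simp_all add: f_def inner_add_right perp_simps nn)
  thus "x : ?R" using y(1) by (simp add: mem_box_cart forall_2)
 qed
 have "f ` ?B : lmeasurable" by (rule measurable_orthogonal_image[OF of]) simp
 thus "?R : lmeasurable" unfolding R by (rule measurable_translation)
 have "vol ?R = vol ?B"
  unfolding R measure_translation by (rule measure_orthogonal_image[OF of]) simp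
 also have "... = (\<beta> - \<alpha>)*(\<delta> - \<gamma>)"
  using le by (simp add: measure_lborel_box_eq prod_Basis_plane inner_axis_plane) (simp add: Basis_plane inner_axis_plane)
 finally show "vol ?R = (\<beta> - \<alpha>)*(\<delta> - \<gamma>)" .
qed

section \<open>Cutoff functions and the tangential component of the flux\<close>

definition "eta = bump 1 (-1) 1"

lemma eta_facts: "smooth1 eta" "abs(eta t) <= 1" "0 <= eta t" "t ~: {-1<..<1} ==> eta t = 0"
 "abs(t) <= 1/2 ==> exp (-4) <= eta t"
proof -
 show "smooth1 eta" unfolding eta_def by (rule smooth1_bump)
 show "0 <= eta t" "abs(eta t) <= 1" unfolding eta_def using bump_bounds[of 1 "-1" 1 t] by simp_all
 show "t ~: {-1<..<1} ==> eta t = 0" unfolding eta_def by (rule bump_zero)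
 assume t: "abs(t) <= 1/2"
 have "inverse (t + 1) <= 2" "inverse (1 - t) <= 2"
  using t le_imp_inverse_le[of "1/2" "t + 1"] le_imp_inverse_le[of "1/2" "1 - t"] by (auto simp: abs_le_iff)
 hence "exp (-2) <= exp (- inverse (t + 1))" "exp (-2) <= exp (- inverse (1 - t))" by simp_all
 hence "exp (-2)*exp (-2) <= exp (- inverse (t + 1))*exp (- inverse (1 - t))" by (intro mult_mono) auto
 moreover have "exp (-2)*exp (-2 :: real) = exp (-4)" by (simp flip: exp_add)
 moreover have "-1 < t & t < 1" using t by linarith
 hence "eta t = exp (- inverse (t + 1))*exp (- inverse (1 - t))"
  by (simp add: eta_def bump_def hexp_def)
 ultimately show "exp (-4) <= eta t" by simp
qed

lemma eta_deriv_bound: "EX K>0. ALL t. abs(deriv eta t) <= K"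
proof -
 have "compact (deriv eta ` {-1..1})"
  by (intro compact_continuous_image smooth1_continuous smooth1_deriv(2) eta_facts(1)) auto
 then obtain K where K0: "K > 0" "ALL x:deriv eta ` {-1..1}. norm x <= K"
  using compact_imp_bounded[THEN bounded_pos[THEN iffD1]] by blast
 have K: "abs(deriv eta t) <= K" if "t : {-1..1}" for t
  using K0(2)[rule_format, OF imageI[OF that, of "deriv eta"]] by simp
 have "abs(deriv eta t) <= K" for t
 proof (cases "t : {-1..1}")
  case True
  thus ?thesis by (rule K)
 next
  case False
  have "deriv eta t = 0" by (rule deriv_support[OF eta_facts(4) False])
  thus ?thesis using K0(1) by simp
 qed
 thus ?thesis using K0(1) by blast
qed

definition "K_eta = (SOME K. K > 0 & (ALL t. abs(deriv eta t) <= K))"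

lemma K_eta: "K_eta > 0" "abs(deriv eta t) <= K_eta"
 using someI_ex[of "%K. K > 0 & (ALL t. abs(deriv eta t) <= K)"] eta_deriv_bound unfolding K_eta_def by blast+

text \<open>The cutoff at scale \<open>h\<close> around \<open>d\<close> lives on distance at most
  \<open>h\<close>. Its vanishing is recorded outside distance \<open>2*h\<close>, the half side of
  the squares \<open>Sq\<close>, which also covers the derivative at the end points of the
  support.\<close>

definition eta_at :: "real => real => real => real" where
 "eta_at h d t = eta ((1/h)*t + (- d/h))"

lemma eta_at_facts:
 assumes h: "h > 0"
 shows "smooth1 (eta_at h d)" "smooth1 (deriv (eta_at h d))" "abs(eta_at h d t) <= 1" "0 <= eta_at h d t"
  "abs(deriv (eta_at h d) t) <= K_eta/h"
  "t ~: {d - 2*h<..<d + 2*h} ==> eta_at h d t = 0" "t ~: {d - 2*h<..<d + 2*h} ==> deriv (eta_at h d) t = 0"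
  "abs(t - d) <= h/2 ==> exp (-4) <= eta_at h d t"
proof -
 have "Ck1 k (eta_at h d)" for k
  unfolding eta_at_def using eta_facts(1) by (intro Ck1_affine) (simp add: smooth1_def)
 thus sm: "smooth1 (eta_at h d)" by (simp add: smooth1_def)
 thus "smooth1 (deriv (eta_at h d))" by (rule smooth1_deriv(2))
 show "abs(eta_at h d t) <= 1" "0 <= eta_at h d t" unfolding eta_at_def by (rule eta_facts)+
 have "((%t. eta ((1/h)*t + (- d/h))) has_real_derivative deriv eta ((1/h)*t + (- d/h))*(1/h)) (at t)"
 proof (rule DERIV_chain2[where f = eta and g = "%t. (1/h)*t + (- d/h)"])
  show "(eta has_real_derivative deriv eta ((1/h)*t + (- d/h))) (at ((1/h)*t + (- d/h)))"
  by (rule smooth1_deriv(1)[OF eta_facts(1)])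
  show "((%t. (1/h)*t + (- d/h)) has_real_derivative 1/h) (at t)"
  by (rule DERIV_cong[OF DERIV_add[OF DERIV_cmult[OF DERIV_ident] DERIV_const]]) simp
 qed
 hence "deriv (eta_at h d) t = deriv eta ((1/h)*t + (- d/h))*(1/h)"
  unfolding eta_at_def by (rule DERIV_imp_deriv)
 thus "abs(deriv (eta_at h d) t) <= K_eta/h"
  using K_eta(2)[of "(1/h)*t + (- d/h)"] h by (simp only: abs_mult) (simp add: divide_right_mono)
 have e: "(1/h) * s + (- d/h) = (s - d)/h" for s by (simp add: diff_divide_distrib)
 have z: "eta_at h d s = 0" if "s ~: {d - h<..<d + h}" for s
  unfolding eta_at_def e using that h by (intro eta_facts(4)) (auto simp: field_simps)
 show "t ~: {d - 2*h<..<d + 2*h} ==> eta_at h d t = 0" using h by (intro z) auto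
 show "t ~: {d - 2*h<..<d + 2*h} ==> deriv (eta_at h d) t = 0"
 proof (rule deriv_support[of "d - h" "d + h"])
  show "s ~: {d - h<..<d + h} ==> eta_at h d s = 0" for s by (rule z)
  assume "t ~: {d - 2*h<..<d + 2*h}"
  thus "t ~: {d - h..d + h}" using h by auto
 qed
 show "abs(t - d) <= h/2 ==> exp (-4) <= eta_at h d t"
  unfolding eta_at_def e using h by (intro eta_facts(5)) (simp add: abs_divide divide_le_eq)
qed

text \<open>No integrability of \<open>f\<close> has to be checked: the integral of a non-integrable
  function is 0 by convention.\<close>

lemma abs_LINT_le:
 fixes f g :: "'a => real"
 assumes "integrable M g" "AE x in M. abs(f x) <= g x"
 shows "abs(LINT x|M. f x) <= (LINT x|M. g x)"
proof (cases "integrable M f")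
 case True
 have "abs(LINT x|M. f x) <= (LINT x|M. abs(f x))" using integral_abs_bound by blast
 also have "... <= (LINT x|M. g x)" by (rule integral_mono_AE) (use True assms in auto)
 finally show ?thesis .
next
 case False
 thus ?thesis
  using assms by (simp add: not_integrable_integral_eq) (intro integral_nonneg_AE, auto elim!: eventually_mono intro: order_trans[OF abs_ge_zero])
qed

text \<open>Pair \<open>u\<close> with the rotated gradient of a cutoff and restrict to
  \<open>Om\<close>. The three terms on the right are the costs of reaching a computable integral:
  the curl of \<open>u\<close> is bounded by its gradient, replacing \<open>u\<close> by
  \<open>ub\<close> costs its deviation divided by \<open>h\<close>, and replacing \<open>Om\<close>
  by the half-plane behind the chord costs a strip of width of order \<open>h^2\<close>. The final
  integral is the tangential component of \<open>ub\<close> times a mass of order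
  \<open>h\<close>.\<close>

lemma tangential_estimate:
 assumes \<beta>: "bm > 0" "bp > 0" "bm ~= bp" and C: "C >= 0"
 shows "EX K>=0. ALL \<O> Om u U p gp D n h ub. open \<O> --> open Om --> 0 < h --> 4*(C + 1)*h <= 1 --> norm n = 1 -->
  Sq D h \<subseteq> \<O> -->
  (ALL i. has_weak_grad \<O> (%x. u x$i) (U i)) --> has_weak_grad \<O> p gp -->
  (AE x in leb \<O>. gp x = (- 1/coef Om bm bp x) *R u x) -->
  (ALL x:Sq D h. C*h^2 < abs(n \<cdot> (x - D)) --> (x : Om \<longleftrightarrow> n \<cdot> (x - D) < 0)) -->
  h\<^sup>2*abs(ub \<cdot> perp n) <= K*((LINT x|leb (Sq D h). norm (u x - ub))
  + h*(LINT x|leb (Sq D h). norm (U 1 x) + norm (U 2 x)) + h ^ 3*norm ub)"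
proof -
 \<comment> \<open>Comes from solving the two global identities for the integral over
   \<open>Om\<close>; the jump of the inverse coefficient is in the denominator.\<close>
 define B where "B = (1/bp)/abs(1/bm - 1/bp)"
 have Bne: "1/bm - 1/bp ~= 0" using \<beta> by (simp add: field_simps)
 have B0: "B >= 0" using \<beta> by (simp add: B_def)
 \<comment> \<open>Lower bound for the cutoff in the square of half side \<open>h/2\<close> around
   \<open>D\<close>, one factor for each variable.\<close>
 define c where "c = exp (-4::real)*exp (-4)"
 have c0: "c > 0" by (simp add: c_def)
 define K where "K = (2/c)*(80*K_eta*(C + 1) + 2*K_eta + B)"
 have K0: "K >= 0" using c0 K_eta(1) C B0 by (simp add: K_def)
 have main: "h^2*abs(ub \<cdot> perp n) <= K*((LINT x|leb Q. norm (u x - ub)) + h*(LINT x|leb Q. norm (U 1 x) + norm (U 2 x)) + h ^ 3*norm ub)"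
  if \<O>: "open \<O>" and Om: "open Om" and h: "0 < h" "4*(C + 1)*h <= 1" and n: "norm n = 1"
  and Qdef: "Q = Sq D h" and Q: "Q \<subseteq> \<O>"
  and wu: "ALL i. has_weak_grad \<O> (%x. u x$i) (U i)" and wp: "has_weak_grad \<O> p gp"
  and gpu: "AE x in leb \<O>. gp x = (- 1/coef Om bm bp x) *R u x"
  and reg: "ALL x:Q. C*h^2 < abs(n \<cdot> (x - D)) --> (x : Om \<longleftrightarrow> n \<cdot> (x - D) < 0)"
  for \<O> Om u U p gp D n h ub Q
 proof -
  let ?e1 = "eta_at h (D$1)" and ?e2 = "eta_at h (D$2)"
  let ?p = "D - pt (2*h) (2*h)" and ?q = "D + pt (2*h) (2*h)"
  define \<phi> where "\<phi> = prod_fun ?e1 ?e2"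
  define d1 where "d1 = prod_fun (deriv ?e1) ?e2"
  define d2 where "d2 = prod_fun ?e1 (deriv ?e2)"
  note ef = eta_at_facts[OF h(1)]
  have pq: "?p$1 = D$1 - 2*h" "?p$2 = D$2 - 2*h" "?q$1 = D$1 + 2*h" "?q$2 = D$2 + 2*h" by simp_all
  note Q' = Q[unfolded Qdef]
  have \<phi>t: "\<phi> : test_functions \<O>" unfolding \<phi>_def
  by (rule prod_fun_test[OF ef(1) ef(1) _ _ Q'], simp_all only: pq) (erule ef(6))+
  have d1t: "d1 : test_functions \<O>" unfolding d1_def
  by (rule prod_fun_test[OF ef(2) ef(1) _ _ Q'], simp_all only: pq) (erule ef(6) ef(7))+
  have d2t: "d2 : test_functions \<O>" unfolding d2_def
  by (rule prod_fun_test[OF ef(1) ef(2) _ _ Q'], simp_all only: pq) (erule ef(6) ef(7))+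
  have g\<phi>: "grad \<phi> x$1 = d1 x" "grad \<phi> x$2 = d2 x" for x
  unfolding \<phi>_def d1_def d2_def by (simp_all add: prod_fun_grad ef)
  have mixed: "grad d2 x$1 = grad d1 x$2" for x
  unfolding d1_def d2_def by (simp add: prod_fun_grad ef)
  have out: "\<phi> x = 0" "d1 x = 0" "d2 x = 0" if "x ~: Q" for x
  proof -
  have "x$1 ~: {D$1 - 2*h<..<D$1 + 2*h} \<or> x$2 ~: {D$2 - 2*h<..<D$2 + 2*h}"
  using that by (auto simp: Qdef mem_box_cart forall_2)
  hence "eta_at h (D$1) (x$1) = 0 & deriv (eta_at h (D$1)) (x$1) = 0 \<or> eta_at h (D$2) (x$2) = 0 & deriv (eta_at h (D$2)) (x$2) = 0"
  using ef(6)[of "x$1" "D$1"] ef(7)[of "x$1" "D$1"] ef(6)[of "x$2" "D$2"] ef(7)[of "x$2" "D$2"] by argo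
  thus "\<phi> x = 0" "d1 x = 0" "d2 x = 0"
  unfolding \<phi>_def d1_def d2_def prod_fun_def by (elim disjE conjE; simp)+
  qed
  have bd: "abs(\<phi> x) <= 1" "abs(d1 x) <= K_eta/h" "abs(d2 x) <= K_eta/h" "0 <= \<phi> x" for x
  proof -
  have k: "0 <= K_eta/h" using K_eta(1) h(1) by simp
  show "abs(\<phi> x) <= 1" unfolding \<phi>_def prod_fun_def abs_mult using mult_mono[OF ef(3) ef(3)] by simp
  show "abs(d1 x) <= K_eta/h" unfolding d1_def prod_fun_def abs_mult using mult_mono[OF ef(5) ef(3) k] by simp
  show "abs(d2 x) <= K_eta/h" unfolding d2_def prod_fun_def abs_mult using mult_mono[OF ef(3) ef(5)] by simp
  show "0 <= \<phi> x" unfolding \<phi>_def prod_fun_def using ef(4) by simp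
  qed
  have \<O>l: "\<O> : sets lebesgue" and Ql: "Q : sets lebesgue" using \<O> by (auto simp: Qdef)
  have lu: "locally_integrable \<O> (%x. u x$i)" and lU: "locally_integrable \<O> (U i)" for i
  using wu by (auto simp: has_weak_grad_def)
  have cQ: "compact Q" unfolding Qdef by simp
  have iQ: "L1 Q f" if "locally_integrable \<O> f" for f :: "plane => 'e::euclidean_space"
  using that Q cQ unfolding locally_integrable_def by simp
  have fm: "Q : lmeasurable" unfolding Qdef by simp
  interpret finQ: finite_measure "leb Q" by (rule finite_measure_lebesgue_on[OF fm])
  have iind: "L1 Q (%x. ind A x :: real)" if "A : sets lebesgue" for A
  proof (rule finQ.integrable_const_bound[where B=1])
  show "AE x in leb Q. norm (ind A x :: real) <= 1" by (rule AE_I2) (simp add: indicator_def)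
  show "(%x. ind A x :: real) : Mb Q"
  by (rule meas_leb, rule borel_measurable_indicator[OF that])
  qed
  have lind: "(LINT x|leb Q. ind A x :: real) = vol (A \<inter> Q)" for A
  proof -
  have "(LINT x|leb Q. ind A x :: real) = (LINT x|lebesgue. ind (A \<inter> Q) x)"
  unfolding LINT_lebesgue_on[OF Ql] by (rule LINT_cong) (auto simp: indicator_def)
  thus ?thesis by simp
  qed
  define \<theta> where "\<theta> x = u x$1*d2 x - u x$2*d1 x" for x
  define \<theta>b where "\<theta>b x = ub$1*d2 x - ub$2*d1 x" for x
  have dm: "d1 : Bm" "d2 : Bm" "\<phi> : Bm"
  using test_continuous(1) d1t d2t \<phi>t by (auto intro: cont_Bm)
  have dmQ: "f : Mb Q" if "f : Bm" for f :: "plane => real"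
  using that by (simp add: meas_leb measurable_completion)
  have i\<theta>: "L1 \<O> (%x. u x$1*d2 x)" "L1 \<O> (%x. u x$2*d1 x)"
  using L1_test(1)[OF \<O> lu d2t] L1_test(1)[OF \<O> lu d1t] by auto
  have toQ: "(LINT x|leb \<O>. f x) = (LINT x|leb Q. f x)" "L1 \<O> f ==> L1 Q f"
  if "!!x. x ~: Q ==> f x = 0" for f :: "plane => real"
  using LINT_support[OF \<O>l Ql Q, of f] that by auto
  have \<theta>i: "L1 \<O> \<theta>" unfolding \<theta>_def by (intro L1_diff i\<theta>)
  have \<theta>Q: "L1 Q \<theta>" by (rule toQ(2)[OF _ \<theta>i]) (simp add: \<theta>_def out)
  have OmQ: "(ind Om :: plane => real) : Mb Q" for Q
  using Om by (intro meas_leb measurable_completion) simp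
  have iOm: "L1 S (%x. f x*ind Om x)" if "L1 S f" for f :: "plane => real" and S
  by (rule L1_mult_bounded[where B = 1, OF that OmQ]) (simp add: indicator_def)
  \<comment> \<open>the weak gradient of \<open>p\<close> is curl-free\<close>
  have J1: "(LINT x|leb \<O>. (1/coef Om bm bp x) * \<theta> x) = 0"
  proof -
  have lg: "locally_integrable \<O> (%x. gp x$i)" for i
  using wp by (auto simp: has_weak_grad_def intro: locally_L1_component)
  have "(LINT x|leb \<O>. p x*grad d2 x$1) = - (LINT x|leb \<O>. gp x$1*d2 x)"
  "(LINT x|leb \<O>. p x*grad d1 x$2) = - (LINT x|leb \<O>. gp x$2*d1 x)"
  using wp d1t d2t unfolding has_weak_grad_def by blast+
  hence "(LINT x|leb \<O>. gp x$1*d2 x) - (LINT x|leb \<O>. gp x$2*d1 x) = 0"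
  by (simp add: mixed)
  hence 0: "(LINT x|leb \<O>. gp x$1*d2 x - gp x$2*d1 x) = 0"
  using L1_test(1)[OF \<O> lg d2t] L1_test(1)[OF \<O> lg d1t] by simp
  have gi: "L1 \<O> (%x. gp x$1*d2 x - gp x$2*d1 x)"
  using L1_test(1)[OF \<O> lg d2t] L1_test(1)[OF \<O> lg d1t] by simp
  have "(LINT x|leb \<O>. - ((1/coef Om bm bp x) * \<theta> x)) = (LINT x|leb \<O>. gp x$1*d2 x - gp x$2*d1 x)"
  proof (rule leb_AE_cong(3)[OF \<O>l _ gi])
  show "AE x in leb \<O>. gp x$1*d2 x - gp x$2*d1 x = - ((1/coef Om bm bp x) * \<theta> x)"
  using gpu by eventually_elim (simp add: \<theta>_def algebra_simps diff_divide_distrib)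
  qed
  thus ?thesis using 0 by simp
  qed
  have J2: "abs(LINT x|leb \<O>. \<theta> x) <= (LINT x|leb Q. norm (U 1 x) + norm (U 2 x))"
  proof -
  have w: "(LINT x|leb \<O>. u x$i*grad \<phi> x$j) = - (LINT x|leb \<O>. U i x$j * \<phi> x)" for i j
  using wu \<phi>t unfolding has_weak_grad_def by blast
  have iU: "L1 \<O> (%x. U i x$j * \<phi> x)" for i j
  by (rule L1_test(1)[OF \<O> locally_L1_component[OF lU] \<phi>t])
  have "(LINT x|leb \<O>. \<theta> x) = (LINT x|leb \<O>. u x$1*d2 x) - (LINT x|leb \<O>. u x$2*d1 x)"
  unfolding \<theta>_def by (rule LINT_diff[OF i\<theta>])
  also have "... = (LINT x|leb \<O>. U 2 x$1 * \<phi> x) - (LINT x|leb \<O>. U 1 x$2 * \<phi> x)"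
  using w[of 1 2] w[of 2 1] by (simp add: g\<phi>)
  also have "... = (LINT x|leb \<O>. U 2 x$1 * \<phi> x - U 1 x$2 * \<phi> x)"
  by (rule LINT_diff[OF iU iU, symmetric])
  also have "... = (LINT x|leb Q. U 2 x$1 * \<phi> x - U 1 x$2 * \<phi> x)"
  by (rule toQ(1)) (simp add: out)
  finally have eq: "(LINT x|leb \<O>. \<theta> x) = (LINT x|leb Q. U 2 x$1 * \<phi> x - U 1 x$2 * \<phi> x)" .
  show ?thesis unfolding eq
  proof (rule abs_LINT_le)
  show "L1 Q (%x. norm (U 1 x) + norm (U 2 x))"
  using iQ[OF lU] by (intro L1_add integrable_norm) auto
  have "abs(U 2 x$1 * \<phi> x - U 1 x$2 * \<phi> x) <= norm (U 1 x) + norm (U 2 x)" for x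
  proof -
  have "abs(U i x$j * \<phi> x) <= norm (U i x)" for i j
  unfolding abs_mult using mult_mono[OF component_le_norm_cart[of "U i x" j] bd(1)[of x]] by simp
  from this[of 1 2] this[of 2 1] show ?thesis by linarith
  qed
  thus "AE x in leb Q. abs(U 2 x$1 * \<phi> x - U 1 x$2 * \<phi> x) <= norm (U 1 x) + norm (U 2 x)" by simp
  qed
  qed
  \<comment> \<open>The inverse coefficient is a constant plus a multiple of the indicator of
    \<open>Om\<close>. So \<open>J1\<close> expresses the integral over \<open>Om\<close> by the
    total integral, which \<open>J2\<close> bounds.\<close>
  have J3: "abs(LINT x|leb Q. \<theta> x*ind Om x) <= B*(LINT x|leb Q. norm (U 1 x) + norm (U 2 x))"
  proof -
  have "(LINT x|leb \<O>. (1/coef Om bm bp x) * \<theta> x) = (LINT x|leb \<O>. (1/bp) * \<theta> x + (1/bm - 1/bp)*(\<theta> x*ind Om x))"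
  by (intro LINT_cong) (auto simp: coef_def indicator_def algebra_simps)
  also have "... = (1/bp)*(LINT x|leb \<O>. \<theta> x) + (1/bm - 1/bp)*(LINT x|leb \<O>. \<theta> x*ind Om x)"
  by (simp only: LINT_add[OF L1_cmult[OF \<theta>i] L1_cmult[OF iOm[OF \<theta>i]]] integral_mult_right_zero)
  also have "(LINT x|leb \<O>. \<theta> x*ind Om x) = (LINT x|leb Q. \<theta> x*ind Om x)"
  by (rule toQ(1)) (simp add: \<theta>_def out)
  finally have "(1/bm - 1/bp)*(LINT x|leb Q. \<theta> x*ind Om x) = - (1/bp)*(LINT x|leb \<O>. \<theta> x)"
  using J1 by simp
  hence "abs(1/bm - 1/bp)*abs(LINT x|leb Q. \<theta> x*ind Om x) = (1/bp)*abs(LINT x|leb \<O>. \<theta> x)"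
  using \<beta>(2) by (subst abs_mult[symmetric]) (simp add: abs_mult)
  hence "abs(LINT x|leb Q. \<theta> x*ind Om x) = B*abs(LINT x|leb \<O>. \<theta> x)"
  using Bne unfolding B_def times_divide_eq_left by (subst eq_divide_eq) (simp add: mult.commute)
  also have "... <= B*(LINT x|leb Q. norm (U 1 x) + norm (U 2 x))" by (rule mult_left_mono[OF J2 B0])
  finally show ?thesis .
  qed
  have i\<theta>b: "L1 Q \<theta>b"
  proof (rule finQ.integrable_const_bound[where B="norm ub*(K_eta/h) + norm ub*(K_eta/h)"])
  have "\<theta>b : Bm" unfolding \<theta>b_def
  by (rule borel_measurable_diff; rule borel_measurable_times; (rule dm borel_measurable_const)+)
  thus "\<theta>b : Mb Q" by (rule dmQ)
  have "abs(ub$1*d2 x - ub$2*d1 x) <= norm ub*(K_eta/h) + norm ub*(K_eta/h)" for x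
  using mult_mono[OF component_le_norm_cart[of ub 1] bd(3)[of x] norm_ge_zero abs_ge_zero] mult_mono[OF component_le_norm_cart[of ub 2] bd(2)[of x] norm_ge_zero abs_ge_zero]
  abs_triangle_ineq4[of "ub$1*d2 x" "ub$2*d1 x"]
  unfolding abs_mult by linarith
  thus "AE x in leb Q. norm (\<theta>b x) <= norm ub*(K_eta/h) + norm ub*(K_eta/h)" by (simp add: \<theta>b_def)
  qed
  have pw: "abs(v$1*d2 x - v$2*d1 x) <= 2*(K_eta/h)*norm v" for v x
  using mult_mono[OF component_le_norm_cart[of v 1] bd(3)[of x]] mult_mono[OF component_le_norm_cart[of v 2] bd(2)[of x]]
  abs_triangle_ineq4[of "v$1*d2 x" "v$2*d1 x"] unfolding abs_mult by (simp add: mult.commute[of "norm v"])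
  have J4: "abs(LINT x|leb Q. (\<theta>b x - \<theta> x)*ind Om x) <= 2*(K_eta/h)*(LINT x|leb Q. norm (u x - ub))"
  proof -
  have "abs(LINT x|leb Q. (\<theta>b x - \<theta> x)*ind Om x) <= (LINT x|leb Q. 2*(K_eta/h)*norm (u x - ub))"
  proof (rule abs_LINT_le)
  have "L1 Q (%x. u x$i)" for i by (rule iQ[OF lu])
  hence "L1 Q (%x. u x$1 *R (axis 1 1 :: plane) + u x$2 *R axis 2 1)"
  by (intro L1_add integrable_scaleR_left)
  hence "L1 Q u" by (simp flip: pt_axis)
  thus "L1 Q (%x. 2*(K_eta/h)*norm (u x - ub))" by simp
  have "abs((\<theta>b x - \<theta> x)*ind Om x) <= 2*(K_eta/h)*norm (u x - ub)" for x
  proof -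
  have "\<theta>b x - \<theta> x = (ub - u x)$1*d2 x - (ub - u x)$2*d1 x" by (simp add: \<theta>_def \<theta>b_def algebra_simps)
  hence "abs(\<theta>b x - \<theta> x) <= 2*(K_eta/h)*norm (ub - u x)" using pw[of "ub - u x" x] by simp
  thus ?thesis using K_eta(1) h(1) by (simp add: norm_minus_commute indicator_def)
  qed
  thus "AE x in leb Q. abs((\<theta>b x - \<theta> x)*ind Om x) <= 2*(K_eta/h)*norm (u x - ub)" by simp
  qed
  thus ?thesis by simp
  qed
  \<comment> \<open>Wider than the uncertainty \<open>C*h^2\<close> of the interface, so that
    outside the strip the ramp below equals the indicator of \<open>Om\<close>. The smallness of
    \<open>h\<close> gives \<open>\<epsilon> <= h/4\<close>.\<close>
  define \<epsilon> where "\<epsilon> = (C + 1)*h^2"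
  have e0: "\<epsilon> > 0" using C h(1) by (simp add: \<epsilon>_def)
  have eh: "\<epsilon> <= h/4"
  proof -
  have "4*(C + 1)*h*h <= 1*h" using h by (intro mult_right_mono) auto
  thus ?thesis by (simp add: \<epsilon>_def power2_eq_square algebra_simps)
  qed
  \<comment> \<open>The difference of two kink functions is a ramp that falls from 1 to 0 across the
    strip behind the chord. Unlike the indicator of a half-plane it has a weak gradient, equal to
    \<open>- n\<close> divided by \<open>\<epsilon>\<close> on the strip.\<close>
  define r1 where "r1 x = 0 + 0 \<cdot> x + (1/\<epsilon>)*max 0 ((-n) \<cdot> (x - D))" for x
  define r2 where "r2 x = 0 + 0 \<cdot> x + (1/\<epsilon>)*max 0 ((-n) \<cdot> (x - (D - \<epsilon> *R n)))" for x
  define r where "r x = r1 x - r2 x" for x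
  have nn: "n \<cdot> n = 1" using n by (simp add: norm_eq_1)
  have s2: "(-n) \<cdot> (x - (D - \<epsilon> *R n)) = - (n \<cdot> (x - D)) - \<epsilon>" for x
  by (simp add: inner_diff_right inner_add_right nn algebra_simps)
  have r: "r x = (if n \<cdot> (x - D) <= - \<epsilon> then 1 else if n \<cdot> (x - D) >= 0 then 0 else - (n \<cdot> (x - D))/\<epsilon>)" for x
  unfolding r_def r1_def r2_def s2 using e0 by (auto simp: max_def field_simps)
  have r01: "0 <= r x" "r x <= 1" for x unfolding r using e0 by (auto simp: field_simps)
  have rm: "r : Bm" unfolding r_def r1_def r2_def by measurable
  let ?strip = "{x. - \<epsilon> <= n \<cdot> (x - D) & n \<cdot> (x - D) < 0}"
  define \<kappa> where "\<kappa> = (1/\<epsilon>)*(LINT x|leb Q. ind ?strip x * \<phi> x)"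
  have J5: "(LINT x|leb Q. r x*grad \<phi> x$i) = \<kappa>*n$i" for i
  proof -
  have k1: "has_weak_grad \<O> r1 (%x. 0 + (if 0 < (-n) \<cdot> (x - D) then (1/\<epsilon>) *R (-n) else 0))"
  unfolding r1_def by (rule kdiff_weak_grad[OF \<O> kdiff_add_kink])
  have k2: "has_weak_grad \<O> r2 (%x. 0 + (if 0 < (-n) \<cdot> (x - (D - \<epsilon> *R n)) then (1/\<epsilon>) *R (-n) else 0))"
  unfolding r2_def by (rule kdiff_weak_grad[OF \<O> kdiff_add_kink])
  note w1 = k1[unfolded has_weak_grad_def, THEN conjunct2, THEN conjunct2, rule_format, OF \<phi>t, of i]
  note w2 = k2[unfolded has_weak_grad_def, THEN conjunct2, THEN conjunct2, rule_format, OF \<phi>t, of i]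
  have l: "locally_integrable \<O> r1" "locally_integrable \<O> r2"
  "locally_integrable \<O> (%x. (0 + (if 0 < (-n) \<cdot> (x - D) then (1/\<epsilon>) *R (-n) else 0))$i)"
  "locally_integrable \<O> (%x. (0 + (if 0 < (-n) \<cdot> (x - (D - \<epsilon> *R n)) then (1/\<epsilon>) *R (-n) else 0))$i)"
  using k1 k2 by (auto simp only: has_weak_grad_def intro!: locally_L1_component)
  have gz: "grad \<phi> x$i = 0" if "x ~: Q" for x using exhaust_2[of i] out[OF that] g\<phi> by auto
  have "(LINT x|leb Q. r x*grad \<phi> x$i) = (LINT x|leb \<O>. r x*grad \<phi> x$i)"
  by (rule toQ(1)[symmetric]) (simp add: gz)
  also have "... = (LINT x|leb \<O>. r1 x*grad \<phi> x$i) - (LINT x|leb \<O>. r2 x*grad \<phi> x$i)"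
  unfolding r_def left_diff_distrib
  by (rule LINT_diff[OF L1_test(2)[OF \<O> l(1) \<phi>t] L1_test(2)[OF \<O> l(2) \<phi>t]])
  also have "... = (LINT x|leb \<O>. (0 + (if 0 < (-n) \<cdot> (x - (D - \<epsilon> *R n)) then (1/\<epsilon>) *R (-n) else 0))$i * \<phi> x)
  - (LINT x|leb \<O>. (0 + (if 0 < (-n) \<cdot> (x - D) then (1/\<epsilon>) *R (-n) else 0))$i * \<phi> x)"
  unfolding w1 w2 by simp
  also have "... = (LINT x|leb \<O>. (0 + (if 0 < (-n) \<cdot> (x - (D - \<epsilon> *R n)) then (1/\<epsilon>) *R (-n) else 0))$i * \<phi> x
  - (0 + (if 0 < (-n) \<cdot> (x - D) then (1/\<epsilon>) *R (-n) else 0))$i * \<phi> x)"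
  by (rule LINT_diff[OF L1_test(1)[OF \<O> l(4) \<phi>t] L1_test(1)[OF \<O> l(3) \<phi>t], symmetric])
  also have "... = (LINT x|leb \<O>. (n$i/\<epsilon>)*(ind ?strip x * \<phi> x))"
  unfolding s2 by (rule LINT_cong[OF refl]) (use e0 in "auto simp: indicator_def")
  also have "... = (LINT x|leb Q. (n$i/\<epsilon>)*(ind ?strip x * \<phi> x))"
  by (rule toQ(1)) (simp add: out)
  also have "... = \<kappa>*n$i" by (simp add: \<kappa>_def)
  finally show ?thesis .
  qed
  \<comment> \<open>The strip contains a rectangle of size \<open>\<epsilon>\<close> by
    \<open>h/2\<close> near \<open>D\<close> on which the cutoff is at least
    \<open>c\<close>.\<close>
  have kap: "\<kappa> >= c*h/2"
  proof -
  let ?R = "{x. - \<epsilon> < n \<cdot> (x - D) & n \<cdot> (x - D) < 0 & - h/4 < perp n \<cdot> (x - D) & perp n \<cdot> (x - D) < h/4}"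
  have R: "?R : lmeasurable" "vol ?R = \<epsilon>*(h/2)"
  using rectangle_measure[OF n, of "-\<epsilon>" 0 "-h/4" "h/4" D] e0 h(1) by simp_all
  have small: "abs(x$i - D$i) <= h/2" if x: "x : ?R" for x i
  proof -
  have "norm (x - D) <= norm (((x - D) \<cdot> perp n) *R perp n) + norm (((x - D) \<cdot> n) *R n)"
  by (subst plane_decompose[OF n, of "x - D"]) (rule norm_triangle_ineq)
  also have "... = abs(perp n \<cdot> (x - D)) + abs(n \<cdot> (x - D))" by (simp add: n perp_simps inner_commute)
  also have "... <= h/4 + h/4" using x eh by (intro add_mono) auto
  finally have "norm (x - D) <= h/2" by simp
  thus ?thesis using component_le_norm_cart[of "x - D" i] by simp
  qed
  have RQ: "?R \<subseteq> Q"
  proof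
  fix x assume "x : ?R"
  from small[OF this, of 1] small[OF this, of 2] h(1)
  have "abs(x$1 - D$1) <= 2*h" "abs(x$2 - D$2) <= 2*h" by linarith+
  thus "x : Q" unfolding abs_le_iff
  by (simp add: Qdef mem_box_cart forall_2)
  qed
  have cR: "c <= \<phi> x" if x: "x : ?R" for x
  unfolding c_def \<phi>_def prod_fun_def using small[OF x] by (intro mult_mono ef(8)) (auto intro: ef(4))
  have istrip: "L1 Q (%x. ind ?strip x * \<phi> x)"
  proof (rule finQ.integrable_const_bound[where B=1])
  show "AE x in leb Q. norm (ind ?strip x * \<phi> x) <= 1" using bd(1) by (intro AE_I2) (simp add: indicator_def)
  have "?strip : sets borel" by measurable
  hence "(%x. ind ?strip x * \<phi> x) : Bm" using dm(3) by measurable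
  thus "(%x. ind ?strip x * \<phi> x) : Mb Q" by (rule dmQ)
  qed
  have "c*(\<epsilon>*(h/2)) = (LINT x|leb Q. c*ind ?R x)"
  using R(2) RQ by (simp only: integral_mult_right_zero lind Int_absorb2)
  also have "... <= (LINT x|leb Q. ind ?strip x * \<phi> x)"
  proof (rule integral_mono[OF _ istrip])
  show "L1 Q (%x. c*ind ?R x)"
  by (rule L1_cmult[OF iind[OF fmeasurableD[OF R(1)]]])
  show "c*ind ?R x <= ind ?strip x * \<phi> x" for x
  using cR[of x] bd(4)[of x] by (auto simp: indicator_def)
  qed
  finally show ?thesis using e0 by (simp add: \<kappa>_def field_simps)
  qed
  \<comment> \<open>Ramp and indicator differ within the rectangle \<open>?R\<close> of area
    \<open>40 * \<epsilon> * h\<close>, where the integrand is at most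
    \<open>2*(K_eta/h)*norm ub\<close>; the product gives the factor 80.\<close>
  have J6: "abs(LINT x|leb Q. \<theta>b x*(r x - ind Om x)) <= 80*K_eta * \<epsilon>*norm ub"
  proof -
  let ?R = "{x. - 2 * \<epsilon> < n \<cdot> (x - D) & n \<cdot> (x - D) < 2 * \<epsilon> & - 5*h < perp n \<cdot> (x - D) & perp n \<cdot> (x - D) < 5*h}"
  have R: "?R : lmeasurable" "vol ?R = (4 * \<epsilon>)*(10*h)"
  using rectangle_measure[OF n, of "-2*\<epsilon>" "2*\<epsilon>" "-5*h" "5*h" D] e0 h(1) by simp_all
  let ?k = "2*(K_eta/h)*norm ub"
  have k0: "?k >= 0" using K_eta(1) h(1) by simp
  have "abs(LINT x|leb Q. \<theta>b x*(r x - ind Om x)) <= (LINT x|leb Q. ?k*ind ?R x)"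
  proof (rule abs_LINT_le)
  show "L1 Q (%x. ?k*ind ?R x)"
  by (rule L1_cmult[OF iind[OF fmeasurableD[OF R(1)]]])
  have "abs(\<theta>b x*(r x - ind Om x)) <= ?k*ind ?R x" if x: "x : Q" for x
  proof (cases "abs(n \<cdot> (x - D)) <= \<epsilon>")
  case True
  have "abs((x - D)$1) <= 2*h" "abs((x - D)$2) <= 2*h" using x by (auto simp: Qdef mem_box_cart forall_2 abs_le_iff)
  hence nb: "norm (x - D) <= 4*h" using norm_le_l1_cart[of "x - D"] by (simp add: sum_2)
  have "abs(perp n \<cdot> (x - D)) <= norm (perp n)*norm (x - D)" by (rule Cauchy_Schwarz_ineq2)
  hence "abs(perp n \<cdot> (x - D)) < 5*h" using nb h(1) by (simp add: perp_simps n)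
  hence "x : ?R" using True e0 by auto
  moreover have "abs(r x - ind Om x) <= 1" using r01[of x] by (auto simp: indicator_def)
  moreover have "abs(\<theta>b x) <= ?k" using pw[of ub x] by (simp add: \<theta>b_def)
  ultimately show ?thesis using mult_mono[of "abs(\<theta>b x)" ?k "abs(r x - ind Om x)" 1] k0 by (simp add: abs_mult)
  next
  case False
  hence "C*h^2 < abs(n \<cdot> (x - D))"
  using zero_le_power2[of h] unfolding \<epsilon>_def distrib_right by linarith
  hence "x : Om \<longleftrightarrow> n \<cdot> (x - D) < 0" using reg x by blast
  hence "r x = ind Om x" using False e0 unfolding r by (auto simp: indicator_def abs_if split: if_splits)
  hence "abs(\<theta>b x*(r x - ind Om x)) = 0" by (simp only: diff_self mult_zero_right abs_zero)
  also have "0 <= ?k*ind ?R x" by (rule mult_nonneg_nonneg[OF k0]) (rule indicator_pos_le)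
  finally show ?thesis .
  qed
  thus "AE x in leb Q. abs(\<theta>b x*(r x - ind Om x)) <= ?k*ind ?R x" by (intro AE_I2) simp
  qed
  also have "... = ?k * vol (?R \<inter> Q)"
  by (simp only: integral_mult_right_zero lind)
  also have "... <= ?k*((4 * \<epsilon>)*(10*h))"
  by (rule mult_left_mono[OF measure_mono_fmeasurable[OF Int_lower1 sets.Int[OF fmeasurableD[OF R(1)] Ql] R(1), unfolded R(2)] k0])
  also have "... = 80*K_eta * \<epsilon>*norm ub" using h(1) by simp
  finally show ?thesis .
  qed
  have rb: "L1 Q (%x. \<theta>b x * r x)"
  by (rule L1_mult_bounded[OF i\<theta>b dmQ[OF rm], of 1]) (use r01 in simp)
  have "(LINT x|leb Q. \<theta>b x * r x) = - \<kappa>*(ub \<cdot> perp n)"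
  proof -
  have gi: "L1 Q (%x. r x*d x)" if d: "d : Bm" "!!x. abs(d x) <= K_eta/h" for d :: "plane => real"
  proof (rule finQ.integrable_const_bound[where B="K_eta/h"])
  show "(%x. r x*d x) : Mb Q" using dmQ[OF rm] dmQ[OF d(1)] by measurable
  show "AE x in leb Q. norm (r x*d x) <= K_eta/h"
  using mult_mono[OF _ d(2), of "abs(r _)" 1] r01 by (intro AE_I2) (simp add: abs_mult)
  qed
  have "(LINT x|leb Q. \<theta>b x * r x) = (LINT x|leb Q. ub$1*(r x*d2 x) - ub$2*(r x*d1 x))"
  by (simp add: \<theta>b_def algebra_simps)
  also have "... = ub$1*(LINT x|leb Q. r x*d2 x) - ub$2*(LINT x|leb Q. r x*d1 x)"
  using gi[OF dm(1) bd(2)] gi[OF dm(2) bd(3)] by simp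
  also have "... = ub$1*(\<kappa>*n$2) - ub$2*(\<kappa>*n$1)" using J5[of 1] J5[of 2] by (simp add: g\<phi>)
  also have "... = - \<kappa>*(ub \<cdot> perp n)" by (simp add: perp_def inner_vec_def sum_2 algebra_simps)
  finally show ?thesis .
  qed
  moreover have "(LINT x|leb Q. \<theta>b x * r x) = (LINT x|leb Q. \<theta>b x*(r x - ind Om x)) + (LINT x|leb Q. (\<theta>b x - \<theta> x)*ind Om x) + (LINT x|leb Q. \<theta> x*ind Om x)"
  using rb iOm[OF i\<theta>b] iOm[OF \<theta>Q] by (simp add: algebra_simps)
  ultimately have "\<kappa>*abs(ub \<cdot> perp n) = abs((LINT x|leb Q. \<theta>b x*(r x - ind Om x)) + (LINT x|leb Q. (\<theta>b x - \<theta> x)*ind Om x) + (LINT x|leb Q. \<theta> x*ind Om x))"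
  proof -
  assume "(LINT x|leb Q. \<theta>b x * r x) = - \<kappa>*(ub \<cdot> perp n)"
  and e: "(LINT x|leb Q. \<theta>b x * r x) = (LINT x|leb Q. \<theta>b x*(r x - ind Om x)) + (LINT x|leb Q. (\<theta>b x - \<theta> x)*ind Om x) + (LINT x|leb Q. \<theta> x*ind Om x)"
  hence "abs(LINT x|leb Q. \<theta>b x * r x) = abs(\<kappa>)*abs(ub \<cdot> perp n)" by (simp add: abs_mult)
  moreover have "0 <= \<kappa>" using kap c0 h(1) mult_pos_pos[OF c0 h(1)] by linarith
  ultimately show ?thesis unfolding e by simp
  qed
  also have "... <= 80*K_eta * \<epsilon>*norm ub + 2*(K_eta/h)*(LINT x|leb Q. norm (u x - ub)) + B*(LINT x|leb Q. norm (U 1 x) + norm (U 2 x))"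
  using J3 J4 J6 by linarith
  finally have fin: "\<kappa>*abs(ub \<cdot> perp n) <= 80*K_eta * \<epsilon>*norm ub + 2*(K_eta/h)*(LINT x|leb Q. norm (u x - ub)) + B*(LINT x|leb Q. norm (U 1 x) + norm (U 2 x))" .
  define a1 a2 where "a1 = (LINT x|leb Q. norm (u x - ub))" and "a2 = (LINT x|leb Q. norm (U 1 x) + norm (U 2 x))"
  have a0: "a1 >= 0" "a2 >= 0" unfolding a1_def a2_def by (intro LINT_nonneg; simp)+
  have "(c*h/2)*abs(ub \<cdot> perp n) <= \<kappa>*abs(ub \<cdot> perp n)" by (rule mult_right_mono[OF kap]) simp
  with fin have "(c*h/2)*abs(ub \<cdot> perp n) <= 80*K_eta * \<epsilon>*norm ub + 2*(K_eta/h)*a1 + B*a2" by (simp add: a1_def a2_def)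
  hence "(2/c*h)*((c*h/2)*abs(ub \<cdot> perp n)) <= (2/c*h)*(80*K_eta * \<epsilon>*norm ub + 2*(K_eta/h)*a1 + B*a2)"
  using c0 h(1) by (intro mult_left_mono) auto
  hence "h^2*abs(ub \<cdot> perp n) <= (2/c)*(80*K_eta*(C + 1)*(h ^ 3*norm ub) + 2*K_eta*a1 + B*(h*a2))"
  proof -
  assume a: "(2/c*h)*((c*h/2)*abs(ub \<cdot> perp n)) <= (2/c*h)*(80*K_eta * \<epsilon>*norm ub + 2*(K_eta/h)*a1 + B*a2)"
  have e1: "(2/c*h)*((c*h/2)*abs(ub \<cdot> perp n)) = h^2*abs(ub \<cdot> perp n)" using c0 by (simp add: power2_eq_square)
  have e2: "(2/c*h)*(80*K_eta * \<epsilon>*norm ub + 2*(K_eta/h)*a1 + B*a2)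
  = (2/c)*(h*(80*K_eta * \<epsilon>*norm ub) + h*(2*(K_eta/h)*a1) + h*(B*a2))" by (simp only: distrib_left mult.assoc)
  have e3: "h*(80*K_eta * \<epsilon>*norm ub) = 80*K_eta*(C + 1)*(h ^ 3*norm ub)"
  by (simp add: \<epsilon>_def power2_eq_square power3_eq_cube)
  have e4: "h*(2*(K_eta/h)*a1) = 2*K_eta*a1" "h*(B*a2) = B*(h*a2)" using h(1) by simp_all
  show ?thesis using a unfolding e1 e2 e3 e4 .
  qed
  also have "... <= (2/c)*((80*K_eta*(C + 1) + 2*K_eta + B)*(a1 + h*a2 + h ^ 3*norm ub))"
  proof (rule mult_left_mono)
  define z1 z2 z3 where "z1 = a1" and "z2 = h*a2" and "z3 = h ^ 3*norm ub"
  have z: "z1 >= 0" "z2 >= 0" "z3 >= 0" using a0 h(1) by (simp_all add: z1_def z2_def z3_def)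
  have kk: "80*K_eta*(C + 1) >= 0" "2*K_eta >= 0" using K_eta(1) C by simp_all
  have "80*K_eta*(C + 1)*z3 + 2*K_eta*z1 + B*z2 <= 80*K_eta*(C + 1)*(z1 + z2 + z3) + 2*K_eta*(z1 + z2 + z3) + B*(z1 + z2 + z3)"
  using z kk B0 by (intro add_mono mult_left_mono) auto
  thus "80*K_eta*(C + 1)*(h ^ 3*norm ub) + 2*K_eta*a1 + B*(h*a2) <= (80*K_eta*(C + 1) + 2*K_eta + B)*(a1 + h*a2 + h ^ 3*norm ub)"
  by (simp add: z1_def z2_def z3_def distrib_right)
  qed (use c0 in simp)
  finally show ?thesis by (simp only: K_def a1_def a2_def mult.assoc)
 qed
 show ?thesis
 proof (rule exI[of _ K], rule conjI[OF K0], intro allI impI, goal_cases)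
  case (1 \<O> Om u U p gp D n h ub)
  show ?case
  by (rule main[OF 1(1-5) refl 1(6-10)])
 qed
qed

section \<open>Restriction of Sobolev functions and L1-L2 bounds\<close>

lemma locally_integrable_subset:
 "locally_integrable \<O> f ==> S \<subseteq> \<O> ==> locally_integrable S f"
 unfolding locally_integrable_def by (meson subset_trans)

lemma has_weak_grad_subset:
 assumes \<O>: "open \<O>" and S: "open S" "S \<subseteq> \<O>" and f: "has_weak_grad \<O> f g"
 shows "has_weak_grad S f g"
proof -
 have l: "\<O> : sets lebesgue" "S : sets lebesgue" using \<O> S by auto
 show ?thesis unfolding has_weak_grad_def
 proof (intro conjI ballI allI)
  show "locally_integrable S f" "locally_integrable S g"
  using f S(2) locally_integrable_subset unfolding has_weak_grad_def by blast+
  fix \<phi> i assume \<phi>: "\<phi> : test_functions S"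
  then obtain K where K: "K \<subseteq> S" "!!x. x ~: K ==> \<phi> x = 0 & grad \<phi> x = 0" using test_support by blast
  have "\<phi> : test_functions \<O>" using \<phi> unfolding test_functions_def mem_Collect_eq
  by (metis (no_types, lifting) S(2) subset_trans)
  hence "(LINT x|leb \<O>. f x*grad \<phi> x$i) = - (LINT x|leb \<O>. g x$i * \<phi> x)"
  using f unfolding has_weak_grad_def by blast
  moreover have "(LINT x|leb \<O>. f x*grad \<phi> x$i) = (LINT x|leb S. f x*grad \<phi> x$i)"
  by (rule LINT_support(1)[OF l S(2)]) (use K in "metis DiffE mult_zero_right subsetD zero_index")
  moreover have "(LINT x|leb \<O>. g x$i * \<phi> x) = (LINT x|leb S. g x$i * \<phi> x)"
  by (rule LINT_support(1)[OF l S(2)]) (use K in "metis DiffE mult_zero_right subsetD")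
  ultimately show "(LINT x|leb S. f x*grad \<phi> x$i) = - (LINT x|leb S. g x$i * \<phi> x)" by simp
 qed
qed

lemma L2_subset:
 fixes f :: "plane => 'a::euclidean_space"
 assumes "f : L2 \<O>" "\<O> : sets lebesgue" "S : sets lebesgue" "S \<subseteq> \<O>"
 shows "f : L2 S"
proof -
 have "f : Mb \<O>" "L1 \<O> (%x. (norm (f x))^2)" using assms(1) by (auto simp: L2_def)
 hence "f : Mb S" "L1 S (%x. (norm (f x))^2)"
  using measurable_restrict_mono[OF _ assms(4)] L1_subset[OF _ assms(2-4)] by blast+
 thus ?thesis unfolding L2_def by simp
qed

lemma H1_subset:
 assumes \<O>: "open \<O>" and S: "open S" "S \<subseteq> \<O>" and f: "f : H1 \<O>"
 shows "f : H1 S" "AE x in leb S. wgrad S f x = wgrad \<O> f x"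
proof -
 have l: "\<O> : sets lebesgue" "S : sets lebesgue" using \<O> S by auto
 note w = H1_wgrad[OF \<O> f]
 note ws = has_weak_grad_subset[OF \<O> S w(1)]
 show "f : H1 S" unfolding H1_def using ws L2_subset[OF w(2) l S(2)] L2_subset[OF w(3) l S(2)] by blast
 show "AE x in leb S. wgrad S f x = wgrad \<O> f x" by (rule wgrad_AE(2)[OF S(1) ws])
qed

lemma leb_finite:
 assumes "S : lmeasurable"
 shows "finite_measure (leb S)" "L1 S (%x. c::real)" "(LINT x|leb S. c::real) = c * vol S"
proof -
 show 1: "finite_measure (leb S)" by (rule finite_measure_lebesgue_on[OF assms])
 then interpret finite_measure "leb S" .
 show "L1 S (%x. c::real)" by simp
 show "(LINT x|leb S. c::real) = c * vol S"
  using assms by (simp add: measure_restrict_space fmeasurableD)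
qed

lemma L2_L1:
 fixes f :: "plane => 'a::euclidean_space"
 assumes S: "S : lmeasurable" and f: "f : L2 S"
 shows "L1 S (%x. norm (f x))" "L1 S f"
proof -
 have m: "f : Mb S" and i: "L1 S (%x. (norm (f x))^2)" using f by (auto simp: L2_def)
 have "(%x. norm (f x)) : L2 S" using i m by (simp add: L2_def)
 thus n: "L1 S (%x. norm (f x))" by (rule L2_integrable[OF S])
 show "L1 S f" by (rule L1_bound[OF n m]) simp
qed

lemma L1_L2:
 fixes f :: "plane => 'a::euclidean_space"
 assumes S: "S : lmeasurable" and f: "f : L2 S"
 shows "(LINT x|leb S. norm (f x))^2 <= vol S*(LINT x|leb S. (norm (f x))^2)"
proof (cases "vol S = 0")
 case True
 hence "emeasure lebesgue S = 0" using S by (simp add: emeasure_eq_measure2)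
 hence "AE x in leb S. norm (f x) = 0"
  using S by (subst AE_leb_iff) (auto simp: fmeasurableD null_sets_def intro!: AE_I'[of S])
 hence "(LINT x|leb S. norm (f x)) = 0" by (intro integral_eq_zero_AE) auto
 thus ?thesis using True by simp
next
 case False
 hence p: "vol S > 0" using measure_nonneg[of lebesgue S] by linarith
 define m where "m = (LINT x|leb S. norm (f x))/vol S"
 note i1 = L2_L1(1)[OF S f]
 have i2: "L1 S (%x. (norm (f x))^2)" using f by (simp add: L2_def)
 have "0 <= (LINT x|leb S. (norm (f x) - m)^2)" by (rule LINT_nonneg) simp
 also have "... = (LINT x|leb S. (norm (f x))^2 - 2*m*norm (f x) + m^2)"
  by (rule LINT_cong) (simp_all add: power2_diff)
 also have "... = (LINT x|leb S. (norm (f x))^2) - 2*m*(LINT x|leb S. norm (f x)) + m^2 * vol S"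
  using i1 i2 leb_finite(2)[OF S, of "m^2"] leb_finite(3)[OF S, of "m^2"]
  by (subst LINT_add) simp_all
 also have "... = (LINT x|leb S. (norm (f x))^2) - (LINT x|leb S. norm (f x))^2/vol S"
  using p by (simp add: m_def power2_eq_square)
 finally show ?thesis using p by (simp add: field_simps)
qed

lemma plane_norm_square: "(norm (v :: plane))^2 = (v$1)^2 + (v$2)^2"
 by (simp add: norm_vec_def L2_set_def sum_2)

text \<open>The shape condition says that \<open>S\<close> has at least half the area of an
  \<open>l1\<close> by \<open>l2\<close> box, as cells and their triangles do. It removes the area
  ratio from the constant of \<open>poincare_borel\<close>.\<close>

lemma poincare_H1:
 assumes S: "open S" "convex S" "bounded S" "S ~= {}" and f: "f : H1 S"
  and l: "!!x y. x : S ==> y : S ==> abs(x$1 - y$1) <= l1 & abs(x$2 - y$2) <= l2"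
  and shape: "l1*l2 <= 2 * vol S"
 defines "m \<equiv> (LINT x|leb S. f x)/vol S"
 shows "L1 S (%x. (f x - m)^2)"
  "(LINT x|leb S. (f x - m)^2) <= 8*(l1^2 + l2^2)*(LINT x|leb S. (norm (wgrad S f x))^2)"
proof -
 have Sb: "S : sets borel" and Sl: "S : sets lebesgue" using S by auto
 obtain f' g where p: "borel_weak_pair S f' g" and ff: "AE x in leb S. f x = f' x"
  and gg: "ALL i. AE x in leb S. wgrad S f x$i = g i x"
  using H1_borel_weak_pair[OF S(1,3) f] by auto
 have f'm: "f' : Bm" and gm: "!!i. g i : Bm"
  and f0: "!!x. x ~: S ==> f' x = 0" and g0: "!!x i. x ~: S ==> g i x = 0"
  using p by (auto simp: borel_weak_pair_def)
 have ml: "measure lborel S = vol S" using Sb by simp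
 have m': "m = (\<integral>x. f' x \<partial>lborel)/measure lborel S"
  unfolding m_def ml by (subst LINT_repr(1)[OF Sb f'm _ ff]) (erule f0, rule refl)
 have sq: "AE x in leb S. (norm (wgrad S f x))^2 = (g 1 x)^2 + (g 2 x)^2"
  using gg[THEN spec, of 1] gg[THEN spec, of 2]
  by eventually_elim (simp only: plane_norm_square)
 have sqm: "(%x. (g 1 x)^2 + (g 2 x)^2) : Bm"
  by (intro borel_measurable_add borel_measurable_power gm)
 have sq0: "(g 1 x)^2 + (g 2 x)^2 = 0" if "x ~: S" for x using g0[OF that] by simp
 have "wgrad S f : L2 S" by (rule H1_wgrad(2)[OF S(1) f])
 hence "L1 S (%x. (norm (wgrad S f x))^2)" by (simp add: L2_def)
 hence ig: "integrable lborel (%x. (g 1 x)^2 + (g 2 x)^2)"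
  by (subst LINT_repr(2)[OF Sb sqm _ sq, symmetric]) (erule sq0)
 have G: "(\<integral>x. (g 1 x)^2 + (g 2 x)^2 \<partial>lborel) = (LINT x|leb S. (norm (wgrad S f x))^2)" (is "?g = ?G")
  by (rule LINT_repr(1)[OF Sb sqm _ sq, symmetric]) (erule sq0)
 have gn: "(\<integral>\<^sup>+x. ennreal ((g 1 x)^2 + (g 2 x)^2) \<partial>lborel) = ennreal ?G"
  unfolding G[symmetric] by (rule nn_integral_eq_integral[OF ig]) simp
 define c where "c = 4*l1*l2*(l1^2 + l2^2)/vol S"
 obtain z where z: "z : S" using S(4) by auto
 have l0: "l1 >= 0" "l2 >= 0" using l[OF z z] by auto
 have G0: "?G >= 0" by (rule LINT_nonneg) simp
 have cc: "c <= 8*(l1^2 + l2^2)"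
 proof (cases "vol S = 0")
  case False
  hence ms: "vol S > 0" using measure_nonneg[of lebesgue S] by linarith
  have "(4*(l1^2 + l2^2))*(l1*l2) <= (4*(l1^2 + l2^2))*(2 * vol S)" by (rule mult_left_mono[OF shape]) simp
  hence "4*l1*l2*(l1^2 + l2^2) <= (8*(l1^2 + l2^2)) * vol S" by argo
  thus ?thesis unfolding c_def pos_divide_le_eq[OF ms] .
 qed (simp add: c_def)
 have c0: "c >= 0" unfolding c_def using l0 by simp
 define h where "h x = ind S x*(f' x - m)^2" for x
 have hm: "h : Bm" unfolding h_def
  by (intro borel_measurable_times borel_measurable_power borel_measurable_diff f'm borel_measurable_const borel_measurable_indicator Sb)
 have h0: "0 <= h x" for x by (simp add: h_def)
 have "(\<integral>\<^sup>+x. ennreal (h x) \<partial>lborel) = (\<integral>\<^sup>+x. ind S x*ennreal ((f' x - m)^2) \<partial>lborel)"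
  by (rule nn_integral_cong) (simp add: h_def indicator_def)
 also have "... <= ennreal c*ennreal ?G"
  using poincare_borel[OF S p l] unfolding gn m' c_def ml .
 also have "... = ennreal (c * ?G)" by (rule ennreal_mult[symmetric, OF c0 G0])
 finally have hn: "(\<integral>\<^sup>+x. ennreal (h x) \<partial>lborel) <= ennreal (c * ?G)" .
 hence hi: "integrable lborel h"
  using hm h0 by (intro integrableI_nonneg) (auto intro: le_less_trans)
 have hs: "AE x in leb S. (f x - m)^2 = h x"
 proof -
  have "AE x in leb S. x : S" using AE_space[of "leb S"] by simp
  with ff show ?thesis by eventually_elim (simp add: h_def)
 qed
 have hz: "h x = 0" if "x ~: S" for x using that by (simp add: h_def)
 show "L1 S (%x. (f x - m)^2)"
  by (subst LINT_repr(2)[OF Sb hm _ hs]) (erule hz, rule hi)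
 have "ennreal (\<integral>x. h x \<partial>lborel) <= ennreal (c * ?G)"
  using hn by (subst (asm) nn_integral_eq_integral[OF hi]) (simp_all add: h0)
 hence "(\<integral>x. h x \<partial>lborel) <= c * ?G" using c0 G0 by (simp add: ennreal_le_iff)
 also have "... <= 8*(l1^2 + l2^2) * ?G" by (rule mult_right_mono[OF cc G0])
 finally show "(LINT x|leb S. (f x - m)^2) <= 8*(l1^2 + l2^2) * ?G"
  by (subst LINT_repr(1)[OF Sb hm _ hs]) (erule hz)
qed

text \<open>The substitute for the trace on a common face. Formally
  \<open>f + (x$m - p$m) * \<partial>f\<close> is the derivative of \<open>(x$m - p$m) * f\<close>,
  so the left integral is the side length times the integral of \<open>f\<close> over the face
  between the boxes; the right integral expresses the same face integral from the other box. Without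
  traces the equality follows from \<open>hat_identity\<close>.\<close>

lemma trace_consistency:
 assumes S: "open S" "convex S" and p: "borel_weak_pair S f g" and pq: "p$m < q$m"
  and e: "e = axis m (q$m - p$m)" and R: "box p q \<subseteq> S" "box (p + e) (q + e) \<subseteq> S"
 shows "(\<integral>x. ind (box p q) x*(f x + (x$m - p$m)*g m x) \<partial>lborel)
  = (\<integral>x. ind (box (p + e) (q + e)) x*(f x + (x$m - (q$m + (q$m - p$m)))*g m x) \<partial>lborel)"
proof -
 define s where "s = q$m - p$m"
 have s: "s > 0" using pq by (simp add: s_def)
 have em: "e$m = s" "!!i. i ~= m ==> e$i = 0" using e by (auto simp: s_def axis_def)
 let ?R = "box p q" and ?R' = "box (p + e) (q + e)"
 have fm: "f : Bm" and gm: "!!i. g i : Bm"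
  and fi: "integrable lborel f" and gi: "!!i. integrable lborel (g i)"
  using p by (auto simp: borel_weak_pair_def)
 have shift: "x + e : ?R' \<longleftrightarrow> x : ?R" for x by (simp add: mem_box_cart)
 have ge: "g 1 x*e$1 + g 2 x*e$2 = s*g m x" for x
  using exhaust_2[of m] em by (elim disjE) auto
 have id: "(\<integral>x. ind ?R x*(f (x + e) - f x) \<partial>lborel) =
  (\<integral>x. (g 1 x*e$1 + g 2 x*e$2)*(\<integral>t. ind {0..1} t*ind ?R (x - t *R e) \<partial>lborel) \<partial>lborel)"
  by (rule hat_identity[OF S p]) (use R shift in auto)
 have bm: "bounded ?R" "bounded ?R'" by (auto intro: bounded_box)
 have ib: "integrable lborel (%x. ind A x*F x)" if "integrable lborel F" "A : sets borel" for A and F :: "plane => real"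
  using integrable_mult_indicator[of A lborel F] that by simp
 have l1: "(\<integral>x. ind ?R x*(f (x + e) - f x) \<partial>lborel) = (\<integral>x. ind ?R' x*f x \<partial>lborel) - (\<integral>x. ind ?R x*f x \<partial>lborel)"
 proof -
  have t: "(%x. ind ?R x*f (x + e)) = (%x. (%y. ind ?R' y*f y) (x + e))" using shift by (auto simp: indicator_def)
  have m: "(%y. ind ?R' y*f y) : Bm" using fm by measurable
  have i: "integrable lborel (%x. ind ?R x*f (x + e))" unfolding t using lborel_translate(2)[OF m] ib[OF fi] by simp
  have "(\<integral>x. ind ?R x*(f (x + e) - f x) \<partial>lborel) = (\<integral>x. ind ?R x*f (x + e) - ind ?R x*f x \<partial>lborel)"
  by (simp add: right_diff_distrib)
  also have "... = (\<integral>x. ind ?R x*f (x + e) \<partial>lborel) - (\<integral>x. ind ?R x*f x \<partial>lborel)"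
  by (rule LINT_diff[OF i ib[OF fi]]) simp
  also have "(\<integral>x. ind ?R x*f (x + e) \<partial>lborel) = (\<integral>x. ind ?R' x*f x \<partial>lborel)"
  unfolding t by (rule lborel_translate(1)[OF m])
  finally show ?thesis .
 qed
 define \<Lambda> :: "plane => real" where "\<Lambda> x = (\<integral>t. ind {0..1} t*ind ?R (x - t *R e) \<partial>lborel)" for x
 have other: "p$i < x$i & x$i < q$i \<longleftrightarrow> (p + e)$i < x$i & x$i < (q + e)$i" if "i ~= m" for i x
  using em(2)[OF that] by simp
 have mem: "x : ?R \<longleftrightarrow> (ALL i. i ~= m --> p$i < x$i & x$i < q$i) & p$m < x$m & x$m < q$m" for x
  unfolding mem_box_cart by metis
 have mem': "x : ?R' \<longleftrightarrow> (ALL i. i ~= m --> p$i < x$i & x$i < q$i) & q$m < x$m & x$m < q$m + s" for x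
 proof -
  have A: "x : ?R' \<longleftrightarrow> (ALL i. i ~= m --> (p + e)$i < x$i & x$i < (q + e)$i) & (p + e)$m < x$m & x$m < (q + e)$m"
  unfolding mem_box_cart by metis
  show ?thesis unfolding A using other em(1) by (simp add: s_def)
 qed
 have memt: "x - t *R e : ?R \<longleftrightarrow> (ALL i. i ~= m --> p$i < x$i & x$i < q$i) & p$m < x$m - t * s & x$m - t * s < q$m" for x t
  unfolding mem using em by (simp add: mult.commute)
 have sp: "q$m = p$m + s" by (simp add: s_def)
 \<comment> \<open>The hat function with peak \<open>s\<close> on the common face and zeros on the
   two outer faces. The face itself is excluded, as the open boxes miss it; it is a null
   set.\<close>
 have \<Lambda>: "s * \<Lambda> x = ind ?R x*(x$m - p$m) + ind ?R' x*(q$m + s - x$m)" if ne: "x$m ~= q$m" for x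
 proof (cases "(ALL i. i ~= m --> p$i < x$i & x$i < q$i) & p$m < x$m & x$m < q$m + s")
  case False
  have "ind {0..1} t*ind ?R (x - t *R e) = (0::real)" for t :: real
  proof (cases "0 <= t & t <= 1")
  case True
  hence "0 <= t * s" "t * s <= 1 * s" using s mult_right_mono[of t 1 s] by auto
  have "x - t *R e ~: ?R"
  proof
  assume "x - t *R e : ?R"
  hence A: "ALL i. i ~= m --> p$i < x$i & x$i < q$i" and B: "p$m < x$m - t * s" "x$m - t * s < q$m"
  unfolding memt by auto
  have "p$m < x$m" "x$m < q$m + s" using B \<open>0 \<le> t * s\<close> \<open>t * s \<le> 1 * s\<close> by linarith+
  with A False show "False" by blast
  qed
  thus ?thesis by simp
  qed simp
  hence "\<Lambda> x = 0" unfolding \<Lambda>_def by (simp only: Bochner_Integration.integral_zero)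
  moreover have "x ~: ?R" "x ~: ?R'" unfolding mem mem' using False s sp by auto
  ultimately show ?thesis by simp
 next
  case True
  show ?thesis
  proof (cases "x$m < q$m")
  case lt: True
  define \<theta> where "\<theta> = (x$m - p$m)/s"
  have \<theta>: "0 < \<theta>" "\<theta> < 1" using True lt s sp by (simp_all add: \<theta>_def)
  have "ind {0..1} t*ind ?R (x - t *R e) = (ind {0..<\<theta>} t :: real)" for t
  proof -
  have "t < \<theta> \<longleftrightarrow> p$m < x$m - t * s" using s by (simp add: \<theta>_def pos_less_divide_eq algebra_simps)
  moreover have "x$m - t * s < q$m" if "0 <= t" using lt mult_nonneg_nonneg[OF that, of s] s by linarith
  ultimately show ?thesis using True \<theta> by (auto simp: indicator_def memt)
  qed
  hence "\<Lambda> x = \<theta>" using \<theta> by (simp add: \<Lambda>_def)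
  moreover have "x : ?R" "x ~: ?R'" unfolding mem mem' using True lt by auto
  ultimately show ?thesis using s by (simp add: \<theta>_def)
  next
  case False
  define \<theta> where "\<theta> = (x$m - q$m)/s"
  have \<theta>: "0 < \<theta>" "\<theta> < 1" using True False s sp ne by (simp_all add: \<theta>_def)
  have "ind {0..1} t*ind ?R (x - t *R e) = (ind {\<theta><..1} t :: real)" for t
  proof -
  have "\<theta> < t \<longleftrightarrow> x$m - t * s < q$m" using s by (simp add: \<theta>_def pos_divide_less_eq algebra_simps)
  moreover have "p$m < x$m - t * s" if "t <= 1" using False sp mult_right_mono[OF that, of s] s ne by linarith
  ultimately show ?thesis using True \<theta> by (auto simp: indicator_def memt)
  qed
  hence "\<Lambda> x = 1 - \<theta>" using \<theta> by (simp add: \<Lambda>_def)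
  moreover have "x ~: ?R" "x : ?R'" unfolding mem mem' using True False ne by auto
  ultimately show ?thesis using s by (simp add: \<theta>_def field_simps)
  qed
 qed
 have "negligible {x :: plane. x$m = q$m}"
  using negligible_standard_hyperplane[of "axis m 1 :: plane" "q$m"] by (simp add: inner_axis axis_in_Basis_iff)
 hence "AE x in lebesgue. \<not> x$m = q$m" unfolding negligible_iff_null_sets by (rule AE_not_in[THEN eventually_mono]) simp
 hence ne: "AE x in lborel. x$m ~= q$m"
  by (subst AE_completion_iff[symmetric]) (auto simp: )
 have bnd: "integrable lborel (%x. ind (box c d) x*((x$m - r)*g m x))" for c d :: plane and r
 proof -
  obtain B where B: "!!x. x : box c d ==> abs(x$m - r) <= B"
  proof -
  have "abs(x$m - r) <= abs(c$m) + abs(d$m) + abs(r)" if "x : box c d" for x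
  using that[unfolded mem_box_cart, rule_format, of m] by linarith
  thus thesis using that by blast
  qed
  have "integrable lborel (%x. g m x*(ind (box c d) x*(x$m - r)))"
  by (rule L1_mult_bounded[where B = "abs(B)", OF gi]) (use B in "force simp: indicator_def")+
  thus ?thesis by (simp add: mult_ac)
 qed
 have "(\<integral>x. (g 1 x*e$1 + g 2 x*e$2) * \<Lambda> x \<partial>lborel)
  = (\<integral>x. ind ?R x*((x$m - p$m)*g m x) - ind ?R' x*((x$m - (q$m + s))*g m x) \<partial>lborel)"
 proof (rule integral_cong_AE)
  have ae: "AE x in lborel. (g 1 x*e$1 + g 2 x*e$2) * \<Lambda> x = ind ?R x*((x$m - p$m)*g m x) - ind ?R' x*((x$m - (q$m + s))*g m x)"
  using ne
  proof eventually_elim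
  case (elim x)
  have "(g 1 x*e$1 + g 2 x*e$2) * \<Lambda> x = (s * \<Lambda> x)*g m x" unfolding ge by simp
  also have "... = ind ?R x*((x$m - p$m)*g m x) - ind ?R' x*((x$m - (q$m + s))*g m x)"
  unfolding \<Lambda>[OF elim] by (simp add: algebra_simps)
  finally show ?case .
  qed
  thus "AE x in lborel. (g 1 x*e$1 + g 2 x*e$2) * \<Lambda> x = ind ?R x*((x$m - p$m)*g m x) - ind ?R' x*((x$m - (q$m + s))*g m x)" .
  have "(%z. ind {0..1} (snd z)*ind ?R (fst z - snd z *R e) :: real) : borel_measurable (borel \<Otimes>\<^sub>M borel)"
  by measurable
  hence "(%(x, t). ind {0..1} t*ind ?R (x - t *R e) :: real) : borel_measurable (borel \<Otimes>\<^sub>M lborel)"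
  by (simp add: case_prod_beta cong: measurable_cong_sets sets_pair_measure_cong)
  hence "\<Lambda> : Bm" unfolding \<Lambda>_def by (rule lborel.borel_measurable_lebesgue_integral)
  thus "(%x. (g 1 x*e$1 + g 2 x*e$2) * \<Lambda> x) : borel_measurable lborel"
  using gm by (intro borel_measurable_times borel_measurable_add borel_measurable_const) auto
  show "(%x. ind ?R x*((x$m - p$m)*g m x) - ind ?R' x*((x$m - (q$m + s))*g m x)) : borel_measurable lborel"
  by (rule L1_meas[OF L1_diff[OF bnd bnd]])
 qed
 also have "... = (\<integral>x. ind ?R x*((x$m - p$m)*g m x) \<partial>lborel) - (\<integral>x. ind ?R' x*((x$m - (q$m + s))*g m x) \<partial>lborel)"
  by (rule LINT_diff[OF bnd bnd])
 finally have l2: "(\<integral>x. (g 1 x*e$1 + g 2 x*e$2) * \<Lambda> x \<partial>lborel) = ..." .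
 have add: "(\<integral>x. ind (box c d) x*(f x + (x$m - r)*g m x) \<partial>lborel)
  = (\<integral>x. ind (box c d) x*f x \<partial>lborel) + (\<integral>x. ind (box c d) x*((x$m - r)*g m x) \<partial>lborel)" for c d r
  unfolding distrib_left by (rule LINT_add[OF ib[OF fi] bnd]) simp
 show ?thesis unfolding add using id l1 l2 unfolding \<Lambda>_def[symmetric] s_def[symmetric] by simp
qed

lemma trace_LINT:
 assumes \<O>: "open \<O>" "convex \<O>" "bounded \<O>" and f: "f : H1 \<O>" and pq: "p$m < q$m"
  and e: "e = axis m (q$m - p$m)" and R: "box p q \<subseteq> \<O>" "box (p + e) (q + e) \<subseteq> \<O>"
 shows "(LINT x|leb (box p q). f x + (x$m - p$m)*wgrad \<O> f x$m)
  = (LINT x|leb (box (p + e) (q + e)). f x + (x$m - (q$m + (q$m - p$m)))*wgrad \<O> f x$m)"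
proof -
 obtain f' g where p: "borel_weak_pair \<O> f' g" and ff: "AE x in leb \<O>. f x = f' x"
  and gg: "ALL i. AE x in leb \<O>. wgrad \<O> f x$i = g i x"
  using H1_borel_weak_pair[OF \<O>(1,3) f] by auto
 have m: "f' : Bm" "!!i. g i : Bm" using p by (auto simp: borel_weak_pair_def)
 have \<O>l: "\<O> : sets lebesgue" using \<O> by auto
 have conv: "(LINT x|leb (box c d). f x + (x$m - r)*wgrad \<O> f x$m)
  = (\<integral>x. ind (box c d) x*(f' x + (x$m - r)*g m x) \<partial>lborel)" if cd: "box c d \<subseteq> \<O>" for c d r
 proof (rule LINT_repr(1))
  show "(%x. ind (box c d) x*(f' x + (x$m - r)*g m x)) : Bm"
  by (intro borel_measurable_times borel_measurable_add borel_measurable_diff m borel_measurable_const borel_measurable_indicator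
  cont_Bm continuous_intros) simp
  have "AE x in lebesgue. x : \<O> --> f x = f' x" "AE x in lebesgue. x : \<O> --> wgrad \<O> f x$m = g m x"
  using ff gg[THEN spec, of m] unfolding AE_leb_iff[OF \<O>l] by simp_all
  hence "AE x in lebesgue. x : box c d --> f x + (x$m - r)*wgrad \<O> f x$m = ind (box c d) x*(f' x + (x$m - r)*g m x)"
  by eventually_elim (use cd in auto)
  thus "AE x in leb (box c d). f x + (x$m - r)*wgrad \<O> f x$m = ind (box c d) x*(f' x + (x$m - r)*g m x)"
  by (subst AE_leb_iff) auto
 qed auto
 show ?thesis unfolding conv[OF R(1)] conv[OF R(2)] by (rule trace_consistency[OF \<O>(1,2) p pq e R])
qed

lemma square_sum3: "(a + b + c)^2 <= 3*(a^2 + b^2 + (c::real)^2)"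
 using sum_squares_bound[of a b] sum_squares_bound[of a c] sum_squares_bound[of b c]
 by (simp add: power2_eq_square algebra_simps)

section \<open>The Raviart--Thomas interpolant and its error\<close>

context grid
begin

definition "cell i j = box (pt (X i) (Y j)) (pt (X (Suc i)) (Y (Suc j)))"
abbreviation "leC i j \<equiv> lebesgue_on (cell i j)"

lemma cell_facts: "open (cell i j)" "convex (cell i j)" "bounded (cell i j)" "cell i j ~= {}" "cell i j : lmeasurable"
 "cell i j : sets lebesgue" "vol (cell i j) = h1*h2" "i < N1 ==> j < N2 ==> cell i j \<subseteq> box a b"
 "x : cell i j \<longleftrightarrow> X i < x$1 & x$1 < X (Suc i) & Y j < x$2 & x$2 < Y (Suc j)"
proof -
 show "open (cell i j)" "convex (cell i j)" "bounded (cell i j)" "cell i j : lmeasurable" "cell i j : sets lebesgue"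
  by (auto simp: cell_def bounded_box)
 show mem: "x : cell i j \<longleftrightarrow> X i < x$1 & x$1 < X (Suc i) & Y j < x$2 & x$2 < Y (Suc j)" for x
  by (auto simp: cell_def mem_box_cart forall_2)
 show "cell i j ~= {}"
  using interior_T_cell T_interior_nonempty[of i j True] mem by blast
 have "!!v. v : Basis ==> pt (X i) (Y j) \<cdot> v <= pt (X (Suc i)) (Y (Suc j)) \<cdot> v"
  using h_pos by (auto simp: Basis_plane inner_axis_plane XY_Suc)
 hence "measure lborel (cell i j) = (\<Prod>v\<in>Basis. (pt (X (Suc i)) (Y (Suc j)) - pt (X i) (Y j)) \<cdot> v)"
  unfolding cell_def by (rule measure_lborel_box)
 thus "vol (cell i j) = h1*h2"
  by (simp add: cell_def prod_Basis_plane inner_axis_plane XY_Suc)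
 assume "i < N1" "j < N2"
 hence "X (Suc i) <= X N1" "Y (Suc j) <= Y N2" "X 0 <= X i" "Y 0 <= Y j" by (auto intro!: XY_mono)
 thus "cell i j \<subseteq> box a b" unfolding XY_end by (auto simp: mem mem_box_cart forall_2)
qed

lemma cell_integral:
 fixes f :: "plane => real"
 assumes "L1 (cell i j) f"
 shows "L1 (T i j k) f"
  "(LINT x|leC i j. f x) = (LINT x|leT i j True. f x) + (LINT x|leT i j False. f x)"
proof -
 \<comment> \<open>A cell is a grid with one cell whose two triangles are the given ones, so the
   splitting of the box integral applies to it.\<close>
 interpret g: grid "pt (X i) (Y j)" "pt (X (Suc i)) (Y (Suc j))" 1 1 "%_ _. \<delta> i j"
 proof
  show "pt (X i) (Y j)$l < pt (X (Suc i)) (Y (Suc j))$l" for l using exhaust_2[of l] h_pos by (auto simp: XY_Suc)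
 qed auto
 have h: "g.h1 = h1" "g.h2 = h2" unfolding g.h1_def g.h2_def step1_def step2_def by (simp_all add: XY_Suc)
 have "g.T 0 0 k = T i j k" for k
  unfolding g.T_def T_def g.corner_def corner_def g.sx_def sx_def g.sy_def sy_def g.X_def g.Y_def h by (simp add: XY_Suc)
 thus "L1 (T i j k) f"
  "(LINT x|leC i j. f x) = (LINT x|leT i j True. f x) + (LINT x|leT i j False. f x)"
  using g.integral_box_T[of f] assms unfolding cell_def g.sum_I by force+
qed

text \<open>The sum runs over triangles while the integrals are over cells; each cell is counted
  twice.\<close>

lemma cell_sum:
 fixes f :: "plane => real"
 assumes f: "L1 (box a b) f"
 shows "(\<Sum>(i, j, k)\<in>I. LINT x|leC i j. f x) = 2*(LINT x|leb (box a b). f x)"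
proof -
 have "(LINT x|leC i j. f x) = (LINT x|leT i j True. f x) + (LINT x|leT i j False. f x)"
  if "i < N1" "j < N2" for i j
  by (rule cell_integral(2)[OF L1_subset[OF f _ cell_facts(6) cell_facts(8)[OF that]]]) auto
 hence "(\<Sum>i<N1. \<Sum>j<N2. (LINT x|leC i j. f x) + (LINT x|leC i j. f x))
  = (\<Sum>i<N1. \<Sum>j<N2. 2*((LINT x|leT i j True. f x) + (LINT x|leT i j False. f x)))"
  by (intro sum.cong refl) (simp add: sum.cong)
 also have "... = 2*(\<Sum>i<N1. \<Sum>j<N2. (LINT x|leT i j True. f x) + (LINT x|leT i j False. f x))"
  by (simp only: sum_distrib_left)
 finally show ?thesis unfolding integral_box_T(2)[OF f] sum_I .
qed

text \<open>Both functions are compared with the mean over the cell: \<open>g\<close> by the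
  Poincare inequality and \<open>r\<close> by the pointwise bound \<open>rb\<close>. With a factor 3
  from squaring a sum of three terms, the gradient part is \<open>48 + 3/2\<close>, rounded up to
  50, and the part of \<open>f\<close> is \<open>3/4\<close>, rounded up to 1.\<close>

lemma component_error:
 assumes ij: "i < N1" "j < N2" and g: "g : H1 (box a b)" and f: "f : L2 (box a b)"
  and s: "0 <= s" "s <= h" and h: "h1 <= h" "h2 <= h" and r: "continuous_on UNIV r"
  and rb: "!!x. x : T i j k ==> abs(r x - (LINT x|leC i j. g x)/(h1*h2))
  <= s/(h1*h2)*(LINT x|leC i j. norm (wgrad (box a b) g x)) + s/(h1*h2)*(LINT x|leT i j k. norm (f x))"
 shows "L1 (T i j k) (%x. (g x - r x)^2)"
  "(LINT x|leT i j k. (g x - r x)^2) <= 50*h^2*(LINT x|leC i j. (norm (wgrad (box a b) g x))^2)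
  + h^2*(LINT x|leT i j k. (f x)^2)"
proof -
 let ?G = "wgrad (box a b) g" and ?c = "cell i j" and ?T = "T i j k"
 define \<mu> where "\<mu> = (LINT x|leb ?c. g x)/(h1*h2)"
 define Gn where "Gn = (LINT x|leb ?c. norm (?G x))"
 define Fn where "Fn = (LINT x|leb ?T. norm (f x))"
 define G2 where "G2 = (LINT x|leb ?c. (norm (?G x))^2)"
 define F2 where "F2 = (LINT x|leb ?T. (f x)^2)"
 have op: "open (box a b)" and bl: "box a b : sets lebesgue" by auto
 note sub = cell_facts(8)[OF ij]
 note w = H1_wgrad[OF op g]
 have GL2: "?G : L2 ?c" by (rule L2_subset[OF w(2) bl cell_facts(6) sub])
 have TT: "?T : lmeasurable" by simp
 have fi: "L1 (box a b) (%x. (norm (f x))^2)" using f by (simp add: L2_def)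
 have tb: "AE x in lebesgue. x : ?T --> x : box a b" using AE_interior_T
  by eventually_elim (use interior_T_box[OF ij] ij in blast)
 have measT: "\<phi> : Mb ?T" if "\<phi> : Mb (box a b)" for \<phi> :: "plane => real"
 proof -
  have i: "interior ?T : sets lebesgue" by auto
  have "\<phi> : Mb (interior ?T)" by (rule measurable_restrict_mono[OF that interior_T_box[OF ij]])
  hence m: "(%x. if x : interior ?T then \<phi> x else 0) : borel_measurable lebesgue"
  using measurable_restrict_space_iff[of "interior ?T" lebesgue 0 borel \<phi>] i by simp
  have "AE x in lebesgue. (if x : interior ?T then \<phi> x else 0) = (if x : ?T then \<phi> x else 0)"
  using AE_interior_T by eventually_elim (use ij interior_subset[of ?T] in auto)
  from borel_measurable_lebesgue_AE[OF m this] show ?thesis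
  using measurable_restrict_space_iff[of ?T lebesgue 0 borel \<phi>] by simp
 qed
 have fT: "f : L2 ?T"
 proof -
  have "f : Mb ?T" by (rule measT) (use f in "simp add: L2_def")
  thus ?thesis unfolding L2_def using integral_box_T(1)[OF fi ij] by simp
 qed
 have hh: "h1*h2 > 0" using h_pos by simp
 have T2: "vol ?T = h1*h2/2" by (rule T_measure)
 have Gn2: "Gn^2 <= (h1*h2)*G2" using L1_L2[OF cell_facts(5) GL2] by (simp add: Gn_def G2_def cell_facts(7))
 have Fn2: "Fn^2 <= (h1*h2/2)*F2" using L1_L2[OF TT fT] by (simp add: Fn_def F2_def T2)
 have n0: "G2 >= 0" "F2 >= 0"
  unfolding G2_def F2_def by (rule LINT_nonneg, rule zero_le_power2)+
 note gc = H1_subset[OF op cell_facts(1) sub g]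
 have diam: "abs(x$1 - y$1) <= h1 & abs(x$2 - y$2) <= h2" if "x : ?c" "y : ?c" for x y
  using that unfolding cell_facts(9) XY_Suc by linarith
 have shape: "h1*h2 <= 2 * vol ?c" using hh by (simp add: cell_facts(7))
 have P: "L1 ?c (%x. (g x - \<mu>)^2)"
  unfolding \<mu>_def by (rule poincare_H1(1)[OF cell_facts(1-4) gc(1) _ shape, unfolded cell_facts(7)]) (erule (1) diam)
 have P2: "(LINT x|leb ?c. (g x - \<mu>)^2) <= 8*(h1^2 + h2^2)*(LINT x|leb ?c. (norm (wgrad ?c g x))^2)"
  unfolding \<mu>_def by (rule poincare_H1(2)[OF cell_facts(1-4) gc(1) _ shape, unfolded cell_facts(7)]) (erule (1) diam)
 have G2': "(LINT x|leb ?c. (norm (wgrad ?c g x))^2) = G2"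
  unfolding G2_def
 proof (rule leb_AE_cong(3)[OF cell_facts(6)])
  show "AE x in leb ?c. (norm (?G x))^2 = (norm (wgrad ?c g x))^2" using gc(2) by eventually_elim simp
  show "L1 ?c (%x. (norm (?G x))^2)" using GL2 by (simp add: L2_def)
 qed
 define E where "E = s/(h1*h2)"
 have E0: "E >= 0" using s hh by (simp add: E_def)
 have pw: "(g x - r x)^2 <= 3*(g x - \<mu>)^2 + 3*((E*Gn)^2 + (E*Fn)^2)" if "x : ?T" for x
 proof -
  have "abs(r x - \<mu>) <= E*Gn + E*Fn" using rb[OF that] by (simp add: \<mu>_def E_def Gn_def Fn_def)
  hence "abs(g x - r x) <= abs(abs(g x - \<mu>) + E*Gn + E*Fn)" by linarith
  hence "(g x - r x)^2 <= (abs(g x - \<mu>) + E*Gn + E*Fn)^2" by (simp only: abs_le_square_iff)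
  also have "... <= 3*(abs(g x - \<mu>)^2 + (E*Gn)^2 + (E*Fn)^2)" by (rule square_sum3)
  finally show ?thesis by simp
 qed
 have gmi: "L1 ?T (%x. (g x - \<mu>)^2)" by (rule cell_integral(1)[OF P])
 have bi: "L1 ?T (%x. 3*(g x - \<mu>)^2 + 3*((E*Gn)^2 + (E*Fn)^2))"
  by (intro L1_add L1_cmult gmi leb_finite(2)[OF TT])
 have "g : Mb (box a b)" using w(3) by (simp add: L2_def)
 hence gm: "g : Mb ?T" by (rule measT)
 have rm: "r : Mb ?T"
  by (intro meas_leb measurable_completion) (simp add: cont_Bm[OF r])
 show gri: "L1 ?T (%x. (g x - r x)^2)"
 proof (rule L1_bound[OF bi])
  show "(%x. (g x - r x)^2) : Mb ?T" by (intro borel_measurable_power borel_measurable_diff gm rm)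
  show "AE x in leb ?T. norm ((g x - r x)^2) <= norm (3*(g x - \<mu>)^2 + 3*((E*Gn)^2 + (E*Fn)^2))"
  by (rule AE_I2) (use pw in "simp add: abs_of_nonneg")
 qed
 have "(LINT x|leb ?T. (g x - r x)^2) <= (LINT x|leb ?T. 3*(g x - \<mu>)^2 + 3*((E*Gn)^2 + (E*Fn)^2))"
  by (rule integral_mono[OF gri bi]) (use pw in simp)
 also have "... = 3*(LINT x|leb ?T. (g x - \<mu>)^2) + 3*((E*Gn)^2 + (E*Fn)^2)*(h1*h2/2)"
  unfolding T2[symmetric] leb_finite(3)[OF TT, symmetric] integral_mult_right_zero[symmetric]
  by (rule LINT_add[OF L1_cmult[OF gmi] leb_finite(2)[OF TT]])
 finally have 0: "(LINT x|leb ?T. (g x - r x)^2) <= 3*(LINT x|leb ?T. (g x - \<mu>)^2) + 3*((E*Gn)^2 + (E*Fn)^2)*(h1*h2/2)" .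
 have "(LINT x|leb ?T. (g x - \<mu>)^2) <= (LINT x|leb ?c. (g x - \<mu>)^2)"
 proof -
  have "(LINT x|leT i j k'. (g x - \<mu>)^2) >= 0" for k' by (rule LINT_nonneg) simp
  from this[of True] this[of False] cell_integral(2)[OF P] show ?thesis by (cases k) simp_all
 qed
 also have "... <= 8*(h1^2 + h2^2)*G2" using P2 unfolding G2' .
 also have "... <= 16*h^2*G2"
 proof (rule mult_right_mono[OF _ n0(1)])
  have "h1^2 <= h^2" "h2^2 <= h^2" using h h_pos by (auto intro!: power_mono)
  thus "8*(h1^2 + h2^2) <= 16*h^2" by simp
 qed
 finally have 1: "(LINT x|leb ?T. (g x - r x)^2) <= 3*(16*h^2*G2) + 3*((E*Gn)^2 + (E*Fn)^2)*(h1*h2/2)"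
  using 0 by linarith
 have E2: "E^2*(h1*h2)*(h1*h2) = s^2" using h_pos by (simp add: E_def power2_eq_square)
 have s2: "s^2 <= h^2" using s by (intro power_mono) auto
 have "(E*Gn)^2*(h1*h2) <= E^2*((h1*h2)*G2)*(h1*h2)"
  unfolding power_mult_distrib by (intro mult_right_mono mult_left_mono Gn2) (use hh in auto)
 also have "... = s^2*G2" using E2 by (simp add: mult_ac)
 also have "... <= h^2*G2" by (rule mult_right_mono[OF s2 n0(1)])
 finally have 2: "(E*Gn)^2*(h1*h2) <= h^2*G2" .
 have "(E*Fn)^2*(h1*h2) <= E^2*((h1*h2/2)*F2)*(h1*h2)"
  unfolding power_mult_distrib by (intro mult_right_mono mult_left_mono Fn2) (use hh in auto)
 also have "... = s^2*F2/2" using E2 by (simp add: mult_ac)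
 also have "... <= h^2*F2/2" using mult_right_mono[OF s2 n0(2)] by simp
 finally have 3: "(E*Fn)^2*(h1*h2) <= h^2*F2/2" .
 have 4: "3*((E*Gn)^2 + (E*Fn)^2)*(h1*h2/2) = (3/2)*((E*Gn)^2*(h1*h2)) + (3/2)*((E*Fn)^2*(h1*h2))" by (simp add: field_simps)
 have pos: "0 <= h^2*G2" "0 <= h^2*F2" using n0 by simp_all
 have "(LINT x|leb ?T. (g x - r x)^2) <= 48*(h^2*G2) + (3/2)*(h^2*G2) + (3/4)*(h^2*F2)"
  using 1 2 3 unfolding 4 by linarith
 also have "... <= 50*(h^2*G2) + h^2*F2" using pos by linarith
 finally show "(LINT x|leb ?T. (g x - r x)^2) <= 50*h^2*G2 + h^2*F2" by (simp only: mult.assoc)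
qed

text \<open>On the legs the normal component is an edge mean of \<open>u\<close> written as a cell
  integral, and \<open>K\<close> makes the divergence the element mean of \<open>f\<close>. These
  data already fix the flux through the diagonal; that both triangles obtain the same one is the
  divergence theorem on the cell combined with \<open>f = div u\<close>.\<close>

lemma rt_interpolant:
 assumes u: "!!m. (%x. u x$m) : H1 (box a b)" and f: "f : L2 (box a b)"
  and U: "!!m. U m = wgrad (box a b) (%x. u x$m)"
  and fu: "AE x in leb (box a b). f x = U 1 x$1 + U 2 x$2"
  and h: "h1 <= h" "h2 <= h"
 shows "EX A B K. conforming A B K & (ALL i j k. K i j k = (LINT x|leT i j k. f x)/(h1*h2)) &
  (ALL i<N1. ALL j<N2. ALL k. L1 (T i j k) (%x. (norm (u x - rt (A i j k) (B i j k) (K i j k) x))^2)) &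
  (\<Sum>(i, j, k)\<in>I. LINT x|leT i j k. (norm (u x - rt (A i j k) (B i j k) (K i j k) x))^2)
  <= h^2*(100*(LINT x|leb (box a b). (norm (U 1 x))^2 + (norm (U 2 x))^2) + 2*(LINT x|leb (box a b). (f x)^2))"
proof -
 let ?\<O> = "box a b"
 have op: "open ?\<O>" "convex ?\<O>" "bounded ?\<O>" and bl: "?\<O> : sets lebesgue" by (auto simp: bounded_box)
 have UL2: "U m : L2 ?\<O>" for m unfolding U by (rule H1_wgrad(2)[OF op(1) u])
 have hp: "h1*h2 > 0" using h_pos by simp
 \<comment> \<open>When \<open>s\<close> is the coordinate of one side of the cell, this is the mean
   of \<open>u$m\<close> over the opposite side, in the form used by
   \<open>trace_consistency\<close>.\<close>
 define c where "c m s i j = (1/(h1*h2))*(LINT x|leC i j. u x$m + (x$m - s)*U m x$m)" for m :: 2 and s :: real and i j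
 define K where "K i j k = (LINT x|leT i j k. f x)/(h1*h2)" for i j k
 \<comment> \<open>Chosen so that the first component \<open>A + K * x\<close> equals the mean of
   \<open>u\<close> over the vertical leg when evaluated there; likewise \<open>B\<close> for the
   horizontal leg.\<close>
 define A where "A i j k = (if \<delta> i j = k then c 1 (X (Suc i)) i j - K i j k*X i else c 1 (X i) i j - K i j k*X (Suc i))" for i j k
 define B where "B i j k = (if k then c 2 (Y j) i j - K i j k*Y (Suc j) else c 2 (Y (Suc j)) i j - K i j k*Y j)" for i j k
 have integ: "L1 (cell i j) (%x. u x$m)" "L1 (cell i j) (%x. U m x$m)"
  "L1 (cell i j) (%x. norm (U m x))" "L1 (cell i j) (%x. (x$m - s)*U m x$m)"
  if ij: "i < N1" "j < N2" for i j m s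
 proof -
  note sub = cell_facts(8)[OF ij]
  show "L1 (cell i j) (%x. u x$m)"
  by (rule L2_L1(2)[OF cell_facts(5) L2_subset[OF H1_wgrad(3)[OF op(1) u] bl cell_facts(6) sub]])
  have L: "U m : L2 (cell i j)" by (rule L2_subset[OF UL2 bl cell_facts(6) sub])
  show "L1 (cell i j) (%x. norm (U m x))" by (rule L2_L1(1)[OF cell_facts(5) L])
  have "L1 (cell i j) (%x. U m x \<cdot> axis m 1)" by (rule integrable_inner_left) (rule L2_L1(2)[OF cell_facts(5) L])
  thus Ui: "L1 (cell i j) (%x. U m x$m)" by (simp add: inner_axis)
  have "L1 (cell i j) (%x. U m x$m*(ind (cell i j) x*(x$m - s)))"
  proof (rule L1_mult_bounded[OF Ui])
  have "(%x. ind (cell i j) x*(x$m - s)) : Bm"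
  by (intro borel_measurable_times borel_measurable_diff borel_measurable_const borel_measurable_indicator
  cont_Bm continuous_intros) (simp add: cell_facts(1))
  thus "(%x. ind (cell i j) x*(x$m - s)) : Mb (cell i j)"
  by (simp add: meas_leb measurable_completion)
  show "abs(ind (cell i j) x*(x$m - s)) <= abs(X i) + abs(X (Suc i)) + abs(Y j) + abs(Y (Suc j)) + abs(s)" for x
  proof (cases "x : cell i j")
  case True
  have "abs(x$m - s) <= abs(X i) + abs(X (Suc i)) + abs(Y j) + abs(Y (Suc j)) + abs(s)"
  using exhaust_2[of m] True[unfolded cell_facts(9)] by (elim disjE) auto
  thus ?thesis using True by simp
  qed simp
  qed
  thus "L1 (cell i j) (%x. (x$m - s)*U m x$m)"
  by (rule Bochner_Integration.integrable_cong[THEN iffD1, rotated -1]) (auto simp: cell_facts(6))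
 qed
 have c_split: "c m s i j = (1/(h1*h2))*((LINT x|leC i j. u x$m) + (LINT x|leC i j. (x$m - s)*U m x$m))"
  if "i < N1" "j < N2" for m s i j
  unfolding c_def by (subst LINT_add[OF integ(1)[OF that] integ(4)[OF that]]) simp
 have c_diff: "c m s i j - c m t i j = (t - s)/(h1*h2)*(LINT x|leC i j. U m x$m)" if "i < N1" "j < N2" for m s t i j
 proof -
  have "(LINT x|leC i j. (x$m - s)*U m x$m) - (LINT x|leC i j. (x$m - t)*U m x$m)
  = (LINT x|leC i j. (x$m - s)*U m x$m - (x$m - t)*U m x$m)"
  by (rule LINT_diff[OF integ(4)[OF that] integ(4)[OF that], symmetric])
  also have "... = (LINT x|leC i j. (t - s)*U m x$m)" by (simp add: algebra_simps)
  finally have "(LINT x|leC i j. (x$m - s)*U m x$m) - (LINT x|leC i j. (x$m - t)*U m x$m)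
  = (t - s)*(LINT x|leC i j. U m x$m)" by simp
  moreover have "c m s i j - c m t i j = (1/(h1*h2))*((LINT x|leC i j. (x$m - s)*U m x$m) - (LINT x|leC i j. (x$m - t)*U m x$m))"
  unfolding c_split[OF that] by (simp only: right_diff_distrib[symmetric] add_diff_cancel_left)
  ultimately show ?thesis by simp
 qed
 have c_mean: "abs(c m s i j - (LINT x|leC i j. u x$m)/(h1*h2)) <= l/(h1*h2)*(LINT x|leC i j. norm (U m x))"
  if ij: "i < N1" "j < N2" and l: "!!x. x : cell i j ==> abs(x$m - s) <= l" for m s i j l
 proof -
  have "abs(LINT x|leC i j. (x$m - s)*U m x$m) <= (LINT x|leC i j. l*norm (U m x))"
  proof (rule abs_LINT_le)
  show "L1 (cell i j) (%x. l*norm (U m x))" using integ(3)[OF ij] by simp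
  have "abs((x$m - s)*U m x$m) <= l*norm (U m x)" if "x : cell i j" for x
  unfolding abs_mult using l[OF that] by (intro mult_mono component_le_norm_cart) auto
  thus "AE x in leC i j. abs((x$m - s)*U m x$m) <= l*norm (U m x)" by (intro AE_I2) simp
  qed
  hence "(1/(h1*h2))*abs(LINT x|leC i j. (x$m - s)*U m x$m) <= (1/(h1*h2))*(l*(LINT x|leC i j. norm (U m x)))"
  using hp by (intro mult_left_mono) auto
  moreover have "c m s i j - (LINT x|leC i j. u x$m)/(h1*h2) = (1/(h1*h2))*(LINT x|leC i j. (x$m - s)*U m x$m)"
  unfolding c_split[OF ij] by (simp add: add_divide_distrib)
  moreover have "abs(1/(h1*h2)) = 1/(h1*h2)" using hp by simp
  ultimately show ?thesis by (simp only: abs_mult) simp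
 qed
 have shift1: "box (pt (X i) (Y j) + axis 1 h1) (pt (X (Suc i)) (Y (Suc j)) + axis 1 h1) = cell (Suc i) j"
  "box (pt (X i) (Y j) + axis 2 h2) (pt (X (Suc i)) (Y (Suc j)) + axis 2 h2) = cell i (Suc j)" for i j
  by (auto simp: cell_def mem_box_cart forall_2 axis_def XY_Suc)
 have conV: "c 1 (X i) i j = c 1 (X (Suc (Suc i))) (Suc i) j" if "Suc i < N1" "j < N2" for i j
 proof -
  have "(LINT x|leC i j. u x$1 + (x$1 - X i)*U 1 x$1)
  = (LINT x|leb (cell (Suc i) j). u x$1 + (x$1 - X (Suc (Suc i)))*U 1 x$1)"
  using trace_LINT[OF op u, of "pt (X i) (Y j)" 1 "pt (X (Suc i)) (Y (Suc j))" "axis 1 h1"] h_pos that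
  cell_facts(8)[of i j] cell_facts(8)[of "Suc i" j]
  unfolding shift1 cell_def[symmetric] U by (simp add: XY_Suc)
  thus ?thesis by (simp add: c_def)
 qed
 have conH: "c 2 (Y j) i j = c 2 (Y (Suc (Suc j))) i (Suc j)" if "i < N1" "Suc j < N2" for i j
 proof -
  have "(LINT x|leC i j. u x$2 + (x$2 - Y j)*U 2 x$2)
  = (LINT x|leb (cell i (Suc j)). u x$2 + (x$2 - Y (Suc (Suc j)))*U 2 x$2)"
  using trace_LINT[OF op u, of "pt (X i) (Y j)" 2 "pt (X (Suc i)) (Y (Suc j))" "axis 2 h2"] h_pos that
  cell_facts(8)[of i j] cell_facts(8)[of i "Suc j"]
  unfolding shift1 cell_def[symmetric] U by (simp add: XY_Suc)
  thus ?thesis by (simp add: c_def)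
 qed
 have fint: "L1 ?\<O> f" by (rule L2_L1(2)[OF _ f]) simp
 have diag: "Df A B K i j True + Df A B K i j False = 0" if ij: "i < N1" "j < N2" for i j
 proof -
  have fc: "L1 (cell i j) f" by (rule L1_subset[OF fint bl cell_facts(6) cell_facts(8)[OF ij]])
  have "AE x in leC i j. f x = U 1 x$1 + U 2 x$2"
  using fu cell_facts(8)[OF ij] unfolding AE_leb_iff[OF bl] AE_leb_iff[OF cell_facts(6)] by (auto elim!: eventually_mono)
  from leb_AE_cong(3)[OF cell_facts(6) this fc]
  have F: "(LINT x|leT i j True. f x) + (LINT x|leT i j False. f x)
  = (LINT x|leC i j. U 1 x$1) + (LINT x|leC i j. U 2 x$2)"
  using integ(2)[OF ij, of 1] integ(2)[OF ij, of 2] cell_integral(2)[OF fc] by simp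
  have "Df A B K i j True + Df A B K i j False =
  (c 1 (X (Suc i)) i j - c 1 (X i) i j)/h1 + (c 2 (Y (Suc j)) i j - c 2 (Y j) i j)/h2 + K i j True + K i j False"
  by (cases "\<delta> i j") (simp_all add: Df_def A_def B_def corner_def sx_def sy_def diff_divide_distrib)
  also have "... = (- (LINT x|leC i j. U 1 x$1) - (LINT x|leC i j. U 2 x$2)
  + ((LINT x|leT i j True. f x) + (LINT x|leT i j False. f x)))/(h1*h2)"
  unfolding c_diff[OF ij] K_def using h_pos by (simp add: XY_Suc field_simps)
  finally show ?thesis unfolding F by simp
 qed
 have conf: "conforming A B K"
  unfolding conforming_def using diag conV conH by (simp add: A_def B_def)
 have comp: "L1 (T i j k) (%x. (u x$m - rt (A i j k) (B i j k) (K i j k) x$m)^2)"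
  "(LINT x|leT i j k. (u x$m - rt (A i j k) (B i j k) (K i j k) x$m)^2)
  <= 50*h^2*(LINT x|leC i j. (norm (U m x))^2) + h^2*(LINT x|leT i j k. (f x)^2)"
  if ij: "i < N1" "j < N2" for i j k m
 proof -
  define s where "s = (if m = 1 then h1 else h2)"
  have s: "0 <= s" "s <= h" using h h_pos by (auto simp: s_def)
  have cont: "continuous_on UNIV (%x. rt (A i j k) (B i j k) (K i j k) x$m)" by (intro continuous_intros continuous_rt)
  have Kb: "abs(K i j k) <= (LINT x|leT i j k. norm (f x))/(h1*h2)"
  unfolding K_def abs_divide using hp integral_norm_bound[of "leT i j k" f] by (simp add: divide_right_mono)
  have "abs(rt (A i j k) (B i j k) (K i j k) x$m - (LINT x|leC i j. u x$m)/(h1*h2))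
  <= s/(h1*h2)*(LINT x|leC i j. norm (U m x)) + s/(h1*h2)*(LINT x|leT i j k. norm (f x))"
  if x: "x : T i j k" for x
  proof -
  have "EX t t'. rt (A i j k) (B i j k) (K i j k) x$m = c m t i j + K i j k*(x$m - t') & abs(x$m - t') <= s & (ALL y:cell i j. abs(y$m - t) <= s)"
  proof (cases "m = 1")
  case True
  show ?thesis
  by (rule exI[of _ "if \<delta> i j = k then X (Suc i) else X i"], rule exI[of _ "if \<delta> i j = k then X i else X (Suc i)"])
  (use T_cell[OF x] True in "auto simp: rt_def A_def s_def cell_facts(9) XY_Suc algebra_simps")
  next
  case False
  hence m: "m = 2" using exhaust_2[of m] by auto
  show ?thesis
  by (rule exI[of _ "if k then Y j else Y (Suc j)"], rule exI[of _ "if k then Y (Suc j) else Y j"])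
  (use T_cell[OF x] m in "auto simp: rt_def B_def s_def cell_facts(9) XY_Suc algebra_simps")
  qed
  then obtain t t' where t: "rt (A i j k) (B i j k) (K i j k) x$m = c m t i j + K i j k*(x$m - t')" "abs(x$m - t') <= s"
  "!!y. y : cell i j ==> abs(y$m - t) <= s" by blast
  have "abs(K i j k*(x$m - t')) <= (LINT x|leT i j k. norm (f x))/(h1*h2) * s"
  unfolding abs_mult by (rule mult_mono[OF Kb t(2)]) (use hp in "auto intro!: divide_nonneg_nonneg LINT_nonneg")
  hence "abs(K i j k*(x$m - t')) <= s/(h1*h2)*(LINT x|leT i j k. norm (f x))" by (simp add: mult.commute)
  with c_mean[OF ij t(3)] show ?thesis unfolding t(1) by linarith
  qed
  note ce = component_error[OF ij u f s h cont this[unfolded U]]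
  show "L1 (T i j k) (%x. (u x$m - rt (A i j k) (B i j k) (K i j k) x$m)^2)" by (rule ce(1))
  show "(LINT x|leT i j k. (u x$m - rt (A i j k) (B i j k) (K i j k) x$m)^2)
  <= 50*h^2*(LINT x|leC i j. (norm (U m x))^2) + h^2*(LINT x|leT i j k. (f x)^2)"
  using ce(2) unfolding U .
 qed
 have U2: "L1 ?\<O> (%x. (norm (U m x))^2)" for m using UL2[of m] by (simp add: L2_def)
 have f2: "L1 ?\<O> (%x. (f x)^2)" using f by (simp add: L2_def)
 have vec: "L1 (T i j k) (%x. (norm (u x - rt (A i j k) (B i j k) (K i j k) x))^2)"
  "(LINT x|leT i j k. (norm (u x - rt (A i j k) (B i j k) (K i j k) x))^2)
  <= 50*h^2*(LINT x|leC i j. (norm (U 1 x))^2 + (norm (U 2 x))^2) + 2*h^2*(LINT x|leT i j k. (f x)^2)"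
  if ij: "i < N1" "j < N2" for i j k
 proof -
  note sub = L1_subset[OF U2 bl cell_facts(6) cell_facts(8)[OF ij]]
  show "L1 (T i j k) (%x. (norm (u x - rt (A i j k) (B i j k) (K i j k) x))^2)"
  unfolding plane_norm_square using comp(1)[OF ij, of k] by simp
  have "(LINT x|leT i j k. (norm (u x - rt (A i j k) (B i j k) (K i j k) x))^2)
  = (LINT x|leT i j k. (u x$1 - rt (A i j k) (B i j k) (K i j k) x$1)^2)
  + (LINT x|leT i j k. (u x$2 - rt (A i j k) (B i j k) (K i j k) x$2)^2)"
  unfolding plane_norm_square vector_minus_component by (rule LINT_add[OF comp(1)[OF ij] comp(1)[OF ij]])
  also have "... <= 50*h^2*((LINT x|leC i j. (norm (U 1 x))^2) + (LINT x|leC i j. (norm (U 2 x))^2)) + 2*h^2*(LINT x|leT i j k. (f x)^2)"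
  using comp(2)[OF ij, of k 1] comp(2)[OF ij, of k 2] unfolding distrib_left by linarith
  also have "(LINT x|leC i j. (norm (U 1 x))^2) + (LINT x|leC i j. (norm (U 2 x))^2) = (LINT x|leC i j. (norm (U 1 x))^2 + (norm (U 2 x))^2)"
  by (rule LINT_add[OF sub sub, symmetric])
  finally show "(LINT x|leT i j k. (norm (u x - rt (A i j k) (B i j k) (K i j k) x))^2)
  <= 50*h^2*(LINT x|leC i j. (norm (U 1 x))^2 + (norm (U 2 x))^2) + 2*h^2*(LINT x|leT i j k. (f x)^2)" .
 qed
 have "(\<Sum>(i, j, k)\<in>I. LINT x|leT i j k. (norm (u x - rt (A i j k) (B i j k) (K i j k) x))^2)
  <= (\<Sum>(i, j, k)\<in>I. 50*h^2*(LINT x|leC i j. (norm (U 1 x))^2 + (norm (U 2 x))^2) + 2*h^2*(LINT x|leT i j k. (f x)^2))"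
  by (rule sum_mono) (use vec(2) in "auto simp: I_def")
 also have "... = 50*h^2*(\<Sum>(i, j, k)\<in>I. LINT x|leC i j. (norm (U 1 x))^2 + (norm (U 2 x))^2) + 2*h^2*(\<Sum>(i, j, k)\<in>I. LINT x|leT i j k. (f x)^2)"
  by (simp add: case_prod_beta sum.distrib sum_distrib_left)
 also have "... = h^2*(100*(LINT x|leb ?\<O>. (norm (U 1 x))^2 + (norm (U 2 x))^2) + 2*(LINT x|leb ?\<O>. (f x)^2))"
  unfolding cell_sum[OF L1_add[OF U2 U2]] integral_box_T(2)[OF f2, symmetric] by (simp add: algebra_simps)
 finally show ?thesis using conf vec(1) K_def by (intro exI[of _ A] exI[of _ B] exI[of _ K]) auto
qed

end

section \<open>The test gradient on a cut element\<close>

lemma coef_measurable: "open Om ==> coef Om bm bp : Bm"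
 unfolding coef_def[abs_def] by (rule measurable_If_set) auto

lemma beta_h_measurable: "beta_h bm bp D n : Bm"
proof -
 have "{x. n \<cdot> (x - D) > 0} : sets borel" by measurable
 hence "(%x. if x : {x. n \<cdot> (x - D) > 0} then bp else bm) : Bm" by (intro measurable_If_set) auto
 thus ?thesis by (simp add: beta_h_def[abs_def])
qed

text \<open>For constant \<open>w\<close> this is the gradient in the local space with
 \<open>\<integral>\<^sub>T \<beta> \<nabla>\<psi> \<cdot> Gop w = \<integral>\<^sub>T \<nabla>\<psi> \<cdot> w\<close> for all local \<open>\<psi>\<close>: it turns the local space into a test space for \<open>w\<close>.\<close>

definition Gop :: "real => real => plane set => plane set => plane => plane => plane => plane => plane" where
 "Gop bm bp Om T D n w = lgrad bm bp D n
  (vol T*(w \<cdot> perp n)/(LINT x|leb T. coef Om bm bp x))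
  ((w \<cdot> n)*(LINT x|leb T. 1/beta_h bm bp D n x)/(LINT x|leb T. coef Om bm bp x/(beta_h bm bp D n x)^2))"

locale cut_element =
 fixes bm bp :: real and Om T :: "plane set" and D n :: plane
 assumes \<beta>: "bm > 0" "bp > 0" and Om: "open Om" and T: "T : lmeasurable" "vol T > 0" and n: "norm n = 1"
begin

definition "ba = min bm bp"
definition "bb = max bm bp"
abbreviation "bc \<equiv> coef Om bm bp"
abbreviation "bh \<equiv> beta_h bm bp D n"
abbreviation "M \<equiv> vol T"
abbreviation "P \<equiv> LINT x|leb T. 1/bh x"
abbreviation "N \<equiv> LINT x|leb T. bc x/(bh x)^2"
abbreviation "Bc \<equiv> LINT x|leb T. bc x"

lemma bnd: "0 < ba" "ba <= bb" "0 < bb" "ba <= bc x" "bc x <= bb" "ba <= bh x" "bh x <= bb" "0 < bc x" "0 < bh x"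
 using \<beta> by (auto simp: ba_def bb_def coef_def beta_h_def)

lemma inv_bnd: "1/bb <= 1/bh x" "1/bh x <= 1/ba" "1/bb <= 1/bc x" "1/bc x <= 1/ba"
 "ba/bb^2 <= bc x/(bh x)^2" "bc x/(bh x)^2 <= bb/ba^2"

 using bnd(1-3) bnd(4-9)[of x] by (auto intro!: divide_left_mono frac_le power_mono mult_pos_pos simp: less_imp_le)

lemma meas: "f : Bm ==> f : Mb T" for f :: "plane => real"
 by (simp add: meas_leb measurable_completion)

lemma bmeas: "bc : Bm" "bh : Bm"
 by (rule coef_measurable[OF Om]) (rule beta_h_measurable)

lemma bounded_integrable:
 assumes "f : Bm" "!!x. abs(f x) <= (c::real)" shows "L1 T f"
proof -
 interpret finite_measure "leb T" by (rule leb_finite(1)[OF T(1)])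
 show ?thesis
 proof (rule integrable_const_bound[of _ c])
  show "AE x in leb T. norm (f x) <= c" using assms(2) by simp
  show "f : Mb T" by (rule meas[OF assms(1)])
 qed
qed

lemma integrals: "L1 T bc" "L1 T (%x. 1/bh x)" "L1 T (%x. 1/bc x)"
 "L1 T (%x. bc x/(bh x)^2)"
proof -
 show "L1 T bc" by (rule bounded_integrable[of _ bb, OF bmeas(1)]) (use bnd in "simp add: less_imp_le")
 show "L1 T (%x. 1/bh x)"
  by (rule bounded_integrable[of _ "1/ba"]) (use bmeas bnd inv_bnd in "auto simp: less_imp_le")
 show "L1 T (%x. 1/bc x)"
  by (rule bounded_integrable[of _ "1/ba"]) (use bmeas bnd inv_bnd in "auto simp: less_imp_le")
 show "L1 T (%x. bc x/(bh x)^2)"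
  by (rule bounded_integrable[of _ "bb/ba^2"]) (use bmeas bnd inv_bnd in "auto simp: less_imp_le")
qed

lemma mean_bnd:
 assumes "L1 T f" "!!x. c <= f x" "!!x. f x <= (d::real)"
 shows "c*M <= (LINT x|leb T. f x)" "(LINT x|leb T. f x) <= d*M"
 unfolding leb_finite(3)[OF T(1), symmetric]
 by (intro integral_mono leb_finite(2)[OF T(1)] assms)+

lemma int_bnd: "ba*M <= Bc" "Bc <= bb*M" "(1/bb)*M <= P" "P <= (1/ba)*M" "(ba/bb^2)*M <= N" "N <= (bb/ba^2)*M"
 "0 < Bc" "0 < P" "0 < N"
proof -
 show 1: "ba*M <= Bc" "Bc <= bb*M" by (rule mean_bnd[OF integrals(1)]; rule bnd)+
 show 2: "(1/bb)*M <= P" "P <= (1/ba)*M" by (rule mean_bnd[OF integrals(2)]; rule inv_bnd)+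
 show 3: "(ba/bb^2)*M <= N" "N <= (bb/ba^2)*M" by (rule mean_bnd[OF integrals(4)]; rule inv_bnd)+
 have "0 < ba*M" "0 < (1/bb)*M" "0 < (ba/bb^2)*M" using bnd T(2) by simp_all
 thus "0 < Bc" "0 < P" "0 < N" using 1(1) 2(1) 3(1) by linarith+
qed

definition "\<tau>0 w = M*(w \<cdot> perp n)/Bc"
definition "\<nu>0 w = (w \<cdot> n)*P/N"

lemma Gop_eq: "Gop bm bp Om T D n w x = \<tau>0 w *R perp n + (\<nu>0 w/bh x) *R n"
 by (simp add: Gop_def lgrad_def \<tau>0_def \<nu>0_def)

lemma nn: "n \<cdot> n = 1" "perp n \<cdot> perp n = 1" "norm (perp n) = 1"
 using n by (auto simp: perp_simps norm_eq_1)

lemma comp_le: "abs(w \<cdot> n) <= norm w" "abs(w \<cdot> perp n) <= norm w"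
 using Cauchy_Schwarz_ineq2[of w n] Cauchy_Schwarz_ineq2[of w "perp n"] by (simp_all add: n nn)

lemma inner_split: "v \<cdot> w = (v \<cdot> perp n)*(w \<cdot> perp n) + (v \<cdot> n)*(w \<cdot> n)"
proof -
 have "v \<cdot> w = ((v \<cdot> perp n) *R perp n + (v \<cdot> n) *R n) \<cdot> w" using plane_decompose[OF n, of v] by simp
 thus ?thesis by (simp only: inner_add_left inner_scaleR_left inner_commute[of "perp n" w] inner_commute[of n w])
qed

definition "cG = 1/ba + bb^2/ba ^ 3"

lemma cG_pos: "cG > 0" using bnd by (simp add: cG_def add_pos_pos)

lemma Gop_norm: "norm (Gop bm bp Om T D n w x) <= cG*norm w"
proof -
 have "abs(\<tau>0 w) = M*abs(w \<cdot> perp n)/Bc" using int_bnd T by (simp add: \<tau>0_def abs_mult)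
 also have "... <= M*norm w/(ba*M)"
  by (rule frac_le[OF _ mult_left_mono[OF comp_le(2)] _ int_bnd(1)]) (use T bnd(1) in simp_all)
 also have "... = (1/ba)*norm w" using T by simp
 finally have 1: "abs(\<tau>0 w) <= (1/ba)*norm w" .
 have "abs(\<nu>0 w/bh x) = (abs(w \<cdot> n)*P/N)/bh x" using int_bnd bnd(9) by (simp add: \<nu>0_def abs_mult less_imp_le abs_of_pos)
 also have "... <= (norm w*((1/ba)*M)/((ba/bb^2)*M))/ba"

  by (rule frac_le[OF _ frac_le[OF _ mult_mono[OF comp_le(1) int_bnd(4)] _ int_bnd(5)] bnd(1) bnd(6)])
  (use T bnd(1-3) int_bnd(8) in "simp_all add: less_imp_le")
 also have "... = (bb^2/ba ^ 3)*norm w" using T bnd by (simp add: field_simps power2_eq_square power3_eq_cube)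
 finally have 2: "abs(\<nu>0 w/bh x) <= (bb^2/ba ^ 3)*norm w" .
 have "norm (Gop bm bp Om T D n w x) <= abs(\<tau>0 w) + abs(\<nu>0 w/bh x)"
  unfolding Gop_eq using norm_triangle_ineq[of "\<tau>0 w *R perp n" "(\<nu>0 w/bh x) *R n"] by (simp add: n nn)
 also have "... <= cG*norm w" unfolding cG_def distrib_right using 1 2 by linarith
 finally show ?thesis .
qed

lemma inner_Gop: "v \<cdot> Gop bm bp Om T D n w x = \<tau>0 w*(v \<cdot> perp n) + (\<nu>0 w*(v \<cdot> n))*(1/bh x)"
 unfolding Gop_eq by (simp add: inner_add_right)

lemma affine_integral: "(LINT x|leb T. c + d*(1/bh x)) = c*M + d*P"
 unfolding leb_finite(3)[OF T(1), symmetric] integral_mult_right_zero[symmetric]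
 by (rule LINT_add[OF leb_finite(2)[OF T(1)] L1_cmult[OF integrals(2)]])

text \<open>Tangential and normal parts decouple: with weights \<open>M*M/Bc\<close> and
  \<open>P*P/N\<close> the integral is a diagonal quadratic form in the two components of
  \<open>w\<close>, and both weights are comparable to the area.\<close>

lemma Gop_coercive: "(LINT x|leb T. w \<cdot> Gop bm bp Om T D n w x) >= (ba^2/bb ^ 3)*(M*(norm w)^2)"
proof -
 have "(LINT x|leb T. w \<cdot> Gop bm bp Om T D n w x) = \<tau>0 w*(w \<cdot> perp n)*M + \<nu>0 w*(w \<cdot> n)*P"
  unfolding inner_Gop affine_integral by simp
 also have "... = (w \<cdot> perp n)^2*(M*M/Bc) + (w \<cdot> n)^2*(P*P/N)" by (simp add: \<tau>0_def \<nu>0_def power2_eq_square mult_ac)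
 also have "... >= (w \<cdot> perp n)^2*((ba^2/bb ^ 3)*M) + (w \<cdot> n)^2*((ba^2/bb ^ 3)*M)"
 proof (intro add_mono mult_left_mono)
  have "ba^2 <= bb^2" using bnd by (intro power_mono) auto
  hence "(ba^2/bb ^ 3)*M <= (bb^2/bb ^ 3)*M" using bnd T by (intro mult_right_mono divide_right_mono) auto
  also have "... = M*M/(bb*M)" using bnd T by (simp add: power2_eq_square power3_eq_cube)
  also have "... <= M*M/Bc" using int_bnd T by (intro divide_left_mono) auto
  finally show "(ba^2/bb ^ 3)*M <= M*M/Bc" .
  have "(ba^2/bb ^ 3)*M = ((1/bb)*M)*((1/bb)*M)/((bb/ba^2)*M)" using bnd T by (simp add: field_simps power2_eq_square power3_eq_cube)
  also have "... <= P*P/N" using int_bnd T bnd by (intro frac_le mult_mono) (auto simp: less_imp_le)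
  finally show "(ba^2/bb ^ 3)*M <= P*P/N" .
 qed auto
 also have "(w \<cdot> perp n)^2*((ba^2/bb ^ 3)*M) + (w \<cdot> n)^2*((ba^2/bb ^ 3)*M) = (ba^2/bb ^ 3)*(M*(norm w)^2)"
  unfolding power2_norm_eq_inner[of w] inner_split[of w w] by (simp add: power2_eq_square algebra_simps)
 finally show ?thesis .
qed

text \<open>The tangential product meets the mean of \<open>coef\<close>; the normal one meets
  \<open>coef\<close> divided by the square of \<open>beta_h\<close>, one factor from each gradient.
  The denominators in \<open>Gop\<close> are these two integrals, so the true coefficient is matched
  exactly although the kink is on the chord.\<close>

lemma Gop_test:
 "(LINT x|leb T. bc x*(lgrad bm bp D n \<tau> \<nu> x \<cdot> Gop bm bp Om T D n w x)) = (LINT x|leb T. w \<cdot> lgrad bm bp D n \<tau> \<nu> x)"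
proof -
 have "(LINT x|leb T. bc x*(lgrad bm bp D n \<tau> \<nu> x \<cdot> Gop bm bp Om T D n w x))
  = (LINT x|leb T. \<tau> * \<tau>0 w*bc x + \<nu> * \<nu>0 w*(bc x/(bh x)^2))"
  by (rule LINT_cong)
  (simp_all add: inner_Gop lgrad_def inner_add_left nn perp_simps power2_eq_square algebra_simps)
 also have "... = \<tau> * \<tau>0 w*Bc + \<nu> * \<nu>0 w*N"
  unfolding integral_mult_right_zero[symmetric]
  by (rule LINT_add[OF L1_cmult[OF integrals(1)] L1_cmult[OF integrals(4)]])
 also have "... = \<tau>*(w \<cdot> perp n)*M + \<nu>*(w \<cdot> n)*P" using int_bnd by (simp add: \<tau>0_def \<nu>0_def)
 also have "... = (LINT x|leb T. \<tau>*(w \<cdot> perp n) + \<nu>*(w \<cdot> n)*(1/bh x))"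
  unfolding affine_integral ..
 also have "... = (LINT x|leb T. w \<cdot> lgrad bm bp D n \<tau> \<nu> x)"
  by (rule LINT_cong) (simp_all add: lgrad_def inner_add_right)
 finally show ?thesis .
qed

text \<open>The tangential estimate divides by the jump of the inverse coefficient. Equal
  coefficients are settled here: the consistency term is identically zero.\<close>

lemma Gop_no_jump: "bm = bp ==> Gop bm bp Om T D n w x = (1/bc x) *R w"
proof -
 assume e: "bm = bp"
 have c: "bc y = bp" "bh y = bp" for y using e by (simp_all add: coef_def beta_h_def)
 have "Bc = bp*M" "P = (1/bp)*M" "N = (bp/bp^2)*M" unfolding c by (rule leb_finite(3)[OF T(1)])+
 hence "\<tau>0 w = (1/bp)*(w \<cdot> perp n)" "\<nu>0 w = w \<cdot> n" using \<beta> T by (simp_all add: \<tau>0_def \<nu>0_def power2_eq_square)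
 hence "Gop bm bp Om T D n w x = (1/bp) *R ((w \<cdot> perp n) *R perp n + (w \<cdot> n) *R n)"
  unfolding Gop_eq c by (simp add: scaleR_add_right)
 thus ?thesis unfolding plane_decompose[OF n, symmetric] c .
qed

definition "mis = {x : T. bc x ~= bh x}"
definition "cM = bb ^ 3/ba ^ 4 + 1/ba"

lemma mis_lmeasurable: "mis : lmeasurable"
proof -
 have "{x. bc x ~= bh x} : sets borel" using bmeas by measurable
 hence "{x. bc x ~= bh x} : sets lebesgue" by simp
 hence "T \<inter> {x. bc x ~= bh x} : lmeasurable" using T by (intro fmeasurable_Int_fmeasurable) auto
 thus ?thesis by (simp add: mis_def Int_def)
qed

lemma mis_bound:
 assumes "L1 T f" "!!x. bc x = bh x ==> f x = 0" "!!x. abs(f x) <= (c::real)"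
 shows "abs(LINT x|leb T. f x) <= c * vol mis"
proof -
 have ml: "mis : sets lebesgue" and sub: "mis \<subseteq> T" and Tl: "T : sets lebesgue" using mis_lmeasurable T by (auto simp: mis_def fmeasurableD)
 have "(LINT x|leb T. f x) = (LINT x|leb mis. f x)"
  by (rule LINT_support(1)[OF Tl ml sub]) (use assms(2) in "auto simp: mis_def")
 also have "\<bar>...\<bar> <= (LINT x|leb mis. c)"
  by (rule abs_LINT_le[OF leb_finite(2)[OF mis_lmeasurable]]) (use assms(3) in simp)
 also have "... = c * vol mis" by (rule leb_finite(3)[OF mis_lmeasurable])
 finally show ?thesis .
qed

text \<open>Split \<open>u\<close> into its deviation from \<open>ub\<close> and the constant
  \<open>ub\<close>. The first part and the tangential component of \<open>ub\<close> meet a bounded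
  factor. In the normal direction the integral of that factor is a combination of differences of
  \<open>P\<close>, \<open>N\<close> and \<open>Q = \<integral> 1/coef\<close>, which coincide where
  \<open>coef\<close> and \<open>beta_h\<close> agree, so it is bounded by the area of
  \<open>mis\<close>.\<close>

lemma Gop_consistency:
 assumes u: "L1 T u"
 shows "abs(LINT x|leb T. u x \<cdot> (Gop bm bp Om T D n w x - (1/bc x) *R w))
  <= (cG + 1/ba + cM)*norm w*((LINT x|leb T. norm (u x - ub)) + M*abs(ub \<cdot> perp n) + norm ub * vol mis)"
proof -
 define Z where "Z x = Gop bm bp Om T D n w x - (1/bc x) *R w" for x
 define c1 where "c1 = cG + 1/ba"
 have c1: "c1 >= 0" using cG_pos bnd(1) by (simp add: c1_def)
 have cM: "cM >= 0" using bnd by (simp add: cM_def)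
 have Zn: "norm (Z x) <= c1*norm w" for x
 proof -
  have "norm ((1/bc x) *R w) <= (1/ba)*norm w" using inv_bnd(4)[of x] bnd(8)[of x] by (simp only: norm_scaleR) (intro mult_right_mono; simp)
  thus ?thesis unfolding Z_def c1_def distrib_right using Gop_norm[of w x] norm_triangle_ineq4[of "Gop bm bp Om T D n w x" "(1/bc x) *R w"] by linarith
 qed
 have vZ: "v \<cdot> Z x = (v \<cdot> perp n)*(\<tau>0 w - (1/bc x)*(w \<cdot> perp n)) + (v \<cdot> n)*(\<nu>0 w*(1/bh x) - (w \<cdot> n)*(1/bc x))" for v x
  unfolding Z_def inner_diff_right inner_Gop inner_scaleR_right inner_split[of v w] by (simp add: algebra_simps)
 have zt: "L1 T (%x. \<tau>0 w - (1/bc x)*(w \<cdot> perp n))"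
  by (intro L1_diff leb_finite(2)[OF T(1)] integrable_mult_left integrals(3))
 have zn: "L1 T (%x. \<nu>0 w*(1/bh x) - (w \<cdot> n)*(1/bc x))"
  by (intro L1_diff L1_cmult integrals)
 have Zi: "L1 T (%x. v \<cdot> Z x)" for v
  unfolding vZ by (intro L1_add L1_cmult zt zn)
 have Zm: "(%x. v \<cdot> Z x) : Mb T" for v by (rule L1_meas[OF Zi])
 have ui: "L1 T (%x. u x - ub)"
  by (rule L1_diff[OF u finite_measure.integrable_const[OF leb_finite(1)[OF T(1)]]])
 have Zeq: "Z x = (Z x \<cdot> perp n) *R perp n + (Z x \<cdot> n) *R n" for x by (rule plane_decompose[OF n])
 have Zme: "Z : Mb T"
  by (subst Zeq[abs_def]) (intro borel_measurable_add borel_measurable_scaleR borel_measurable_const; simp add: inner_commute[of "Z _"] Zm)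
 have bound1: "abs((u x - ub) \<cdot> Z x) <= c1*norm w*norm (u x - ub)" for x
 proof -
  have "abs((u x - ub) \<cdot> Z x) <= norm (u x - ub)*norm (Z x)" by (rule Cauchy_Schwarz_ineq2)
  also have "... <= norm (u x - ub)*(c1*norm w)" by (rule mult_left_mono[OF Zn]) simp
  finally show ?thesis by (simp add: mult_ac)
 qed
 have bi: "L1 T (%x. c1*norm w*norm (u x - ub))" using ui by simp
 have i1: "L1 T (%x. (u x - ub) \<cdot> Z x)"
 proof (rule L1_bound[OF bi])
  show "(%x. (u x - ub) \<cdot> Z x) : Mb T"
  by (rule borel_measurable_inner[OF L1_meas[OF ui] Zme])
  show "AE x in leb T. norm ((u x - ub) \<cdot> Z x) <= norm (c1*norm w*norm (u x - ub))"
  using bound1 c1 by (intro AE_I2) simp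
 qed
 have "(LINT x|leb T. u x \<cdot> Z x) = (LINT x|leb T. (u x - ub) \<cdot> Z x + ub \<cdot> Z x)" by (simp add: inner_diff_left)
 also have "... = (LINT x|leb T. (u x - ub) \<cdot> Z x) + (LINT x|leb T. ub \<cdot> Z x)"
  by (rule LINT_add[OF i1 Zi])
 also have "(LINT x|leb T. ub \<cdot> Z x) = (ub \<cdot> perp n)*(LINT x|leb T. perp n \<cdot> Z x) + (ub \<cdot> n)*(LINT x|leb T. n \<cdot> Z x)"
 proof -
  have "(LINT x|leb T. ub \<cdot> Z x) = (LINT x|leb T. (ub \<cdot> perp n)*(perp n \<cdot> Z x) + (ub \<cdot> n)*(n \<cdot> Z x))"
  by (simp add: inner_split[of ub "Z _"] inner_commute[of "Z _"])
  also have "... = (ub \<cdot> perp n)*(LINT x|leb T. perp n \<cdot> Z x) + (ub \<cdot> n)*(LINT x|leb T. n \<cdot> Z x)"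
  using Zi by simp
  finally show ?thesis .
 qed
 finally have split: "(LINT x|leb T. u x \<cdot> Z x) = (LINT x|leb T. (u x - ub) \<cdot> Z x)
  + ((ub \<cdot> perp n)*(LINT x|leb T. perp n \<cdot> Z x) + (ub \<cdot> n)*(LINT x|leb T. n \<cdot> Z x))" .
 have A: "abs(LINT x|leb T. (u x - ub) \<cdot> Z x) <= c1*norm w*(LINT x|leb T. norm (u x - ub))"
  using abs_LINT_le[OF bi, of "%x. (u x - ub) \<cdot> Z x"] bound1 by simp
 have "abs(LINT x|leb T. perp n \<cdot> Z x) <= (LINT x|leb T. c1*norm w)"
 proof (rule abs_LINT_le[OF leb_finite(2)[OF T(1)]])
  have "abs(perp n \<cdot> Z x) <= c1*norm w" for x using Cauchy_Schwarz_ineq2[of "perp n" "Z x"] Zn[of x] by (simp add: nn)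
  thus "AE x in leb T. abs(perp n \<cdot> Z x) <= c1*norm w" by simp
 qed
 hence B: "abs(LINT x|leb T. perp n \<cdot> Z x) <= c1*norm w*M" unfolding leb_finite(3)[OF T(1)] .
 define Q where "Q = (LINT x|leb T. 1/bc x)"
 have "n \<cdot> Z x = \<nu>0 w*(1/bh x) - (w \<cdot> n)*(1/bc x)" for x unfolding vZ by (simp add: nn perp_simps)
 hence "(LINT x|leb T. n \<cdot> Z x) = (LINT x|leb T. \<nu>0 w*(1/bh x) - (w \<cdot> n)*(1/bc x))" by (simp only:)
 also have "... = \<nu>0 w*P - (w \<cdot> n)*Q"
  unfolding Q_def integral_mult_right_zero[symmetric]
  by (rule LINT_diff[OF L1_cmult[OF integrals(2)] L1_cmult[OF integrals(3)]])
 also have "... = (w \<cdot> n)*((P/N)*(P - N) + (P - Q))" using int_bnd(9) by (simp add: \<nu>0_def field_simps)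
 finally have nZ: "(LINT x|leb T. n \<cdot> Z x) = (w \<cdot> n)*((P/N)*(P - N) + (P - Q))" .
 have PN: "abs(P - N) <= (bb/ba^2) * vol mis"
 proof -
  have "P - N = (LINT x|leb T. 1/bh x - bc x/(bh x)^2)"
  by (rule LINT_diff[OF integrals(2,4), symmetric])
  also have "\<bar>...\<bar> <= (bb/ba^2) * vol mis"
  proof (rule mis_bound)
  show "L1 T (%x. 1/bh x - bc x/(bh x)^2)" by (rule L1_diff[OF integrals(2,4)])
  show "bc x = bh x ==> 1/bh x - bc x/(bh x)^2 = 0" for x using bnd(9)[of x] by (simp add: power2_eq_square)
  fix x
  have "1/bh x - bc x/(bh x)^2 = (bh x - bc x)/(bh x)^2" using bnd(9)[of x] by (simp add: field_simps power2_eq_square)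
  also have "\<bar>...\<bar> = \<bar>bh x - bc x\<bar> / (bh x)^2" by simp
  also have "... <= bb/ba^2" using bnd(1-3) bnd(4-9)[of x] by (intro frac_le power_mono) auto
  finally show "abs(1/bh x - bc x/(bh x)^2) <= bb/ba^2" .
  qed
  finally show ?thesis .
 qed
 have PQ: "abs(P - Q) <= (1/ba) * vol mis"
 proof -
  have "P - Q = (LINT x|leb T. 1/bh x - 1/bc x)"
  unfolding Q_def by (rule LINT_diff[OF integrals(2,3), symmetric])
  also have "\<bar>...\<bar> <= (1/ba) * vol mis"
  proof (rule mis_bound)
  show "L1 T (%x. 1/bh x - 1/bc x)" by (rule L1_diff[OF integrals(2,3)])
  show "abs(1/bh x - 1/bc x) <= 1/ba" for x
  proof -
  have "0 <= 1/bh x" "0 <= 1/bc x" using bnd(1-3) bnd(4-9)[of x] by simp_all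
  thus ?thesis using inv_bnd(1-4)[of x] by linarith
  qed
  qed simp
  finally show ?thesis .
 qed
 have PdN: "0 <= P/N" "P/N <= bb^2/ba^2"
 proof -
  show "0 <= P/N" using int_bnd by simp
  have "P/N <= ((1/ba)*M)/((ba/bb^2)*M)" using int_bnd bnd T by (intro frac_le) (auto simp: less_imp_le)
  also have "... = bb^2/ba^2" using bnd T by (simp add: field_simps power2_eq_square)
  finally show "P/N <= bb^2/ba^2" .
 qed
 have "abs((P/N)*(P - N) + (P - Q)) <= (bb^2/ba^2)*((bb/ba^2) * vol mis) + (1/ba) * vol mis"
 proof -
  have "abs((P/N)*(P - N)) <= (bb^2/ba^2)*((bb/ba^2) * vol mis)"
  unfolding abs_mult abs_of_nonneg[OF PdN(1)] by (rule mult_mono[OF PdN(2) PN]) auto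
  thus ?thesis using PQ by linarith
 qed
 also have "... = cM * vol mis" using bnd(1) by (simp add: cM_def field_simps power2_eq_square power3_eq_cube eval_nat_numeral)
 finally have "abs(LINT x|leb T. n \<cdot> Z x) <= norm w*(cM * vol mis)"
  unfolding nZ abs_mult[of "w \<cdot> n"] by (intro mult_mono comp_le) auto
 hence C: "abs((ub \<cdot> n)*(LINT x|leb T. n \<cdot> Z x)) <= norm ub*(norm w*(cM * vol mis))"
  unfolding abs_mult by (intro mult_mono comp_le) auto
 have B': "abs((ub \<cdot> perp n)*(LINT x|leb T. perp n \<cdot> Z x)) <= abs(ub \<cdot> perp n)*(c1*norm w*M)"
  unfolding abs_mult by (rule mult_left_mono[OF B]) simp
 define a1 a2 a3 where "a1 = (LINT x|leb T. norm (u x - ub))" and "a2 = M*abs(ub \<cdot> perp n)" and "a3 = norm ub * vol mis"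
 have a: "0 <= a1" "0 <= a2" "0 <= a3" using T by (auto simp: a1_def a2_def a3_def intro!: LINT_nonneg)
 have "abs(LINT x|leb T. u x \<cdot> Z x) <= c1*norm w*a1 + c1*norm w*a2 + cM*norm w*a3"
  unfolding split using A B' C unfolding a1_def a2_def a3_def by (simp add: mult_ac)
 also have "... <= (c1 + cM)*norm w*a1 + (c1 + cM)*norm w*a2 + (c1 + cM)*norm w*a3"
  using a c1 cM by (intro add_mono mult_right_mono) auto
 also have "... = (cG + 1/ba + cM)*norm w*(a1 + a2 + a3)" by (simp only: c1_def distrib_left)
 finally show ?thesis unfolding Z_def a1_def a2_def a3_def .
qed

end

section \<open>The consistency estimate on interface elements\<close>

lemma cbox_box_LINT:
 fixes f :: "plane => real"
 assumes "L1 (box p q) f"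
 shows "(LINT x|leb (cbox p q). f x) = (LINT x|leb (box p q). f x)"
proof (rule leb_AE_set(2)[OF _ _ _ assms])
 have "negligible (frontier (cbox p q))" by (rule negligible_convex_frontier) (rule convex_box)
 hence "negligible (cbox p q - box p q)" by (simp add: frontier_cbox split: if_splits)
 hence "AE x in lebesgue. x ~: cbox p q - box p q" unfolding negligible_iff_null_sets by (rule AE_not_in)
 thus "AE x in lebesgue. x : box p q \<longleftrightarrow> x : cbox p q" by eventually_elim (use box_subset_cbox in blast)
qed auto

lemma square_norm_le2: "(norm (v :: plane)) <= abs(v$1) + abs(v$2)"
 using norm_le_l1_cart[of v] by (simp add: sum_2)

lemma mean_square:
 assumes S: "S : lmeasurable" "vol S > 0" and f: "f : L2 S"
 shows "((LINT x|leb S. f x)/vol S)^2 <= (LINT x|leb S. (norm (f x :: real))^2)/vol S"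
proof -
 have "abs(LINT x|leb S. f x) <= (LINT x|leb S. norm (f x))" using integral_norm_bound[of "leb S" f] by simp
 hence "(LINT x|leb S. f x)^2 <= (LINT x|leb S. norm (f x))^2" by (intro abs_le_square_iff[THEN iffD1]) simp
 also have "... <= vol S*(LINT x|leb S. (norm (f x))^2)" by (rule L1_L2[OF S(1) f])
 finally show ?thesis using S(2) by (simp add: power_divide divide_le_eq power2_eq_square mult.commute)
qed

text \<open>Take for \<open>ub\<close> the mean of \<open>u\<close> over the square around
  \<open>D\<close>. The three terms of \<open>Gop_consistency\<close> are then bounded by the
  Poincare inequality on the square, by \<open>tangential_estimate\<close>, and by the area of a
  thin rectangle containing \<open>mis\<close>. The bound on \<open>e^2\<close> carries the factor
  \<open>vol T\<close> because that is the form that can be absorbed.\<close>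

lemma interface_estimate:
 assumes \<beta>: "bm > 0" "bp > 0" and C: "C >= 0" and \<kappa>: "\<kappa> > 0"
 shows "EX K>=0. ALL \<O> Om u U p gp T D n h. open \<O> --> open Om --> 0 < h --> 4*(C + 1)*h <= 1 --> norm n = 1 -->
  Sq D h \<subseteq> \<O> -->
  (ALL m. (%x. u x$m) : H1 \<O>) --> (ALL m. U m = wgrad \<O> (%x. u x$m)) --> has_weak_grad \<O> p gp -->
  (AE x in leb \<O>. gp x = (- 1/coef Om bm bp x) *R u x) -->
  (ALL x:Sq D h. C*h^2 < abs(n \<cdot> (x - D)) --> (x : Om \<longleftrightarrow> n \<cdot> (x - D) < 0)) -->
  T : lmeasurable --> (ALL x:T. ALL l. abs(x$l - D$l) <= h) --> vol T <= h^2 --> h\<^sup>2 <= \<kappa> * vol T -->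
  (EX e>=0. (ALL w. abs(LINT x|leb T. u x \<cdot> (Gop bm bp Om T D n w x - (1/coef Om bm bp x) *R w)) <= norm w*e) &
  e^2 <= vol T*(K*h^2*(LINT x|leb (Sq D h). (norm (u x))^2 + ((norm (U 1 x))^2 + (norm (U 2 x))^2))))"
proof (cases "bm = bp")
 case True
 show ?thesis
 proof (rule exI[of _ 0], intro conjI allI impI, simp, goal_cases)
  case (1 \<O> Om u U p gp T D n h)
  have "0 < h^2" using 1(3) by simp
  with 1(15) have "0 < \<kappa> * vol T" by linarith
  hence M: "vol T > 0" using \<kappa> by (simp add: zero_less_mult_iff)
  interpret cut_element bm bp Om T D n by unfold_locales (use \<beta> 1(2,5,12) M in auto)
  show ?case by (rule exI[of _ 0]) (simp add: Gop_no_jump[OF True])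
 qed
next
 case False
 obtain Kt where Kt: "Kt >= 0" and tang: "!!\<O> Om u U p gp D n h ub. open \<O> ==> open Om ==> 0 < h ==> 4*(C + 1)*h <= 1 ==> norm n = 1 ==>
  Sq D h \<subseteq> \<O> ==>
  (ALL i. has_weak_grad \<O> (%x. u x$i) (U i)) ==> has_weak_grad \<O> p gp ==>
  (AE x in leb \<O>. gp x = (- 1/coef Om bm bp x) *R u x) ==>
  (ALL x:Sq D h. C*h^2 < abs(n \<cdot> (x - D)) --> (x : Om \<longleftrightarrow> n \<cdot> (x - D) < 0)) ==>
  h^2*abs(ub \<cdot> perp n) <= Kt*((LINT x|leb (Sq D h). norm (u x - ub))
  + h*(LINT x|leb (Sq D h). norm (U 1 x) + norm (U 2 x)) + h ^ 3*norm ub)"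
  using tangential_estimate[OF \<beta> False C] by blast
 define a b where "a = min bm bp" and "b = max bm bp"
 define c0 where "c0 = (1/a + b^2/a ^ 3) + 1/a + (b ^ 3/a ^ 4 + 1/a)"
 have a0: "a > 0" "b > 0" using \<beta> by (simp_all add: a_def b_def)
 have c0: "c0 >= 0" using a0 by (simp add: c0_def)
 define c1 where "c1 = c0*(1 + Kt + 12*(C + 1))"
 have c1: "c1 >= 0" using c0 Kt C by (simp add: c1_def)
 \<comment> \<open>The 3 comes from squaring a sum of three terms. The 5000 dominates
   \<open>4096 + 32\<close>: area \<open>16*h^2\<close> times Poincare constant
   \<open>256*h^2\<close> for the deviation, and 32 for the gradient term. The factor
   \<open>\<kappa>\<close> converts \<open>h^2\<close> into the area of \<open>T\<close>.\<close>
 define K where "K = 3*c1^2*5000 * \<kappa>"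
 have K: "K >= 0" using \<kappa> by (simp add: K_def)
 have main: "EX e>=0. (ALL w. abs(LINT x|leb T. u x \<cdot> (Gop bm bp Om T D n w x - (1/coef Om bm bp x) *R w)) <= norm w*e) &
  e^2 <= vol T*(K*h^2*(LINT x|leb Q. (norm (u x))^2 + ((norm (U 1 x))^2 + (norm (U 2 x))^2)))"
  if \<O>: "open \<O>" and Om: "open Om" and h: "0 < h" "4*(C + 1)*h <= 1" and n: "norm n = 1"
  and Qdef: "Q = Sq D h" and Q: "Q \<subseteq> \<O>"
  and uH: "ALL m. (%x. u x$m) : H1 \<O>" and U: "ALL m. U m = wgrad \<O> (%x. u x$m)" and wp: "has_weak_grad \<O> p gp"
  and gpu: "AE x in leb \<O>. gp x = (- 1/coef Om bm bp x) *R u x"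
  and reg: "ALL x:Q. C*h^2 < abs(n \<cdot> (x - D)) --> (x : Om \<longleftrightarrow> n \<cdot> (x - D) < 0)"
  and T: "T : lmeasurable" and TD: "ALL x:T. ALL l. abs(x$l - D$l) <= h" and Th: "vol T <= h^2" "h^2 <= \<kappa> * vol T"
  for \<O> Om u U p gp T D n h Q
 proof -
  let ?M = "vol T"
  have h2: "0 < h^2" using h by simp
  with Th(2) have "0 < \<kappa> * ?M" by linarith
  hence M: "?M > 0" using \<kappa> by (simp add: zero_less_mult_iff)
  interpret ce: cut_element bm bp Om T D n by unfold_locales (use \<beta> Om T M n in auto)
  define Qo where "Qo = box (D - pt (2*h) (2*h)) (D + pt (2*h) (2*h))"
  have QoQ: "Qo \<subseteq> Q" unfolding Qo_def Qdef by (rule box_subset_cbox)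
  have Qo: "open Qo" "convex Qo" "bounded Qo" "Qo : lmeasurable" "Qo : sets lebesgue" by (auto simp: Qo_def bounded_box)
  have Qm: "Q : lmeasurable" "Q : sets lebesgue" by (auto simp: Qdef)
  have \<O>l: "\<O> : sets lebesgue" using \<O> by auto
  have Qo\<O>: "Qo \<subseteq> \<O>" using QoQ Q by (rule subset_trans)
  have bas: "v : Basis ==> (D - pt (2*h) (2*h)) \<cdot> v <= (D + pt (2*h) (2*h)) \<cdot> v" for v
  using h by (auto simp: Basis_plane inner_axis_plane)
  have "measure lborel Qo = 16*h^2" "measure lborel Q = 16*h^2"
  unfolding Qo_def Qdef using measure_lborel_box[OF bas] measure_lborel_cbox[OF bas] by (simp_all add: prod_Basis_plane inner_axis_plane power2_eq_square)
  hence Qmeas: "vol Qo = 16*h^2" "vol Q = 16*h^2" by (simp_all add: Qo_def Qdef)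
  have D: "D : Qo" using h by (auto simp: Qo_def mem_box_cart forall_2)
  have TQ: "T \<subseteq> Q"
  proof
  fix x assume "x : T"
  hence "abs(x$1 - D$1) <= h" "abs(x$2 - D$2) <= h" using TD by auto
  thus "x : Q" using h(1) unfolding Qdef by (simp add: mem_box_cart forall_2 abs_le_iff)
  qed
  have UL: "U m : L2 \<O>" and uL: "(%x. u x$m) : L2 \<O>" and wu: "has_weak_grad \<O> (%x. u x$m) (U m)" for m
  using H1_wgrad[OF \<O> uH[THEN spec, of m]] U by auto
  have ULQ: "U m : L2 Q" and uLQ: "(%x. u x$m) : L2 Q" and uLQo: "(%x. u x$m) : L2 Qo" and ULQo: "U m : L2 Qo" for m
  by (rule L2_subset[OF UL \<O>l Qm(2) Q] L2_subset[OF uL \<O>l Qm(2) Q] L2_subset[OF uL \<O>l Qo(5) Qo\<O>] L2_subset[OF UL \<O>l Qo(5) Qo\<O>])+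
  have U2i: "L1 Q (%x. (norm (U m x))^2)" "L1 Qo (%x. (norm (U m x))^2)"
  and u2i: "L1 Q (%x. (u x$m)^2)" for m
  using ULQ[of m] ULQo[of m] uLQ[of m] by (simp_all add: L2_def)
  define \<mu> where "\<mu> m = (LINT x|leb Qo. u x$m)/(16*h^2)" for m
  define ub where "ub = pt (\<mu> 1) (\<mu> 2)"
  define I1 where "I1 = (LINT x|leb Q. (norm (U 1 x))^2 + (norm (U 2 x))^2)"
  define I0 where "I0 = (LINT x|leb Q. (norm (u x))^2)"
  have norm_u: "(%x. (norm (u x))^2) = (%x. (u x$1)^2 + (u x$2)^2)" by (rule ext) (rule plane_norm_square)
  have I0i: "L1 Q (%x. (norm (u x))^2)" unfolding norm_u by (intro L1_add u2i)
  have I1i: "L1 Q (%x. (norm (U 1 x))^2 + (norm (U 2 x))^2)" by (intro L1_add U2i)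
  have Isplit: "(LINT x|leb Q. (norm (u x))^2 + ((norm (U 1 x))^2 + (norm (U 2 x))^2)) = I0 + I1"
  unfolding I0_def I1_def by (rule LINT_add[OF I0i I1i])
  have I1s: "I1 = (LINT x|leb Q. (norm (U 1 x))^2) + (LINT x|leb Q. (norm (U 2 x))^2)"
  unfolding I1_def by (rule LINT_add[OF U2i(1) U2i(1)])
  have I0s: "I0 = (LINT x|leb Q. (u x$1)^2) + (LINT x|leb Q. (u x$2)^2)"
  unfolding I0_def norm_u by (rule LINT_add[OF u2i u2i])
  have I0n: "0 <= I0" "0 <= I1" unfolding I0_def I1_def by (rule LINT_nonneg; simp)+
  have pw: "L1 Qo (%x. (u x$m - \<mu> m)^2)"
  "(LINT x|leb Q. (u x$m - \<mu> m)^2) <= 256*h^2*(LINT x|leb Q. (norm (U m x))^2)" for m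
  proof -
  note hs = H1_subset[OF \<O> Qo(1) Qo\<O> uH[THEN spec, of m]]
  have ne: "Qo ~= {}" using D by auto
  have diam: "abs(x$1 - y$1) <= 4*h & abs(x$2 - y$2) <= 4*h" if "x : Qo" "y : Qo" for x y
  using that unfolding Qo_def mem_box_cart forall_2 by (simp add: abs_le_iff)
  have shape: "4*h*(4*h) <= 2 * vol Qo" unfolding Qmeas by (simp add: power2_eq_square)
  show i: "L1 Qo (%x. (u x$m - \<mu> m)^2)"
  unfolding \<mu>_def by (rule poincare_H1(1)[OF Qo(1-3) ne hs(1) _ shape, unfolded Qmeas]) (erule (1) diam)
  have "(LINT x|leb Qo. (u x$m - \<mu> m)^2) <= 8*((4*h)^2 + (4*h)^2)*(LINT x|leb Qo. (norm (wgrad Qo (%x. u x$m) x))^2)"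
  unfolding \<mu>_def by (rule poincare_H1(2)[OF Qo(1-3) ne hs(1) _ shape, unfolded Qmeas]) (erule (1) diam)
  also have "(LINT x|leb Qo. (norm (wgrad Qo (%x. u x$m) x))^2) = (LINT x|leb Qo. (norm (U m x))^2)"
  proof (rule leb_AE_cong(3)[OF Qo(5) _ U2i(2)])
  show "AE x in leb Qo. (norm (U m x))^2 = (norm (wgrad Qo (%x. u x$m) x))^2"
  using hs(2) unfolding U[THEN spec, of m] by eventually_elim simp
  qed
  finally show "(LINT x|leb Q. (u x$m - \<mu> m)^2) <= 256*h^2*(LINT x|leb Q. (norm (U m x))^2)"
  unfolding Qdef cbox_box_LINT[OF i[unfolded Qo_def]] cbox_box_LINT[OF U2i(2)[unfolded Qo_def]] Qo_def[symmetric] by (simp add: power_mult_distrib)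
  qed
  have cst: "L1 Q (%x. (c :: plane))" for c
  by (rule finite_measure.integrable_const[OF leb_finite(1)[OF Qm(1)]])
  have ui: "L1 Q u"
  proof -
  have "L1 Q (%x. u x$i)" for i by (rule L2_L1(2)[OF Qm(1) uLQ])
  hence "L1 Q (%x. u x$1 *R (axis 1 1 :: plane) + u x$2 *R axis 2 1)"
  by (intro L1_add integrable_scaleR_left)
  thus ?thesis by (simp flip: pt_axis)
  qed
  have udi: "L1 Q (%x. u x - ub)" by (rule L1_diff[OF ui cst])
  have ud2: "L1 Q (%x. (u x$m - c)^2)" for m c
  proof -
  have "L1 Q (%x. (u x$m)^2 - 2*c*(u x$m) + c^2)"
  by (intro L1_add L1_diff u2i L1_cmult L2_L1(2)[OF Qm(1) uLQ] leb_finite(2)[OF Qm(1)])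
  thus ?thesis by (simp add: power2_diff algebra_simps)
  qed
  have ndiff: "(%x. (norm (u x - ub))^2) = (%x. (u x$1 - \<mu> 1)^2 + (u x$2 - \<mu> 2)^2)"
  by (rule ext) (simp add: plane_norm_square ub_def)
  have udL2: "(%x. u x - ub) : L2 Q"
  unfolding L2_def mem_Collect_eq ndiff by (intro conjI L1_add ud2 L1_meas[OF udi])
  define A where "A = (LINT x|leb Q. norm (u x - ub))"
  define B where "B = (LINT x|leb Q. norm (U 1 x) + norm (U 2 x))"
  have A2: "A^2 <= 4096*h ^ 4*I1"
  proof -
  have "A^2 <= 16*h^2*(LINT x|leb Q. (norm (u x - ub))^2)"
  using L1_L2[OF Qm(1) udL2] unfolding Qmeas A_def .
  also have "(LINT x|leb Q. (norm (u x - ub))^2) = (LINT x|leb Q. (u x$1 - \<mu> 1)^2) + (LINT x|leb Q. (u x$2 - \<mu> 2)^2)"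
  unfolding ndiff by (rule LINT_add[OF ud2 ud2])
  also have "16*h^2 * ... <= 16*h^2*(256*h^2*I1)"
  unfolding I1s distrib_left[of "256*h^2"] by (intro mult_left_mono add_mono pw(2)) simp
  finally show ?thesis by (simp add: power2_eq_square eval_nat_numeral mult_ac)
  qed
  have B2: "(h*B)^2 <= 32*h ^ 4*I1"
  proof -
  define B1 where "B1 m = (LINT x|leb Q. norm (U m x))" for m
  have "B = B1 1 + B1 2" unfolding B_def B1_def
  by (rule LINT_add[OF L2_L1(1)[OF Qm(1) ULQ] L2_L1(1)[OF Qm(1) ULQ]])
  hence "B^2 <= 2*((B1 1)^2 + (B1 2)^2)" using sum_squares_bound[of "B1 1" "B1 2"] by (simp add: power2_sum)
  also have "... <= 2*(16*h^2*I1)"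
  unfolding I1s distrib_left[of "16*h^2"] B1_def using L1_L2[OF Qm(1) ULQ] unfolding Qmeas by (intro mult_left_mono add_mono) auto
  finally have "h^2*B^2 <= h^2*(2*(16*h^2*I1))" by (intro mult_left_mono) auto
  thus ?thesis by (simp add: power2_eq_square eval_nat_numeral mult_ac)
  qed
  have ub2: "(h ^ 3*norm ub)^2 <= h ^ 4*I0"
  proof -
  have m2: "(\<mu> m)^2 <= (LINT x|leb Q. (u x$m)^2)/(16*h^2)" for m
  proof -
  have i: "L1 Qo (%x. (u x$m)^2)" using uLQo[of m] by (simp add: L2_def)
  have "(\<mu> m)^2 <= (LINT x|leb Qo. (u x$m)^2)/(16*h^2)"
  using mean_square[OF Qo(4) _ uLQo[of m]] h2 unfolding Qmeas \<mu>_def by simp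
  thus ?thesis unfolding Qdef cbox_box_LINT[OF i[unfolded Qo_def]] unfolding Qo_def .
  qed
  have "(norm ub)^2 = (\<mu> 1)^2 + (\<mu> 2)^2" by (simp add: ub_def plane_norm_square)
  also have "... <= I0/(16*h^2)" unfolding I0s add_divide_distrib by (intro add_mono m2)
  finally have "h ^ 6*(norm ub)^2 <= h ^ 6*(I0/(16*h^2))" using h(1) by (intro mult_left_mono) auto
  also have "... = h ^ 4*I0/16" using h(1) by (simp add: eval_nat_numeral)
  also have "... <= h ^ 4*I0" using I0n(1) h(1) by simp
  finally show ?thesis by (simp add: power_mult_distrib flip: power_mult)
  qed
  have A0: "A >= 0" "B >= 0" unfolding A_def B_def by (rule LINT_nonneg; simp)+
  define E where "E = A + h*B + h ^ 3*norm ub"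
  have E0: "E >= 0" using A0 h(1) by (simp add: E_def)
  have AE: "A <= E" "h ^ 3*norm ub <= E" using A0 h(1) by (simp_all add: E_def)
  have E2: "E^2 <= 3*5000*h ^ 4*(I0 + I1)"
  proof -
  have "E^2 <= 3*(A^2 + (h*B)^2 + (h ^ 3*norm ub)^2)" unfolding E_def by (rule square_sum3)
  also have "... <= 3*(4096*h ^ 4*I1 + 32*h ^ 4*I1 + h ^ 4*I0)" using A2 B2 ub2 by (intro mult_left_mono add_mono) auto
  also have "... <= 3*5000*h ^ 4*(I0 + I1)"
  proof -
  have "0 <= h ^ 4*I1" "0 <= h ^ 4*I0" using I0n h(1) by simp_all
  thus ?thesis unfolding distrib_left by linarith
  qed
  finally show ?thesis .
  qed
  have tan: "h^2*abs(ub \<cdot> perp n) <= Kt*E"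
  unfolding E_def A_def B_def Qdef by (rule tang[OF \<O> Om h n Q[unfolded Qdef] _ wp gpu reg[unfolded Qdef]]) (use wu in blast)
  \<comment> \<open>Where the coefficients differ, a point of \<open>T\<close> is within
    \<open>(C + 1)*h^2\<close> of the chord line and within \<open>3*h\<close> along it.\<close>
  have mis: "vol ce.mis <= 12*(C + 1)*h ^ 3"
  proof -
  let ?R = "{x. - ((C + 1)*h^2) < n \<cdot> (x - D) & n \<cdot> (x - D) < (C + 1)*h^2 & - (3*h) < perp n \<cdot> (x - D) & perp n \<cdot> (x - D) < 3*h}"
  have cp: "0 < (C + 1)*h^2" using C h2 by simp
  have R: "?R : lmeasurable" "vol ?R = (2*((C + 1)*h^2))*(6*h)"
  using rectangle_measure[OF n, of "- ((C + 1)*h^2)" "(C + 1)*h^2" "- (3*h)" "3*h" D] cp h(1) by simp_all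
  have "ce.mis \<subseteq> ?R"
  proof
  fix x assume "x : ce.mis"
  hence x: "x : T" "coef Om bm bp x ~= beta_h bm bp D n x" by (auto simp: ce.mis_def)
  have "\<not> C*h^2 < abs(n \<cdot> (x - D))"
  proof
  assume "C*h^2 < abs(n \<cdot> (x - D))"
  moreover from this have "n \<cdot> (x - D) ~= 0" using mult_nonneg_nonneg[OF C zero_le_power2[of h]] by auto
  ultimately show False using reg x TQ by (auto simp: coef_def beta_h_def split: if_splits)
  qed
  hence 1: "abs(n \<cdot> (x - D)) < (C + 1)*h^2" using h2 unfolding distrib_right by linarith
  have "abs((x - D)$1) <= h" "abs((x - D)$2) <= h" using TD x by auto
  hence "norm (x - D) <= 2*h" using square_norm_le2[of "x - D"] by linarith
  moreover have "abs(perp n \<cdot> (x - D)) <= norm (x - D)" using Cauchy_Schwarz_ineq2[of "perp n" "x - D"] by (simp add: perp_simps n)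
  ultimately have "abs(perp n \<cdot> (x - D)) < 3*h" using h(1) by linarith
  with 1 show "x : ?R" by auto
  qed
  hence "vol ce.mis <= vol ?R" using R(1) ce.mis_lmeasurable by (intro measure_mono_fmeasurable) auto
  thus ?thesis unfolding R(2) by (simp add: power2_eq_square power3_eq_cube mult_ac)
  qed
  define e where "e = c1*E"
  have e0: "e >= 0" using c1 E0 by (simp add: e_def)
  have uT: "L1 T u" by (rule L1_subset[OF ui Qm(2) _ TQ]) (use T in auto)
  have aT: "(LINT x|leb T. norm (u x - ub)) <= A"
  proof -
  have Tl: "T : sets lebesgue" using T by auto
  have i: "L1 Q (%x. ind T x*norm (u x - ub))"
  using L1_mult_bounded[OF integrable_norm[OF udi], where h = "ind T" and B = 1] Tl
  by (simp add: meas_leb mult.commute indicator_def)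
  have "(LINT x|leb T. norm (u x - ub)) = (LINT x|leb T. ind T x*norm (u x - ub))"
  by (rule LINT_cong) (auto simp: Tl)
  also have "... = (LINT x|leb Q. ind T x*norm (u x - ub))"
  by (rule LINT_support(1)[OF Qm(2) Tl TQ, symmetric]) simp
  also have "... <= A" unfolding A_def by (rule integral_mono[OF i integrable_norm[OF udi]]) (simp add: indicator_def)
  finally show ?thesis .
  qed
  have cc: "ce.cG + 1/ce.ba + ce.cM = c0" unfolding ce.cG_def ce.cM_def ce.ba_def ce.bb_def c0_def a_def b_def ..
  have est: "abs(LINT x|leb T. u x \<cdot> (Gop bm bp Om T D n w x - (1/coef Om bm bp x) *R w)) <= norm w*e" for w
  proof -
  have 2: "?M*abs(ub \<cdot> perp n) <= Kt*E" using mult_right_mono[OF Th(1), of "abs(ub \<cdot> perp n)"] tan by simp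
  have "norm ub * vol ce.mis <= norm ub*(12*(C + 1)*h ^ 3)" by (rule mult_left_mono[OF mis]) simp
  also have "... = 12*(C + 1)*(h ^ 3*norm ub)" by simp
  also have "... <= 12*(C + 1)*E" using C by (intro mult_left_mono AE) auto
  finally have 3: "norm ub * vol ce.mis <= 12*(C + 1)*E" .
  have "abs(LINT x|leb T. u x \<cdot> (Gop bm bp Om T D n w x - (1/coef Om bm bp x) *R w))
  <= c0*norm w*((LINT x|leb T. norm (u x - ub)) + ?M*abs(ub \<cdot> perp n) + norm ub * vol ce.mis)"
  using ce.Gop_consistency[OF uT, of w ub] unfolding cc .
  also have "... <= c0*norm w*(E + Kt*E + 12*(C + 1)*E)"
  using aT AE(1) 2 3 c0 by (intro mult_left_mono add_mono) auto
  also have "... = norm w*e" unfolding e_def c1_def by (simp add: algebra_simps)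
  finally show ?thesis .
  qed
  have "e^2 <= ?M*(K*h^2*(I0 + I1))"
  proof -
  have "e^2 = c1^2*E^2" by (simp add: e_def power_mult_distrib)
  also have "... <= c1^2*(3*5000*h ^ 4*(I0 + I1))" by (rule mult_left_mono[OF E2]) simp
  also have "... = (3*c1^2*5000*h^2*(I0 + I1))*h^2" by (simp add: power2_eq_square eval_nat_numeral)
  also have "... <= (3*c1^2*5000*h^2*(I0 + I1))*(\<kappa> * ?M)" using Th(2) I0n by (intro mult_left_mono) auto
  also have "... = ?M*(K*h^2*(I0 + I1))" by (simp add: K_def)
  finally show ?thesis .
  qed
  thus ?thesis unfolding Isplit using e0 est by blast
 qed
 show ?thesis
 proof (rule exI[of _ K], rule conjI[OF K], intro allI impI, goal_cases)
  case (1 \<O> Om u U p gp T D n h)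
  show ?case by (rule main[OF 1(1-5) refl 1(6-15)])
 qed
qed

text \<open>Young's inequality on each element, weighted so that half of the left side absorbs the
  quadratic part. The factor \<open>m t\<close> in the bound of \<open>e t\<close> is what cancels
  the weight and leaves the plain sum of \<open>g\<close>.\<close>

lemma absorb_sum:
 fixes w e g m :: "'a => real"
 assumes J: "finite J" and c: "c > 0" and le: "c*(\<Sum>t\<in>J. m t*(w t)^2) <= (\<Sum>t\<in>J. w t*e t)"
  and m: "!!t. t : J ==> m t > 0" and e: "!!t. t : J ==> (e t)^2 <= m t*g t"
 shows "(\<Sum>t\<in>J. m t*(w t)^2) <= (\<Sum>t\<in>J. g t)/c^2"
proof -
 have "w t*e t <= (c/2)*(m t*(w t)^2) + (1/(2*c))*g t" if t: "t : J" for t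
 proof -
  have "0 <= (c*m t*w t - e t)^2" by simp
  hence "2*(c*m t*w t)*e t <= (c*m t*w t)^2 + (e t)^2" by (simp add: power2_diff)
  also have "... <= (c*m t*w t)^2 + m t*g t" using e[OF t] by simp
  finally have "(2*c*m t)*(w t*e t) <= (2*c*m t)*((c/2)*(m t*(w t)^2) + (1/(2*c))*g t)"
  using c by (simp add: power2_eq_square algebra_simps)
  thus ?thesis using c m[OF t] by (simp only: mult_le_cancel_left_pos mult_pos_pos zero_less_numeral)
 qed
 hence "(\<Sum>t\<in>J. w t*e t) <= (\<Sum>t\<in>J. (c/2)*(m t*(w t)^2) + (1/(2*c))*g t)" by (rule sum_mono)
 also have "... = (c/2)*(\<Sum>t\<in>J. m t*(w t)^2) + (1/(2*c))*(\<Sum>t\<in>J. g t)" by (simp only: sum.distrib sum_distrib_left)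
 finally have "(c/2)*(\<Sum>t\<in>J. m t*(w t)^2) <= (1/(2*c))*(\<Sum>t\<in>J. g t)" using le by linarith
 thus ?thesis using c by (simp add: field_simps power2_eq_square)
qed

section \<open>Overlap of the squares around interface points\<close>

lemma card_near:
 assumes "r >= 0"
 shows "finite {i::nat. abs(t - real i) <= r}" "real (card {i::nat. abs(t - real i) <= r}) <= 2 * r + 1"
proof -
 let ?A = "{i::nat. abs(t - real i) <= r}"
 have "?A \<subseteq> {..nat \<lceil>t + r\<rceil>}"
 proof
  fix i assume "i : ?A"
  hence "real i <= t + r" by auto
  thus "i : {..nat \<lceil>t + r\<rceil>}" by (simp add: le_nat_iff) linarith
 qed
 thus fin: "finite ?A" by (rule finite_subset) simp
 show "real (card ?A) <= 2 * r + 1"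
 proof (cases "?A = {}")
  case True
  thus ?thesis using assms by simp
 next
  case False
  have "?A \<subseteq> {Min ?A..Max ?A}" using fin by auto
  hence "card ?A <= card {Min ?A..Max ?A}" by (intro card_mono) auto
  hence "real (card ?A) <= real (Suc (Max ?A) - Min ?A)" by simp
  also have "... <= real (Max ?A) - real (Min ?A) + 1" using Min_le[OF fin Max_in[OF fin False]] by (simp add: of_nat_diff)
  also have "... <= 2 * r + 1" using Min_in[OF fin False] Max_in[OF fin False] by auto
  finally show ?thesis .
 qed
qed

context grid
begin

text \<open>If \<open>x\<close> lies in the square belonging to an element, then \<open>x\<close> is
  within \<open>3*h\<close> of the element's cell corner in each coordinate. In units of the mesh
  widths this leaves at most \<open>6 * \<kappa> + 1\<close> indices per direction, and every cell
  has two triangles.\<close>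

lemma finite_overlap:
 fixes F :: "plane => real" and D :: "nat \<times> nat \<times> bool => plane"
 assumes J: "J \<subseteq> I" and D: "!!i j k. (i, j, k) : J ==> D (i, j, k) : T i j k"
  and Q: "!!t. t : J ==> Sq (D t) h \<subseteq> box a b"
  and h: "h1 <= h" "h2 <= h" "h <= \<kappa>*h1" "h <= \<kappa>*h2" and \<kappa>: "\<kappa> >= 0"
  and F: "L1 (box a b) F" "!!x. F x >= 0"
 shows "(\<Sum>t\<in>J. LINT x|leb (Sq (D t) h). F x)
  <= 2*(6 * \<kappa> + 1)^2*(LINT x|leb (box a b). F x)"
proof -
 define Q where "Q t = Sq (D t) h" for t
 have bl: "box a b : sets lebesgue" and Ql: "Q t : sets lebesgue" for t by (auto simp: Q_def)
 have fJ: "finite J" using J finite_I by (rule finite_subset)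
 have i: "L1 (box a b) (%x. ind (Q t) x*F x)" for t
  using L1_mult_bounded[OF F(1), where h = "ind (Q t)" and B = 1] Ql[of t]
  by (simp add: meas_leb mult.commute indicator_def)
 have "(\<Sum>t\<in>J. LINT x|leb (Q t). F x) = (\<Sum>t\<in>J. LINT x|leb (box a b). ind (Q t) x*F x)"
 proof (rule sum.cong[OF refl])
  fix t assume t: "t : J"
  have "(LINT x|leb (Q t). F x) = (LINT x|leb (Q t). ind (Q t) x*F x)"
  by (rule LINT_cong) (auto simp: Ql)
  also have "... = (LINT x|leb (box a b). ind (Q t) x*F x)"
  by (rule LINT_support(1)[OF bl Ql, symmetric]) (use Q[OF t] in "auto simp: Q_def")
  finally show "(LINT x|leb (Q t). F x) = (LINT x|leb (box a b). ind (Q t) x*F x)" .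
 qed
 also have "... = (LINT x|leb (box a b). (\<Sum>t\<in>J. ind (Q t) x*F x))"
  by (rule Bochner_Integration.integral_sum[symmetric]) (rule i)
 also have "... <= (LINT x|leb (box a b). 2*(6 * \<kappa> + 1)^2*F x)"
 proof (rule integral_mono)
  show "L1 (box a b) (%x. \<Sum>t\<in>J. ind (Q t) x*F x)" by (rule Bochner_Integration.integrable_sum) (rule i)
  show "L1 (box a b) (%x. 2*(6 * \<kappa> + 1)^2*F x)" by (rule L1_cmult[OF F(1)])
  fix x :: plane
  let ?A = "{i::nat. abs((x$1 - a$1)/h1 - real i) <= 3 * \<kappa>}" and ?B = "{j::nat. abs((x$2 - a$2)/h2 - real j) <= 3 * \<kappa>}"
  have r: "0 <= 3 * \<kappa>" using \<kappa> by simp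
  have sub: "{t\<in>J. x : Q t} \<subseteq> ?A \<times> ?B \<times> (UNIV :: bool set)"
  proof
  fix t :: "nat \<times> nat \<times> bool" assume t: "t : {t\<in>J. x : Q t}"
  obtain i j k where tt: "t = (i, j, k)" by (cases t) auto
  have DT: "D t : T i j k" using D t tt by auto
  have xD: "abs(x$1 - D t$1) <= 2*h" "abs(x$2 - D t$2) <= 2*h"
  using t by (auto simp: Q_def mem_box_cart forall_2 abs_le_iff)
  have "abs(x$1 - X i) <= 3*(\<kappa>*h1)" "abs(x$2 - Y j) <= 3*(\<kappa>*h2)"
  using xD T_cell[OF DT] h unfolding XY_Suc by linarith+
  hence "abs(x$1 - X i)/h1 <= 3 * \<kappa>" "abs(x$2 - Y j)/h2 <= 3 * \<kappa>" using h_pos by (simp_all add: pos_divide_le_eq)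
  moreover have "(x$1 - a$1)/h1 - real i = (x$1 - X i)/h1" "(x$2 - a$2)/h2 - real j = (x$2 - Y j)/h2"
  using h_pos by (simp_all add: X_def Y_def field_simps)
  ultimately show "t : ?A \<times> ?B \<times> UNIV" using h_pos by (simp add: tt)
  qed
  have "(\<Sum>t\<in>J. ind (Q t) x :: real) = real (card {t\<in>J. x : Q t})"
  using fJ by (simp add: indicator_def sum.If_cases Int_def)
  also have "... <= real (card (?A \<times> ?B \<times> (UNIV :: bool set)))"
  proof (rule of_nat_mono)
  show "card {t\<in>J. x : Q t} <= card (?A \<times> ?B \<times> (UNIV :: bool set))"
  by (rule card_mono[OF _ sub]) (simp add: card_near(1)[OF r])
  qed
  also have "... = real (card ?A)*(real (card ?B)*2)" by (simp add: card_cartesian_product)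
  also have "... <= (2*(3 * \<kappa>) + 1)*((2*(3 * \<kappa>) + 1)*2)"
  by (intro mult_mono card_near(2)[OF r]) (use \<kappa> in auto)
  also have "... = 2*(6 * \<kappa> + 1)^2" by (simp add: power2_eq_square)
  finally have "(\<Sum>t\<in>J. ind (Q t) x :: real) <= 2*(6 * \<kappa> + 1)^2" .
  hence "(\<Sum>t\<in>J. ind (Q t) x)*F x <= 2*(6 * \<kappa> + 1)^2*F x" by (rule mult_right_mono) (rule F(2))
  thus "(\<Sum>t\<in>J. ind (Q t) x*F x) <= 2*(6 * \<kappa> + 1)^2*F x" by (simp only: sum_distrib_right)
 qed
 finally show ?thesis unfolding Q_def by simp
qed

end

section \<open>Weak divergence and orthogonality to gradients\<close>

lemma has_weak_grad_diff:
 assumes S: "open S" and f: "has_weak_grad S f F" and g: "has_weak_grad S g G"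
 shows "has_weak_grad S (%x. f x - g x) (%x. F x - G x)"
 unfolding has_weak_grad_def
proof (intro conjI ballI allI)
 have l: "locally_integrable S f" "locally_integrable S g" "locally_integrable S F" "locally_integrable S G"
  using f g by (auto simp: has_weak_grad_def)
 show "locally_integrable S (%x. f x - g x)" "locally_integrable S (%x. F x - G x)"
  using l by (simp_all add: locally_integrable_diff)
 fix \<phi> i assume \<phi>: "\<phi> : test_functions S"
 have "(LINT x|leb S. (f x - g x)*grad \<phi> x$i) = (LINT x|leb S. f x*grad \<phi> x$i) - (LINT x|leb S. g x*grad \<phi> x$i)"
  unfolding left_diff_distrib by (rule LINT_diff[OF L1_test(2)[OF S l(1) \<phi>] L1_test(2)[OF S l(2) \<phi>]])
 also have "... = - ((LINT x|leb S. F x$i * \<phi> x) - (LINT x|leb S. G x$i * \<phi> x))"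
  using f g \<phi> unfolding has_weak_grad_def by simp
 also have "(LINT x|leb S. F x$i * \<phi> x) - (LINT x|leb S. G x$i * \<phi> x) = (LINT x|leb S. (F x - G x)$i * \<phi> x)"
  unfolding vector_minus_component left_diff_distrib
  by (rule LINT_diff[OF L1_test(1)[OF S locally_L1_component[OF l(3)] \<phi>] L1_test(1)[OF S locally_L1_component[OF l(4)] \<phi>], symmetric])
 finally show "(LINT x|leb S. (f x - g x)*grad \<phi> x$i) = - (LINT x|leb S. (F x - G x)$i * \<phi> x)" .
qed

lemma test_weak_grad: "open S ==> \<phi> : test_functions S' ==> has_weak_grad S \<phi> (grad \<phi>)"
 by (rule kdiff_weak_grad[OF _ kdiff_test])

lemma L2_plane_iff:
 fixes v :: "plane => plane"
 assumes "v : Mb S" "!!i. L1 S (%x. v x$i * v x$i)"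
 shows "v : L2 S"
 unfolding L2_def mem_Collect_eq plane_norm_square using assms by (simp add: power2_eq_square)

lemma L2_diff:
 fixes f g :: "plane => 'a::euclidean_space"
 assumes "f : L2 S" "g : L2 S"
 shows "(%x. f x - g x) : L2 S"
proof -
 have m: "f : Mb S" "g : Mb S"
  and i: "L1 S (%x. (norm (f x))^2)" "L1 S (%x. (norm (g x))^2)"
  using assms by (auto simp: L2_def)
 have d: "(%x. f x - g x) : Mb S" by (rule borel_measurable_diff[OF m])
 have "L1 S (%x. (norm (f x - g x))^2)"
 proof (rule L1_bound)
  show "L1 S (%x. 2*(norm (f x))^2 + 2*(norm (g x))^2)" using i by simp
  show "(%x. (norm (f x - g x))^2) : Mb S" using d by simp
  have "(norm (y - z))^2 <= 2*(norm y)^2 + 2*(norm z)^2" for y z :: 'a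
  proof -
  have "(norm (y - z))^2 <= (norm y + norm z)^2" by (intro power_mono norm_triangle_ineq4) simp
  also have "... <= 2*(norm y)^2 + 2*(norm z)^2" using sum_squares_bound[of "norm y" "norm z"] by (simp add: power2_sum)
  finally show ?thesis .
  qed
  thus "AE x in leb S. norm ((norm (f x - g x))^2) <= norm (2*(norm (f x))^2 + 2*(norm (g x))^2)" by simp
 qed
 thus ?thesis using d by (simp add: L2_def)
qed

lemma L1_inner_bounded:
 fixes w v :: "plane => plane"
 assumes S: "S : lmeasurable" and wm: "w : Mb S" and wb: "AE x in leb S. norm (w x) <= W"
  and v: "v : L2 S"
 shows "L1 S (%x. w x \<cdot> v x)"
proof (rule L1_bound[of _ "%x. W*norm (v x)"])
 show "L1 S (%x. W*norm (v x))" by (rule L1_cmult[OF L2_L1(1)[OF S v]])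
 show "(%x. w x \<cdot> v x) : Mb S" by (rule borel_measurable_inner[OF wm]) (use v in "simp add: L2_def")
 show "AE x in leb S. norm (w x \<cdot> v x) <= norm (W*norm (v x))" using wb
 proof eventually_elim
  case (elim x)
  have "abs(w x \<cdot> v x) <= norm (w x)*norm (v x)" by (rule Cauchy_Schwarz_ineq2)
  also have "... <= W*norm (v x)" by (rule mult_right_mono[OF elim]) simp
  finally show ?case by simp
 qed
qed

lemma test_H1:
 assumes S: "open S" and \<phi>: "\<phi> : test_functions S"
 shows "\<phi> : H1 S" "AE x in leb S. wgrad S \<phi> x = grad \<phi> x" "grad \<phi> : L2 S"
proof -
 note w = test_weak_grad[OF S \<phi>]
 have l: "locally_integrable S \<phi>" "locally_integrable S (grad \<phi>)" using w by (auto simp: has_weak_grad_def)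
 have 1: "\<phi> : L2 S"
  unfolding L2_def using locally_integrable_measurable[OF S l(1)] L1_test(1)[OF S l(1) \<phi>] by (simp add: power2_eq_square)
 show 2: "grad \<phi> : L2 S"
  by (rule L2_plane_iff[OF locally_integrable_measurable[OF S l(2)] L1_test(2)[OF S locally_L1_component[OF l(2)] \<phi>]])
 show "\<phi> : H1 S" unfolding H1_def using 1 2 w by blast
 show "AE x in leb S. wgrad S \<phi> x = grad \<phi> x" by (rule wgrad_AE(2)[OF S w])
qed

lemma test_H1_0:
 assumes S: "open S" and \<phi>: "\<phi> : test_functions S"
 shows "\<phi> : H1_0 S"
proof -
 have "has_weak_grad S (%x. 0 + 0 \<cdot> x) (%x. 0)" by (rule kdiff_weak_grad[OF S kdiff_affine])
 hence "AE x in leb S. wgrad S (%x. 0) x = 0" using wgrad_AE(2)[OF S, of "%x. 0" "%x. 0"] by simp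
 hence "(LINT x|leb S. (norm (wgrad S (%x. 0) x))^2) = 0"
  by (intro integral_eq_zero_AE) (auto elim!: eventually_mono)
 hence "h1norm S (%x. \<phi> x - \<phi> x) = 0" by (simp add: h1norm_def l2norm_def)
 hence "(%n::nat. h1norm S (%x. \<phi> x - \<phi> x)) \<longlonglongrightarrow> 0" by (simp only: tendsto_const)
 thus ?thesis unfolding H1_0_def using test_H1(1)[OF S \<phi>] \<phi> by (intro CollectI conjI exI[of _ "%_. \<phi>"]) auto
qed

lemma H1_vec_weak_div:
 assumes S: "open S" and u: "!!m. has_weak_grad S (%x. u x$m) (U m)" and ul: "locally_integrable S u"
 shows "has_weak_div S u (%x. U 1 x$1 + U 2 x$2)"
 unfolding has_weak_div_def
proof (intro conjI ballI)
 have lU: "locally_integrable S (%x. U m x$i)" and lu: "locally_integrable S (%x. u x$m)" for m i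
  using u[of m] by (auto simp: has_weak_grad_def intro: locally_L1_component)
 show "locally_integrable S u" by (rule ul)
 show "locally_integrable S (%x. U 1 x$1 + U 2 x$2)"
  using lU unfolding locally_integrable_def by simp
 fix \<phi> assume \<phi>: "\<phi> : test_functions S"
 have w: "(LINT x|leb S. u x$m*grad \<phi> x$m) = - (LINT x|leb S. U m x$m * \<phi> x)" for m
  using u[of m] \<phi> unfolding has_weak_grad_def by blast
 have "(LINT x|leb S. u x \<cdot> grad \<phi> x) = (LINT x|leb S. u x$1*grad \<phi> x$1 + u x$2*grad \<phi> x$2)"
  by (simp add: inner_vec_def sum_2)
 also have "... = (LINT x|leb S. u x$1*grad \<phi> x$1) + (LINT x|leb S. u x$2*grad \<phi> x$2)"
  by (rule LINT_add[OF L1_test(2)[OF S lu \<phi>] L1_test(2)[OF S lu \<phi>]])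
 also have "... = - ((LINT x|leb S. U 1 x$1 * \<phi> x) + (LINT x|leb S. U 2 x$2 * \<phi> x))" unfolding w by simp
 also have "(LINT x|leb S. U 1 x$1 * \<phi> x) + (LINT x|leb S. U 2 x$2 * \<phi> x) = (LINT x|leb S. (U 1 x$1 + U 2 x$2) * \<phi> x)"
  unfolding distrib_right by (rule LINT_add[OF L1_test(1)[OF S lU \<phi>] L1_test(1)[OF S lU \<phi>], symmetric])
 finally show "(LINT x|leb S. u x \<cdot> grad \<phi> x) = - (LINT x|leb S. (U 1 x$1 + U 2 x$2) * \<phi> x)" .
qed

lemma L2_locally_integrable:
 fixes f :: "plane => 'a::euclidean_space"
 assumes "f : L2 S" "S : lmeasurable" shows "locally_integrable S f"
 unfolding locally_integrable_def
proof (intro allI impI, elim conjE)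
 fix K assume K: "compact K" "K \<subseteq> S"
 have Kl: "K : lmeasurable" using K by (simp add: lmeasurable_compact)
 show "L1 K f"
  by (rule L2_L1(2)[OF Kl L2_subset[OF assms(1) _ _ K(2)]]) (use assms(2) Kl in auto)
qed

text \<open>Test functions belong to \<open>H1_0\<close>, and for them the variational equation is
  the definition of the weak divergence of \<open>u\<close>.\<close>

lemma weak_solution_div:
 assumes S: "open S" "S : lmeasurable" and p: "p : H1 S" and sol: "weak_solution S Om bm bp f p"
  and ue: "AE x in leb S. u x = - (coef Om bm bp x *R wgrad S p x)"
  and u: "u : L2 S" and f: "f : L2 S"
 shows "has_weak_div S u f"
 unfolding has_weak_div_def
proof (intro conjI ballI)
 show lu: "locally_integrable S u" and "locally_integrable S f" by (rule L2_locally_integrable[OF u S(2)] L2_locally_integrable[OF f S(2)])+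
 have Sl: "S : sets lebesgue" using S by auto
 fix \<phi> assume \<phi>: "\<phi> : test_functions S"
 have ui: "L1 S (%x. u x \<cdot> grad \<phi> x)"
 proof -
  have lc: "locally_integrable S (%x. u x$i)" for i by (rule locally_L1_component[OF lu])
  have "L1 S (%x. u x$1*grad \<phi> x$1 + u x$2*grad \<phi> x$2)"
  by (rule L1_add[OF L1_test(2)[OF S(1) lc \<phi>] L1_test(2)[OF S(1) lc \<phi>]])
  thus ?thesis by (simp add: inner_vec_def sum_2)
 qed
 have "AE x in leb S. - (u x \<cdot> grad \<phi> x) = coef Om bm bp x*(wgrad S p x \<cdot> wgrad S \<phi> x)"
  using ue test_H1(2)[OF S(1) \<phi>] by eventually_elim simp
 from leb_AE_cong(3)[OF Sl this] ui
 have "(LINT x|leb S. coef Om bm bp x*(wgrad S p x \<cdot> wgrad S \<phi> x)) = - (LINT x|leb S. u x \<cdot> grad \<phi> x)" by simp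
 moreover have "(LINT x|leb S. coef Om bm bp x*(wgrad S p x \<cdot> wgrad S \<phi> x)) = (LINT x|leb S. f x * \<phi> x)"
  using sol test_H1_0[OF S(1) \<phi>] unfolding weak_solution_def by blast
 ultimately show "(LINT x|leb S. u x \<cdot> grad \<phi> x) = - (LINT x|leb S. f x * \<phi> x)" by simp
qed

text \<open>For test functions this is the definition of a vanishing weak divergence. Boundedness of
  \<open>w\<close> makes the integral continuous in the \<open>H1\<close> norm, so it passes to the
  limit in \<open>H1_0\<close>.\<close>

lemma H1_0_orthogonal:
 assumes S: "open S" "S : lmeasurable" and p: "p : H1_0 S" and w: "has_weak_div S w d" and d: "AE x in leb S. d x = 0"
  and wm: "w : Mb S" and wb: "AE x in leb S. norm (w x) <= W"
 shows "(LINT x|leb S. w x \<cdot> wgrad S p x) = 0"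
proof -
 have Sl: "S : sets lebesgue" using S by auto
 have pH: "p : H1 S" using p by (simp add: H1_0_def)
 obtain \<phi> where \<phi>: "!!n. \<phi> n : test_functions S" and lim: "(%n. h1norm S (%x. \<phi> n x - p x)) \<longlonglongrightarrow> 0"
  using p unfolding H1_0_def by blast
 note wp = H1_wgrad[OF S(1) pH]
 define W' where "W' = abs(W)"
 have wb': "AE x in leb S. norm (w x) <= W'" using wb by eventually_elim (simp add: W'_def)
 have W0: "W' >= 0" by (simp add: W'_def)
 note wint = L1_inner_bounded[OF S(2) wm wb']
 have bound: "abs(LINT x|leb S. w x \<cdot> wgrad S p x) <= W' * sqrt (vol S)*h1norm S (%x. \<phi> n x - p x)" for n
 proof -
  note t = test_H1[OF S(1) \<phi>[of n]]
  have wd: "has_weak_grad S (%x. \<phi> n x - p x) (%x. grad (\<phi> n) x - wgrad S p x)"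
  by (rule has_weak_grad_diff[OF S(1) test_weak_grad[OF S(1) \<phi>] wp(1)])
  note ae = wgrad_AE(2)[OF S(1) wd]
  have "AE x in leb S. d x * \<phi> n x = 0" using d by eventually_elim simp
  hence "0 = - (LINT x|leb S. d x * \<phi> n x)" by (simp add: integral_eq_zero_AE)
  also have "... = (LINT x|leb S. w x \<cdot> grad (\<phi> n) x)" using w \<phi>[of n] unfolding has_weak_div_def by simp
  finally have z: "(LINT x|leb S. w x \<cdot> grad (\<phi> n) x) = 0" by simp
  have di: "L1 S (%x. w x \<cdot> grad (\<phi> n) x - w x \<cdot> wgrad S p x)"
  by (rule L1_diff[OF wint[OF t(3)] wint[OF wp(2)]])
  have "(LINT x|leb S. w x \<cdot> wgrad S p x) = - (LINT x|leb S. w x \<cdot> grad (\<phi> n) x - w x \<cdot> wgrad S p x)"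
  using z by (simp add: LINT_diff[OF wint[OF t(3)] wint[OF wp(2)]])
  moreover have dL: "(%x. grad (\<phi> n) x - wgrad S p x) : L2 S" by (rule L2_diff[OF t(3) wp(2)])
  ultimately have "abs(LINT x|leb S. w x \<cdot> wgrad S p x) = abs(LINT x|leb S. w x \<cdot> grad (\<phi> n) x - w x \<cdot> wgrad S p x)" by simp
  also have "... <= (LINT x|leb S. W'*norm (grad (\<phi> n) x - wgrad S p x))"
  proof (rule abs_LINT_le)
  show "L1 S (%x. W'*norm (grad (\<phi> n) x - wgrad S p x))" by (rule L1_cmult[OF L2_L1(1)[OF S(2) dL]])
  show "AE x in leb S. abs(w x \<cdot> grad (\<phi> n) x - w x \<cdot> wgrad S p x) <= W'*norm (grad (\<phi> n) x - wgrad S p x)" using wb'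
  proof eventually_elim
  case (elim x)
  have "abs(w x \<cdot> (grad (\<phi> n) x - wgrad S p x)) <= norm (w x)*norm (grad (\<phi> n) x - wgrad S p x)" by (rule Cauchy_Schwarz_ineq2)
  also have "... <= W'*norm (grad (\<phi> n) x - wgrad S p x)" by (rule mult_right_mono[OF elim]) simp
  finally show ?case by (simp add: inner_diff_right)
  qed
  qed
  also have "... = W'*(LINT x|leb S. norm (grad (\<phi> n) x - wgrad S p x))" by simp
  also have "... <= W'*(sqrt (vol S)*h1norm S (%x. \<phi> n x - p x))"
  proof (rule mult_left_mono[OF _ W0])
  have "(LINT x|leb S. norm (grad (\<phi> n) x - wgrad S p x)) <= sqrt (vol S*(LINT x|leb S. (norm (grad (\<phi> n) x - wgrad S p x))^2))"
  by (rule real_le_rsqrt[OF L1_L2[OF S(2) dL]])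
  also have "... = sqrt (vol S)*l2norm S (%x. grad (\<phi> n) x - wgrad S p x)" by (simp add: real_sqrt_mult l2norm_def)
  also have "l2norm S (%x. grad (\<phi> n) x - wgrad S p x) = l2norm S (wgrad S (%x. \<phi> n x - p x))"
  proof -
  have "AE x in leb S. (norm (grad (\<phi> n) x - wgrad S p x))^2 = (norm (wgrad S (%x. \<phi> n x - p x) x))^2" using ae by eventually_elim simp
  from leb_AE_cong(3)[OF Sl this] dL show ?thesis by (simp add: l2norm_def L2_def)
  qed
  also have "... <= h1norm S (%x. \<phi> n x - p x)" unfolding h1norm_def by (rule real_le_rsqrt) simp
  finally show "(LINT x|leb S. norm (grad (\<phi> n) x - wgrad S p x)) <= sqrt (vol S)*h1norm S (%x. \<phi> n x - p x)"
  by (simp add: mult_left_mono)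
  qed
  finally show ?thesis by (simp add: mult.assoc)
 qed
 have "(%n. W' * sqrt (vol S)*h1norm S (%x. \<phi> n x - p x)) \<longlonglongrightarrow> W' * sqrt (vol S)*0"
  by (rule tendsto_mult_left[OF lim])
 hence "abs(LINT x|leb S. w x \<cdot> wgrad S p x) <= 0"
  by (intro LIMSEQ_le_const[of _ 0]) (use bound in auto)
 thus ?thesis by simp
qed

section \<open>Testing the scheme on one element\<close>

lemma L1_borel_bounded:
 fixes f :: "plane => 'a::euclidean_space"
 assumes T: "T : lmeasurable" and f: "f : Bm" and b: "!!x. x : T ==> norm (f x) <= B"
 shows "L1 T f"
proof (rule finite_measure.integrable_const_bound[OF leb_finite(1)[OF T]])
 show "AE x in leb T. norm (f x) <= B" by (rule AE_I2) (use b in simp)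
 show "f : Mb T" using f by (simp add: meas_leb measurable_completion)
qed

lemma lgrad_measurable: "lgrad bm bp D n \<tau> \<nu> : Bm"
 unfolding lgrad_def[abs_def] using beta_h_measurable[of bm bp D n] by measurable

lemma lgrad_bounded: "norm (lgrad bm bp D n \<tau> \<nu> x) <= abs(\<tau>)*norm n + (abs(\<nu> / bm) + abs(\<nu> / bp))*norm n"
proof -
 have "norm (lgrad bm bp D n \<tau> \<nu> x) <= abs(\<tau>)*norm n + abs(\<nu> / beta_h bm bp D n x)*norm n"
  unfolding lgrad_def using norm_triangle_ineq[of "\<tau> *R perp n" "(\<nu> / beta_h bm bp D n x) *R n"] by (simp add: perp_simps)
 also have "... <= abs(\<tau>)*norm n + (abs(\<nu> / bm) + abs(\<nu> / bp))*norm n"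
  by (intro add_left_mono mult_right_mono) (auto simp: beta_h_def)
 finally show ?thesis .
qed

context grid
begin

lemma T_pos: "vol (T i j k) > 0"
 unfolding T_measure using h_pos by simp

lemma T_interior_AE_iff:
 assumes "AE x in leb (interior (T i j k)). P x" "i < N1" "j < N2"
 shows "AE x in leT i j k. P x"
proof -
 have "AE x in lebesgue. x : interior (T i j k) --> P x" using assms(1) by (subst (asm) AE_leb_iff) auto
 with AE_interior_T have "AE x in lebesgue. x : T i j k --> P x" by eventually_elim (use assms in blast)
 thus ?thesis by (simp add: AE_leb_iff)
qed

text \<open>Gives elements with and without interface one interface: a bounded, coercive test
  gradient \<open>G\<close> and the tested scheme. On a plain element the connected interior misses
  the frontier of \<open>Om\<close>, so the coefficient is constant there and \<open>w\<close>
  divided by it is itself the gradient of an admissible function.\<close>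

lemma element_test:
 assumes ij: "i < N1" "j < N2" and \<beta>: "bm > 0" "bp > 0" and Om: "open Om"
  and scheme: "ALL \<phi>:S_local Om bm bp (T i j k). (LINT x|leT i j k. (uh x + coef Om bm bp x *R wgrad (interior (T i j k)) ph x) \<cdot>
  wgrad (interior (T i j k)) \<phi> x) = 0"
  and kd: "kdiff \<Phi> Gp" and ph: "ALL x:interior (T i j k). ph x = \<Phi> x"
  and form: "if interface_element Om (T i j k) then EX D E n \<tau> \<nu>. cut Om (T i j k) D E n & Gp = lgrad bm bp D n \<tau> \<nu> else EX g. Gp = (%x. g)"
  and uh: "!!x. x : interior (T i j k) ==> uh x = rt \<alpha>0 \<beta>0 \<kappa>0 x"
 defines "aa \<equiv> min bm bp" and "bb \<equiv> max bm bp"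
 shows "EX G D E n. G : Bm & (ALL x. norm (G x) <= (1/aa + bb^2/aa ^ 3)*norm w) &
  (aa^2/bb ^ 3)*(vol (T i j k)*(norm w)^2) <= (LINT x|leT i j k. w \<cdot> G x) &
  (LINT x|leT i j k. rt \<alpha>0 \<beta>0 \<kappa>0 x \<cdot> G x) = - (LINT x|leT i j k. w \<cdot> Gp x) &
  (if interface_element Om (T i j k) then cut Om (T i j k) D E n & G = Gop bm bp Om (T i j k) D n w
  else AE x in leT i j k. G x = (1/coef Om bm bp x) *R w)"
proof -
 let ?T = "T i j k" and ?c = "coef Om bm bp"
 have Tm: "?T : lmeasurable" by simp
 have oT: "open (interior ?T)" by simp
 have ab: "0 < aa" "aa <= bb" "0 < bb" using \<beta> by (auto simp: aa_def bb_def)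
 have cm: "?c : Bm" by (rule coef_measurable[OF Om])
 have cb: "abs(?c x) <= bb" "0 < ?c x" for x using \<beta> by (auto simp: coef_def bb_def)
 obtain Bp where Gpm: "Gp : Bm" and Bp: "!!x. norm (Gp x) <= Bp"
 proof -
  show thesis
  proof (cases "interface_element Om ?T")
  case True
  then obtain D n \<tau> \<nu> where g: "Gp = lgrad bm bp D n \<tau> \<nu>" using form by auto
  show thesis by (rule that[of "abs(\<tau>)*norm n + (abs(\<nu> / bm) + abs(\<nu> / bp))*norm n"]) (simp_all only: g lgrad_measurable lgrad_bounded)
  next
  case False
  then obtain g where g: "Gp = (%x. g)" using form by auto
  show thesis by (rule that[of "norm g"]) (simp_all add: g)
  qed
 qed
 \<comment> \<open>The defining property \<open>key\<close> of \<open>G\<close> turns the pressure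
   part of the tested scheme into the integral of \<open>w\<close> against the gradient of the
   discrete pressure. In this form the sum over all elements vanishes by discrete
   orthogonality.\<close>
 have common: "(LINT x|leb ?T. rt \<alpha>0 \<beta>0 \<kappa>0 x \<cdot> G x) = - (LINT x|leb ?T. w \<cdot> Gp x)"
  if Gm: "G : Bm" and Gb: "!!x. norm (G x) <= B"
  and \<phi>: "\<phi> : S_local Om bm bp ?T" "kdiff \<phi> G"
  and key: "(LINT x|leb ?T. ?c x*(Gp x \<cdot> G x)) = (LINT x|leb ?T. w \<cdot> Gp x)" for G B \<phi>
 proof -
  have B0: "B >= 0" using norm_ge_zero[of "G 0"] Gb[of 0] by linarith
  obtain Br where Br: "!!x. x : ?T ==> norm (rt \<alpha>0 \<beta>0 \<kappa>0 x) <= Br"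
  proof -
  have "bounded (rt \<alpha>0 \<beta>0 \<kappa>0 ` ?T)" by (rule continuous_bounded_image[OF continuous_rt T_bounded])
  thus thesis using that unfolding bounded_iff by blast
  qed
  have rm: "rt \<alpha>0 \<beta>0 \<kappa>0 : Bm" by (rule cont_Bm[OF continuous_rt])
  have i1: "L1 ?T (%x. rt \<alpha>0 \<beta>0 \<kappa>0 x \<cdot> G x)"
  proof (rule L1_borel_bounded[OF Tm borel_measurable_inner[OF rm Gm]])
  fix x assume "x : ?T"
  have "abs(rt \<alpha>0 \<beta>0 \<kappa>0 x \<cdot> G x) <= norm (rt \<alpha>0 \<beta>0 \<kappa>0 x)*norm (G x)" by (rule Cauchy_Schwarz_ineq2)
  also have "... <= Br*B" using Br[OF \<open>x \<in> ?T\<close>] Gb[of x] norm_ge_zero[of "rt \<alpha>0 \<beta>0 \<kappa>0 x"] norm_ge_zero[of "G x"] by (intro mult_mono) linarith+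
  finally show "norm (rt \<alpha>0 \<beta>0 \<kappa>0 x \<cdot> G x) <= Br*B" by simp
  qed
  have i2: "L1 ?T (%x. ?c x*(Gp x \<cdot> G x))"
  proof (rule L1_borel_bounded[OF Tm borel_measurable_times[OF cm borel_measurable_inner[OF Gpm Gm]]])
  fix x
  have "abs(Gp x \<cdot> G x) <= norm (Gp x)*norm (G x)" by (rule Cauchy_Schwarz_ineq2)
  also have "... <= Bp*B" using Bp[of x] Gb[of x] norm_ge_zero[of "Gp x"] norm_ge_zero[of "G x"] by (intro mult_mono) linarith+
  finally have "abs(?c x)*abs(Gp x \<cdot> G x) <= bb*(Bp*B)" using cb(1)[of x] ab by (intro mult_mono) auto
  thus "norm (?c x*(Gp x \<cdot> G x)) <= bb*(Bp*B)" by (simp add: abs_mult)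
  qed
  have "has_weak_grad (interior ?T) ph Gp"
  using has_weak_grad_cong[of "interior ?T" ph \<Phi> Gp] ph kdiff_weak_grad[OF oT kd] by blast
  from wgrad_AE(2)[OF oT this] have 1: "AE x in leb ?T. wgrad (interior ?T) ph x = Gp x" by (rule T_interior_AE_iff[OF _ ij])
  have 2: "AE x in leb ?T. wgrad (interior ?T) \<phi> x = G x" by (rule T_interior_AE_iff[OF wgrad_AE(2)[OF oT kdiff_weak_grad[OF oT \<phi>(2)]] ij])
  have 3: "AE x in leb ?T. uh x = rt \<alpha>0 \<beta>0 \<kappa>0 x" by (rule T_AE[OF ij uh])
  have "AE x in leb ?T. rt \<alpha>0 \<beta>0 \<kappa>0 x \<cdot> G x + ?c x*(Gp x \<cdot> G x) = (uh x + ?c x *R wgrad (interior ?T) ph x) \<cdot> wgrad (interior ?T) \<phi> x"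
  using 1 2 3 by eventually_elim (simp add: inner_add_left)
  from leb_AE_cong(3)[OF T_lebesgue(1) this L1_add[OF i1 i2]] scheme \<phi>(1)
  have "(LINT x|leb ?T. rt \<alpha>0 \<beta>0 \<kappa>0 x \<cdot> G x + ?c x*(Gp x \<cdot> G x)) = 0" by simp
  thus ?thesis using LINT_add[OF i1 i2] key by simp
 qed
 show ?thesis
 proof (cases "interface_element Om ?T")
  case True
  then obtain D E n \<tau> \<nu> where cut: "cut Om ?T D E n" and Gp: "Gp = lgrad bm bp D n \<tau> \<nu>" using form by auto
  hence n: "norm n = 1" by (simp add: cut_def)
  interpret ce: cut_element bm bp Om ?T D n by unfold_locales (use \<beta> Om n Tm T_pos in auto)
  have cab: "ce.ba = aa" "ce.bb = bb" by (simp_all add: ce.ba_def ce.bb_def aa_def bb_def)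
  let ?G = "Gop bm bp Om ?T D n w"
  have Gm: "?G : Bm" unfolding Gop_def by (rule lgrad_measurable)
  have Gn: "norm (?G x) <= (1/aa + bb^2/aa ^ 3)*norm w" for x using ce.Gop_norm[of w x] unfolding ce.cG_def cab .
  obtain \<phi> where \<phi>: "\<phi> : S_local Om bm bp ?T" "kdiff \<phi> ?G"
  using S_local_exists[OF cut True \<beta>[THEN less_imp_neq, THEN not_sym]] unfolding Gop_def by blast
  have "(LINT x|leb ?T. ?c x*(Gp x \<cdot> ?G x)) = (LINT x|leb ?T. w \<cdot> Gp x)"
  unfolding Gp by (rule ce.Gop_test)
  from common[OF Gm Gn \<phi> this] show ?thesis
  using Gm Gn ce.Gop_coercive[of w] cut True unfolding cab by (intro exI[of _ ?G] exI[of _ D] exI[of _ E] exI[of _ n]) simp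
 next
  case False
  then obtain g where g: "Gp = (%x. g)" using form by auto
  have "interior ?T \<inter> frontier Om = {}" using False by (auto simp: interface_element_def)
  hence "interior ?T \<subseteq> Om \<or> interior ?T \<inter> Om = {}"
  using connected_Int_frontier[of "interior ?T" Om] convex_connected[OF convex_interior[OF T_convex[of i j k]]] by blast
  then obtain c where c: "!!x. x : interior ?T ==> ?c x = c" "c = bm \<or> c = bp"
  proof (elim disjE)
  assume "interior ?T \<subseteq> Om"
  thus thesis by (intro that[of bm]) (auto simp: coef_def)
  next
  assume "interior ?T \<inter> Om = {}"
  thus thesis by (intro that[of bp]) (auto simp: coef_def)
  qed
  have c0: "aa <= c" "c <= bb" "0 < c" using c(2) \<beta> by (auto simp: aa_def bb_def)
  have cae: "AE x in leb ?T. ?c x = c" by (rule T_AE[OF ij c(1)])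
  let ?G = "%x::plane. (1/c) *R w"
  have Gm: "?G : Bm" by simp
  have Gn: "norm (?G x) <= (1/aa + bb^2/aa ^ 3)*norm w" for x
  proof -
  have "1/c <= 1/aa" using c0 ab by (intro divide_left_mono) auto
  also have "... <= 1/aa + bb^2/aa ^ 3" using ab by simp
  finally show ?thesis using c0(3) by (simp add: mult_right_mono del: times_divide_eq_left)
  qed
  define \<phi> where "\<phi> x = 0 + ((1/c) *R w) \<cdot> x" for x
  have \<phi>: "\<phi> : S_local Om bm bp ?T" "kdiff \<phi> ?G"
  proof -
  show "kdiff \<phi> ?G" unfolding \<phi>_def[abs_def] by (rule kdiff_affine)
  show "\<phi> : S_local Om bm bp ?T" unfolding S_local_def if_not_P[OF False]
  by (rule CollectI, rule exI[of _ 0], rule exI[of _ "(1/c) *R w"]) (simp add: \<phi>_def)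
  qed
  have "(LINT x|leb ?T. ?c x*(Gp x \<cdot> ?G x)) = (LINT x|leb ?T. w \<cdot> Gp x)"
  proof (rule leb_AE_cong(3)[OF T_lebesgue(1)])
  show "AE x in leb ?T. w \<cdot> Gp x = ?c x*(Gp x \<cdot> ?G x)" using cae by eventually_elim (use c0 in "simp add: inner_commute")
  show "L1 ?T (%x. w \<cdot> Gp x)" unfolding g by (rule leb_finite(2)[OF Tm])
  qed
  note cmn = common[OF Gm Gn \<phi> this]
  have "(LINT x|leb ?T. w \<cdot> ?G x) = (1/c)*(vol ?T*(norm w)^2)"
  unfolding leb_finite(3)[OF Tm] by (simp add: power2_norm_eq_inner)
  moreover have "(aa^2/bb ^ 3) <= 1/c"
  proof -
  have "aa^2/bb ^ 3 <= bb^2/bb ^ 3" using ab by (intro divide_right_mono power_mono) auto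
  also have "... = 1/bb" using ab by (simp add: power2_eq_square power3_eq_cube)
  also have "... <= 1/c" using c0 by (intro divide_left_mono) auto
  finally show ?thesis .
  qed
  ultimately have coer: "(aa^2/bb ^ 3)*(vol ?T*(norm w)^2) <= (LINT x|leb ?T. w \<cdot> ?G x)"
  by (simp only:) (rule mult_right_mono, assumption, simp)
  have "AE x in leb ?T. ?G x = (1/?c x) *R w" using cae by eventually_elim simp
  thus ?thesis using Gm Gn coer cmn False by (intro exI[of _ ?G]) simp
 qed
qed

end

section \<open>Global error estimates\<close>

lemma L2_vec:
 fixes u :: "plane => plane"
 assumes S: "S : lmeasurable" and u: "!!m. (%x. u x$m) : L2 S"
 shows "u : L2 S"
proof (rule L2_plane_iff)
 have "L1 S (%x. u x$i)" for i by (rule L2_L1(2)[OF S u])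
 hence "L1 S (%x. u x$1 *R (axis 1 1 :: plane) + u x$2 *R axis 2 1)"
  by (intro L1_add integrable_scaleR_left)
 thus "u : Mb S" by (intro L1_meas) (simp flip: pt_axis)
 show "L1 S (%x. u x$i*u x$i)" for i using u[of i] by (simp add: L2_def power2_eq_square)
qed

context grid
begin

lemma T_AE_box:
 assumes "AE x in leb (box a b). P x" "i < N1" "j < N2"
 shows "AE x in leT i j k. P x"
proof -
 have "AE x in lebesgue. x : box a b --> P x" using assms(1) by (subst (asm) AE_leb_iff) auto
 with AE_interior_T have "AE x in lebesgue. x : T i j k --> P x"
  by eventually_elim (use assms interior_T_box[OF assms(2,3), of k] in blast)
 thus ?thesis by (simp add: AE_leb_iff)
qed

lemma L2_T:
 fixes v :: "plane => plane"
 assumes v: "!!m. (%x. v x$m) : L2 (box a b)" and ij: "i < N1" "j < N2"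
 shows "v : L2 (T i j k)"
proof -
 have c: "L1 (T i j k) (%x. v x$m)" for m
  by (rule integral_box_T(1)[OF L2_L1(2)[OF _ v] ij]) simp
 have s: "L1 (T i j k) (%x. (v x$m)^2)" for m
  using integral_box_T(1)[OF _ ij, of "%x. (v x$m)^2"] v[of m] by (simp add: L2_def)
 have "L1 (T i j k) (%x. v x$1 *R (axis 1 1 :: plane) + v x$2 *R axis 2 1)"
  by (intro L1_add integrable_scaleR_left c)
 hence "v : Mb (T i j k)" by (intro L1_meas) (simp flip: pt_axis)
 thus ?thesis by (rule L2_plane_iff) (use s in "simp add: power2_eq_square")
qed

lemma conforming_diff:
 assumes c: "conforming A B K" "conforming A' B' K'" and K: "!!i j k. i < N1 ==> j < N2 ==> K i j k = K' i j k"
 shows "conforming (%i j k. A i j k - A' i j k) (%i j k. B i j k - B' i j k) (%i j k. 0)"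
proof -
 have Df: "Df (%i j k. A i j k - A' i j k) (%i j k. B i j k - B' i j k) (%i j k. 0) i j k = Df A B K i j k - Df A' B' K' i j k"
  if "i < N1" "j < N2" for i j k
  unfolding Df_def K[OF that] by (simp add: diff_divide_distrib add_divide_distrib)
 have dg: "Df A B K i j True + Df A B K i j False = 0" "Df A' B' K' i j True + Df A' B' K' i j False = 0" if "i < N1" "j < N2" for i j
  using c that unfolding conforming_def by blast+
 show ?thesis unfolding conforming_def
 proof (intro conjI allI impI)
  fix i j assume ij: "Suc i < N1" "j < N2"
  have "A i j (\<not> \<delta> i j) + K i j (\<not> \<delta> i j)*X (Suc i) = A (Suc i) j (\<delta> (Suc i) j) + K (Suc i) j (\<delta> (Suc i) j)*X (Suc i)"
  "A' i j (\<not> \<delta> i j) + K' i j (\<not> \<delta> i j)*X (Suc i) = A' (Suc i) j (\<delta> (Suc i) j) + K' (Suc i) j (\<delta> (Suc i) j)*X (Suc i)"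
  using c ij unfolding conforming_def by blast+
  thus "A i j (\<not> \<delta> i j) - A' i j (\<not> \<delta> i j) + 0*X (Suc i) = A (Suc i) j (\<delta> (Suc i) j) - A' (Suc i) j (\<delta> (Suc i) j) + 0*X (Suc i)"
  using K[of i j "\<not> \<delta> i j"] K[of "Suc i" j "\<delta> (Suc i) j"] ij by simp
 next
  fix i j assume ij: "i < N1" "Suc j < N2"
  have "B i j True + K i j True*Y (Suc j) = B i (Suc j) False + K i (Suc j) False*Y (Suc j)"
  "B' i j True + K' i j True*Y (Suc j) = B' i (Suc j) False + K' i (Suc j) False*Y (Suc j)"
  using c ij unfolding conforming_def by blast+
  thus "B i j True - B' i j True + 0*Y (Suc j) = B i (Suc j) False - B' i (Suc j) False + 0*Y (Suc j)"
  using K[of i j True] K[of i "Suc j" False] ij by simp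
 next
  fix i j assume ij: "i < N1" "j < N2"
  show "Df (%i j k. A i j k - A' i j k) (%i j k. B i j k - B' i j k) (%i j k. 0) i j True + Df (%i j k. A i j k - A' i j k) (%i j k. B i j k - B' i j k) (%i j k. 0) i j False = 0"
  unfolding Df[OF ij] using dg[OF ij] by simp
 qed
qed

definition "elem t = (case t of (i, j, k) => T i j k)"

lemma I_cases:
 assumes "t : I" obtains i j k where "t = (i, j, k)" "i < N1" "j < N2"
 using assms by (cases t) (auto simp: I_def)

lemma sum_I_elem: "(\<Sum>(i, j, k)\<in>I. F i j k) = (\<Sum>t\<in>I. F (fst t) (fst (snd t)) (snd (snd t)))"
 by (simp add: case_prod_beta)

lemma rt_L2:
 assumes v: "!!i j k x. i < N1 ==> j < N2 ==> x : interior (T i j k) ==> v x = rt (A i j k) (B i j k) (K i j k) x"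
  and vi: "L1 (box a b) v"
 shows "v : L2 (box a b)"
 unfolding L2_def mem_Collect_eq
proof
 show "v : Mb (box a b)" by (rule L1_meas[OF vi])
 have "L1 (box a b) (pw (%i j k x. (norm (rt (A i j k) (B i j k) (K i j k) x))^2))"
  by (rule pw_integrable) (intro continuous_intros continuous_rt)
 moreover have "AE x in leb (box a b). pw (%i j k x. (norm (rt (A i j k) (B i j k) (K i j k) x))^2) x = (norm (v x))^2"
  by (rule box_AE) (simp add: pw_interior v)
 ultimately show "L1 (box a b) (%x. (norm (v x))^2)" using leb_AE_cong(2)[of "box a b"] by fastforce
qed

text \<open>The parameters \<open>g\<close> and \<open>S\<close> separate the global argument from
  the size of \<open>h\<close>: they stand for any elementwise consistency bound and a bound for its
  sum. As \<open>g\<close> may depend on the endpoint \<open>D\<close>, around which squares are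
  centred, the sum has to be controlled for every choice of endpoints.\<close>

lemma vector_error:
 assumes \<beta>: "bm > 0" "bp > 0" and Om: "open Om" and h: "h1 <= h" "h2 <= h"
  and uH: "!!m. (%x. u x$m) : H1 (box a b)" and f: "f : L2 (box a b)"
  and U: "!!m. U m = wgrad (box a b) (%x. u x$m)"
  and fu: "AE x in leb (box a b). f x = U 1 x$1 + U 2 x$2"
  and p: "p : H1_0 (box a b)" and ue: "AE x in leb (box a b). u x = - (coef Om bm bp x *R wgrad (box a b) p x)"
  and uh: "uh : V_h (mesh a b N1 N2 \<delta>)" and ph: "ph : S_h (box a b) Om bm bp (mesh a b N1 N2 \<delta>)"
  and scheme: "mfv_scheme (box a b) Om bm bp (mesh a b N1 N2 \<delta>) f uh ph"
  and g: "!!t D E n. t : I ==> interface_element Om (elem t) ==> cut Om (elem t) D E n ==>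
  EX e>=0. (ALL w. abs(LINT x|leb (elem t). u x \<cdot> (Gop bm bp Om (elem t) D n w x - (1/coef Om bm bp x) *R w)) <= norm w*e) &
  e^2 <= vol (elem t)*g t D"
  and gs: "!!D. (!!t. t : I ==> interface_element Om (elem t) ==> EX E n. cut Om (elem t) (D t) E n) ==>
  (\<Sum>t\<in>{t\<in>I. interface_element Om (elem t)}. g t (D t)) <= S"
 defines "aa \<equiv> min bm bp" and "bb \<equiv> max bm bp"
  and "E1 \<equiv> h\<^sup>2*(100*(LINT x|leb (box a b). (norm (U 1 x))^2 + (norm (U 2 x))^2) + 2*(LINT x|leb (box a b). (f x)^2))"
 shows "(l2norm (box a b) (%x. u x - uh x))^2 <= 2*E1 + 2*((2*(1/aa + bb^2/aa ^ 3)^2*E1 + 2*S)/(aa^2/bb ^ 3)^2)"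
  and "AE x in leb (box a b). wdiv (box a b) uh x = pw (%i j k x. (LINT x|leT i j k. f x)/vol (T i j k)) x"
  and "wdiv (box a b) uh : Mb (box a b)"
proof -
 let ?\<O> = "box a b" and ?c = "coef Om bm bp"
 have op: "open ?\<O>" and bm: "?\<O> : lmeasurable" and bl: "?\<O> : sets lebesgue" by auto
 have ab: "0 < aa" "aa <= bb" "0 < bb" using \<beta> by (auto simp: aa_def bb_def)
 define cg where "cg = 1/aa + bb^2/aa ^ 3"
 define c0 where "c0 = aa^2/bb ^ 3"
 have cg0: "cg >= 0" and c00: "c0 > 0" using ab by (auto simp: cg_def c0_def)
 have cpos: "0 < ?c x" "aa <= ?c x" for x using \<beta> by (auto simp: coef_def aa_def)
 have cm: "?c : Bm" by (rule coef_measurable[OF Om])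
 have inT: "T i j k : mesh a b N1 N2 \<delta>" if "i < N1" "j < N2" for i j k
  unfolding mesh_T using that by (intro image_eqI[of _ _ "(i, j, k)"]) (auto simp: I_def)
 obtain A' B' K' where conf': "conforming A' B' K'"
  and uhrt: "!!i j k x. i < N1 ==> j < N2 ==> x : interior (T i j k) ==> uh x = rt (A' i j k) (B' i j k) (K' i j k) x"
  using V_h_conforming[OF uh] by blast
 have wd: "has_weak_div ?\<O> uh (pw (%i j k x. 2*K' i j k))" "L1 ?\<O> uh"
  by (rule conforming_div[OF conf'], erule (2) uhrt)+
 note wd2 = wdiv_AE[OF op wd(1)]
 \<comment> \<open>The divergence of \<open>uh\<close> is constant on the element and has the same
   integral as \<open>f\<close>, which is also how the interpolant was chosen. Hence the difference
   of the two fields is constant on each element.\<close>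
 have K'eq: "K' i j k = (LINT x|leT i j k. f x)/(h1*h2)" if ij: "i < N1" "j < N2" for i j k
 proof -
  have "AE x in leT i j k. pw (%i j k x. 2*K' i j k) x = 2*K' i j k"
  by (rule T_AE[OF ij]) (simp add: pw_interior[OF ij])
  hence "AE x in leT i j k. 2*K' i j k = wdiv ?\<O> uh x"
  using T_AE_box[OF wd2(2) ij] by eventually_elim simp
  from leb_AE_cong(3)[OF T_lebesgue(1) this leb_finite(2)[OF T_lebesgue(3)]]
  have "(LINT x|leT i j k. wdiv ?\<O> uh x) = 2*K' i j k*(h1*h2/2)"
  unfolding leb_finite(3)[OF T_lebesgue(3)] T_measure .
  moreover have "(LINT x|leT i j k. wdiv ?\<O> uh x) = (LINT x|leT i j k. f x)"
  using scheme inT[OF ij] unfolding mfv_scheme_def by blast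
  ultimately show ?thesis using h_pos by (simp add: field_simps)
 qed
 show "AE x in leb ?\<O>. wdiv ?\<O> uh x = pw (%i j k x. (LINT x|leT i j k. f x)/vol (T i j k)) x"
 proof -
  have "AE x in leb ?\<O>. pw (%i j k x. 2*K' i j k) x = pw (%i j k x. (LINT x|leT i j k. f x)/vol (T i j k)) x"
  by (rule box_AE) (simp add: pw_interior K'eq T_measure)
  with wd2(2) show ?thesis by eventually_elim simp
 qed
 show "wdiv ?\<O> uh : Mb ?\<O>"
  using wd2(1) locally_integrable_measurable[OF op] unfolding has_weak_div_def by blast
 obtain \<Phi> Gp where mc: "mean_conforming \<Phi>" and kd: "!!i j k. i < N1 ==> j < N2 ==> kdiff (\<Phi> i j k) (Gp i j k)"
  and ph\<Phi>: "!!i j k. i < N1 ==> j < N2 ==> ALL x:interior (T i j k). ph x = \<Phi> i j k x"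
  and form: "!!i j k. i < N1 ==> j < N2 ==> if interface_element Om (T i j k) then EX D E n \<tau> \<nu>. cut Om (T i j k) D E n & Gp i j k = lgrad bm bp D n \<tau> \<nu> else EX g. Gp i j k = (%x. g)"
  using S_h_conforming[OF ph \<beta>[THEN less_imp_neq, THEN not_sym]] by blast
 obtain A B K where conf: "conforming A B K" and Keq: "!!i j k. K i j k = (LINT x|leT i j k. f x)/(h1*h2)"
  and ei: "!!i j k. i < N1 ==> j < N2 ==> L1 (T i j k) (%x. (norm (u x - rt (A i j k) (B i j k) (K i j k) x))^2)"
  and es: "(\<Sum>(i, j, k)\<in>I. LINT x|leT i j k. (norm (u x - rt (A i j k) (B i j k) (K i j k) x))^2) <= E1"
  using rt_interpolant[OF uH f U fu h] unfolding E1_def by blast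
 have KK: "K i j k = K' i j k" if "i < N1" "j < N2" for i j k using K'eq[OF that] Keq by simp
 define w where "w i j k = pt (A i j k - A' i j k) (B i j k - B' i j k)" for i j k
 have rtw: "rt (A i j k - A' i j k) (B i j k - B' i j k) 0 x = w i j k" for i j k x by (simp add: rt_def w_def)
 have rtd: "rt (A i j k) (B i j k) (K i j k) x - rt (A' i j k) (B' i j k) (K' i j k) x = w i j k" if "i < N1" "j < N2" for i j k x
  unfolding KK[OF that] by (simp add: rt_def w_def plane_eq_iff)
 have confw: "conforming (%i j k. A i j k - A' i j k) (%i j k. B i j k - B' i j k) (%i j k. 0)"
  by (rule conforming_diff[OF conf conf' KK])
 have uL: "(%x. u x$m) : L2 ?\<O>" for m by (rule H1_wgrad(3)[OF op uH])
 have uT: "u : L2 (T i j k)" if "i < N1" "j < N2" for i j k by (rule L2_T[OF uL that])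
 have uTi: "L1 (T i j k) u" "L1 (T i j k) (%x. norm (u x))" if "i < N1" "j < N2" for i j k
  using L2_L1[OF T_lebesgue(3) uT[OF that]] by auto
 have rtb: "EX R. ALL x:T i j k. norm (rt \<alpha>0 \<beta>0 \<kappa>0 x) <= R" for \<alpha>0 \<beta>0 \<kappa>0 i j k
  using continuous_bounded_image[OF continuous_rt T_bounded, of \<alpha>0 \<beta>0 \<kappa>0 i j k] unfolding bounded_iff by blast
 have rtm: "rt \<alpha>0 \<beta>0 \<kappa>0 : Bm" for \<alpha>0 \<beta>0 \<kappa>0 by (rule cont_Bm[OF continuous_rt])
 \<comment> \<open>The cut data come out of an existential on each element. A single predicate on
   the whole tuple lets one choice fix \<open>G\<close>, \<open>D\<close>, \<open>E\<close> and
   \<open>n\<close> consistently.\<close>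
 define Pr where "Pr i j k G D E n \<longleftrightarrow> G : Bm & (ALL x. norm (G x) <= cg*norm (w i j k)) &
  c0*(vol (T i j k)*(norm (w i j k))^2) <= (LINT x|leT i j k. w i j k \<cdot> G x) &
  (LINT x|leT i j k. rt (A' i j k) (B' i j k) (K' i j k) x \<cdot> G x) = - (LINT x|leT i j k. w i j k \<cdot> Gp i j k x) &
  (if interface_element Om (T i j k) then cut Om (T i j k) D E n & G = Gop bm bp Om (T i j k) D n (w i j k)
  else AE x in leT i j k. G x = (1/?c x) *R w i j k)" for i j k G D E n
 have test: "EX q. Pr i j k (fst q) (fst (snd q)) (fst (snd (snd q))) (snd (snd (snd q)))" if ij: "i < N1" "j < N2" for i j k
 proof -
  have sch: "ALL \<phi>:S_local Om bm bp (T i j k). (LINT x|leT i j k. (uh x + ?c x *R wgrad (interior (T i j k)) ph x) \<cdot>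
  wgrad (interior (T i j k)) \<phi> x) = 0"
  using scheme inT[OF ij] unfolding mfv_scheme_def by blast
  have "EX G D E n. Pr i j k G D E n"
  unfolding Pr_def cg_def c0_def aa_def bb_def
  by (rule element_test[OF ij \<beta> Om sch kd[OF ij] ph\<Phi>[OF ij] form[OF ij]]) (rule uhrt[OF ij])
  then obtain G D E n where "Pr i j k G D E n" by blast
  thus ?thesis by (intro exI[of _ "(G, D, E, n)"]) simp
 qed
 define q where "q t = (SOME q. Pr (fst t) (fst (snd t)) (snd (snd t)) (fst q) (fst (snd q)) (fst (snd (snd q))) (snd (snd (snd q))))" for t
 define G where "G i j k = fst (q (i, j, k))" for i j k
 define D where "D t = fst (snd (q t))" for t
 define E where "E t = fst (snd (snd (q t)))" for t
 define n where "n t = snd (snd (snd (q t)))" for t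
 have Gall: "Pr i j k (G i j k) (D (i, j, k)) (E (i, j, k)) (n (i, j, k))" if ij: "i < N1" "j < N2" for i j k
  using someI_ex[OF test[OF ij, of k]] unfolding G_def D_def E_def n_def q_def by simp
 have Gm: "G i j k : Bm" and Gn: "norm (G i j k x) <= cg*norm (w i j k)"
  and Gc: "c0*(vol (T i j k)*(norm (w i j k))^2) <= (LINT x|leT i j k. w i j k \<cdot> G i j k x)"
  and Gs: "(LINT x|leT i j k. rt (A' i j k) (B' i j k) (K' i j k) x \<cdot> G i j k x) = - (LINT x|leT i j k. w i j k \<cdot> Gp i j k x)"
  and Gi: "interface_element Om (T i j k) ==> cut Om (T i j k) (D (i, j, k)) (E (i, j, k)) (n (i, j, k))"
  and Gi2: "interface_element Om (T i j k) ==> G i j k = Gop bm bp Om (T i j k) (D (i, j, k)) (n (i, j, k)) (w i j k)"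
  and Gni: "\<not> interface_element Om (T i j k) ==> AE x in leT i j k. G i j k x = (1/?c x) *R w i j k"
  if ij: "i < N1" "j < N2" for i j k x
  using Gall[OF ij, of k] unfolding Pr_def by (auto split: if_splits)
 define Et where "Et i j k = (LINT x|leT i j k. (norm (u x - rt (A i j k) (B i j k) (K i j k) x))^2)" for i j k
 define alpha where "alpha i j k = (LINT x|leT i j k. norm (u x - rt (A i j k) (B i j k) (K i j k) x))" for i j k
 define Z where "Z i j k = (LINT x|leT i j k. u x \<cdot> (G i j k x - (1/?c x) *R w i j k))" for i j k
 have dL: "(%x. u x - rt (A i j k) (B i j k) (K i j k) x) : L2 (T i j k)" if ij: "i < N1" "j < N2" for i j k
 proof -
  have "rt (A i j k) (B i j k) (K i j k) : Mb (T i j k)" using rtm by (simp add: meas_leb measurable_completion)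
  thus ?thesis using ei[OF ij] borel_measurable_diff[OF L1_meas[OF uTi(1)[OF ij]]] by (simp add: L2_def)
 qed
 have alpha2: "(alpha i j k)^2 <= vol (T i j k)*Et i j k" if ij: "i < N1" "j < N2" for i j k
  unfolding alpha_def Et_def by (rule L1_L2[OF T_lebesgue(3) dL[OF ij]])
 have Gmem: "G i j k : Mb (T i j k)" if ij: "i < N1" "j < N2" for i j k
  using Gm[OF ij] by (simp add: meas_leb measurable_completion)
 have cwm: "(%x. (1/?c x) *R v) : Mb (T i j k)" for v :: plane and i j k
 proof -
  have "(%x. (1/?c x) *R v) : Bm" using cm by measurable
  thus ?thesis by (simp add: meas_leb measurable_completion)
 qed
 have cwb: "norm ((1/?c x) *R v) <= (1/aa)*norm v" for x and v :: plane
 proof -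
  have "1/?c x <= 1/aa" using cpos[of x] ab by (intro divide_left_mono) auto
  thus ?thesis using cpos(1)[of x] by (simp only: norm_scaleR abs_of_pos zero_less_divide_1_iff) (rule mult_right_mono, auto)
 qed
 have ucw: "L1 (T i j k) (%x. u x \<cdot> ((1/?c x) *R w i j k))" if ij: "i < N1" "j < N2" for i j k
  using L1_inner_bounded[OF T_lebesgue(3) cwm[of "w i j k" i j k] AE_I2[OF cwb[of _ "w i j k"]] uT[OF ij]] by (simp add: inner_commute)
 have uG: "L1 (T i j k) (%x. u x \<cdot> G i j k x)" if ij: "i < N1" "j < N2" for i j k
  using L1_inner_bounded[OF T_lebesgue(3) Gmem[OF ij] AE_I2[OF Gn[OF ij]] uT[OF ij]] by (simp add: inner_commute)
 have dG: "L1 (T i j k) (%x. (u x - rt (A i j k) (B i j k) (K i j k) x) \<cdot> G i j k x)" if ij: "i < N1" "j < N2" for i j k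
  using L1_inner_bounded[OF T_lebesgue(3) Gmem[OF ij] AE_I2[OF Gn[OF ij]] dL[OF ij]] by (simp add: inner_commute)
 have rG: "L1 (T i j k) (%x. rt (A' i j k) (B' i j k) (K' i j k) x \<cdot> G i j k x)" if ij: "i < N1" "j < N2" for i j k
 proof -
  obtain R where R: "ALL x:T i j k. norm (rt (A' i j k) (B' i j k) (K' i j k) x) <= R" using rtb by blast
  show ?thesis
  proof (rule L1_borel_bounded[OF T_lebesgue(3) borel_measurable_inner[OF rtm Gm[OF ij]]])
  fix x assume x: "x : T i j k"
  have R0: "0 <= R" using R x norm_ge_zero order_trans by blast
  have "abs(rt (A' i j k) (B' i j k) (K' i j k) x \<cdot> G i j k x) <= norm (rt (A' i j k) (B' i j k) (K' i j k) x)*norm (G i j k x)" by (rule Cauchy_Schwarz_ineq2)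
  also have "... <= R*(cg*norm (w i j k))" using R x Gn[OF ij, of k x] norm_ge_zero[of "rt (A' i j k) (B' i j k) (K' i j k) x"]
  by (intro mult_mono R0) auto
  finally show "norm (rt (A' i j k) (B' i j k) (K' i j k) x \<cdot> G i j k x) <= R*(cg*norm (w i j k))" by simp
  qed
 qed
 \<comment> \<open>Write \<open>w\<close> as \<open>u\<close>, minus its interpolation error, minus
   \<open>uh\<close>. The \<open>uh\<close> part is replaced by the tested scheme, and the
   \<open>u\<close> part is split into the consistency term \<open>Z\<close> and the pairing of
   \<open>u\<close> with \<open>w\<close> divided by the coefficient.\<close>
 have wsplit: "(LINT x|leT i j k. w i j k \<cdot> G i j k x) = - (LINT x|leT i j k. (u x - rt (A i j k) (B i j k) (K i j k) x) \<cdot> G i j k x)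
  + Z i j k + (LINT x|leT i j k. u x \<cdot> ((1/?c x) *R w i j k)) + (LINT x|leT i j k. w i j k \<cdot> Gp i j k x)"
  if ij: "i < N1" "j < N2" for i j k
 proof -
  have pt: "w i j k \<cdot> G i j k x = u x \<cdot> G i j k x - (u x - rt (A i j k) (B i j k) (K i j k) x) \<cdot> G i j k x - rt (A' i j k) (B' i j k) (K' i j k) x \<cdot> G i j k x" for x
  unfolding rtd[OF ij, of k x, symmetric] inner_diff_left by simp
  have "(LINT x|leT i j k. w i j k \<cdot> G i j k x)
  = (LINT x|leT i j k. u x \<cdot> G i j k x - (u x - rt (A i j k) (B i j k) (K i j k) x) \<cdot> G i j k x - rt (A' i j k) (B' i j k) (K' i j k) x \<cdot> G i j k x)"
  unfolding pt[symmetric] ..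
  also have "... = (LINT x|leT i j k. u x \<cdot> G i j k x) - (LINT x|leT i j k. (u x - rt (A i j k) (B i j k) (K i j k) x) \<cdot> G i j k x)
  - (LINT x|leT i j k. rt (A' i j k) (B' i j k) (K' i j k) x \<cdot> G i j k x)"
  by (simp only: LINT_diff[OF L1_diff[OF uG[OF ij] dG[OF ij]] rG[OF ij]] LINT_diff[OF uG[OF ij] dG[OF ij]])
  moreover have "Z i j k = (LINT x|leT i j k. u x \<cdot> G i j k x) - (LINT x|leT i j k. u x \<cdot> ((1/?c x) *R w i j k))"
  unfolding Z_def inner_diff_right by (rule LINT_diff[OF uG[OF ij] ucw[OF ij]])
  ultimately show ?thesis unfolding Gs[OF ij] by linarith
 qed
 \<comment> \<open>With zero divergence the second summand of the discrete orthogonality drops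
   out.\<close>
 have sum1: "(\<Sum>(i, j, k)\<in>I. LINT x|leT i j k. w i j k \<cdot> Gp i j k x) = 0"
 proof -
  have "(\<Sum>(i, j, k)\<in>I. LINT x|leT i j k. rt (A i j k - A' i j k) (B i j k - B' i j k) 0 x \<cdot> Gp i j k x + 2*0 * \<Phi> i j k x) = 0"
  by (rule discrete_orthogonality[OF confw mc kd])
  thus ?thesis unfolding rtw by simp
 qed
 define wv where "wv = pw (%i j k x. w i j k)"
 \<comment> \<open>On the whole domain this is minus the pairing of the gradient of \<open>p\<close>
   with the piecewise constant field \<open>wv\<close>, whose weak divergence is zero, and
   \<open>p\<close> lies in \<open>H1_0\<close>.\<close>
 have sum2: "(\<Sum>(i, j, k)\<in>I. LINT x|leT i j k. u x \<cdot> ((1/?c x) *R w i j k)) = 0"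
 proof -
  have wvi: "wv x = rt (A i j k - A' i j k) (B i j k - B' i j k) 0 x" if "i < N1" "j < N2" "x : interior (T i j k)" for i j k x
  unfolding wv_def rtw by (rule pw_interior[OF that])
  have wdw: "has_weak_div ?\<O> wv (pw (%i j k x. 2*0))" "L1 ?\<O> wv"
  by (rule conforming_div[OF confw], erule (2) wvi)+
  have d0: "AE x in leb ?\<O>. pw (%i j k x. 2*0) x = (0::real)" by (rule box_AE) (simp add: pw_interior)
  have wvm: "wv : Mb ?\<O>" by (rule L1_meas[OF wdw(2)])
  have wvb: "AE x in leb ?\<O>. norm (wv x) <= (\<Sum>(i, j, k)\<in>I. norm (w i j k))"
  proof (rule box_AE)
  fix i j k x assume ij: "i < N1" "j < N2" and x: "x : interior (T i j k)"
  have "(case (i, j, k) of (i, j, k) => norm (w i j k)) <= (\<Sum>(i, j, k)\<in>I. norm (w i j k))"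
  by (rule member_le_sum) (use ij finite_I in "auto simp: I_def")
  thus "norm (wv x) <= (\<Sum>(i, j, k)\<in>I. norm (w i j k))" unfolding wv_def pw_interior[OF ij x] by simp
  qed
  have pH: "p : H1 ?\<O>" using p by (simp add: H1_0_def)
  have "L1 ?\<O> (%x. wv x \<cdot> wgrad ?\<O> p x)"
  by (rule L1_inner_bounded[OF bm wvm wvb H1_wgrad(2)[OF op pH]])
  note ibT = integral_box_T[OF this]
  have "(LINT x|leb ?\<O>. wv x \<cdot> wgrad ?\<O> p x) = 0"
  by (rule H1_0_orthogonal[OF op bm p wdw(1) d0 wvm wvb])
  hence z: "(\<Sum>(i, j, k)\<in>I. LINT x|leT i j k. wv x \<cdot> wgrad ?\<O> p x) = 0" unfolding ibT(2) .
  have "(LINT x|leT i j k. u x \<cdot> ((1/?c x) *R w i j k)) = - (LINT x|leT i j k. wv x \<cdot> wgrad ?\<O> p x)" if ij: "i < N1" "j < N2" for i j k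
  proof -
  have "AE x in leT i j k. wv x = w i j k" unfolding wv_def by (rule T_AE[OF ij]) (rule pw_interior[OF ij])
  hence "AE x in leT i j k. - (wv x \<cdot> wgrad ?\<O> p x) = u x \<cdot> ((1/?c x) *R w i j k)"
  using T_AE_box[OF ue ij]
  proof eventually_elim
  case (elim x)
  thus ?case using cpos(1)[of x] by (simp add: inner_commute)
  qed
  from leb_AE_cong(3)[OF T_lebesgue(1) this] show ?thesis using ibT(1)[OF ij, of k] by simp
  qed
  hence "(\<Sum>(i, j, k)\<in>I. LINT x|leT i j k. u x \<cdot> ((1/?c x) *R w i j k)) = (\<Sum>(i, j, k)\<in>I. - (LINT x|leT i j k. wv x \<cdot> wgrad ?\<O> p x))"
  by (intro sum.cong refl) (auto simp: I_def)
  thus ?thesis using z by (simp add: sum_negf case_prod_beta)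
 qed
 \<comment> \<open>On plain elements \<open>G\<close> is almost everywhere \<open>w\<close> divided
   by the coefficient, so the consistency term is 0 there.\<close>
 define gt where "gt t = (if interface_element Om (elem t) then g t (D t) else 0)" for t
 have et: "EX e>=0. abs(Z i j k) <= norm (w i j k)*e & e^2 <= vol (T i j k)*gt (i, j, k)" if ij: "i < N1" "j < N2" for i j k
 proof (cases "interface_element Om (T i j k)")
  case True
  have "(i, j, k) : I" using ij by (simp add: I_def)
  from g[OF this, of "D (i, j, k)" "E (i, j, k)" "n (i, j, k)"] True Gi[OF ij True]
  show ?thesis unfolding Z_def Gi2[OF ij True] gt_def by (auto simp: elem_def)
 next
  case False
  have "AE x in leT i j k. u x \<cdot> (G i j k x - (1/?c x) *R w i j k) = 0" using Gni[OF ij False] by eventually_elim simp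
  hence "Z i j k = 0" unfolding Z_def by (rule integral_eq_zero_AE)
  thus ?thesis using False by (intro exI[of _ 0]) (simp add: gt_def elem_def)
 qed
 define e where "e i j k = (SOME e. 0 <= e & abs(Z i j k) <= norm (w i j k)*e & e^2 <= vol (T i j k)*gt (i, j, k))" for i j k
 have e: "0 <= e i j k" "abs(Z i j k) <= norm (w i j k)*e i j k" "(e i j k)^2 <= vol (T i j k)*gt (i, j, k)" if ij: "i < N1" "j < N2" for i j k
  using someI_ex[OF et[OF ij, of k]] unfolding e_def by auto
 have elem_ineq: "c0*(vol (T i j k)*(norm (w i j k))^2) - (LINT x|leT i j k. u x \<cdot> ((1/?c x) *R w i j k)) - (LINT x|leT i j k. w i j k \<cdot> Gp i j k x)
  <= norm (w i j k)*(cg*alpha i j k + e i j k)" if ij: "i < N1" "j < N2" for i j k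
 proof -
  have "abs(LINT x|leT i j k. (u x - rt (A i j k) (B i j k) (K i j k) x) \<cdot> G i j k x)
  <= (LINT x|leT i j k. cg*norm (w i j k)*norm (u x - rt (A i j k) (B i j k) (K i j k) x))"
  proof (rule abs_LINT_le)
  show "L1 (T i j k) (%x. cg*norm (w i j k)*norm (u x - rt (A i j k) (B i j k) (K i j k) x))"
  by (rule L1_cmult[OF L2_L1(1)[OF T_lebesgue(3) dL[OF ij]]])
  have "abs(v \<cdot> G i j k x) <= cg*norm (w i j k)*norm v" for v x
  proof -
  have "abs(v \<cdot> G i j k x) <= norm v * norm (G i j k x)" by (rule Cauchy_Schwarz_ineq2)
  also have "... <= norm v * (cg*norm (w i j k))" by (rule mult_left_mono[OF Gn[OF ij]]) simp
  finally show ?thesis by (simp add: mult_ac)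
  qed
  thus "AE x in leT i j k. abs((u x - rt (A i j k) (B i j k) (K i j k) x) \<cdot> G i j k x) <= cg*norm (w i j k)*norm (u x - rt (A i j k) (B i j k) (K i j k) x)"
  by (intro AE_I2) blast
  qed
  also have "... = norm (w i j k)*(cg*alpha i j k)" unfolding alpha_def by simp
  finally show ?thesis using Gc[OF ij, of k] wsplit[OF ij, of k] e(2)[OF ij, of k] unfolding distrib_left by linarith
 qed
 have total: "c0*(\<Sum>(i, j, k)\<in>I. vol (T i j k)*(norm (w i j k))^2) <= (\<Sum>(i, j, k)\<in>I. norm (w i j k)*(cg*alpha i j k + e i j k))"
 proof -
  have "(\<Sum>(i, j, k)\<in>I. c0*(vol (T i j k)*(norm (w i j k))^2) - (LINT x|leT i j k. u x \<cdot> ((1/?c x) *R w i j k)) - (LINT x|leT i j k. w i j k \<cdot> Gp i j k x))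
  <= (\<Sum>(i, j, k)\<in>I. norm (w i j k)*(cg*alpha i j k + e i j k))"
  by (rule sum_mono) (use elem_ineq in "auto simp: I_def")
  thus ?thesis using sum1 sum2 by (simp add: case_prod_beta sum_subtractf sum_distrib_left)
 qed
 have W: "(\<Sum>(i, j, k)\<in>I. vol (T i j k)*(norm (w i j k))^2) <= (\<Sum>(i, j, k)\<in>I. 2*cg^2*Et i j k + 2*gt (i, j, k))/c0^2"
  unfolding sum_I_elem
 proof (rule absorb_sum[where e = "%t. cg*alpha (fst t) (fst (snd t)) (snd (snd t)) + e (fst t) (fst (snd t)) (snd (snd t))", OF finite_I c00 total[unfolded sum_I_elem]])
  fix t assume "t : I"
  then obtain i j k where t: "t = (i, j, k)" and ij: "i < N1" "j < N2" by (rule I_cases)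
  show "0 < vol (T (fst t) (fst (snd t)) (snd (snd t)))" by (rule T_pos)
  have "(cg*alpha i j k + e i j k)^2 <= 2*(cg*alpha i j k)^2 + 2*(e i j k)^2"
  using sum_squares_bound[of "cg*alpha i j k" "e i j k"] by (simp add: power2_sum)
  also have "... <= 2*(cg^2*(vol (T i j k)*Et i j k)) + 2*(vol (T i j k)*gt (i, j, k))"
  unfolding power_mult_distrib by (intro add_mono mult_left_mono alpha2[OF ij] e(3)[OF ij]) auto
  also have "... = vol (T i j k)*(2*cg^2*Et i j k + 2*gt (i, j, k))" by (simp add: algebra_simps)
  finally show "(cg*alpha (fst t) (fst (snd t)) (snd (snd t)) + e (fst t) (fst (snd t)) (snd (snd t)))^2
  <= vol (T (fst t) (fst (snd t)) (snd (snd t)))*(2*cg^2*Et (fst t) (fst (snd t)) (snd (snd t)) + 2*gt (fst t, fst (snd t), snd (snd t)))"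
  by (simp add: t)
 qed
 have gts: "(\<Sum>t\<in>I. gt t) <= S"
 proof -
  have "(\<Sum>t\<in>I. gt t) = (\<Sum>t\<in>{t\<in>I. interface_element Om (elem t)}. g t (D t))"
  unfolding gt_def by (rule sum.inter_filter[OF finite_I, symmetric])
  also have "... <= S"
  proof (rule gs)
  fix t assume "t : I" and ie: "interface_element Om (elem t)"
  then obtain i j k where t: "t = (i, j, k)" and ij: "i < N1" "j < N2" by (auto elim: I_cases)
  show "EX E n. cut Om (elem t) (D t) E n" using Gi[OF ij, of k] ie unfolding t elem_def by auto
  qed
  finally show ?thesis .
 qed
 have Es: "(\<Sum>(i, j, k)\<in>I. Et i j k) <= E1" using es unfolding Et_def .
 have "(\<Sum>(i, j, k)\<in>I. 2*cg^2*Et i j k + 2*gt (i, j, k)) = 2*cg^2*(\<Sum>(i, j, k)\<in>I. Et i j k) + 2*(\<Sum>t\<in>I. gt t)"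
  by (simp add: case_prod_beta sum.distrib sum_distrib_left)
 also have "... <= 2*cg^2*E1 + 2*S" by (intro add_mono mult_left_mono Es gts) auto
 finally have W2: "(\<Sum>(i, j, k)\<in>I. vol (T i j k)*(norm (w i j k))^2) <= (2*cg^2*E1 + 2*S)/c0^2"
  using W c00 by (meson divide_right_mono order_trans zero_le_power2)
 have uL2: "u : L2 ?\<O>"
  by (rule L2_vec[OF bm uL])
 have uuL: "(%x. u x - uh x) : L2 ?\<O>"
  by (rule L2_diff[OF uL2 rt_L2[OF _ wd(2)]]) (erule (2) uhrt)
 hence uui: "L1 ?\<O> (%x. (norm (u x - uh x))^2)" by (simp add: L2_def)
 have per: "(LINT x|leT i j k. (norm (u x - uh x))^2) <= 2*Et i j k + 2*(vol (T i j k)*(norm (w i j k))^2)" if ij: "i < N1" "j < N2" for i j k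
 proof -
  have bi: "L1 (T i j k) (%x. 2*(norm (u x - rt (A i j k) (B i j k) (K i j k) x))^2 + 2*(norm (w i j k))^2)"
  by (intro L1_add L1_cmult ei[OF ij] leb_finite(2)[OF T_lebesgue(3)])
  have uhae: "AE x in leT i j k. uh x = rt (A' i j k) (B' i j k) (K' i j k) x" by (rule T_AE[OF ij uhrt[OF ij]])
  have "(LINT x|leT i j k. (norm (u x - uh x))^2) <= (LINT x|leT i j k. 2*(norm (u x - rt (A i j k) (B i j k) (K i j k) x))^2 + 2*(norm (w i j k))^2)"
  proof (rule integral_mono_AE[OF integral_box_T(1)[OF uui ij] bi])
  show "AE x in leT i j k. (norm (u x - uh x))^2 <= 2*(norm (u x - rt (A i j k) (B i j k) (K i j k) x))^2 + 2*(norm (w i j k))^2"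
  using uhae
  proof eventually_elim
  case (elim x)
  let ?d = "u x - rt (A i j k) (B i j k) (K i j k) x"
  have "u x - uh x = ?d + w i j k" unfolding elim rtd[OF ij, of k x, symmetric] by simp
  hence "(norm (u x - uh x))^2 <= (norm ?d + norm (w i j k))^2"
  by (simp only:) (rule power_mono[OF norm_triangle_ineq norm_ge_zero])
  also have "... <= 2*(norm ?d)^2 + 2*(norm (w i j k))^2" using sum_squares_bound[of "norm ?d" "norm (w i j k)"] by (simp add: power2_sum)
  finally show ?case .
  qed
  qed
  also have "... = (LINT x|leT i j k. 2*(norm (u x - rt (A i j k) (B i j k) (K i j k) x))^2) + (LINT x|leT i j k. 2*(norm (w i j k))^2)"
  by (rule LINT_add[OF L1_cmult[OF ei[OF ij]] leb_finite(2)[OF T_lebesgue(3)]])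
  also have "... = 2*Et i j k + 2*(vol (T i j k)*(norm (w i j k))^2)"
  unfolding leb_finite(3)[OF T_lebesgue(3)] Et_def by simp
  finally show ?thesis .
 qed
 have "(l2norm ?\<O> (%x. u x - uh x))^2 = (LINT x|leb ?\<O>. (norm (u x - uh x))^2)"
  unfolding l2norm_def by (rule real_sqrt_pow2) (rule LINT_nonneg, simp)
 also have "... = (\<Sum>(i, j, k)\<in>I. LINT x|leT i j k. (norm (u x - uh x))^2)" by (rule integral_box_T(2)[OF uui])
 also have "... <= (\<Sum>(i, j, k)\<in>I. 2*Et i j k + 2*(vol (T i j k)*(norm (w i j k))^2))"
  by (rule sum_mono) (use per in "auto simp: I_def")
 also have "... = 2*(\<Sum>(i, j, k)\<in>I. Et i j k) + 2*(\<Sum>(i, j, k)\<in>I. vol (T i j k)*(norm (w i j k))^2)"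
  by (simp add: case_prod_beta sum.distrib sum_distrib_left)
 also have "... <= 2*E1 + 2*((2*cg^2*E1 + 2*S)/c0^2)" using Es W2 by linarith
 finally show "(l2norm ?\<O> (%x. u x - uh x))^2 <= 2*E1 + 2*((2*(1/aa + bb^2/aa ^ 3)^2*E1 + 2*S)/(aa^2/bb ^ 3)^2)"
  unfolding cg_def c0_def .
qed

text \<open>The piecewise mean \<open>v\<close> is the divergence of the discrete field, so its
  distance to \<open>f\<close> is the divergence error; the Poincare inequality on each triangle
  bounds it. The last bound feeds the volume term of the interpolation error into the broken
  norm.\<close>

lemma mean_error:
 assumes f: "f : L2 (box a b)" and fT: "!!T. T : mesh a b N1 N2 \<delta> ==> f : H1 (interior T)" and h: "h1 <= h" "h2 <= h"
 defines "v \<equiv> pw (%i j k x. (LINT x|leT i j k. f x)/vol (T i j k))"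
 shows "(%x. f x - v x) : L2 (box a b)"
  "(LINT x|leb (box a b). (f x - v x)^2) <= 16*h^2*(broken_h1norm (mesh a b N1 N2 \<delta>) f)^2"
  "(LINT x|leb (box a b). (f x)^2) <= (broken_h1norm (mesh a b N1 N2 \<delta>) f)^2"
proof -
 have inT: "T i j k : mesh a b N1 N2 \<delta>" if "i < N1" "j < N2" for i j k
  unfolding mesh_T using that by (intro image_eqI[of _ _ "(i, j, k)"]) (auto simp: I_def)
 have vL: "v : L2 (box a b)"
  unfolding L2_def mem_Collect_eq
 proof
  have "L1 (box a b) v" unfolding v_def by (rule pw_integrable) simp
  thus "v : Mb (box a b)" by (rule L1_meas)
  have "L1 (box a b) (pw (%i j k x. ((LINT x|leT i j k. f x)/vol (T i j k))^2))"
  by (rule pw_integrable) simp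
  moreover have "AE x in leb (box a b). pw (%i j k x. ((LINT x|leT i j k. f x)/vol (T i j k))^2) x = (norm (v x))^2"
  by (rule box_AE) (simp only: v_def pw_interior real_norm_def power2_abs)
  ultimately show "L1 (box a b) (%x. (norm (v x))^2)" using leb_AE_cong(2)[of "box a b"] by fastforce
 qed
 show dL: "(%x. f x - v x) : L2 (box a b)" by (rule L2_diff[OF f vL])
 have di: "L1 (box a b) (%x. (f x - v x)^2)" and fi: "L1 (box a b) (%x. (f x)^2)"
  using dL f by (simp_all add: L2_def)
 have sq: "(l2norm S g)^2 = (LINT x|leb S. (norm (g x))^2)" for S and g :: "plane => 'z::euclidean_space"
  unfolding l2norm_def by (rule real_sqrt_pow2) (rule LINT_nonneg, simp)
 have broken: "(broken_h1norm (mesh a b N1 N2 \<delta>) f)^2 = (\<Sum>(i, j, k)\<in>I. (l2norm (interior (T i j k)) f)^2 + (l2norm (interior (T i j k)) (wgrad (interior (T i j k)) f))^2)"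
 proof -
  have "(broken_h1norm (mesh a b N1 N2 \<delta>) f)^2 = (\<Sum>T\<in>mesh a b N1 N2 \<delta>. (h1norm (interior T) f)^2)"
  unfolding broken_h1norm_def by (rule real_sqrt_pow2) (intro sum_nonneg zero_le_power2)
  also have "... = (\<Sum>(i, j, k)\<in>I. (h1norm (interior (T i j k)) f)^2)"
  unfolding mesh_T sum.reindex[OF T_inj] by (simp add: case_prod_beta o_def)
  finally show ?thesis unfolding h1norm_def by (simp add: case_prod_beta)
 qed
 have per: "(LINT x|leT i j k. (f x)^2) = (l2norm (interior (T i j k)) f)^2"
  "(LINT x|leT i j k. (f x - v x)^2) <= 16*h^2*(l2norm (interior (T i j k)) (wgrad (interior (T i j k)) f))^2"
  if ij: "i < N1" "j < N2" for i j k
 proof -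
  let ?T = "T i j k" and ?S = "interior (T i j k)"
  have fH: "f : H1 ?S" by (rule fT[OF inT[OF ij]])
  have oS: "open ?S" "convex ?S" "bounded ?S" "?S ~= {}"
  by (simp_all add: convex_interior T_convex bounded_interior T_bounded T_interior_nonempty)
  have Sl: "?S : sets lebesgue" by auto
  have ae: "AE x in lebesgue. x : ?S \<longleftrightarrow> x : ?T" using AE_interior_T by eventually_elim (use ij interior_subset[of ?T] in blast)
  have tr: "L1 ?S F ==> (LINT x|leb ?T. F x) = (LINT x|leb ?S. F x)" for F :: "plane => real"
  by (rule leb_AE_set(2)[OF Sl T_lebesgue(1) ae])
  have fL: "f : L2 ?S" by (rule H1_wgrad(3)[OF oS(1) fH])
  have "L1 ?S (%x. (f x)^2)" using fL by (simp add: L2_def)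
  from tr[OF this] show "(LINT x|leb ?T. (f x)^2) = (l2norm ?S f)^2" unfolding sq by simp
  have Slm: "?S : lmeasurable" by (simp add: lmeasurable_interior T_bounded)
  have Sm: "vol ?S = vol ?T"
  using tr[OF leb_finite(2)[OF Slm, of 1]] unfolding leb_finite(3)[OF T_lebesgue(3)] leb_finite(3)[OF Slm] by simp
  have mean: "(LINT x|leb ?S. f x)/vol ?S = (LINT x|leb ?T. f x)/vol ?T" (is "?m = ?m'")
  unfolding Sm tr[OF L2_L1(2)[OF Slm fL]] ..
  have diam: "abs(x$1 - y$1) <= h1 & abs(x$2 - y$2) <= h2" if "x : ?S" "y : ?S" for x y
  using interior_T_cell[OF that(1)] interior_T_cell[OF that(2)] unfolding XY_Suc by linarith
  have shape: "h1*h2 <= 2 * vol ?S" unfolding Sm T_measure by simp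
  have i: "L1 ?S (%x. (f x - ?m)^2)" by (rule poincare_H1(1)[OF oS fH _ shape]) (erule (1) diam)
  have le: "(LINT x|leb ?S. (f x - ?m)^2) <= 8*(h1^2 + h2^2)*(LINT x|leb ?S. (norm (wgrad ?S f x))^2)"
  by (rule poincare_H1(2)[OF oS fH _ shape]) (erule (1) diam)
  have "AE x in leb ?T. (f x - v x)^2 = (f x - ?m)^2"
  by (rule T_AE[OF ij]) (simp only: v_def pw_interior[OF ij] mean)
  from leb_AE_cong(3)[OF T_lebesgue(1) this integral_box_T(1)[OF di ij]]
  have "(LINT x|leb ?T. (f x - v x)^2) = (LINT x|leb ?T. (f x - ?m)^2)" by simp
  also have "... = (LINT x|leb ?S. (f x - ?m)^2)" by (rule tr[OF i])
  also have "... <= 8*(h1^2 + h2^2)*(l2norm ?S (wgrad ?S f))^2" using le unfolding sq .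
  also have "... <= 16*h^2*(l2norm ?S (wgrad ?S f))^2"
  proof (rule mult_right_mono)
  have "h1^2 <= h^2" "h2^2 <= h^2" using h h_pos by (auto intro!: power_mono)
  thus "8*(h1^2 + h2^2) <= 16*h^2" by simp
  qed simp
  finally show "(LINT x|leb ?T. (f x - v x)^2) <= 16*h^2*(l2norm ?S (wgrad ?S f))^2" .
 qed
 show "(LINT x|leb (box a b). (f x)^2) <= (broken_h1norm (mesh a b N1 N2 \<delta>) f)^2"
  unfolding integral_box_T(2)[OF fi] broken by (rule sum_mono) (use per(1) in "auto simp: I_def")
 have "(LINT x|leb (box a b). (f x - v x)^2) <= (\<Sum>(i, j, k)\<in>I. 16*h^2*((l2norm (interior (T i j k)) f)^2 + (l2norm (interior (T i j k)) (wgrad (interior (T i j k)) f))^2))"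
  unfolding integral_box_T(2)[OF di]
 proof (rule sum_mono)
  fix t assume "t : I"
  then obtain i j k where t: "t = (i, j, k)" and ij: "i < N1" "j < N2" by (rule I_cases)
  have "0 <= 16*h^2*(l2norm (interior (T i j k)) f)^2" by simp
  thus "(case t of (i, j, k) => LINT x|leT i j k. (f x - v x)^2) <= (case t of (i, j, k) => 16*h^2*((l2norm (interior (T i j k)) f)^2 + (l2norm (interior (T i j k)) (wgrad (interior (T i j k)) f))^2))"
  using per(2)[OF ij, of k] unfolding t prod.case distrib_left by linarith
 qed
 also have "... = 16*h^2*(broken_h1norm (mesh a b N1 N2 \<delta>) f)^2" unfolding broken by (simp add: sum_distrib_left case_prod_beta)
 finally show "(LINT x|leb (box a b). (f x - v x)^2) <= 16*h^2*(broken_h1norm (mesh a b N1 N2 \<delta>) f)^2" .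
qed

end

section \<open>The mesh threshold and the final constant\<close>

theorem theorem5p2:
  fixes a b :: "real^2" and Om :: "(real^2) set" and \<beta>m \<beta>p \<kappa> :: real
  assumes "\<forall>i. a $ i < b $ i"
    and "interface_geometry (box a b) Om"
    and "\<beta>m > 0" and "\<beta>p > 0"
  shows "\<exists>C>0. \<forall>(N1::nat) (N2::nat) (\<delta> :: nat \<Rightarrow> nat \<Rightarrow> bool)
      (f :: real^2 \<Rightarrow> real) (p :: real^2 \<Rightarrow> real) (u :: real^2 \<Rightarrow> real^2)
      (uh :: real^2 \<Rightarrow> real^2) (ph :: real^2 \<Rightarrow> real).
    N1 > 0 \<longrightarrow> N2 > 0 \<longrightarrow> shape_regular \<kappa> a b N1 N2 \<longrightarrow>
    resolves_interface Om (mesh a b N1 N2 \<delta>) \<longrightarrow>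
    f \<in> L2 (box a b) \<longrightarrow> (\<forall>T\<in>mesh a b N1 N2 \<delta>. f \<in> H1 (interior T)) \<longrightarrow>
    p \<in> H2_tilde (box a b) Om \<inter> H1_0 (box a b) \<longrightarrow>
    weak_solution (box a b) Om \<beta>m \<beta>p f p \<longrightarrow>
    (AE x in lebesgue_on (box a b). u x = - (coef Om \<beta>m \<beta>p x *\<^sub>R wgrad (box a b) p x)) \<longrightarrow>
    u \<in> H1_vec (box a b) \<longrightarrow>
    uh \<in> V_h (mesh a b N1 N2 \<delta>) \<longrightarrow>
    ph \<in> S_h (box a b) Om \<beta>m \<beta>p (mesh a b N1 N2 \<delta>) \<longrightarrow>
    mfv_scheme (box a b) Om \<beta>m \<beta>p (mesh a b N1 N2 \<delta>) f uh ph \<longrightarrow>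
    l2norm (box a b) (\<lambda>x. u x - uh x) +
      l2norm (box a b) (\<lambda>x. wdiv (box a b) u x - wdiv (box a b) uh x)
    \<le> C * mesh_size a b N1 N2 *
        (h1norm_vec (box a b) u + h2norm_tilde (box a b) Om p +
         broken_h1norm (mesh a b N1 N2 \<delta>) f)"
proof -
 let ?\<O> = "box a b"
 have ab: "!!i. a$i < b$i" using assms(1) by blast
 have Om: "open Om" "Om \<subseteq> ?\<O>" "frontier Om \<subseteq> ?\<O>" "C2_boundary Om" using assms(2) by (auto simp: interface_geometry_def)
 have \<beta>: "\<beta>m > 0" "\<beta>p > 0" by (rule assms)+
 have op: "open ?\<O>" and bm: "?\<O> : lmeasurable" and bl: "?\<O> : sets lebesgue" by auto
 have bOm: "bounded Om" by (rule bounded_subset[OF bounded_box Om(2)])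
 \<comment> \<open>No sign of \<open>\<kappa>\<close> is assumed, whereas the geometric lemmas ask
   for a positive constant.\<close>
 define \<kappa>' where "\<kappa>' = max \<kappa> 1"
 have \<kappa>': "\<kappa>' > 0" "\<kappa> <= \<kappa>'" by (auto simp: \<kappa>'_def)
 obtain h0 C where h0: "h0 > 0" and C: "C >= 0" and chord: "!!P c d h D E n x. 0 < h ==> h <= h0 ==> c ~= 0 ==> d ~= 0 ==> abs(c) <= h ==> abs(d) <= h ==>
  h <= \<kappa>'*abs(c) ==> h <= \<kappa>'*abs(d) ==> cut Om (tri P c d) D E n ==> norm (x - D) <= 3*h ==> C*h^2 < abs(n \<cdot> (x - D)) ==> (x : Om \<longleftrightarrow> n \<cdot> (x - D) < 0)"
  using chord_region[OF Om(1,4) bOm \<kappa>'(1)] by (elim exE conjE) (erule that, assumption, blast)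
 \<comment> \<open>Elements have area \<open>h1*h2/2\<close>, so bounded aspect ratio means
   \<open>h^2 <= (2 * \<kappa>'^2) * vol T\<close>.\<close>
 have "2 * \<kappa>'^2 > 0" using \<kappa>'(1) by simp
 from interface_estimate[OF \<beta> C this] obtain Ki where Ki: "Ki >= 0" and iest: "!!\<O> Om u U p gp T D n h. open \<O> ==> open Om ==> 0 < h ==> 4*(C + 1)*h <= 1 ==> norm n = 1 ==>
  Sq D h \<subseteq> \<O> ==>
  (ALL m. (%x. u x$m) : H1 \<O>) ==> (ALL m. U m = wgrad \<O> (%x. u x$m)) ==> has_weak_grad \<O> p gp ==>
  (AE x in leb \<O>. gp x = (- 1/coef Om \<beta>m \<beta>p x) *R u x) ==>
  (ALL x:Sq D h. C*h^2 < abs(n \<cdot> (x - D)) --> (x : Om \<longleftrightarrow> n \<cdot> (x - D) < 0)) ==>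
  T : lmeasurable ==> (ALL x:T. ALL l. abs(x$l - D$l) <= h) ==> vol T <= h^2 ==> h^2 <= (2 * \<kappa>'^2) * vol T ==>
  (EX e>=0. (ALL w. abs(LINT x|leb T. u x \<cdot> (Gop \<beta>m \<beta>p Om T D n w x - (1/coef Om \<beta>m \<beta>p x) *R w)) <= norm w*e) &
  e^2 <= vol T*(Ki*h^2*(LINT x|leb (Sq D h). (norm (u x))^2 + ((norm (U 1 x))^2 + (norm (U 2 x))^2))))"
  by (elim exE conjE) (erule that, blast)
 have "compact (frontier Om)" using bOm by (rule compact_frontier_bounded)
 note sep = compact_in_open_separated[OF _ this op Om(3)]
 obtain \<rho> where \<rho>: "frontier Om ~= {} ==> \<rho> > 0"
  "frontier Om ~= {} ==> {x. infdist x (frontier Om) <= \<rho>} \<subseteq> ?\<O>" using sep by metis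
 define r where "r = (if frontier Om = {} then 1 else \<rho>)"
 have r: "r > 0" "!!x D. D : frontier Om ==> norm (x - D) <= r ==> x : ?\<O>"
 proof -
  show "r > 0" using \<rho>(1) by (auto simp: r_def)
  fix x D assume D: "D : frontier Om" "norm (x - D) <= r"
  hence "infdist x (frontier Om) <= \<rho>" using infdist_le[OF D(1), of x] by (auto simp: r_def dist_norm split: if_splits)
  thus "x : ?\<O>" using \<rho>(2) D(1) by blast
 qed
 \<comment> \<open>Up to \<open>hs\<close> the chord lemma applies, the squares around interface
   points, which reach out less than \<open>3*h\<close>, stay in the domain, and the strip in the
   tangential estimate is thin compared with \<open>h\<close>.\<close>
 define hs where "hs = min h0 (min (r/3) (1/(4*(C + 1))))"
 have hs: "hs > 0" using h0 r C by (simp add: hs_def)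
 define aa bb where "aa = min \<beta>m \<beta>p" and "bb = max \<beta>m \<beta>p"
 have aab: "0 < aa" "0 < bb" using \<beta> by (simp_all add: aa_def bb_def)
 define cg where "cg = 1/aa + bb^2/aa ^ 3"
 define c0 where "c0 = aa^2/bb ^ 3"
 define ce where "ce = cg + 1/aa"
 have ce0: "ce >= 0" using aab by (simp add: ce_def cg_def)
 \<comment> \<open>For \<open>h > hs\<close> the consistency term is bounded by the size of
   \<open>u\<close> alone; the missing factor \<open>h^2\<close> is supplied by
   \<open>h^2/hs^2\<close>, which then is at least 1. This makes the constant valid on coarse meshes
   too.\<close>
 define Kl where "Kl = ce^2/hs^2"
 define Kst where "Kst = Ki*(2*(6 * \<kappa>' + 1)^2) + Kl"
 have Kl: "Kl >= 0" by (simp add: Kl_def)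
 have Kst: "Kst >= 0" using Ki Kl by (simp add: Kst_def)
 \<comment> \<open>\<open>vector_error\<close> with its first bound \<open>E1\<close> estimated by
   100 times, and its second bound \<open>S\<close> by \<open>Kst\<close> times, the product of
   \<open>h^2\<close> and the squared norms.\<close>
 define Cv where "Cv = 200 + 2*((200*cg^2 + 2*Kst)/c0^2)"
 have Cv: "Cv >= 0" using Kst by (simp add: Cv_def)
 define Cst where "Cst = sqrt Cv + 4"
 have Cst: "Cst > 0" using Cv by (simp add: Cst_def add_nonneg_pos)
 show ?thesis
 proof (rule exI[of _ Cst], rule conjI[OF Cst], intro allI impI, goal_cases)
  case (1 N1 N2 \<delta> f p u uh ph)
  interpret grid a b N1 N2 \<delta> by unfold_locales (use ab 1(1,2) in auto)
  define h where "h = mesh_size a b N1 N2"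
  have h_max: "h = max h1 h2" by (simp add: h_def mesh_size_def h1_def h2_def)
  have h: "h1 <= h" "h2 <= h" "0 < h" using h_pos by (auto simp: h_max)
  have hk: "h <= \<kappa>'*h1" "h <= \<kappa>'*h2"
  proof -
  have "h <= \<kappa>*min h1 h2" using 1(3) by (simp add: shape_regular_def h_max h1_def h2_def)
  also have "... <= \<kappa>'*min h1 h2" using \<kappa>'(2) h_pos by (intro mult_right_mono) auto
  finally have "h <= \<kappa>'*min h1 h2" .
  moreover have "\<kappa>'*min h1 h2 <= \<kappa>'*h1" "\<kappa>'*min h1 h2 <= \<kappa>'*h2" using \<kappa>' by (auto intro: mult_left_mono)
  ultimately show "h <= \<kappa>'*h1" "h <= \<kappa>'*h2" by linarith+
  qed
  have pH: "p : H1_0 ?\<O>" using 1(7) by blast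
  hence pH1: "p : H1 ?\<O>" by (simp add: H1_0_def)
  have uH: "(%x. u x$m) : H1 ?\<O>" for m using 1(10) by (simp add: H1_vec_def)
  define U where "U m = wgrad ?\<O> (%x. u x$m)" for m
  note uw = H1_wgrad[OF op uH, folded U_def]
  have uL2: "u : L2 ?\<O>" by (rule L2_vec[OF bm uw(3)])
  have wdf: "has_weak_div ?\<O> u f" by (rule weak_solution_div[OF op bm pH1 1(8,9) uL2 1(5)])
  have wdU: "has_weak_div ?\<O> u (%x. U 1 x$1 + U 2 x$2)"
  by (rule H1_vec_weak_div[OF op uw(1) L2_locally_integrable[OF uL2 bm]])
  \<comment> \<open>The variational equation and the weak gradients of the components give two weak
    divergences of \<open>u\<close>, which agree by uniqueness.\<close>
  have fu: "AE x in leb ?\<O>. f x = U 1 x$1 + U 2 x$2" by (rule has_weak_div_unique[OF op wdf wdU])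
  have wgp: "AE x in leb ?\<O>. wgrad ?\<O> p x = (- 1/coef Om \<beta>m \<beta>p x) *R u x"
  using 1(9)
  proof eventually_elim
  case (elim x)
  have "coef Om \<beta>m \<beta>p x ~= 0" using \<beta> by (simp add: coef_def)
  thus ?case unfolding elim by simp
  qed
  define F where "F x = (norm (u x))^2 + ((norm (U 1 x))^2 + (norm (U 2 x))^2)" for x
  have i1: "L1 ?\<O> (%x. (norm (u x))^2)" and i2: "L1 ?\<O> (%x. (norm (U m x))^2)" for m
  using uL2 uw(2)[of m] by (simp_all add: L2_def)
  have iU: "L1 ?\<O> (%x. (norm (U 1 x))^2 + (norm (U 2 x))^2)" by (rule L1_add[OF i2 i2])
  have Fi: "L1 ?\<O> F" unfolding F_def[abs_def] by (rule L1_add[OF i1 iU])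
  have F0: "0 <= F x" for x by (simp add: F_def)
  define I0 where "I0 = (LINT x|leb ?\<O>. F x)"
  have I0: "I0 >= 0" unfolding I0_def by (rule LINT_nonneg[OF F0])
  \<comment> \<open>On a coarse mesh the square around \<open>D\<close> could leave the domain, so
    there the bound uses the element itself, and no overlap has to be counted.\<close>
  define g where "g t D = (if h <= hs then Ki*h^2*(LINT x|leb (Sq D h). F x)
  else Kl*h^2*(LINT x|leb (elem t). F x))" for t D
  have cutD: "D : frontier Om & D : T i j k & norm n = 1" if "cut Om (T i j k) D E n" for i j k D E n
  proof -
  have "D : frontier Om \<inter> frontier (T i j k)" using that by (auto simp: cut_def)
  thus ?thesis using frontier_subset_closed[OF T_closed] that by (auto simp: cut_def)
  qed
  have Qn: "norm (x - D) <= 3*h" if "x : Sq D h" for x D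
  proof (rule power2_le_imp_le)
  have "abs((x - D)$1) <= abs(2*h)" "abs((x - D)$2) <= abs(2*h)" using that h(3) by (auto simp: mem_box_cart forall_2 abs_le_iff)
  hence "((x - D)$1)^2 <= (2*h)^2" "((x - D)$2)^2 <= (2*h)^2" by (simp_all only: abs_le_square_iff)
  hence "(norm (x - D))^2 <= (2*h)^2 + (2*h)^2" unfolding plane_norm_square by linarith
  also have "... <= (3*h)^2" by (simp add: power_mult_distrib)
  finally show "(norm (x - D))^2 <= (3*h)^2" .
  qed (use h in simp)
  have Qsub: "Sq D h \<subseteq> ?\<O>" if "D : frontier Om" "h <= hs" for D
  proof
  fix x assume "x : Sq D h"
  from Qn[OF this] that(2) have "norm (x - D) <= r" by (simp add: hs_def)
  thus "x : ?\<O>" by (rule r(2)[OF that(1)])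
  qed
  have ghyp: "EX e>=0. (ALL w. abs(LINT x|leb (elem t). u x \<cdot> (Gop \<beta>m \<beta>p Om (elem t) D n w x - (1/coef Om \<beta>m \<beta>p x) *R w)) <= norm w*e) &
  e^2 <= vol (elem t)*g t D" if t: "t : I" and cut: "cut Om (elem t) D E n" for t D E n
  proof -
  obtain i j k where tt: "t = (i, j, k)" and ij: "i < N1" "j < N2" using t by (rule I_cases)
  have el: "elem t = T i j k" by (simp add: elem_def tt)
  note cutT = cut[unfolded el]
  note cD = cutD[OF cutT]
  show ?thesis
  proof (cases "h <= hs")
  case True
  have TD: "ALL x:T i j k. ALL l. abs(x$l - D$l) <= h"
  proof (intro ballI allI)
  fix x and l :: 2 assume x: "x : T i j k"
  have "abs(x$1 - D$1) <= h" "abs(x$2 - D$2) <= h"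
  using T_cell[OF x] T_cell[of D i j k] cD h unfolding XY_Suc by linarith+
  thus "abs(x$l - D$l) <= h" using exhaust_2[of l] by auto
  qed
  have M1: "vol (T i j k) <= h^2"
  proof -
  have "h1*h2 <= h*h" using h h_pos by (intro mult_mono) auto
  thus ?thesis unfolding T_measure power2_eq_square using h_pos mult_pos_pos[of h1 h2] by linarith
  qed
  have M2: "h^2 <= (2 * \<kappa>'^2) * vol (T i j k)"
  proof -
  have "h*h <= (\<kappa>'*h1)*(\<kappa>'*h2)" using hk h \<kappa>' h_pos by (intro mult_mono) auto
  thus ?thesis unfolding T_measure by (simp add: power2_eq_square mult_ac)
  qed
  have small: "4*(C + 1)*h <= 1"
  proof -
  have "h <= 1/(4*(C + 1))" using True by (simp add: hs_def)
  thus ?thesis using C by (simp add: pos_le_divide_eq mult.commute)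
  qed
  have reg: "ALL x:Sq D h. C*h^2 < abs(n \<cdot> (x - D)) --> (x : Om \<longleftrightarrow> n \<cdot> (x - D) < 0)"
  proof (intro ballI impI)
  fix x assume x: "x : Sq D h" "C*h^2 < abs(n \<cdot> (x - D))"
  have hh: "h <= h0" using True by (simp add: hs_def)
  show "x : Om \<longleftrightarrow> n \<cdot> (x - D) < 0"
  by (rule chord[OF h(3) hh s_nz(1,2) _ _ _ _ cutT[unfolded T_def] Qn[OF x(1)] x(2)]) (simp_all add: h hk)
  qed
  from iest[OF op Om(1) h(3) small _ Qsub _ _ H1_wgrad(1)[OF op pH1] wgp reg T_lebesgue(3) TD M1 M2, of U] cD True uH U_def
  show ?thesis unfolding el g_def F_def by simp
  next
  case False
  interpret cl: cut_element \<beta>m \<beta>p Om "T i j k" D n by unfold_locales (use \<beta> Om cD T_pos in auto)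
  have uT: "u : L2 (T i j k)" by (rule L2_T[OF uw(3) ij])
  define e where "e = ce*(LINT x|leb (T i j k). norm (u x))"
  have e0: "e >= 0" unfolding e_def by (intro mult_nonneg_nonneg ce0 LINT_nonneg) simp
  have est: "abs(LINT x|leb (T i j k). u x \<cdot> (Gop \<beta>m \<beta>p Om (T i j k) D n w x - (1/coef Om \<beta>m \<beta>p x) *R w)) <= norm w*e" for w
  proof -
  have "abs(LINT x|leb (T i j k). u x \<cdot> (Gop \<beta>m \<beta>p Om (T i j k) D n w x - (1/coef Om \<beta>m \<beta>p x) *R w))
  <= (LINT x|leb (T i j k). (norm w*ce)*norm (u x))"
  proof (rule abs_LINT_le)
  show "L1 (T i j k) (%x. (norm w*ce)*norm (u x))"
  by (rule L1_cmult[OF L2_L1(1)[OF T_lebesgue(3) uT]])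
  have "abs(u x \<cdot> (Gop \<beta>m \<beta>p Om (T i j k) D n w x - (1/coef Om \<beta>m \<beta>p x) *R w)) <= (norm w*ce)*norm (u x)" for x
  proof -
  have G: "norm (Gop \<beta>m \<beta>p Om (T i j k) D n w x) <= cg*norm w"
  using cl.Gop_norm[of w x] unfolding cl.cG_def cl.ba_def cl.bb_def cg_def aa_def bb_def .
  have "1/coef Om \<beta>m \<beta>p x <= 1/aa" using cl.inv_bnd(4)[of x] unfolding cl.ba_def aa_def .
  hence W: "norm ((1/coef Om \<beta>m \<beta>p x) *R w) <= (1/aa)*norm w"
  using cl.bnd(8)[of x] by (simp only: norm_scaleR abs_of_pos zero_less_divide_1_iff) (rule mult_right_mono, auto)
  have "abs(u x \<cdot> (Gop \<beta>m \<beta>p Om (T i j k) D n w x - (1/coef Om \<beta>m \<beta>p x) *R w))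
  <= norm (u x)*norm (Gop \<beta>m \<beta>p Om (T i j k) D n w x - (1/coef Om \<beta>m \<beta>p x) *R w)" by (rule Cauchy_Schwarz_ineq2)
  also have "... <= norm (u x)*(cg*norm w + (1/aa)*norm w)"
  using norm_triangle_ineq4[of "Gop \<beta>m \<beta>p Om (T i j k) D n w x" "(1/coef Om \<beta>m \<beta>p x) *R w"] G W by (intro mult_left_mono) auto
  finally show ?thesis by (simp add: ce_def algebra_simps)
  qed
  thus "AE x in leb (T i j k). abs(u x \<cdot> (Gop \<beta>m \<beta>p Om (T i j k) D n w x - (1/coef Om \<beta>m \<beta>p x) *R w)) <= (norm w*ce)*norm (u x)"
  by (intro AE_I2) blast
  qed
  thus ?thesis by (simp add: e_def mult.assoc)
  qed
  have "e^2 <= vol (T i j k)*(Kl*h^2*(LINT x|leb (T i j k). F x))"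
  proof -
  have FT: "L1 (T i j k) F" by (rule integral_box_T(1)[OF Fi ij])
  have u2T: "L1 (T i j k) (%x. (norm (u x))^2)" using uT by (simp add: L2_def)
  have "e^2 = ce^2*(LINT x|leb (T i j k). norm (u x))^2" by (simp add: e_def power_mult_distrib)
  also have "... <= ce^2*(vol (T i j k)*(LINT x|leb (T i j k). (norm (u x))^2))"
  by (rule mult_left_mono[OF L1_L2[OF T_lebesgue(3) uT]]) simp
  also have "... <= ce^2*(vol (T i j k)*(LINT x|leb (T i j k). F x))"
  by (intro mult_left_mono integral_mono[OF u2T FT]) (auto simp: F_def)
  also have "... <= ce^2*(vol (T i j k)*(LINT x|leb (T i j k). F x))*(h^2/hs^2)"
  proof -
  have "hs^2 <= h^2" using False hs by (intro power_mono) auto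
  hence q: "1 <= h^2/hs^2" using hs by simp
  have "0 <= ce^2*(vol (T i j k)*(LINT x|leb (T i j k). F x))"
  by (intro mult_nonneg_nonneg LINT_nonneg F0) auto
  from mult_left_mono[OF q this] show ?thesis by simp
  qed
  also have "... = vol (T i j k)*(Kl*h^2*(LINT x|leb (T i j k). F x))" by (simp add: Kl_def)
  finally show ?thesis .
  qed
  thus ?thesis using e0 est False unfolding el g_def by (intro exI[of _ e]) simp
  qed
  qed
  have gsum: "(\<Sum>t\<in>{t\<in>I. interface_element Om (elem t)}. g t (D t)) <= Kst*h^2*I0"
  if D: "!!t. t : I ==> interface_element Om (elem t) ==> EX E n. cut Om (elem t) (D t) E n" for D
  proof (cases "h <= hs")
  case True
  let ?J = "{t\<in>I. interface_element Om (elem t)}"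
  have DT: "D (i, j, k) : T i j k & D (i, j, k) : frontier Om" if "(i, j, k) : ?J" for i j k
  using D[of "(i, j, k)"] that cutD[of i j k] unfolding elem_def by auto
  have "(\<Sum>t\<in>?J. LINT x|leb (Sq (D t) h). F x) <= 2*(6 * \<kappa>' + 1)^2*I0"
  unfolding I0_def
  proof (rule finite_overlap[OF _ _ _ h(1,2) hk _ Fi F0])
  show "?J \<subseteq> I" by auto
  show "D (i, j, k) : T i j k" if "(i, j, k) : ?J" for i j k using DT[OF that] by simp
  show "Sq (D t) h \<subseteq> ?\<O>" if "t : ?J" for t
  using Qsub[OF _ True] DT[of "fst t" "fst (snd t)" "snd (snd t)"] that by simp
  show "0 <= \<kappa>'" using \<kappa>' by simp
  qed
  hence "Ki*h^2*(\<Sum>t\<in>?J. LINT x|leb (Sq (D t) h). F x) <= Ki*h^2*(2*(6 * \<kappa>' + 1)^2*I0)"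
  using Ki by (intro mult_left_mono) auto
  also have "... = (Ki*(2*(6 * \<kappa>' + 1)^2))*h^2*I0" by simp
  also have "... <= Kst*h^2*I0" unfolding Kst_def using Kl I0 by (intro mult_right_mono) auto
  finally show ?thesis using True by (simp add: g_def sum_distrib_left)
  next
  case False
  have "(\<Sum>t\<in>{t\<in>I. interface_element Om (elem t)}. LINT x|leb (elem t). F x) <= (\<Sum>t\<in>I. LINT x|leb (elem t). F x)"
  by (rule sum_mono2[OF finite_I]) (auto intro!: LINT_nonneg F0)
  also have "... = I0" unfolding I0_def integral_box_T(2)[OF Fi] by (simp add: elem_def case_prod_beta)
  finally have "Kl*h^2*(\<Sum>t\<in>{t\<in>I. interface_element Om (elem t)}. LINT x|leb (elem t). F x) <= Kl*h^2*I0"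
  using Kl by (intro mult_left_mono) auto
  also have "... <= Kst*h^2*I0" unfolding Kst_def using Ki I0 by (intro mult_right_mono) auto
  finally show ?thesis using False by (simp add: g_def sum_distrib_left)
  qed
  note ve = vector_error[OF \<beta> Om(1) h(1,2) uH 1(5) U_def fu pH 1(9) 1(11-13) ghyp gsum, folded aa_def bb_def, folded cg_def c0_def]
  define A where "A = h1norm_vec ?\<O> u"
  define B where "B = broken_h1norm (mesh a b N1 N2 \<delta>) f"
  define V where "V = l2norm ?\<O> (%x. u x - uh x)"
  define I1 where "I1 = (LINT x|leb ?\<O>. (norm (U 1 x))^2 + (norm (U 2 x))^2)"
  define I2 where "I2 = (LINT x|leb ?\<O>. (f x)^2)"
  define E1 where "E1 = h^2*(100*I1 + 2*I2)"
  note me = mean_error[OF 1(5) 1(6)[rule_format] h(1,2)]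
  have sq: "(l2norm S v)^2 = (LINT x|leb S. (norm (v x))^2)" for S and v :: "plane => 'z::euclidean_space"
  unfolding l2norm_def by (rule real_sqrt_pow2) (rule LINT_nonneg, simp)
  have A0: "A >= 0" "B >= 0" "h2norm_tilde ?\<O> Om p >= 0"
  by (auto simp: A_def B_def h1norm_vec_def broken_h1norm_def h2norm_tilde_def intro!: sum_nonneg add_nonneg_nonneg)
  have A2: "A^2 = I0"
  proof -
  have i3: "L1 ?\<O> (%x. (u x$m)^2)" for m using uw(3)[of m] by (simp add: L2_def)
  have "A^2 = (\<Sum>m\<in>UNIV. (h1norm ?\<O> (%x. u x$m))^2)"
  unfolding A_def h1norm_vec_def by (rule real_sqrt_pow2) (intro sum_nonneg zero_le_power2)
  also have "... = (h1norm ?\<O> (%x. u x$1))^2 + (h1norm ?\<O> (%x. u x$2))^2" by (rule sum_2)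
  also have "... = ((l2norm ?\<O> (%x. u x$1))^2 + (l2norm ?\<O> (U 1))^2) + ((l2norm ?\<O> (%x. u x$2))^2 + (l2norm ?\<O> (U 2))^2)"
  unfolding h1norm_def U_def by simp
  also have "... = ((LINT x|leb ?\<O>. (u x$1)^2) + (LINT x|leb ?\<O>. (u x$2)^2)) + ((LINT x|leb ?\<O>. (norm (U 1 x))^2) + (LINT x|leb ?\<O>. (norm (U 2 x))^2))"
  unfolding sq by simp
  also have "... = (LINT x|leb ?\<O>. (norm (u x))^2) + (LINT x|leb ?\<O>. (norm (U 1 x))^2 + (norm (U 2 x))^2)"
  unfolding plane_norm_square[of "u _"] LINT_add[OF i3 i3] LINT_add[OF i2 i2] ..
  also have "... = I0" unfolding I0_def F_def by (rule LINT_add[OF i1 iU, symmetric])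
  finally show ?thesis .
  qed
  have I1le: "I1 <= I0" unfolding I1_def I0_def by (rule integral_mono[OF iU Fi]) (simp add: F_def)
  have I2le: "I2 <= B^2" using me(3) by (simp add: I2_def B_def)
  have I1n: "I1 >= 0" "I2 >= 0" unfolding I1_def I2_def by (rule LINT_nonneg; simp)+
  have h2: "h^2 >= 0" by simp
  have E1le: "E1 <= 100*(h^2*(A^2 + B^2))"
  proof -
  have gen: "100*x + 2*y <= 100*(s + t)" if "x <= s" "y <= t" "0 <= y" for x y s t :: real
  proof -
  have "2*y <= 100*t" using that(2,3) by simp
  with that(1) show ?thesis unfolding distrib_left by (intro add_mono) simp_all
  qed
  have "100*I1 + 2*I2 <= 100*(A^2 + B^2)" by (rule gen[OF _ I2le I1n(2)]) (simp only: A2 I1le)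
  from mult_left_mono[OF this h2] show ?thesis unfolding E1_def mult.left_commute[of "h^2" 100] .
  qed
  have Sle: "Kst*h^2*I0 <= Kst*(h^2*(A^2 + B^2))"
  proof -
  have "I0 <= A^2 + B^2" using A2 by simp
  from mult_left_mono[OF this h2] have "h^2*I0 <= h^2*(A^2 + B^2)" .
  from mult_left_mono[OF this Kst] show ?thesis by (simp only: mult.assoc)
  qed
  have "V^2 <= 2*E1 + 2*((2*cg^2*E1 + 2*(Kst*h^2*I0))/c0^2)"
  using ve(1) unfolding V_def E1_def I1_def I2_def .
  also have "... <= 2*(100*(h^2*(A^2 + B^2))) + 2*((2*cg^2*(100*(h^2*(A^2 + B^2))) + 2*(Kst*(h^2*(A^2 + B^2))))/c0^2)"
  using E1le Sle by (intro add_mono mult_left_mono divide_right_mono) auto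
  also have "... = Cv * (h^2*(A^2 + B^2))" by (simp add: Cv_def algebra_simps add_divide_distrib)
  also have "... <= Cv * (h^2*(A + B)^2)" using A0 Cv by (intro mult_left_mono) (auto simp: power2_sum)
  also have "... = (sqrt Cv * (h*(A + B)))^2" using Cv by (simp add: power_mult_distrib)
  finally have V: "V <= sqrt Cv * (h*(A + B))"
  by (rule power2_le_imp_le) (use A0 h(3) Cv in auto)
  have vdiv: "AE x in leb ?\<O>. wdiv ?\<O> uh x = pw (%i j k x. (LINT x|leb (T i j k). f x)/vol (T i j k)) x"
  using ve(2) .
  define W where "W = l2norm ?\<O> (%x. wdiv ?\<O> u x - wdiv ?\<O> uh x)"
  have "W^2 <= (4*(h*B))^2"
  proof -
  let ?v = "pw (%i j k x. (LINT x|leb (T i j k). f x)/vol (T i j k))"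
  have "AE x in leb ?\<O>. (norm (f x - ?v x))^2 = (norm (wdiv ?\<O> u x - wdiv ?\<O> uh x))^2"
  using vdiv wdiv_AE(2)[OF op wdf] by eventually_elim simp
  moreover have "L1 ?\<O> (%x. (norm (f x - ?v x))^2)" using me(1) unfolding L2_def by blast
  ultimately have "W^2 = (LINT x|leb ?\<O>. (norm (f x - ?v x))^2)"
  unfolding W_def sq by (rule leb_AE_cong(3)[OF bl])
  also have "... <= 16*h^2*B^2" using me(2) unfolding B_def by simp
  finally show ?thesis by (simp add: power_mult_distrib)
  qed
  hence W: "W <= 4*(h*B)" by (rule power2_le_imp_le) (use A0 h(3) in auto)
  have "V + W <= sqrt Cv * (h*(A + B)) + 4*(h*B)" using V W by linarith
  also have "... <= sqrt Cv * (h*(A + h2norm_tilde ?\<O> Om p + B)) + 4*(h*(A + h2norm_tilde ?\<O> Om p + B))"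
  using A0 h(3) Cv by (intro add_mono mult_left_mono) auto
  also have "... = Cst*h*(A + h2norm_tilde ?\<O> Om p + B)" by (simp add: Cst_def algebra_simps)
  finally show ?case unfolding V_def W_def A_def B_def h_def .
 qed
qed

end
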